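(* Let $0\le k<n$ be integers, let $\Psi$ be a Lipschitz geometric integrand (on $\operatorname{ray}\mathbf{G}_0(n,k)$), and let $c>0$. Then $$\Psi\in \mathrm{AUE}(\mathcal{P}_C,c)\quad\Longleftrightarrow\quad \Psi\in\mathrm{UPC}(c),$$ that is, $\Psi$ is Almgren uniformly elliptic with constant $c$ with respect to polyhedral test pairs (with real coefficients) if and only if $\Psi$ is uniformly polyconvex with the same constant $c$.
   Context: **Oriented Grassmannian.** $\bigwedge_k\mathbf{R}^n$ carries its standard Euclidean norm $|\cdot|$. $\mathbf{G}_0(n,k)=\{\xi\in\bigwedge_k\mathbf{R}^n:\xi \text{ is simple},\ |\xi|=1\}$. For a subset $A$ of a vector space, $\operatorname{ray}A=\{ta:0\le t<\infty,\ a\in A\}$. **Geometric integrand.** A positively homogeneous ($\Psi(t\xi)=t\Psi(\xi)$ for $t\ge 0$), non-negative, continuous function $\Psi:\operatorname{ray}\mathbf{G}_0(n,k)\to\mathbf{R}$. **Uniform polyconvexity.** For $0<c<\infty$, $\Psi\in\mathrm{UPC}(c)$ means $$\sum_{i=1}^d m_i\Psi(\eta_i)-\Psi(\eta_0)\ \ge\ c\Bigl(\sum_{i=1}^d m_i|\eta_i|-|\eta_0|\Bigr)$$ whenever $d$ is a positive integer, $m_1,\dots,m_d\in(0,\infty)$ and $\eta_0,\dots,\eta_d\in\mathbf{G}_0(n,k)$ satisfy $\eta_0=\sum_{i=1}^d m_i\eta_i$. **Polyhedral currents.** $\mathbf{P}_k(\mathbf{R}^n)$ is the space of polyhedral $k$-currents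 in $\mathbf{R}^n$ with real coefficients (finite real linear combinations of currents associated with oriented $k$-dimensional simplices). $I_k\in\mathbf{I}_k(\mathbf{R}^k)$ is the current associated with the unit cube $[0,1]^k$ with its standard orientation. **Polyhedral test pairs.** A linear map $p:\mathbf{R}^n\to\mathbf{R}^k$ is an orthogonal projection if its adjoint $p^*:\mathbf{R}^k\to\mathbf{R}^n$ satisfies $p\circ p^*=\mathrm{id}_{\mathbf{R}^k}$. A pair $(S,D)$ is a polyhedral test pair, $(S,D)\in\mathcal{P}_C$, if there exists an orthogonal projection $p:\mathbf{R}^n\to\mathbf{R}^k$ such that $S\in\mathbf{P}_k(\mathbf{R}^n)$, $D=(p^* )_{\#}I_k$, and $\partial S=\partial D$. **Energy.** For a $k$-rectifiable current $T$ represented by $(M,\tau,\Theta)$ ($M$ a $k$-rectifiable set, $\tau$ an orientation of $M$ by unit simple $k$-vectors, $\Theta$ the positive multiplicity function), $E_\Psi(T)=\int_M\Theta(x)\,\Psi(\tau(x))\,d\mathscr{H}^k(x)$, and $\mathbf{M}(T)=\int_M\Theta\,d\mathscr{H}^k$ is the mass. **Uniform ellipticity.** $\Psi\in\mathrm{AUE}(\mathcal{P}_C,c)$ means $E_\Psi(S)-E_\Psi(D)\ge c\bigl(\mathbf{M}(S)-\mathbf{M}(D)\bigr)$ for all $(S,D)\in\mathcal{P}_C$.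
   Formalization: For k = 0 the boundary of a 0-dimensional current T is taken to be its augmentation T(1); with the convention that this boundary is 0 the equivalence fails (e.g. Ψ = 2|·|, c = 1, S = 0). For k ≥ 1 nothing is changed. *)

theory Defs
  imports "HOL-Analysis.Analysis"
begin

text \<open>
  The exterior algebra of \<open>real ^ 'n\<close> is the Euclidean space \<open>real ^ ('n set)\<close>: the coordinate with
  index \<open>I\<close> belongs to the basis vector \<open>e_I = e_i1 \<and> \<dots> \<and> e_ik\<close>, where \<open>I = {i1 < \<dots> < ik}\<close>.
  These basis vectors are orthonormal, so \<open>norm\<close> is the standard norm of multivectors.
  The dual space of \<open>k\<close>-covectors is identified with the space of \<open>k\<close>-vectors through \<open>\<bullet>\<close>.

  \<open>R^k\<close> is the set \<open>PiE {..<k} (\<lambda>_. UNIV)\<close> with the measure \<open>Pi\<^sub>M {..<k} (\<lambda>_. lborel)\<close>, because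
  \<open>k = 0\<close> has to be included; for \<open>k = 0\<close> this is one point of mass \<open>1\<close>.
\<close>

definition kvectors :: "nat \<Rightarrow> (real ^ ('n::finite set)) set" where
  "kvectors k = {\<xi>. \<forall>I. card I \<noteq> k \<longrightarrow> \<xi> $ I = 0}"

text \<open>The coordinates of \<open>v 0 \<and> \<dots> \<and> v (k - 1)\<close> are the \<open>k \<times> k\<close> minors.\<close>

definition wedge :: "nat \<Rightarrow> (nat \<Rightarrow> real ^ 'n::{finite,linorder}) \<Rightarrow> real ^ ('n set)" where
  "wedge k v = (\<chi> I. if card I = k
     then \<Sum>\<pi> | \<pi> permutes {..<k}. of_int (sign \<pi>) * (\<Prod>j<k. v j $ (sorted_list_of_set I ! \<pi> j))
     else 0)"

text \<open>
  The scalar \<open>a\<close> matters only for \<open>k = 0\<close>: every \<open>0\<close>-vector (real number) is simple, so that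
  \<open>G0 0\<close> consists of the two orientations \<open>1\<close> and \<open>-1\<close> of a point.
\<close>

definition simple_kvector :: "nat \<Rightarrow> real ^ ('n::{finite,linorder} set) \<Rightarrow> bool" where
  "simple_kvector k \<xi> \<longleftrightarrow> (\<exists>a v. \<xi> = a *\<^sub>R wedge k v)"

definition G0 :: "nat \<Rightarrow> (real ^ ('n::{finite,linorder} set)) set" where
  "G0 k = {\<xi>. simple_kvector k \<xi> \<and> norm \<xi> = 1}"

definition ray :: "'a::real_vector set \<Rightarrow> 'a set" where
  "ray A = {t *\<^sub>R a |t a. 0 \<le> t \<and> a \<in> A}"

definition geometric_integrand :: "nat \<Rightarrow> (real ^ ('n::{finite,linorder} set) \<Rightarrow> real) \<Rightarrow> bool" where
  "geometric_integrand k \<Psi> \<longleftrightarrow>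
     (\<forall>\<xi>\<in>ray (G0 k). \<forall>t\<ge>0. \<Psi> (t *\<^sub>R \<xi>) = t * \<Psi> \<xi>) \<and>
     (\<forall>\<xi>\<in>ray (G0 k). 0 \<le> \<Psi> \<xi>) \<and>
     continuous_on (ray (G0 k)) \<Psi>"

definition UPC :: "nat \<Rightarrow> real \<Rightarrow> (real ^ ('n::{finite,linorder} set) \<Rightarrow> real) set" where
  "UPC k c = {\<Psi>. \<forall>d m \<eta>. 0 < d \<longrightarrow> (\<forall>i\<in>{1..d}. 0 < m i) \<longrightarrow> (\<forall>i\<in>{0..d}. \<eta> i \<in> G0 k) \<longrightarrow>
     \<eta> 0 = (\<Sum>i=1..d. m i *\<^sub>R \<eta> i) \<longrightarrow>
     (\<Sum>i=1..d. m i * \<Psi> (\<eta> i)) - \<Psi> (\<eta> 0) \<ge>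
       c * ((\<Sum>i=1..d. m i * norm (\<eta> i)) - norm (\<eta> (0::nat)))}"

primrec Cm :: "nat \<Rightarrow> ('a::euclidean_space \<Rightarrow> 'b::real_normed_vector) \<Rightarrow> bool" where
  "Cm 0 f \<longleftrightarrow> continuous_on UNIV f"
| "Cm (Suc m) f \<longleftrightarrow> (\<forall>x. f differentiable at x) \<and>
     (\<forall>b\<in>Basis. Cm m (\<lambda>x. frechet_derivative f (at x) b))"

definition smooth_forms :: "nat \<Rightarrow> (real ^ 'n::finite \<Rightarrow> real ^ ('n set)) set" where
  "smooth_forms k = {\<omega>. (\<forall>m. Cm m \<omega>) \<and> range \<omega> \<subseteq> kvectors k}"

text \<open>
  \<open>d \<omega> = (\<Sum>J. \<Sum>i. \<partial>\<^sub>i \<omega>_J dx_i \<and> dx_J)\<close>; sorting \<open>i\<close> into \<open>J = I - {i}\<close> gives the sign.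
\<close>

definition ext_deriv ::
  "(real ^ 'n::{finite,linorder} \<Rightarrow> real ^ ('n set)) \<Rightarrow>
   real ^ 'n::{finite,linorder} \<Rightarrow> real ^ ('n set)" where
  "ext_deriv \<omega> x = (\<chi> I. \<Sum>i\<in>I. (-1) ^ card {j\<in>I. j < i} *
     frechet_derivative \<omega> (at x) (axis i 1) $ (I - {i}))"

text \<open>
  All currents below have compact support, so they act on all smooth forms.  A current of
  dimension \<open>k\<close> is given by its values on \<open>smooth_forms k\<close> and is set to \<open>0\<close> elsewhere, which makes
  equality of currents the equality of functions.
\<close>

type_synonym 'n current = "(real ^ 'n \<Rightarrow> real ^ ('n set)) \<Rightarrow> real"

text \<open>
  The boundary of a \<open>0\<close>-dimensional current is its augmentation \<open>T(1)\<close>, that is, the de Rham complex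
  is augmented by the inclusion \<open>d\<close> of the constants into the functions (\<open>axis {} 1\<close> is the
  \<open>0\<close>-covector \<open>1\<close>).  With boundary \<open>0\<close> instead, every \<open>0\<close>-dimensional polyhedral current would be a
  competitor of a point mass, and ellipticity would not follow from polyconvexity for \<open>k = 0\<close>.
\<close>

definition boundary :: "nat \<Rightarrow> 'n::{finite,linorder} current \<Rightarrow> 'n current" where
  "boundary k T = (\<lambda>\<phi>. if k = 0 then T (\<lambda>x. axis {} 1)
     else if \<phi> \<in> smooth_forms (k - 1) then T (ext_deriv \<phi>) else 0)"

text \<open>
  The pushforward under an affine map \<open>q\<close> of the current in \<open>R^k\<close> given by integration over \<open>A\<close>
  with the standard orientation; \<open>q (unit_coord k j) - q 0\<close> is the \<open>j\<close>-th partial derivative of \<open>q\<close>.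
\<close>

definition zero_coord :: "nat \<Rightarrow> nat \<Rightarrow> real" where
  "zero_coord k = (\<lambda>i\<in>{..<k}. 0)"

definition unit_coord :: "nat \<Rightarrow> nat \<Rightarrow> nat \<Rightarrow> real" where
  "unit_coord k j = (\<lambda>i\<in>{..<k}. if i = j then 1 else 0)"

definition push_current ::
  "nat \<Rightarrow> ((nat \<Rightarrow> real) \<Rightarrow> real ^ 'n::{finite,linorder}) \<Rightarrow> (nat \<Rightarrow> real) set \<Rightarrow> 'n current" where
  "push_current k q A = (\<lambda>\<omega>. if \<omega> \<in> smooth_forms k
     then LINT y:A|Pi\<^sub>M {..<k} (\<lambda>_. lborel).
            \<omega> (q y) \<bullet> wedge k (\<lambda>j. q (unit_coord k j) - q (zero_coord k))
     else 0)"

definition unit_cube :: "nat \<Rightarrow> (nat \<Rightarrow> real) set" where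
  "unit_cube k = PiE {..<k} (\<lambda>_. {0..1})"

definition std_simplex :: "nat \<Rightarrow> (nat \<Rightarrow> real) set" where
  "std_simplex k = {y \<in> PiE {..<k} (\<lambda>_. {0..}). (\<Sum>j<k. y j) \<le> 1}"

definition simplex_current :: "nat \<Rightarrow> (nat \<Rightarrow> real ^ 'n::{finite,linorder}) \<Rightarrow> 'n current" where
  "simplex_current k v =
     push_current k (\<lambda>y. v 0 + (\<Sum>j<k. y j *\<^sub>R (v (Suc j) - v 0))) (std_simplex k)"

definition polyhedral_currents :: "nat \<Rightarrow> 'n::{finite,linorder} current set" where
  "polyhedral_currents k = {(\<lambda>\<omega>. \<Sum>i<N. a i * simplex_current k (v i) \<omega>) |(N::nat) a v.
     \<forall>i<N. inj_on (v i) {..k} \<and> \<not> affine_dependent (v i ` {..k})}"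

definition linear_to_Rk :: "nat \<Rightarrow> (real ^ 'n::finite \<Rightarrow> nat \<Rightarrow> real) \<Rightarrow> bool" where
  "linear_to_Rk k p \<longleftrightarrow> range p \<subseteq> PiE {..<k} (\<lambda>_. UNIV) \<and> (\<forall>j<k. linear (\<lambda>x. p x j))"

definition adjoint_Rk :: "nat \<Rightarrow> (real ^ 'n::finite \<Rightarrow> nat \<Rightarrow> real) \<Rightarrow> (nat \<Rightarrow> real) \<Rightarrow> real ^ 'n" where
  "adjoint_Rk k p y = (THE w. \<forall>x. (\<Sum>j<k. p x j * y j) = x \<bullet> w)"

definition orthogonal_projection :: "nat \<Rightarrow> (real ^ 'n::finite \<Rightarrow> nat \<Rightarrow> real) \<Rightarrow> bool" where
  "orthogonal_projection k p \<longleftrightarrow> linear_to_Rk k p \<and>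
     (\<forall>y \<in> PiE {..<k} (\<lambda>_. UNIV). p (adjoint_Rk k p y) = y)"

definition polyhedral_test_pairs ::
  "nat \<Rightarrow> ('n::{finite,linorder} current \<times> 'n current) set" where
  "polyhedral_test_pairs k = {(S, D). \<exists>p. orthogonal_projection k p \<and>
     S \<in> polyhedral_currents k \<and>
     D = push_current k (adjoint_Rk k p) (unit_cube k) \<and>
     boundary k S = boundary k D}"

text \<open>\<open>k\<close>-dimensional Hausdorff measure, normalised to agree with Lebesgue measure on \<open>k\<close>-dimensional planes.\<close>

definition hausdorff_gauge :: "nat \<Rightarrow> 'a::metric_space set \<Rightarrow> ennreal" where
  "hausdorff_gauge k C =
     (if C = {} then 0 else ennreal (unit_ball_vol (real k) * (diameter C / 2) ^ k))"

definition hausdorff_outer :: "nat \<Rightarrow> 'a::metric_space set \<Rightarrow> ennreal" where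
  "hausdorff_outer k A = (SUP \<delta>\<in>{0<..}. INF C\<in>{C :: nat \<Rightarrow> 'a set.
     A \<subseteq> (\<Union>i. C i) \<and> (\<forall>i. bounded (C i) \<and> diameter (C i) \<le> \<delta>)}. \<Sum>i. hausdorff_gauge k (C i))"

definition hausdorff_measure :: "nat \<Rightarrow> 'a::metric_space measure" where
  "hausdorff_measure k = measure_of UNIV (sets borel) (hausdorff_outer k)"

text \<open>
  Rectifiable sets are bounded and of finite measure here.  Borel sets are enough because every
  \<open>\<H>^k\<close>-measurable set of finite measure is a Borel set up to a null set.
\<close>

definition lipschitz_Rk ::
  "nat \<Rightarrow> (nat \<Rightarrow> real) set \<Rightarrow> ((nat \<Rightarrow> real) \<Rightarrow> 'a::metric_space) \<Rightarrow> bool" where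
  "lipschitz_Rk k A f \<longleftrightarrow>
     (\<exists>L. \<forall>y\<in>A. \<forall>z\<in>A. dist (f y) (f z) \<le> L * L2_set (\<lambda>j. y j - z j) {..<k})"

definition rectifiable_set :: "nat \<Rightarrow> 'a::euclidean_space set \<Rightarrow> bool" where
  "rectifiable_set k M \<longleftrightarrow> M \<in> sets borel \<and> bounded M \<and> emeasure (hausdorff_measure k) M < \<infinity> \<and>
     (\<exists>A f. (\<forall>i::nat. A i \<subseteq> PiE {..<k} (\<lambda>_. UNIV) \<and> lipschitz_Rk k (A i) (f i)) \<and>
        (\<exists>N\<in>null_sets (hausdorff_measure k). M \<subseteq> N \<union> (\<Union>i. f i ` A i)))"

definition approx_tangent_space ::
  "nat \<Rightarrow> 'a::euclidean_space set \<Rightarrow> 'a \<Rightarrow> 'a set \<Rightarrow> bool" where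
  "approx_tangent_space k M x V \<longleftrightarrow> subspace V \<and> dim V = k \<and>
     (\<forall>f :: 'a \<Rightarrow> real. continuous_on UNIV f \<longrightarrow> bounded {y. f y \<noteq> 0} \<longrightarrow>
        ((\<lambda>r. (LINT y:M|hausdorff_measure k. f ((y - x) /\<^sub>R r)) / r ^ k)
           \<longlongrightarrow> (LINT y:V|hausdorff_measure k. f y)) (at_right 0))"

text \<open>\<open>\<tau> x\<close> orients the approximate tangent space \<open>span (v ` {..<k})\<close> of \<open>M\<close> at almost every \<open>x\<close>.\<close>

definition orientation ::
  "nat \<Rightarrow> (real ^ 'n::{finite,linorder}) set \<Rightarrow>
   (real ^ 'n::{finite,linorder} \<Rightarrow> real ^ ('n set)) \<Rightarrow> bool" where
  "orientation k M \<tau> \<longleftrightarrow> \<tau> \<in> borel_measurable (restrict_space borel M) \<and> (\<forall>x\<in>M. \<tau> x \<in> G0 k) \<and>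
     (AE x in hausdorff_measure k. x \<in> M \<longrightarrow>
        (\<exists>a v. \<tau> x = a *\<^sub>R wedge k v \<and> approx_tangent_space k M x (span (v ` {..<k}))))"

definition represents ::
  "nat \<Rightarrow> 'n::{finite,linorder} current \<Rightarrow>
   (real ^ 'n::{finite,linorder}) set \<Rightarrow> (real ^ 'n::{finite,linorder} \<Rightarrow> real ^ ('n set)) \<Rightarrow>
   (real ^ 'n::{finite,linorder} \<Rightarrow> real) \<Rightarrow> bool" where
  "represents k T M \<tau> \<Theta> \<longleftrightarrow> rectifiable_set k M \<and> orientation k M \<tau> \<and>
     (\<forall>x\<in>M. 0 < \<Theta> x) \<and> set_integrable (hausdorff_measure k) M \<Theta> \<and>
     (\<forall>\<omega>\<in>smooth_forms k. T \<omega> = (LINT x:M|hausdorff_measure k. \<Theta> x * (\<omega> x \<bullet> \<tau> x)))"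

text \<open>
  \<open>T\<close> determines the measure \<open>\<Theta> \<H>^k\<close> on \<open>M\<close> and, almost everywhere, \<open>\<tau>\<close>.  Hence neither number
  below depends on the representation.
\<close>

definition energy ::
  "nat \<Rightarrow> (real ^ ('n::{finite,linorder} set) \<Rightarrow> real) \<Rightarrow> 'n current \<Rightarrow> real" where
  "energy k \<Psi> T = (THE e. \<exists>M \<tau> \<Theta>. represents k T M \<tau> \<Theta> \<and>
     e = (LINT x:M|hausdorff_measure k. \<Theta> x * \<Psi> (\<tau> x)))"

definition mass :: "nat \<Rightarrow> 'n::{finite,linorder} current \<Rightarrow> real" where
  "mass k T = (THE e. \<exists>M \<tau> \<Theta>. represents k T M \<tau> \<Theta> \<and>
     e = (LINT x:M|hausdorff_measure k. \<Theta> x))"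

definition AUE ::
  "nat \<Rightarrow> ('n::{finite,linorder} current \<times> 'n current) set \<Rightarrow> real \<Rightarrow>
   (real ^ ('n set) \<Rightarrow> real) set" where
  "AUE k \<P> c = {\<Psi>. \<forall>(S, D)\<in>\<P>. energy k \<Psi> S - energy k \<Psi> D \<ge> c * (mass k S - mass k D)}"

end

theory Submission
  imports Defs "HOL-Library.Function_Algebras"
begin

text \<open>
  The excess of a polyhedral current \<open>S\<close> is \<open>E\<^sub>\<Psi>(S) - c M(S)\<close>.  If \<open>S\<close> acts by integration of a
  multivector field \<open>F\<close> against \<open>\<H>\<^sup>k\<close>, then its excess is \<open>\<integral> g(F) d\<H>\<^sup>k\<close> with \<open>g = h - c |\<cdot>|\<close>, where \<open>h\<close> is
  a Lipschitz extension of \<open>\<Psi>\<close> to all multivectors.  Ellipticity says that a unit cube \<open>D\<close> of dimension \<open>k\<close>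
  minimises the excess among the polyhedral currents with the boundary of \<open>D\<close>.  Polyconvexity says that
  \<open>g(\<Sum>\<xi>\<^sub>i) \<le> \<Sum>g(\<xi>\<^sub>i)\<close> when the \<open>\<xi>\<^sub>i\<close> and their sum are simple.

  From polyconvexity to ellipticity (\<open>UPC_imp_AUE\<close>): constant forms are exact, so two currents with the same
  boundary have densities with the same integral (\<open>cycle_density_integral_zero\<close>).  The density of a polyhedral
  current takes finitely many values, all of them simple (\<open>polyhedral_represents\<close>); polyconvexity, applied to these
  values with the measures of their level sets as weights, is the assertion.

  From ellipticity to polyconvexity (\<open>AUE_imp_UPC\<close>): let \<open>\<xi> = e\<^sub>0 \<and> \<dots> \<and> e\<^sub>k\<^sub>-\<^sub>1\<close> be the sum of the simple \<open>\<xi>\<^sub>i\<close>, with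
  \<open>e\<close> orthonormal.  One needs competitors for the cube spanned by \<open>e\<close> whose excess is close to \<open>\<Sum>g(\<xi>\<^sub>i)\<close>, that is,
  currents made of small cells parallel to the \<open>\<xi>\<^sub>i\<close>, in the right proportion, up to a current of small mass
  (\<open>cube_filling\<close>).  No explicit construction is used.  Call a current negligible if,
  for every \<open>\<epsilon> > 0\<close>, some average of finitely many of its translates is, up to a cycle, a current of mass at most \<open>\<epsilon>\<close>.  Negligible currents
  form a linear subspace, which contains the cycles and the differences of translates.  If a linear combination of
  cubes with vanishing total multivector were not negligible, a linear functional would vanish on all negligible
  currents but not on it.  Stokes' theorem for prisms shows that such a functional is additive in each edge
  of a cube, hence an alternating form of the edges, hence a linear function of their multivector: a contradiction
  (\<open>negligible_combination_of_cubes\<close>).  Tiling the cube by \<open>N\<^sup>k\<close> small cubes turns averages over large translations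
  into averages over small ones, which cost little.  Finally, since \<open>k < n\<close>, the cells can be moved into pairwise
  different planes, so that their excesses add up (\<open>generic_cells\<close>).

  The groundwork is of two kinds.  Every polyhedral current must be shown to be represented by a rectifiable set,
  and its density must be unique, so that energy and mass are integrals of the density.  And Hausdorff measure must be
  compared with Lebesgue measure on planes; by uniqueness of translation invariant measures they are
  proportional, and the factor cancels everywhere.
\<close>

section \<open>Hausdorff measure\<close>

definition hausdorff_pre :: "nat \<Rightarrow> real \<Rightarrow> 'a::metric_space set \<Rightarrow> ennreal" where
  "hausdorff_pre k \<delta> A = (INF C\<in>{C :: nat \<Rightarrow> 'a set.
     A \<subseteq> (\<Union>i. C i) \<and> (\<forall>i. bounded (C i) \<and> diameter (C i) \<le> \<delta>)}. \<Sum>i. hausdorff_gauge k (C i))"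

lemma hausdorff_outer_eq_SUP: "hausdorff_outer k A = (SUP \<delta>\<in>{0<..}. hausdorff_pre k \<delta> A)"
  unfolding hausdorff_outer_def hausdorff_pre_def ..

lemma hausdorff_pre_le:
  assumes "A \<subseteq> (\<Union>i. C i)" "\<And>i. bounded (C i)" "\<And>i. diameter (C i) \<le> \<delta>"
  shows "hausdorff_pre k \<delta> A \<le> (\<Sum>i. hausdorff_gauge k (C i))"
  unfolding hausdorff_pre_def using assms by (intro INF_lower) auto

lemma hausdorff_pre_le_outer: "0 < \<delta> \<Longrightarrow> hausdorff_pre k \<delta> A \<le> hausdorff_outer k A"
  unfolding hausdorff_outer_eq_SUP by (intro SUP_upper) auto

lemma hausdorff_pre_mono: "A \<subseteq> B \<Longrightarrow> hausdorff_pre k \<delta> A \<le> hausdorff_pre k \<delta> B"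
  unfolding hausdorff_pre_def by (intro INF_superset_mono) auto

lemma hausdorff_gauge_empty [simp]: "hausdorff_gauge k {} = 0"
  by (simp add: hausdorff_gauge_def)

lemma hausdorff_outer_mono: "A \<subseteq> B \<Longrightarrow> hausdorff_outer k A \<le> hausdorff_outer k B"
  unfolding hausdorff_outer_eq_SUP by (intro SUP_mono') (auto intro: hausdorff_pre_mono)

lemma hausdorff_outer_empty [simp]: "hausdorff_outer k ({} :: 'a::metric_space set) = 0"
proof -
  have "hausdorff_pre k \<delta> ({} :: 'a set) \<le> 0" if "\<delta> > 0" for \<delta> :: real
    unfolding hausdorff_pre_def using that by (intro INF_lower2[of "\<lambda>_. {}"]) auto
  then show ?thesis
    by (auto simp: hausdorff_outer_eq_SUP intro!: antisym SUP_least)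
qed

lemma hausdorff_pre_countably_subadditive:
  fixes A :: "nat \<Rightarrow> 'a::metric_space set"
  shows "hausdorff_pre k \<delta> (\<Union>i. A i) \<le> (\<Sum>n. hausdorff_pre k \<delta> (A n))"
proof (rule ennreal_le_epsilon)
  fix e :: real assume e: "0 < e" and fin: "(\<Sum>n. hausdorff_pre k \<delta> (A n)) < top"
  then have *: "hausdorff_pre k \<delta> (A n) < hausdorff_pre k \<delta> (A n) + e * (1/2)^Suc n" for n
    by (auto simp add: less_top dest!: ennreal_suminf_lessD)
  have "\<exists>C. A n \<subseteq> (\<Union>i. C i) \<and> (\<forall>i. bounded (C i) \<and> diameter (C i) \<le> \<delta>) \<and>
          (\<Sum>i. hausdorff_gauge k (C i)) < hausdorff_pre k \<delta> (A n) + e * (1/2)^Suc n" for n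
    using *[of n] unfolding hausdorff_pre_def[of k \<delta> "A n"] INF_less_iff by blast
  then obtain B where B: "\<And>n. A n \<subseteq> (\<Union>i. B n i)" "\<And>n i. bounded (B n i)" "\<And>n i. diameter (B n i) \<le> \<delta>"
      and Ble: "\<And>n. (\<Sum>i. hausdorff_gauge k (B n i)) \<le> hausdorff_pre k \<delta> (A n) + e * (1/2)^Suc n"
    using less_imp_le by metis
  define C where "C = case_prod B o prod_decode"
  have "(\<Union>i. A i) \<subseteq> (\<Union>i. C i)"
    using B(1) by (auto simp add: C_def subset_eq) (metis prod.case prod_encode_inverse)
  then have "hausdorff_pre k \<delta> (\<Union>i. A i) \<le> (\<Sum>i. hausdorff_gauge k (C i))"
    using B(2,3) by (intro hausdorff_pre_le) (auto simp: C_def split: prod.split)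
  also have "\<dots> = (\<Sum>n. \<Sum>i. hausdorff_gauge k (B n i))"
    unfolding C_def comp_def by (intro suminf_ennreal_2dimen) auto
  also have "\<dots> \<le> (\<Sum>n. hausdorff_pre k \<delta> (A n) + e * (1/2) ^ Suc n)"
    by (intro suminf_le Ble) auto
  also have "... = (\<Sum>n. hausdorff_pre k \<delta> (A n)) + (\<Sum>n. ennreal e * ennreal ((1/2) ^ Suc n))"
    using \<open>0 < e\<close> by (subst suminf_add[symmetric])
      (auto simp del: ennreal_suminf_cmult simp add: ennreal_mult[symmetric])
  also have "\<dots> = (\<Sum>n. hausdorff_pre k \<delta> (A n)) + e"
    unfolding ennreal_suminf_cmult
    by (subst suminf_ennreal_eq[OF zero_le_power power_half_series]) auto
  finally show "hausdorff_pre k \<delta> (\<Union>i. A i) \<le> (\<Sum>n. hausdorff_pre k \<delta> (A n)) + e" .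
qed

lemma hausdorff_outer_countably_subadditive:
  fixes A :: "nat \<Rightarrow> 'a::metric_space set"
  shows "hausdorff_outer k (\<Union>i. A i) \<le> (\<Sum>n. hausdorff_outer k (A n))"
  unfolding hausdorff_outer_eq_SUP[of k "\<Union>i. A i"]
proof (intro SUP_least)
  fix \<delta> :: real assume "\<delta> \<in> {0<..}"
  then show "hausdorff_pre k \<delta> (\<Union>i. A i) \<le> (\<Sum>n. hausdorff_outer k (A n))"
    by (intro order_trans[OF hausdorff_pre_countably_subadditive] suminf_le hausdorff_pre_le_outer) auto
qed

lemma outer_measure_space_hausdorff:
  "outer_measure_space (Pow UNIV) (hausdorff_outer k :: 'a::metric_space set \<Rightarrow> ennreal)"
  unfolding outer_measure_space_def positive_def increasing_def countably_subadditive_def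
  using hausdorff_outer_countably_subadditive by (auto intro: hausdorff_outer_mono)

text \<open>
  A covering set of diameter less than \<open>d\<close> cannot meet both \<open>A\<close> and \<open>B\<close>, so a fine covering of the union splits.
\<close>

lemma hausdorff_outer_separated:
  fixes A B :: "'a::metric_space set"
  assumes d: "0 < d" and sep: "\<And>x y. x \<in> A \<Longrightarrow> y \<in> B \<Longrightarrow> d \<le> dist x y"
  shows "hausdorff_outer k A + hausdorff_outer k B \<le> hausdorff_outer k (A \<union> B)"
proof -
  have main: "hausdorff_pre k \<delta>1 A + hausdorff_pre k \<delta>2 B \<le> hausdorff_outer k (A \<union> B)"
    if \<delta>: "\<delta>1 > 0" "\<delta>2 > 0" for \<delta>1 \<delta>2
  proof -
    define \<delta> where "\<delta> = min (min \<delta>1 \<delta>2) (d/2)"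
    have "hausdorff_pre k \<delta>1 A + hausdorff_pre k \<delta>2 B \<le> hausdorff_pre k \<delta> (A \<union> B)"
      unfolding hausdorff_pre_def[of k \<delta>]
    proof (intro INF_greatest)
      fix C :: "nat \<Rightarrow> 'a set"
      assume "C \<in> {C. A \<union> B \<subseteq> \<Union> (range C) \<and> (\<forall>i. bounded (C i) \<and> diameter (C i) \<le> \<delta>)}"
      then have C: "A \<union> B \<subseteq> \<Union> (range C)" "\<And>i. bounded (C i)" "\<And>i. diameter (C i) \<le> \<delta>" by auto
      define CA where "CA = (\<lambda>i. if C i \<inter> A = {} then {} else C i)"
      define CB where "CB = (\<lambda>i. if C i \<inter> B = {} then {} else C i)"
      have disj: "C i \<inter> A = {} \<or> C i \<inter> B = {}" for i
      proof (rule ccontr)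
        assume "\<not> ?thesis"
        then obtain x y where xy: "x \<in> C i" "x \<in> A" "y \<in> C i" "y \<in> B" by blast
        have "dist x y \<le> diameter (C i)" using C(2) xy diameter_bounded_bound by blast
        with C(3)[of i] sep[OF xy(2,4)] d show False unfolding \<delta>_def by linarith
      qed
      have "hausdorff_pre k \<delta>1 A \<le> (\<Sum>i. hausdorff_gauge k (CA i))"
      proof (intro hausdorff_pre_le)
        show "A \<subseteq> \<Union> (range CA)"
        proof
          fix x assume "x \<in> A"
          then obtain i where "x \<in> C i" using C(1) by blast
          with \<open>x \<in> A\<close> have "x \<in> CA i" by (auto simp: CA_def)
          then show "x \<in> \<Union> (range CA)" by blast
        qed
        show "diameter (CA i) \<le> \<delta>1" for i
          using C(3)[of i] \<delta> by (auto simp: CA_def \<delta>_def)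
      qed (use C in \<open>auto simp: CA_def\<close>)
      moreover have "hausdorff_pre k \<delta>2 B \<le> (\<Sum>i. hausdorff_gauge k (CB i))"
      proof (intro hausdorff_pre_le)
        show "B \<subseteq> \<Union> (range CB)"
        proof
          fix x assume "x \<in> B"
          then obtain i where "x \<in> C i" using C(1) by blast
          with \<open>x \<in> B\<close> have "x \<in> CB i" by (auto simp: CB_def)
          then show "x \<in> \<Union> (range CB)" by blast
        qed
        show "diameter (CB i) \<le> \<delta>2" for i
          using C(3)[of i] \<delta> by (auto simp: CB_def \<delta>_def)
      qed (use C in \<open>auto simp: CB_def\<close>)
      ultimately have "hausdorff_pre k \<delta>1 A + hausdorff_pre k \<delta>2 B \<le>
          (\<Sum>i. hausdorff_gauge k (CA i)) + (\<Sum>i. hausdorff_gauge k (CB i))"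
        by (rule add_mono)
      also have "\<dots> = (\<Sum>i. hausdorff_gauge k (CA i) + hausdorff_gauge k (CB i))"
        by (rule suminf_add) auto
      also have "\<dots> \<le> (\<Sum>i. hausdorff_gauge k (C i))"
        using disj by (intro suminf_le) (auto simp: CA_def CB_def)
      finally show "hausdorff_pre k \<delta>1 A + hausdorff_pre k \<delta>2 B \<le> (\<Sum>i. hausdorff_gauge k (C i))" .
    qed
    also have "\<dots> \<le> hausdorff_outer k (A \<union> B)"
      using \<delta> d by (intro hausdorff_pre_le_outer) (auto simp: \<delta>_def)
    finally show ?thesis .
  qed
  have "hausdorff_outer k A + hausdorff_outer k B = (SUP \<delta>\<in>{0<..}. hausdorff_pre k \<delta> A + hausdorff_outer k B)"
    unfolding hausdorff_outer_eq_SUP[of k A] by (subst ennreal_SUP_add_left) (auto simp: gt_ex)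
  also have "\<dots> = (SUP \<delta>1\<in>{0<..}. SUP \<delta>2\<in>{0<..}. hausdorff_pre k \<delta>1 A + hausdorff_pre k \<delta>2 B)"
    unfolding hausdorff_outer_eq_SUP[of k B] by (subst ennreal_SUP_add_right) (auto simp: gt_ex)
  also have "\<dots> \<le> hausdorff_outer k (A \<union> B)"
    using main by (intro SUP_least) auto
  finally show ?thesis .
qed

text \<open>
  The shells around a closed set \<open>C\<close> with indices of equal parity are at positive distance from each
  other.  Hence the series of their measures converges, and the part of \<open>T\<close> near \<open>C\<close> but outside
  \<open>C\<close> is small.
\<close>

lemma closed_in_lambda_system_hausdorff:
  fixes C :: "'a::metric_space set"
  assumes "closed C"
  shows "C \<in> lambda_system UNIV (Pow UNIV) (hausdorff_outer k)"
proof (cases "C = {}")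
  case True
  then show ?thesis by (auto simp: lambda_system_def)
next
  case False
  let ?m = "hausdorff_outer k :: 'a set \<Rightarrow> ennreal"
  have sub: "?m (A \<union> B) \<le> ?m A + ?m B" for A B
  proof -
    have "?m (\<Union>i. binaryset A B i) \<le> (\<Sum>i. ?m (binaryset A B i))"
      by (rule hausdorff_outer_countably_subadditive)
    then show ?thesis by (simp add: UN_binaryset_eq suminf_binaryset_eq)
  qed
  have ge: "?m (T \<inter> C) + ?m (T - C) \<le> ?m T" if fin: "?m T < top" for T
  proof (rule ennreal_le_epsilon)
    fix e :: real assume e: "0 < e"
    define S where "S = (\<lambda>n::nat. {x\<in>T. 1 / real (n+1) \<le> infdist x C})"
    define D where "D = (\<lambda>j::nat. {x\<in>T. 1 / real (j+2) \<le> infdist x C \<and> infdist x C < 1 / real (j+1)})"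
    have half: "(\<Sum>j<n. ?m (D (2*j+p))) \<le> ?m (\<Union>j<n. D (2*j+p))" for n p
    proof (induction n)
      case (Suc n)
      have "(\<Sum>j<Suc n. ?m (D (2*j+p))) \<le> ?m (\<Union>j<n. D (2*j+p)) + ?m (D (2*n+p))"
        using Suc by (simp add: add_mono)
      also have "\<dots> \<le> ?m ((\<Union>j<n. D (2*j+p)) \<union> D (2*n+p))"
      proof (rule hausdorff_outer_separated)
        show "0 < (if 2*n+p = 0 then 1 else 1 / real (2*n+p) - 1 / real (2*n+p+1))"
          by (auto simp add: field_simps)
        fix x y assume x: "x \<in> (\<Union>j<n. D (2*j+p))" and y: "y \<in> D (2*n+p)"
        then obtain j where j: "j < n" "x \<in> D (2*j+p)" by blast
        have "1 / real (2*n+p) \<le> 1 / real (2*j+p+2)"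
          using j(1) by (intro divide_left_mono) auto
        also have "\<dots> \<le> infdist x C" using j(2) by (auto simp: D_def)
        also have "\<dots> \<le> infdist y C + dist x y" by (rule infdist_triangle)
        also have "infdist y C < 1 / real (2*n+p+1)" using y by (auto simp: D_def)
        finally show "(if 2*n+p = 0 then 1 else 1 / real (2*n+p) - 1 / real (2*n+p+1)) \<le> dist x y"
          using j(1) by (simp add: algebra_simps)
      qed
      also have "(\<Union>j<n. D (2*j+p)) \<union> D (2*n+p) = (\<Union>j<Suc n. D (2*j+p))"
        by (auto simp: less_Suc_eq)
      finally show ?case .
    qed simp
    have DT: "(\<Union>j<n. D (2*j+p)) \<subseteq> T" for n p by (auto simp: D_def)
    have half': "(\<Sum>j<n. ?m (D (2*j+p))) \<le> ?m T" for n p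
      by (rule order_trans[OF half hausdorff_outer_mono[OF DT]])
    have "(\<Sum>j<n. ?m (D j)) \<le> ?m T + ?m T" for n
    proof -
      have "(\<Sum>j<n. ?m (D j)) \<le> (\<Sum>j<2*n. ?m (D j))"
        by (intro sum_mono2) auto
      also have "\<dots> = (\<Sum>j<n. ?m (D (2*j+0))) + (\<Sum>j<n. ?m (D (2*j+1)))"
      proof (induction n)
        case (Suc n)
        have "(\<Sum>j<2*Suc n. ?m (D j)) = (\<Sum>j<2*n. ?m (D j)) + (?m (D (2*n)) + ?m (D (2*n+1)))"
          by (simp add: add.assoc)
        also note Suc
        finally show ?case by (simp add: add.assoc add.left_commute)
      qed simp
      also have "\<dots> \<le> ?m T + ?m T" by (intro add_mono half')
      finally show ?thesis .
    qed
    then have "(\<Sum>j. ?m (D j)) \<le> ?m T + ?m T"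
      unfolding suminf_eq_SUP by (intro SUP_least) auto
    then have sfin: "(\<Sum>j. ?m (D j)) < top" using fin
      by (metis ennreal_add_eq_top infinity_ennreal_def less_top order_le_less_trans top.not_eq_extremum)
    have "\<exists>n. (\<Sum>j. ?m (D j)) \<le> (\<Sum>j<n. ?m (D j)) + ennreal e"
    proof (cases "(\<Sum>j. ?m (D j)) = 0")
      case False
      then have "(\<Sum>j. ?m (D j)) - ennreal e < (SUP n. \<Sum>j<n. ?m (D j))"
        unfolding suminf_eq_SUP[symmetric]
        by (intro ennreal_between) (use e sfin in \<open>auto simp: zero_less_iff_neq_zero\<close>)
      then obtain n where "(\<Sum>j. ?m (D j)) - ennreal e < (\<Sum>j<n. ?m (D j))"
        unfolding less_SUP_iff by auto
      then show ?thesis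
        by (metis add.commute ennreal_minus_le_iff ennreal_neq_top less_imp_le)
    qed auto
    then obtain n where n: "(\<Sum>j. ?m (D j)) \<le> (\<Sum>j<n. ?m (D j)) + ennreal e" by blast
    have split: "(\<Sum>j. ?m (D j)) = (\<Sum>j. ?m (D (j+n))) + (\<Sum>j<n. ?m (D j))"
      by (rule suminf_offset) auto
    have tail: "(\<Sum>j. ?m (D (j+n))) \<le> ennreal e"
    proof -
      have "(\<Sum>j<n. ?m (D j)) < top"
        using sfin unfolding split by (metis ennreal_add_eq_top less_top)
      moreover have "(\<Sum>j<n. ?m (D j)) + (\<Sum>j. ?m (D (j+n))) \<le> (\<Sum>j<n. ?m (D j)) + ennreal e"
        using n unfolding split by (simp only: add.commute)
      ultimately show ?thesis
        unfolding ennreal_add_left_cancel_le infinity_ennreal_def by (metis less_irrefl)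
    qed
    have "T - C \<subseteq> S n \<union> (\<Union>j. D (j+n))"
    proof
      fix x assume x: "x \<in> T - C"
      then have pos: "infdist x C > 0"
        using assms False by (metis DiffD2 in_closed_iff_infdist_zero infdist_nonneg less_eq_real_def)
      show "x \<in> S n \<union> (\<Union>j. D (j+n))"
      proof (cases "1 / real (n+1) \<le> infdist x C")
        case F: False
        define l where "l = (LEAST l. 1 / real (l+1) \<le> infdist x C)"
        obtain l0 where "1 / real (l0+1) \<le> infdist x C"
          using pos by (metis Suc_eq_plus1 inverse_eq_divide less_imp_le reals_Archimedean)
        then have l: "1 / real (l+1) \<le> infdist x C" unfolding l_def by (rule LeastI)
        have "n < l"
        proof (rule ccontr)
          assume "\<not> n < l"
          then have "1 / real (n+1) \<le> 1 / real (l+1)" by (intro divide_left_mono) auto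
          with l F show False by linarith
        qed
        have "\<not> 1 / real ((l-1)+1) \<le> infdist x C"
          using not_less_Least[of "l-1" "\<lambda>l. 1 / real (l+1) \<le> infdist x C"] \<open>n < l\<close>
          unfolding l_def[symmetric] by auto
        then have "x \<in> D ((l - 1 - n) + n)"
          using x l \<open>n < l\<close> by (auto simp: D_def)
        then show ?thesis by blast
      qed (use x in \<open>auto simp: S_def\<close>)
    qed
    then have "?m (T - C) \<le> ?m (S n \<union> (\<Union>j. D (j+n)))" by (rule hausdorff_outer_mono)
    also have "\<dots> \<le> ?m (S n) + ?m (\<Union>j. D (j+n))" by (rule sub)
    also have "?m (\<Union>j. D (j+n)) \<le> (\<Sum>j. ?m (D (j+n)))" by (rule hausdorff_outer_countably_subadditive)
    also note tail
    finally have 1: "?m (T - C) \<le> ?m (S n) + ennreal e" by (simp add: add_mono)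
    have 2: "?m (T \<inter> C) + ?m (S n) \<le> ?m T"
    proof -
    have "?m (T \<inter> C) + ?m (S n) \<le> ?m ((T \<inter> C) \<union> S n)"
    proof (rule hausdorff_outer_separated)
      show "0 < 1 / real (n+1)" by simp
      fix x y assume "x \<in> T \<inter> C" "y \<in> S n"
      then show "1 / real (n+1) \<le> dist x y"
        using infdist_le[of x C y] by (auto simp: S_def dist_commute)
    qed
    also have "\<dots> \<le> ?m T" by (rule hausdorff_outer_mono) (auto simp: S_def)
    finally show ?thesis .
    qed
    have "?m (T \<inter> C) + ?m (T - C) \<le> ?m (T \<inter> C) + (?m (S n) + ennreal e)"
      using 1 by (rule add_left_mono)
    also have "\<dots> \<le> ?m T + ennreal e"
      unfolding add.assoc[symmetric] using 2 by (rule add_right_mono)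
    finally show "?m (T \<inter> C) + ?m (T - C) \<le> ?m T + ennreal e" .
  qed
  show ?thesis
    unfolding lambda_system_def
  proof (safe intro!: antisym)
    fix T :: "'a set"
    have eq: "C \<inter> T = T \<inter> C" "(UNIV - C) \<inter> T = T - C" by auto
    show "?m (C \<inter> T) + ?m ((UNIV - C) \<inter> T) \<le> ?m T"
      unfolding eq
    proof (cases "?m T < top")
      case False
      then have "?m T = top" by (simp add: less_top[symmetric])
      then show "?m (T \<inter> C) + ?m (T - C) \<le> ?m T" by (simp only: top_greatest)
    qed (rule ge)
    have "?m T \<le> ?m ((T \<inter> C) \<union> (T - C))" by (rule hausdorff_outer_mono) auto
    then show "?m T \<le> ?m (C \<inter> T) + ?m ((UNIV - C) \<inter> T)"
      unfolding eq using sub order_trans by blast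
  qed auto
qed

lemma space_hausdorff [simp]: "space (hausdorff_measure k) = UNIV"
  by (simp add: hausdorff_measure_def space_measure_of_conv)

lemma sets_hausdorff [simp, measurable_cong]:
  "sets (hausdorff_measure k :: 'a::metric_space measure) = sets borel"
proof -
  have "sigma_sets UNIV (sets (borel :: 'a measure)) = sets borel"
    by (metis sets.sigma_sets_eq space_borel)
  then show ?thesis
    by (simp add: hausdorff_measure_def sets_measure_of_conv)
qed

text \<open>
  Caratheodory's criterion: closed sets are measurable for an outer measure that is additive on separated sets.
\<close>

lemma emeasure_hausdorff:
  fixes A :: "'a::metric_space set"
  assumes "A \<in> sets borel"
  shows "emeasure (hausdorff_measure k) A = hausdorff_outer k A"
proof -
  interpret pow: sigma_algebra "UNIV :: 'a set" "Pow UNIV" by (rule sigma_algebra_Pow)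
  have ms: "measure_space UNIV (lambda_system UNIV (Pow UNIV) (hausdorff_outer k)) (hausdorff_outer k :: 'a set \<Rightarrow> ennreal)"
    by (rule pow.caratheodory_lemma[OF outer_measure_space_hausdorff])
  then interpret L: sigma_algebra "UNIV :: 'a set" "lambda_system UNIV (Pow UNIV) (hausdorff_outer k :: 'a set \<Rightarrow> ennreal)"
    by (simp add: measure_space_def)
  have "sets (borel :: 'a measure) = sigma_sets UNIV {S. closed S}"
    by (simp add: borel_eq_closed)
  also have "\<dots> \<subseteq> lambda_system UNIV (Pow UNIV) (hausdorff_outer k)"
    using closed_in_lambda_system_hausdorff by (intro L.sigma_sets_subset) blast
  finally have sub: "sets (borel :: 'a measure) \<subseteq> lambda_system UNIV (Pow UNIV) (hausdorff_outer k)" .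
  have "sigma_algebra UNIV (sets (borel :: 'a measure))"
    by (metis sets.sigma_algebra_axioms space_borel)
  from measure_down[OF ms this sub]
  have "measure_space UNIV (sets (borel :: 'a measure)) (hausdorff_outer k)" .
  then show ?thesis
    unfolding hausdorff_measure_def
    by (intro emeasure_measure_of_sigma assms) (auto simp: measure_space_def)
qed

section \<open>Hausdorff measure of parametrised planes\<close>

lemma ennreal_le_mult_of_scaled:
  fixes a b :: ennreal and r :: real
  assumes "r > 0" "ennreal (1/r) * a \<le> b"
  shows "a \<le> ennreal r * b"
proof -
  have "a = ennreal r * (ennreal (1/r) * a)"
    using assms(1) by (simp add: mult.assoc[symmetric] ennreal_mult[symmetric])
  also have "\<dots> \<le> ennreal r * b" using assms(2) by (rule mult_left_mono) simp
  finally show ?thesis .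
qed

lemma hausdorff_outer_lipschitz_image:
  fixes f :: "'a::real_normed_vector \<Rightarrow> 'b::real_normed_vector"
  assumes r: "r > 0" and f: "\<And>x y. dist (f x) (f y) \<le> r * dist x y"
  shows "hausdorff_outer k (f ` A) \<le> ennreal (r^k) * hausdorff_outer k A"
proof -
  have diam: "diameter (f ` C) \<le> r * diameter C" and bnd: "bounded (f ` C)" if "bounded C" for C
  proof -
    have *: "dist (f x) (f y) \<le> r * diameter C" if "x \<in> C" "y \<in> C" for x y
      by (rule order_trans[OF f]) (use that \<open>bounded C\<close> r diameter_bounded_bound in auto)
    show "diameter (f ` C) \<le> r * diameter C"
      using * r diameter_ge_0[OF \<open>bounded C\<close>] by (intro diameter_le) (auto simp: dist_norm)
    show "bounded (f ` C)"
      using * unfolding bounded_two_points by blast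
  qed
  have gauge: "ennreal (1/r^k) * hausdorff_gauge k (f ` C) \<le> hausdorff_gauge k C" if "bounded C" for C
  proof (cases "C = {}")
    case False
    have "diameter (f ` C) / r \<le> diameter C" using diam[OF that] r by (simp add: field_simps)
    then have "((diameter (f ` C) / r) / 2) ^ k \<le> (diameter C / 2) ^ k"
      using diameter_ge_0[OF bnd[OF that]] r by (intro power_mono) auto
    then have "(1/r^k) * (unit_ball_vol (real k) * (diameter (f ` C) / 2) ^ k) \<le>
        unit_ball_vol (real k) * (diameter C / 2) ^ k"
      using mult_left_mono[of "((diameter (f ` C) / r) / 2) ^ k" "(diameter C / 2) ^ k" "unit_ball_vol (real k)"]
      by (simp add: power_divide field_simps)
    then show ?thesis using False r
      by (simp add: hausdorff_gauge_def ennreal_mult'[symmetric] ennreal_leI)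
  qed simp
  have "ennreal (1/r^k) * hausdorff_outer k (f ` A) \<le> hausdorff_outer k A"
    unfolding hausdorff_outer_eq_SUP[of k "f ` A"] SUP_mult_left_ennreal
  proof (intro SUP_least)
    fix \<delta> :: real assume "\<delta> \<in> {0<..}"
    then have \<delta>: "\<delta> > 0" by simp
    have "ennreal (1/r^k) * hausdorff_pre k \<delta> (f ` A) \<le> hausdorff_pre k (\<delta>/r) A"
      unfolding hausdorff_pre_def[of k "\<delta>/r"]
    proof (intro INF_greatest)
      fix C :: "nat \<Rightarrow> 'a set"
      assume "C \<in> {C. A \<subseteq> \<Union> (range C) \<and> (\<forall>i. bounded (C i) \<and> diameter (C i) \<le> \<delta>/r)}"
      then have C: "A \<subseteq> \<Union> (range C)" "\<And>i. bounded (C i)" "\<And>i. diameter (C i) \<le> \<delta>/r" by auto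
      have "hausdorff_pre k \<delta> (f ` A) \<le> (\<Sum>i. hausdorff_gauge k (f ` C i))"
      proof (rule hausdorff_pre_le)
        show "diameter (f ` C i) \<le> \<delta>" for i
          using diam[OF C(2), of i] C(3)[of i] r by (simp add: field_simps)
        show "f ` A \<subseteq> (\<Union>i. f ` C i)" using C(1) by fastforce
      qed (use C bnd in auto)
      then have "ennreal (1/r^k) * hausdorff_pre k \<delta> (f ` A) \<le> (\<Sum>i. ennreal (1/r^k) * hausdorff_gauge k (f ` C i))"
        by (simp add: mult_left_mono)
      also have "\<dots> \<le> (\<Sum>i. hausdorff_gauge k (C i))"
        by (intro suminf_le gauge C) auto
      finally show "ennreal (1/r^k) * hausdorff_pre k \<delta> (f ` A) \<le> (\<Sum>i. hausdorff_gauge k (C i))" .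
    qed
    also have "\<dots> \<le> hausdorff_outer k A" using \<delta> r by (intro hausdorff_pre_le_outer) auto
    finally show "ennreal (1/r^k) * hausdorff_pre k \<delta> (f ` A) \<le> hausdorff_outer k A" .
  qed
  then show ?thesis using r by (intro ennreal_le_mult_of_scaled) auto
qed

lemma hausdorff_outer_similarity:
  fixes A :: "'a::real_normed_vector set"
  assumes r: "r > 0"
  shows "hausdorff_outer k ((\<lambda>y. b + r *\<^sub>R y) ` A) = ennreal (r^k) * hausdorff_outer k A"
proof (rule antisym)
  show "hausdorff_outer k ((\<lambda>y. b + r *\<^sub>R y) ` A) \<le> ennreal (r^k) * hausdorff_outer k A"
    using r by (intro hausdorff_outer_lipschitz_image) (auto simp: dist_norm scaleR_right_diff_distrib[symmetric])
  let ?g = "\<lambda>y. (1/r) *\<^sub>R (y - b)"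
  have "A = ?g ` ((\<lambda>y. b + r *\<^sub>R y) ` A)" using r by (auto simp: image_image)
  then have "hausdorff_outer k A \<le> ennreal ((1/r)^k) * hausdorff_outer k ((\<lambda>y. b + r *\<^sub>R y) ` A)"
    using hausdorff_outer_lipschitz_image[of "1/r" ?g k "(\<lambda>y. b + r *\<^sub>R y) ` A"] r
    by (simp add: dist_norm scaleR_right_diff_distrib[symmetric])
  then have "ennreal (r^k) * hausdorff_outer k A \<le>
      ennreal (r^k) * (ennreal ((1/r)^k) * hausdorff_outer k ((\<lambda>y. b + r *\<^sub>R y) ` A))"
    by (rule mult_left_mono) simp
  also have "\<dots> = hausdorff_outer k ((\<lambda>y. b + r *\<^sub>R y) ` A)"
    using r by (simp add: mult.assoc[symmetric] ennreal_mult[symmetric] power_mult_distrib[symmetric])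
  finally show "ennreal (r^k) * hausdorff_outer k A \<le> hausdorff_outer k ((\<lambda>y. b + r *\<^sub>R y) ` A)" .
qed

text \<open>
  This makes blow-ups of a plane around one of its points independent of the scale.
\<close>

lemma integral_hausdorff_rescale:
  fixes u :: "'a::euclidean_space \<Rightarrow> real"
  assumes r: "r > 0" and u: "u \<in> borel_measurable borel"
  shows "(LINT y|hausdorff_measure k. u ((y - b) /\<^sub>R r)) = r^k * (LINT y|hausdorff_measure k. u y)"
proof -
  let ?H = "hausdorff_measure k :: 'a measure"
  let ?\<phi> = "\<lambda>y. (y - b) /\<^sub>R r"
  have [measurable]: "?\<phi> \<in> borel_measurable borel" by measurable
  have "distr ?H borel ?\<phi> = density ?H (\<lambda>_. ennreal (r^k))"
  proof (rule measure_eqI)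
    fix E assume "E \<in> sets (distr ?H borel ?\<phi>)"
    then have E[measurable]: "E \<in> sets borel" by simp
    have E': "?\<phi> -` E \<in> sets borel" using measurable_sets_borel[OF \<open>?\<phi> \<in> _\<close> E] by simp
    have eq: "?\<phi> -` E = (\<lambda>y. b + r *\<^sub>R y) ` E"
    proof (intro equalityI subsetI)
      fix x assume "x \<in> ?\<phi> -` E"
      then have "?\<phi> x \<in> E" "x = b + r *\<^sub>R ?\<phi> x" using r by auto
      then show "x \<in> (\<lambda>y. b + r *\<^sub>R y) ` E" by blast
    qed (use r in auto)
    have "emeasure (distr ?H borel ?\<phi>) E = emeasure ?H (?\<phi> -` E)"
      by (subst emeasure_distr) auto
    also have "\<dots> = ennreal (r^k) * emeasure ?H E"
      using r E' by (simp add: emeasure_hausdorff eq hausdorff_outer_similarity)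
    also have "\<dots> = emeasure (density ?H (\<lambda>_. ennreal (r^k))) E"
      by (simp add: emeasure_density_const)
    finally show "emeasure (distr ?H borel ?\<phi>) E = emeasure (density ?H (\<lambda>_. ennreal (r^k))) E" .
  qed simp
  moreover have "(LINT y|?H. u (?\<phi> y)) = (LINT y|distr ?H borel ?\<phi>. u y)"
    using u by (subst integral_distr) auto
  moreover have "(LINT y|density ?H (\<lambda>_. ennreal (r^k)). u y) = (LINT y|?H. r^k *\<^sub>R u y)"
    using r u by (subst integral_density) auto
  ultimately show ?thesis by simp
qed

abbreviation leb_Rk :: "nat \<Rightarrow> (nat \<Rightarrow> real) measure" where
  "leb_Rk k \<equiv> Pi\<^sub>M {..<k} (\<lambda>_. lborel)"

interpretation lborels: product_sigma_finite "\<lambda>_::nat. lborel :: real measure"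
  by standard

lemma sigma_finite_leb_Rk: "sigma_finite_measure (leb_Rk k)"
  by (rule lborels.sigma_finite) simp

lemma emeasure_leb_Rk_box:
  assumes "\<And>i. i < k \<Longrightarrow> A i \<in> sets borel"
  shows "emeasure (leb_Rk k) (PiE {..<k} A) = (\<Prod>i<k. emeasure lborel (A i))"
  using assms by (subst lborels.emeasure_PiM) auto

text \<open>
  Coordinatewise measure-preserving maps and permutations of the coordinates preserve Lebesgue
  measure; this covers translations and the reflections \<open>y \<mapsto> x - y\<close>.
\<close>

lemma distr_leb_Rk_coordinatewise:
  assumes g: "\<And>i. i < k \<Longrightarrow> g i \<in> borel_measurable borel"
    and pres: "\<And>i. i < k \<Longrightarrow> distr lborel borel (g i) = lborel"
    and \<sigma>: "\<sigma> permutes {..<k}"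
  shows "distr (leb_Rk k) (leb_Rk k) (\<lambda>y. \<lambda>i\<in>{..<k}. g i (y (\<sigma> i))) = leb_Rk k"
    and "(\<lambda>y. \<lambda>i\<in>{..<k}. g i (y (\<sigma> i))) \<in> measurable (leb_Rk k) (leb_Rk k)"
proof -
  have \<sigma>k: "\<sigma> i < k \<longleftrightarrow> i < k" for i using \<sigma> permutes_in_image by fastforce
  show meas: "(\<lambda>y. \<lambda>i\<in>{..<k}. g i (y (\<sigma> i))) \<in> measurable (leb_Rk k) (leb_Rk k)"
  proof (rule measurable_restrict)
    fix i assume i: "i \<in> {..<k}"
    have "(\<lambda>y. y (\<sigma> i)) \<in> measurable (leb_Rk k) lborel"
      using i \<sigma>k by (intro measurable_component_singleton) auto
    then show "(\<lambda>y. g i (y (\<sigma> i))) \<in> measurable (leb_Rk k) lborel"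
      using g[of i] i by (auto intro: measurable_compose)
  qed
  show "distr (leb_Rk k) (leb_Rk k) (\<lambda>y. \<lambda>i\<in>{..<k}. g i (y (\<sigma> i))) = leb_Rk k" (is "?D = _")
  proof (rule lborels.PiM_eqI)
    fix A :: "nat \<Rightarrow> real set" assume A: "\<And>i. i \<in> {..<k} \<Longrightarrow> A i \<in> sets lborel"
    have inv: "inv \<sigma> i < k \<longleftrightarrow> i < k" for i using permutes_inv[OF \<sigma>] permutes_in_image by fastforce
    have pre: "(\<lambda>y. \<lambda>i\<in>{..<k}. g i (y (\<sigma> i))) -` (PiE {..<k} A) \<inter> space (leb_Rk k) =
       PiE {..<k} (\<lambda>i. g (inv \<sigma> i) -` A (inv \<sigma> i))" (is "?l = ?r")
    proof (intro equalityI subsetI)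
      fix y assume y: "y \<in> ?l"
      then have *: "g i (y (\<sigma> i)) \<in> A i" if "i < k" for i
        using that by (auto simp: PiE_iff)
      show "y \<in> ?r" using y *[of "inv \<sigma> i" for i] inv permutes_inverses(1)[OF \<sigma>]
        by (auto simp: PiE_iff space_PiM)
    next
      fix y assume y: "y \<in> ?r"
      have "g i (y (\<sigma> i)) \<in> A i" if "i < k" for i
      proof -
        have "g (inv \<sigma> (\<sigma> i)) (y (\<sigma> i)) \<in> A (inv \<sigma> (\<sigma> i))"
          using y \<sigma>k[of i] that by (auto simp: PiE_iff)
        then show ?thesis using permutes_inverses(2)[OF \<sigma>, of i] by simp
      qed
      then show "y \<in> ?l" using y by (auto simp: PiE_iff space_PiM)
    qed
    have m: "g i -` A i \<in> sets borel" if "i < k" for i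
      using measurable_sets_borel[OF g[OF that]] A[of i] that by auto
    have "emeasure ?D (PiE {..<k} A) = emeasure (leb_Rk k) (PiE {..<k} (\<lambda>i. g (inv \<sigma> i) -` A (inv \<sigma> i)))"
      using A meas by (subst emeasure_distr) (auto simp: pre)
    also have "\<dots> = (\<Prod>i<k. emeasure lborel (g (inv \<sigma> i) -` A (inv \<sigma> i)))"
      using m inv by (intro emeasure_leb_Rk_box) auto
    also have "\<dots> = (\<Prod>i<k. emeasure lborel (g i -` A i))"
      using prod.permute[OF permutes_inv[OF \<sigma>], of "\<lambda>i. emeasure lborel (g i -` A i)"] by (simp add: comp_def)
    also have "\<dots> = (\<Prod>i<k. emeasure lborel (A i))"
    proof (intro prod.cong refl)
      fix i assume i: "i \<in> {..<k}"
      have "emeasure (distr lborel borel (g i)) (A i) = emeasure lborel (g i -` A i \<inter> space lborel)"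
        using g[of i] A[of i] i by (intro emeasure_distr) auto
      then show "emeasure lborel (g i -` A i) = emeasure lborel (A i)" using pres[of i] i by simp
    qed
    finally show "emeasure ?D (PiE {..<k} A) = (\<Prod>i<k. emeasure lborel (A i))" .
  qed auto
qed

definition trans_Rk :: "nat \<Rightarrow> (nat \<Rightarrow> real) \<Rightarrow> (nat \<Rightarrow> real) \<Rightarrow> nat \<Rightarrow> real" where
  "trans_Rk k z y = (\<lambda>i\<in>{..<k}. y i + z i)"

lemma measurable_trans_Rk_pair:
  "(\<lambda>(x, y). trans_Rk k (\<lambda>i. s * y i) x) \<in> measurable (leb_Rk k \<Otimes>\<^sub>M leb_Rk k) (leb_Rk k)"
  unfolding trans_Rk_def case_prod_beta
proof (rule measurable_restrict)
  fix i assume i: "i \<in> {..<k}"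
  have 1: "(\<lambda>x. x i) \<in> borel_measurable (leb_Rk k)"
    using measurable_component_singleton[OF i, of "\<lambda>_. lborel"] by simp
  have "(\<lambda>p. fst p i + s * snd p i) \<in> borel_measurable (leb_Rk k \<Otimes>\<^sub>M leb_Rk k)"
    using measurable_compose[OF measurable_fst 1] measurable_compose[OF measurable_snd 1] by measurable
  then show "(\<lambda>p. fst p i + s * snd p i) \<in> measurable (leb_Rk k \<Otimes>\<^sub>M leb_Rk k) lborel" by simp
qed

text \<open>
  Uniqueness of Haar measure: the double integral of \<open>1_A(x) 1_B(x + y)\<close> with respect to \<open>\<nu>\<close> and
  Lebesgue measure is computed in both orders.
\<close>

lemma translation_invariant_measure_unique:
  fixes \<nu> :: "(nat \<Rightarrow> real) measure"
  assumes sets[measurable_cong]: "sets \<nu> = sets (leb_Rk k)" and sf: "sigma_finite_measure \<nu>"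
    and inv: "\<And>z. distr \<nu> (leb_Rk k) (trans_Rk k z) = \<nu>"
    and A: "A \<in> sets (leb_Rk k)"
  shows "emeasure \<nu> A = emeasure \<nu> (unit_cube k) * emeasure (leb_Rk k) A"
proof -
  define B where "B = unit_cube k"
  have B: "B \<in> sets (leb_Rk k)" and LB: "emeasure (leb_Rk k) B = 1"
    unfolding B_def unit_cube_def by (auto simp: emeasure_leb_Rk_box intro!: sets_PiM_I_finite)
  interpret L: sigma_finite_measure "leb_Rk k" by (rule sigma_finite_leb_Rk)
  interpret N: sigma_finite_measure \<nu> by (rule sf)
  interpret P: pair_sigma_finite \<nu> "leb_Rk k" ..
  let ?L = "leb_Rk k"
  note [measurable] = A B
  have tp: "(\<lambda>(x, y). trans_Rk k (\<lambda>i. s * y i) x) \<in> measurable (\<nu> \<Otimes>\<^sub>M ?L) ?L" for s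
    using measurable_trans_Rk_pair[of k s] by (simp cong: measurable_cong_sets add: sets)
  have [measurable]: "(\<lambda>(x, y). trans_Rk k y x) \<in> measurable (\<nu> \<Otimes>\<^sub>M ?L) ?L"
    "(\<lambda>(x, y). trans_Rk k (\<lambda>i. - y i) x) \<in> measurable (\<nu> \<Otimes>\<^sub>M ?L) ?L"
    using tp[of 1] tp[of "-1"] by auto
  have tz: "trans_Rk k z \<in> measurable ?L ?L" for z
    unfolding trans_Rk_def
    using distr_leb_Rk_coordinatewise(2)[of k "\<lambda>i y. z i + y" id]
    by (auto simp: permutes_id[unfolded id_def] lborel_distr_plus id_def add.commute)
  have sp\<nu>: "space \<nu> = space ?L" using sets by (rule sets_eq_imp_space_eq)
  have 1: "(\<integral>\<^sup>+x. \<integral>\<^sup>+y. indicator A x * indicator B (trans_Rk k y x) \<partial>?L \<partial>\<nu>) = emeasure \<nu> A"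
  proof -
    have "(\<integral>\<^sup>+y. indicator A x * indicator B (trans_Rk k y x) \<partial>?L) = indicator A x" if "x \<in> space \<nu>" for x
    proof -
      have d: "distr ?L ?L (\<lambda>y. \<lambda>i\<in>{..<k}. (x i + y i)) = ?L"
        and m: "(\<lambda>y. \<lambda>i\<in>{..<k}. (x i + y i)) \<in> measurable ?L ?L"
        using distr_leb_Rk_coordinatewise[of k "\<lambda>i y. x i + y" id] by (auto simp: permutes_id[unfolded id_def] lborel_distr_plus id_def)
      have "(\<integral>\<^sup>+y. indicator B (trans_Rk k y x) \<partial>?L) = (\<integral>\<^sup>+y. indicator B y \<partial>distr ?L ?L (\<lambda>y. \<lambda>i\<in>{..<k}. (x i + y i)))"
        using m by (subst nn_integral_distr) (auto simp: trans_Rk_def)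
      also have "\<dots> = 1" unfolding d using LB by simp
      finally show ?thesis
        using that m by (subst nn_integral_cmult) (auto simp: trans_Rk_def[abs_def])
    qed
    then show ?thesis by (simp cong: nn_integral_cong add: sets)
  qed
  have 2: "(\<integral>\<^sup>+x. \<integral>\<^sup>+y. indicator A (trans_Rk k (\<lambda>i. - y i) x) * indicator B x \<partial>?L \<partial>\<nu>) = emeasure ?L A * emeasure \<nu> B"
  proof -
    have "(\<integral>\<^sup>+y. indicator A (trans_Rk k (\<lambda>i. - y i) x) * indicator B x \<partial>?L) = emeasure ?L A * indicator B x" if "x \<in> space \<nu>" for x
    proof -
      have r: "distr lborel borel (\<lambda>y. a - y) = lborel" for a :: real
        using lborel_real_affine[of "-1" a] by (simp add: density_1 one_ennreal_def[symmetric])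
      have d: "distr ?L ?L (\<lambda>y. \<lambda>i\<in>{..<k}. (x i - y i)) = ?L"
        and m: "(\<lambda>y. \<lambda>i\<in>{..<k}. (x i - y i)) \<in> measurable ?L ?L"
        using distr_leb_Rk_coordinatewise[of k "\<lambda>i y. x i - y" id] r by (auto simp: permutes_id[unfolded id_def] id_def)
      have "(\<integral>\<^sup>+y. indicator A (trans_Rk k (\<lambda>i. - y i) x) \<partial>?L) = (\<integral>\<^sup>+y. indicator A y \<partial>distr ?L ?L (\<lambda>y. \<lambda>i\<in>{..<k}. (x i - y i)))"
        using m by (subst nn_integral_distr) (auto simp: trans_Rk_def)
      also have "\<dots> = emeasure ?L A" unfolding d by simp
      finally show ?thesis
        using that m by (subst nn_integral_multc) (auto simp: trans_Rk_def[abs_def])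
    qed
    then have "(\<integral>\<^sup>+x. \<integral>\<^sup>+y. indicator A (trans_Rk k (\<lambda>i. - y i) x) * indicator B x \<partial>?L \<partial>\<nu>) =
       (\<integral>\<^sup>+x. emeasure ?L A * indicator B x \<partial>\<nu>)" by (rule nn_integral_cong)
    also have "\<dots> = emeasure ?L A * emeasure \<nu> B" using B sets by (intro nn_integral_cmult_indicator) auto
    finally show ?thesis .
  qed
  have "(\<integral>\<^sup>+x. \<integral>\<^sup>+y. indicator A x * indicator B (trans_Rk k y x) \<partial>?L \<partial>\<nu>) =
      (\<integral>\<^sup>+y. \<integral>\<^sup>+x. indicator A x * indicator B (trans_Rk k y x) \<partial>\<nu> \<partial>?L)"
    by (rule P.Fubini'[symmetric]) measurable
  also have "\<dots> = (\<integral>\<^sup>+y. \<integral>\<^sup>+x. indicator A (trans_Rk k (\<lambda>i. - y i) x) * indicator B x \<partial>\<nu> \<partial>?L)"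
  proof (rule nn_integral_cong)
    fix y assume y: "y \<in> space ?L"
    let ?t = "trans_Rk k (\<lambda>i. - y i)"
    have t\<nu>: "?t \<in> measurable \<nu> ?L" using tz by (simp cong: measurable_cong_sets add: sets)
    have ty: "trans_Rk k y \<in> measurable \<nu> ?L" using tz by (simp cong: measurable_cong_sets add: sets)
    have "(\<integral>\<^sup>+x. indicator A x * indicator B (trans_Rk k y x) \<partial>\<nu>) =
        (\<integral>\<^sup>+x. indicator A x * indicator B (trans_Rk k y x) \<partial>distr \<nu> ?L ?t)"
      by (simp add: inv)
    also have "\<dots> = (\<integral>\<^sup>+x. indicator A (?t x) * indicator B (trans_Rk k y (?t x)) \<partial>\<nu>)"
      using t\<nu> tz by (subst nn_integral_distr) auto
    also have "\<dots> = (\<integral>\<^sup>+x. indicator A (?t x) * indicator B x \<partial>\<nu>)"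
    proof (rule nn_integral_cong)
      fix x assume "x \<in> space \<nu>"
      then have "trans_Rk k y (?t x) = x"
        unfolding sp\<nu> by (auto simp: trans_Rk_def space_PiM PiE_iff extensional_def fun_eq_iff)
      then show "indicator A (?t x) * indicator B (trans_Rk k y (?t x)) = (indicator A (?t x) * indicator B x :: ennreal)" by simp
    qed
    finally show "(\<integral>\<^sup>+x. indicator A x * indicator B (trans_Rk k y x) \<partial>\<nu>) = (\<integral>\<^sup>+x. indicator A (?t x) * indicator B x \<partial>\<nu>)" .
  qed
  also have "\<dots> = (\<integral>\<^sup>+x. \<integral>\<^sup>+y. indicator A (trans_Rk k (\<lambda>i. - y i) x) * indicator B x \<partial>?L \<partial>\<nu>)"
    by (rule P.Fubini') measurable
  finally have "emeasure \<nu> A = emeasure (leb_Rk k) A * emeasure \<nu> B" unfolding 1 2 .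
  then show ?thesis unfolding B_def by (simp only: mult.commute)
qed

definition aff :: "nat \<Rightarrow> 'a::real_vector \<Rightarrow> (nat \<Rightarrow> 'a) \<Rightarrow> (nat \<Rightarrow> real) \<Rightarrow> 'a" where
  "aff k x v y = x + (\<Sum>j<k. y j *\<^sub>R v j)"

definition indep_frame :: "nat \<Rightarrow> (nat \<Rightarrow> 'a::real_vector) \<Rightarrow> bool" where
  "indep_frame k v \<longleftrightarrow> inj_on v {..<k} \<and> independent (v ` {..<k})"

definition plane :: "nat \<Rightarrow> 'a::real_vector \<Rightarrow> (nat \<Rightarrow> 'a) \<Rightarrow> 'a set" where
  "plane k x v = {p. p - x \<in> span (v ` {..<k})}"

lemma aff_in_plane: "aff k x v y \<in> plane k x v"
  unfolding aff_def plane_def by (auto intro!: span_sum span_scale intro: span_base)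

lemma base_in_plane: "x \<in> plane k x v"
  by (simp add: plane_def span_zero)

lemma closed_plane: "closed (plane k x (v :: nat \<Rightarrow> 'a::euclidean_space))"
proof -
  have "plane k x v = (\<lambda>p. p - x) -` span (v ` {..<k})" by (auto simp: plane_def)
  also have "closed \<dots>" by (intro closed_vimage closed_span continuous_intros)
  finally show ?thesis .
qed

lemma aff_cong: "(\<And>j. j < k \<Longrightarrow> y j = z j) \<Longrightarrow> aff k x v y = aff k x v z"
  by (simp add: aff_def)

lemma norm_aff_diff_le:
  fixes v :: "nat \<Rightarrow> 'a::real_normed_vector"
  shows "norm (aff k x v y - aff k x v z) \<le> (\<Sum>j<k. \<bar>y j - z j\<bar> * norm (v j))"
proof -
  have "aff k x v y - aff k x v z = (\<Sum>j<k. (y j - z j) *\<^sub>R v j)"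
    by (simp add: aff_def scaleR_diff_left sum_subtractf)
  then show ?thesis by (metis (no_types, lifting) norm_scaleR norm_sum sum.cong)
qed

lemma measurable_aff [measurable]:
  fixes v :: "nat \<Rightarrow> 'a::euclidean_space"
  shows "aff k x v \<in> borel_measurable (leb_Rk k)"
proof -
  have 1: "(\<lambda>y. y j) \<in> borel_measurable (leb_Rk k)" if "j < k" for j
    using measurable_component_singleton[of j "{..<k}" "\<lambda>_. lborel :: real measure"] that by simp
  then show ?thesis unfolding aff_def by (intro borel_measurable_add borel_measurable_sum borel_measurable_scaleR) auto
qed

text \<open>
  Some linear functionals dual to the frame; they are unique only on its span.
\<close>

definition dual_frame :: "nat \<Rightarrow> (nat \<Rightarrow> 'a::real_vector) \<Rightarrow> nat \<Rightarrow> 'a \<Rightarrow> real" where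
  "dual_frame k v = (SOME \<pi>. (\<forall>l. linear (\<pi> l)) \<and> (\<forall>l<k. \<forall>m<k. \<pi> l (v m) = (if l = m then 1 else 0)))"

lemma dual_frame:
  assumes "indep_frame k v"
  shows linear_dual_frame: "linear (dual_frame k v l)"
    and dual_frame_frame: "l < k \<Longrightarrow> m < k \<Longrightarrow> dual_frame k v l (v m) = (if l = m then 1 else 0)"
proof -
  have "\<exists>g. linear g \<and> (l < k \<longrightarrow> (\<forall>m<k. g (v m) = (if l = m then 1 else (0::real))))" for l
  proof -
    have "independent (v ` {..<k})" using assms by (simp add: indep_frame_def)
    from linear_independent_extend[OF this, of "\<lambda>b. if b = v l then 1 else (0::real)"]
    obtain g where g: "linear g" "\<And>m. m < k \<Longrightarrow> g (v m) = (if v m = v l then 1 else (0::real))" by auto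
    have "g (v m) = (if l = m then 1 else 0)" if "l < k" "m < k" for m
      using g(2)[of m] that assms by (auto simp: indep_frame_def inj_on_def)
    with g(1) show ?thesis by blast
  qed
  then obtain g where "\<forall>l. linear (g l) \<and> (l < k \<longrightarrow> (\<forall>m<k. g l (v m) = (if l = m then 1 else (0::real))))"
    by metis
  then have "\<exists>\<pi>. (\<forall>l. linear (\<pi> l)) \<and> (\<forall>l<k. \<forall>m<k. \<pi> l (v m) = (if l = m then 1 else (0::real)))"
    by blast
  from someI_ex[OF this]
  show "linear (dual_frame k v l)" "l < k \<Longrightarrow> m < k \<Longrightarrow> dual_frame k v l (v m) = (if l = m then 1 else 0)"
    unfolding dual_frame_def[symmetric] by blast+
qed

lemma dual_frame_aff:
  assumes "indep_frame k v" "l < k"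
  shows "dual_frame k v l (aff k x v y - x) = y l"
proof -
  have "dual_frame k v l (aff k x v y - x) = (\<Sum>j<k. y j * dual_frame k v l (v j))"
    using linear_dual_frame[OF assms(1)] by (simp add: aff_def linear_sum linear_scale)
  also have "\<dots> = (\<Sum>j<k. if j = l then y j else 0)"
    using assms by (intro sum.cong) (auto simp: dual_frame_frame)
  finally show ?thesis using assms(2) by simp
qed

lemma plane_eq_range_aff:
  assumes "indep_frame k v"
  shows "plane k x v = range (aff k x v)"
proof (intro equalityI subsetI)
  fix p assume "p \<in> plane k x v"
  then have "p - x \<in> span (v ` {..<k})" by (simp add: plane_def)
  then obtain u where u: "p - x = (\<Sum>b\<in>v ` {..<k}. u b *\<^sub>R b)"
    unfolding span_finite[OF finite_imageI[OF finite_lessThan]] by auto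
  also have "\<dots> = (\<Sum>j<k. u (v j) *\<^sub>R v j)"
    using assms by (simp add: sum.reindex indep_frame_def)
  finally have "p = aff k x v (\<lambda>j. u (v j))" by (simp add: aff_def algebra_simps)
  then show "p \<in> range (aff k x v)" by blast
qed (auto intro: aff_in_plane)

definition frame_coords :: "nat \<Rightarrow> 'a::real_vector \<Rightarrow> (nat \<Rightarrow> 'a) \<Rightarrow> 'a \<Rightarrow> nat \<Rightarrow> real" where
  "frame_coords k x v p = (\<lambda>l\<in>{..<k}. dual_frame k v l (p - x))"

lemma frame_coords_aff: "indep_frame k v \<Longrightarrow> frame_coords k x v (aff k x v y) = restrict y {..<k}"
  by (auto simp: frame_coords_def dual_frame_aff)

lemma aff_frame_coords:
  assumes "indep_frame k v" "p \<in> plane k x v"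
  shows "aff k x v (frame_coords k x v p) = p"
proof -
  obtain y where y: "p = aff k x v y" using assms plane_eq_range_aff by blast
  show ?thesis unfolding y frame_coords_aff[OF assms(1)] by (rule aff_cong) simp
qed

lemma measurable_frame_coords:
  fixes v :: "nat \<Rightarrow> 'a::euclidean_space"
  assumes "indep_frame k v"
  shows "frame_coords k x v \<in> measurable borel (leb_Rk k)"
  unfolding frame_coords_def
proof (rule measurable_restrict)
  fix l
  have "continuous_on UNIV (\<lambda>p. dual_frame k v l (p - x))"
    using linear_dual_frame[OF assms]
    by (intro continuous_on_compose2[OF linear_continuous_on[of "dual_frame k v l"]] continuous_intros)
      (auto simp: linear_conv_bounded_linear)
  then show "(\<lambda>p. dual_frame k v l (p - x)) \<in> measurable borel lborel"
    by (simp add: borel_measurable_continuous_onI)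
qed

lemma aff_image_eq:
  assumes "indep_frame k v" "B \<subseteq> space (leb_Rk k)"
  shows "aff k x v ` B = {p \<in> plane k x v. frame_coords k x v p \<in> B}"
proof (intro equalityI subsetI)
  fix p assume "p \<in> aff k x v ` B"
  then obtain y where y: "y \<in> B" "p = aff k x v y" by blast
  then have "restrict y {..<k} = y" using assms(2) by (auto simp: space_PiM PiE_iff extensional_restrict)
  then show "p \<in> {p \<in> plane k x v. frame_coords k x v p \<in> B}"
    using y assms(1) by (auto simp: aff_in_plane frame_coords_aff)
next
  fix p assume "p \<in> {p \<in> plane k x v. frame_coords k x v p \<in> B}"
  then show "p \<in> aff k x v ` B" using aff_frame_coords[OF assms(1)] by (metis (mono_tags, lifting) imageI mem_Collect_eq)
qed

lemma borel_aff_image: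
  fixes v :: "nat \<Rightarrow> 'a::euclidean_space"
  assumes "indep_frame k v" "B \<in> sets (leb_Rk k)"
  shows "aff k x v ` B \<in> sets borel"
proof -
  have "aff k x v ` B = plane k x v \<inter> frame_coords k x v -` B"
    using aff_image_eq[OF assms(1) sets.sets_into_space[OF assms(2)]] by auto
  also have "\<dots> \<in> sets borel"
    using measurable_sets_borel[OF measurable_frame_coords[OF assms(1)] assms(2)] borel_closed[OF closed_plane]
    by (intro sets.Int) auto
  finally show ?thesis .
qed

lemma hausdorff_pre_finite_cover:
  assumes "finite Z" "A \<subseteq> (\<Union>z\<in>Z. C z)" "\<And>z. z \<in> Z \<Longrightarrow> bounded (C z)" "\<And>z. z \<in> Z \<Longrightarrow> diameter (C z) \<le> \<delta>" "0 \<le> \<delta>"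
  shows "hausdorff_pre k \<delta> A \<le> (\<Sum>z\<in>Z. hausdorff_gauge k (C z))"
proof -
  obtain h where h: "bij_betw h {0..<card Z} Z" using ex_bij_betw_nat_finite[OF assms(1)] by blast
  define D where "D = (\<lambda>i. if i < card Z then C (h i) else {})"
  have hZ: "h i \<in> Z" if "i < card Z" for i using h that by (auto simp: bij_betw_def)
  have "hausdorff_pre k \<delta> A \<le> (\<Sum>i. hausdorff_gauge k (D i))"
  proof (rule hausdorff_pre_le)
    show "A \<subseteq> \<Union> (range D)"
    proof
      fix a assume "a \<in> A"
      then obtain z where "z \<in> Z" "a \<in> C z" using assms(2) by blast
      moreover from \<open>z \<in> Z\<close> h obtain i where "i \<in> {0..<card Z}" "h i = z"
        unfolding bij_betw_def by (metis imageE)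
      ultimately have "a \<in> D i" by (simp add: D_def)
      then show "a \<in> \<Union> (range D)" by blast
    qed
  qed (use assms hZ in \<open>auto simp: D_def\<close>)
  also have "\<dots> = (\<Sum>i<card Z. hausdorff_gauge k (D i))"
    by (rule suminf_finite) (auto simp: D_def)
  also have "\<dots> = (\<Sum>i\<in>{0..<card Z}. hausdorff_gauge k (C (h i)))"
    by (rule sum.cong) (auto simp: D_def)
  also have "\<dots> = (\<Sum>z\<in>Z. hausdorff_gauge k (C z))"
    by (rule sum.reindex_bij_betw[OF h])
  finally show ?thesis .
qed

lemma hausdorff_gauge_le:
  assumes "diameter C \<le> d" "bounded C" "0 \<le> d"
  shows "hausdorff_gauge k C \<le> ennreal (unit_ball_vol (real k) * (d / 2) ^ k)"
  unfolding hausdorff_gauge_def using assms diameter_ge_0[OF assms(2)]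
  by (auto intro!: ennreal_leI mult_left_mono power_mono)

text \<open>
  The cube is cut into \<open>N\<^sup>k\<close> small cubes, whose images have diameter of order \<open>1 / N\<close>.
\<close>

lemma hausdorff_outer_aff_cube_finite:
  fixes v :: "nat \<Rightarrow> 'a::real_normed_vector"
  shows "hausdorff_outer k (aff k x v ` unit_cube k) < top"
proof -
  define C where "C = (\<Sum>j<k. norm (v j))"
  have C0: "C \<ge> 0" unfolding C_def by (simp add: sum_nonneg)
  define K where "K = unit_ball_vol (real k) * (C/2)^k"
  have "hausdorff_pre k \<delta> (aff k x v ` unit_cube k) \<le> ennreal K" if \<delta>: "\<delta> > 0" for \<delta>
  proof -
    obtain N :: nat where N: "real N > C / \<delta>" using reals_Archimedean2 by blast
    then have Np: "N > 0" using C0 \<delta>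
      by (metis divide_nonneg_pos gr0I not_less of_nat_0)
    then have CN: "C / real N \<le> \<delta>" using N \<delta> by (simp add: field_simps)
    define Z where "Z = PiE {..<k} (\<lambda>_. {..<N})"
    define Q where "Q = (\<lambda>z. {y \<in> unit_cube k. \<forall>l<k. real (z l) / real N \<le> y l \<and> y l \<le> (real (z l) + 1) / real N})"
    have dist: "dist p q \<le> C / real N" if pq: "p \<in> aff k x v ` Q z" "q \<in> aff k x v ` Q z" for p q z
    proof -
      obtain y y' where y: "y \<in> Q z" "y' \<in> Q z" "p = aff k x v y" "q = aff k x v y'" using pq by auto
      have "\<bar>y j - y' j\<bar> \<le> 1 / real N" if "j < k" for j
      proof -
        have "real (z j) / real N \<le> y j" "y j \<le> real (z j) / real N + 1 / real N"
          "real (z j) / real N \<le> y' j" "y' j \<le> real (z j) / real N + 1 / real N"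
          using y that by (auto simp: Q_def add_divide_distrib)
        then show ?thesis by linarith
      qed
      then have "(\<Sum>j<k. \<bar>y j - y' j\<bar> * norm (v j)) \<le> (\<Sum>j<k. (1 / real N) * norm (v j))"
        by (intro sum_mono mult_right_mono) auto
      also have "\<dots> = C / real N" by (simp add: C_def sum_divide_distrib)
      finally show ?thesis using norm_aff_diff_le[of k x v y y'] y by (simp add: dist_norm)
    qed
    have diam: "diameter (aff k x v ` Q z) \<le> C / real N" for z
      using dist C0 by (intro diameter_le) (auto simp: dist_norm)
    have bnd: "bounded (aff k x v ` Q z)" for z
      unfolding bounded_two_points using dist by blast
    have cover: "aff k x v ` unit_cube k \<subseteq> (\<Union>z\<in>Z. aff k x v ` Q z)"
    proof
      fix p assume "p \<in> aff k x v ` unit_cube k"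
      then obtain y where y: "y \<in> unit_cube k" "p = aff k x v y" by blast
      define z where "z = (\<lambda>l\<in>{..<k}. if y l = 1 then N - 1 else nat \<lfloor>y l * real N\<rfloor>)"
      have yl: "0 \<le> y l \<and> y l \<le> 1" if "l < k" for l using y that by (auto simp: unit_cube_def PiE_iff)
      have "z l < N \<and> real (z l) / real N \<le> y l \<and> y l \<le> (real (z l) + 1) / real N" if l: "l < k" for l
      proof (cases "y l = 1")
        case True
        then show ?thesis using Np l by (auto simp: z_def of_nat_diff field_simps)
      next
        case False
        then have y1: "y l < 1" using yl[OF l] by linarith
        have zl: "z l = nat \<lfloor>y l * real N\<rfloor>" using l False by (simp add: z_def)
        have f0: "0 \<le> \<lfloor>y l * real N\<rfloor>" using yl[OF l] by simp
        have r: "real (z l) = of_int \<lfloor>y l * real N\<rfloor>" using f0 by (simp add: zl)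
        have a: "real (z l) \<le> y l * real N" "y l * real N < real (z l) + 1" unfolding r by linarith+
        have "real (z l) < real N" using a(1) y1 Np
          by (smt (verit, best) mult_less_cancel_right2 of_nat_0_less_iff)
        then show ?thesis using a Np by (auto simp: field_simps)
      qed
      then have "z \<in> Z" "y \<in> Q z" using y(1) by (auto simp: Z_def Q_def z_def)
      then show "p \<in> (\<Union>z\<in>Z. aff k x v ` Q z)" using y(2) by blast
    qed
    have finZ: "finite Z" unfolding Z_def by (intro finite_PiE) auto
    have "hausdorff_pre k \<delta> (aff k x v ` unit_cube k) \<le> (\<Sum>z\<in>Z. hausdorff_gauge k (aff k x v ` Q z))"
      using order_trans[OF diam CN] bnd \<delta> by (intro hausdorff_pre_finite_cover finZ cover) auto
    also have "\<dots> \<le> (\<Sum>z\<in>Z. ennreal (unit_ball_vol (real k) * ((C / real N) / 2) ^ k))"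
      using diam bnd C0 by (intro sum_mono hausdorff_gauge_le) auto
    also have "\<dots> = ennreal (real (card Z)) * ennreal (unit_ball_vol (real k) * ((C / real N) / 2) ^ k)"
      by (simp add: ennreal_of_nat_eq_real_of_nat)
    also have "\<dots> = ennreal (real (N^k) * (unit_ball_vol (real k) * ((C / real N) / 2) ^ k))"
      using C0 by (subst ennreal_mult) (auto simp: Z_def card_PiE)
    also have "real (N^k) * (unit_ball_vol (real k) * ((C / real N) / 2) ^ k) = K"
      using Np by (simp add: K_def power_divide)
    finally show ?thesis .
  qed
  then have "hausdorff_outer k (aff k x v ` unit_cube k) \<le> ennreal K"
    unfolding hausdorff_outer_eq_SUP by (intro SUP_least) auto
  then show ?thesis by (metis ennreal_less_top order_le_less_trans)
qed

text \<open>
  A covering set of diameter \<open>d\<close> has coordinates in a box with sides of order \<open>d\<close>, so that the boxes of a covering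
  have total volume at least \<open>1\<close>.
\<close>

lemma hausdorff_outer_aff_cube_pos:
  fixes v :: "nat \<Rightarrow> 'a::euclidean_space"
  assumes ind: "indep_frame k v"
  shows "hausdorff_outer k (aff k x v ` unit_cube k) > 0"
proof -
  have "\<exists>b>0. \<forall>p. \<bar>dual_frame k v l p\<bar> \<le> b * norm p" for l
    using linear_bounded_pos[OF linear_dual_frame[OF ind, of l]] by auto
  then obtain b0 where b0: "\<And>l. b0 l > 0" "\<And>l p. \<bar>dual_frame k v l p\<bar> \<le> b0 l * norm p" by metis
  define b where "b = 1 + (\<Sum>l<k. b0 l)"
  have b: "b > 0" unfolding b_def using b0(1) by (simp add: add_pos_nonneg sum_nonneg less_imp_le)
  have bl: "\<bar>dual_frame k v l p\<bar> \<le> b * norm p" if "l < k" for l p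
  proof -
    have "b0 l \<le> (\<Sum>l<k. b0 l)" using that b0(1) by (intro member_le_sum) (auto intro: less_imp_le)
    then have "b0 l * norm p \<le> b * norm p" unfolding b_def by (intro mult_right_mono) auto
    with b0(2)[of l p] show ?thesis by linarith
  qed
  define \<alpha> where "\<alpha> = unit_ball_vol (real k)"
  have \<alpha>: "\<alpha> > 0" by (simp add: \<alpha>_def)
  define K where "K = (4*b)^k / \<alpha>"
  have K: "K > 0" using b \<alpha> by (simp add: K_def)
  have "ennreal (1/K) \<le> hausdorff_pre k 1 (aff k x v ` unit_cube k)"
    unfolding hausdorff_pre_def
  proof (intro INF_greatest)
    fix C :: "nat \<Rightarrow> 'a set"
    assume "C \<in> {C. aff k x v ` unit_cube k \<subseteq> \<Union> (range C) \<and> (\<forall>i. bounded (C i) \<and> diameter (C i) \<le> 1)}"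
    then have C: "aff k x v ` unit_cube k \<subseteq> \<Union> (range C)" "\<And>i. bounded (C i)" by auto
    define p where "p = (\<lambda>i. SOME p. p \<in> C i)"
    have p: "p i \<in> C i" if "C i \<noteq> {}" for i using that unfolding p_def by (simp add: some_in_eq)
    define box where "box = (\<lambda>i. if C i = {} then {} else
       PiE {..<k} (\<lambda>l. {dual_frame k v l (p i - x) - b * diameter (C i) .. dual_frame k v l (p i - x) + b * diameter (C i)}))"
    have boxm: "box i \<in> sets (leb_Rk k)" for i
      by (auto simp: box_def intro!: sets_PiM_I_finite)
    have boxL: "emeasure (leb_Rk k) (box i) \<le> ennreal K * hausdorff_gauge k (C i)" for i
    proof (cases "C i = {}")
      case False
      define d where "d = diameter (C i)"
      have d: "d \<ge> 0" using C(2) by (simp add: d_def diameter_ge_0)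
      have "emeasure (leb_Rk k) (box i) = (\<Prod>l<k. ennreal (2 * (b * d)))"
        using False b d by (simp add: box_def d_def[symmetric] emeasure_leb_Rk_box)
      also have "\<dots> = ennreal ((2*(b*d))^k)" using b d by (simp add: ennreal_power)
      also have "(2*(b*d))^k = K * (\<alpha> * (d/2)^k)"
      proof -
        have "K * (\<alpha> * (d/2)^k) = (4*b)^k * (d/2)^k" using \<alpha> by (simp add: K_def)
        also have "\<dots> = (4*b*(d/2))^k" by (simp only: power_mult_distrib)
        finally show ?thesis by simp
      qed
      also have "ennreal \<dots> = ennreal K * hausdorff_gauge k (C i)"
        using False K \<alpha> d by (simp add: hausdorff_gauge_def \<alpha>_def d_def ennreal_mult)
      finally show ?thesis by simp
    qed (simp add: box_def)
    have "unit_cube k \<subseteq> (\<Union>i. box i)"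
    proof
      fix y assume y: "y \<in> unit_cube k"
      then obtain i where i: "aff k x v y \<in> C i" using C(1) by blast
      have "\<bar>y l - dual_frame k v l (p i - x)\<bar> \<le> b * diameter (C i)" if l: "l < k" for l
      proof -
        have "y l - dual_frame k v l (p i - x) = dual_frame k v l (aff k x v y - x) - dual_frame k v l (p i - x)"
          by (simp add: dual_frame_aff[OF ind l])
        also have "\<dots> = dual_frame k v l (aff k x v y - p i)"
          using linear_dual_frame[OF ind] by (simp add: linear_diff[symmetric])
        finally have "\<bar>y l - dual_frame k v l (p i - x)\<bar> \<le> b * norm (aff k x v y - p i)"
          using bl[OF l] by simp
        also have "norm (aff k x v y - p i) \<le> diameter (C i)"
          using diameter_bounded_bound[OF C(2) i p[of i]] i by (auto simp: dist_norm)
        finally show ?thesis using b by simp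
      qed
      then have "y l \<in> {dual_frame k v l (p i - x) - b * diameter (C i) .. dual_frame k v l (p i - x) + b * diameter (C i)}"
        if "l < k" for l using that unfolding atLeastAtMost_iff by (smt (verit, best))
      then have "y \<in> box i" using y i by (simp add: box_def unit_cube_def PiE_iff) auto
      then show "y \<in> (\<Union>i. box i)" by blast
    qed
    then have "emeasure (leb_Rk k) (unit_cube k) \<le> emeasure (leb_Rk k) (\<Union>i. box i)"
      using boxm by (intro emeasure_mono) auto
    also have "\<dots> \<le> (\<Sum>i. emeasure (leb_Rk k) (box i))"
      using boxm by (intro emeasure_subadditive_countably) auto
    also have "\<dots> \<le> (\<Sum>i. ennreal K * hausdorff_gauge k (C i))"
      by (intro suminf_le boxL) auto
    also have "\<dots> = ennreal K * (\<Sum>i. hausdorff_gauge k (C i))" by simp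
    also have "emeasure (leb_Rk k) (unit_cube k) = 1"
      by (simp add: unit_cube_def emeasure_leb_Rk_box)
    finally have "ennreal (1/K) * 1 \<le> ennreal (1/K) * (ennreal K * (\<Sum>i. hausdorff_gauge k (C i)))"
      by (rule mult_left_mono) simp
    also have "\<dots> = (\<Sum>i. hausdorff_gauge k (C i))"
      using K by (simp add: mult.assoc[symmetric] ennreal_mult[symmetric])
    finally show "ennreal (1/K) \<le> (\<Sum>i. hausdorff_gauge k (C i))" by simp
  qed
  also have "\<dots> \<le> hausdorff_outer k (aff k x v ` unit_cube k)" by (rule hausdorff_pre_le_outer) simp
  finally have "ennreal (1/K) \<le> hausdorff_outer k (aff k x v ` unit_cube k)" .
  moreover have "0 < ennreal (1/K)" using K by simp
  ultimately show ?thesis by (rule less_le_trans[rotated])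
qed

text \<open>
  On a plane, Hausdorff measure is a positive multiple of Lebesgue measure in affine coordinates.
  The reason is that the Hausdorff measure of the image of a set of coordinates is invariant under
  translations.  The factor is not computed: it cancels from energies and masses.
\<close>

lemma hausdorff_plane:
  fixes v :: "nat \<Rightarrow> 'a::euclidean_space"
  assumes ind: "indep_frame k v"
  shows "\<exists>c>0. distr (leb_Rk k) borel (aff k x v) =
    density (hausdorff_measure k) (\<lambda>p. ennreal (indicator (plane k x v) p / c))"
proof -
  let ?H = "hausdorff_measure k :: 'a measure" and ?L = "leb_Rk k"
  let ?P = "plane k x v" and ?f = "frame_coords k x v"
  have P[measurable]: "?P \<in> sets borel" by (simp add: closed_plane borel_closed)
  have f[measurable]: "?f \<in> measurable borel ?L" by (rule measurable_frame_coords[OF ind])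
  define \<nu> where "\<nu> = distr (density ?H (indicator ?P)) ?L ?f"
  have \<nu>: "emeasure \<nu> B = hausdorff_outer k {p\<in>?P. ?f p \<in> B}" if B: "B \<in> sets ?L" for B
  proof -
    have vB: "?f -` B \<in> sets borel" using measurable_sets_borel[OF f B] by simp
    have "emeasure \<nu> B = emeasure (density ?H (indicator ?P)) (?f -` B)"
      unfolding \<nu>_def using B by (subst emeasure_distr) auto
    also have "\<dots> = emeasure ?H (?P \<inter> ?f -` B)"
      using vB by (subst emeasure_density) (auto simp: indicator_inter_arith[symmetric])
    also have "?P \<inter> ?f -` B = {p\<in>?P. ?f p \<in> B}" by auto
    finally have eq: "emeasure \<nu> B = emeasure ?H {p\<in>?P. ?f p \<in> B}" .
    have "{p\<in>?P. ?f p \<in> B} \<in> sets borel"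
      using sets.Int[OF P vB] by (simp add: Int_def vimage_def)
    then show ?thesis using eq by (simp add: emeasure_hausdorff)
  qed
  have cubem: "unit_cube k \<in> sets ?L" unfolding unit_cube_def by (auto intro!: sets_PiM_I_finite)
  have \<nu>a: "emeasure \<nu> B = hausdorff_outer k (aff k x v ` B)" if B: "B \<in> sets ?L" for B
    using \<nu>[OF B] aff_image_eq[OF ind sets.sets_into_space[OF B]] by simp
  have sets\<nu>[simp]: "sets \<nu> = sets ?L" by (simp add: \<nu>_def)
  have tz: "trans_Rk k z \<in> measurable ?L ?L" for z
    unfolding trans_Rk_def
    using distr_leb_Rk_coordinatewise(2)[of k "\<lambda>i y. z i + y" id]
    by (auto simp: permutes_id[unfolded id_def] lborel_distr_plus id_def add.commute)
  have inv: "distr \<nu> ?L (trans_Rk k z) = \<nu>" for z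
  proof (rule measure_eqI)
    fix B assume "B \<in> sets (distr \<nu> ?L (trans_Rk k z))"
    then have B: "B \<in> sets ?L" by simp
    define w where "w = (\<Sum>j<k. z j *\<^sub>R v j)"
    have tz': "trans_Rk k z \<in> measurable \<nu> ?L" using tz by (simp cong: measurable_cong_sets)
    have pre: "trans_Rk k z -` B \<inter> space \<nu> \<in> sets ?L" using measurable_sets[OF tz' B] by simp
    have w: "w \<in> span (v ` {..<k})" unfolding w_def by (auto intro!: span_sum span_scale intro: span_base)
    have sh: "p + w \<in> ?P \<longleftrightarrow> p \<in> ?P" for p
      using span_add[OF _ w, of "p - x"] span_diff[OF _ w, of "p + w - x"] unfolding plane_def
      by (auto simp: algebra_simps)
    have fw: "?f (p + w) = trans_Rk k z (?f p)" for p
    proof -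
      have "dual_frame k v l (p + w - x) = dual_frame k v l (p - x) + z l" if "l < k" for l
      proof -
        have "w = aff k 0 v z - 0" by (simp add: w_def aff_def)
        then have "dual_frame k v l w = z l" using dual_frame_aff[OF ind that, of 0 z] by simp
        moreover have "p + w - x = (p - x) + w" by simp
        ultimately show ?thesis using linear_add[OF linear_dual_frame[OF ind]] by metis
      qed
      then show ?thesis by (auto simp: frame_coords_def trans_Rk_def)
    qed
    have "{p\<in>?P. ?f p \<in> B} = (\<lambda>p. w + 1 *\<^sub>R p) ` {p\<in>?P. ?f p \<in> trans_Rk k z -` B \<inter> space \<nu>}"
    proof (intro equalityI subsetI)
      fix p assume p: "p \<in> {p\<in>?P. ?f p \<in> B}"
      have fs: "?f q \<in> space \<nu>" for q
        unfolding sets_eq_imp_space_eq[OF sets\<nu>] by (auto simp: frame_coords_def space_PiM)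
      have "p - w \<in> ?P" "trans_Rk k z (?f (p - w)) = ?f p" using sh[of "p - w"] fw[of "p - w"] p by auto
      then show "p \<in> (\<lambda>p. w + 1 *\<^sub>R p) ` {p\<in>?P. ?f p \<in> trans_Rk k z -` B \<inter> space \<nu>}"
        using p fs by (intro image_eqI[of _ _ "p - w"]) auto
    next
      fix p assume "p \<in> (\<lambda>p. w + 1 *\<^sub>R p) ` {p\<in>?P. ?f p \<in> trans_Rk k z -` B \<inter> space \<nu>}"
      then show "p \<in> {p\<in>?P. ?f p \<in> B}" using sh fw by (auto simp: add.commute[of w])
    qed
    then have "emeasure \<nu> B = hausdorff_outer k {p\<in>?P. ?f p \<in> trans_Rk k z -` B \<inter> space \<nu>}"
      using \<nu>[OF B] hausdorff_outer_similarity[of 1 k w] by simp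
    also have "\<dots> = emeasure \<nu> (trans_Rk k z -` B \<inter> space \<nu>)" using \<nu>[OF pre] by simp
    also have "\<dots> = emeasure (distr \<nu> ?L (trans_Rk k z)) B"
      using B tz' by (subst emeasure_distr) auto
    finally show "emeasure (distr \<nu> ?L (trans_Rk k z)) B = emeasure \<nu> B" by simp
  qed simp
  have fin: "emeasure \<nu> (unit_cube k) < top"
    using \<nu>a[OF cubem] hausdorff_outer_aff_cube_finite[of k x v] by simp
  have pos: "emeasure \<nu> (unit_cube k) > 0"
    using \<nu>a[OF cubem] hausdorff_outer_aff_cube_pos[OF ind, of x] by simp
  define cube where "cube = (\<lambda>z. PiE {..<k} (\<lambda>l. {z l..z l + (1::real)}))"
  have cm: "cube z \<in> sets ?L" for z by (auto simp: cube_def intro!: sets_PiM_I_finite)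
  have "emeasure \<nu> (cube z) = emeasure \<nu> (unit_cube k)" for z
  proof -
    have tz': "trans_Rk k z \<in> measurable \<nu> ?L" using tz by (simp cong: measurable_cong_sets)
    have sp: "space \<nu> = PiE {..<k} (\<lambda>_. UNIV)"
      using sets_eq_imp_space_eq[OF sets\<nu>] by (simp add: space_PiM)
    have "trans_Rk k z -` cube z \<inter> space \<nu> = unit_cube k"
    proof (rule set_eqI)
      fix y
      have "y l + z l \<in> {z l..z l + 1} \<longleftrightarrow> y l \<in> {0..1}" for l by auto
      then show "y \<in> trans_Rk k z -` cube z \<inter> space \<nu> \<longleftrightarrow> y \<in> unit_cube k"
        unfolding sp vimage_def Int_iff mem_Collect_eq cube_def unit_cube_def trans_Rk_def PiE_iff
        by (simp del: atLeastAtMost_iff)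
    qed
    then have "emeasure (distr \<nu> ?L (trans_Rk k z)) (cube z) = emeasure \<nu> (unit_cube k)"
      using cm tz' by (subst emeasure_distr) auto
    then show ?thesis by (simp add: inv)
  qed
  then have cfin: "emeasure \<nu> (cube z) \<noteq> \<infinity>" for z using fin by (simp add: less_top)
  have sf: "sigma_finite_measure \<nu>"
  proof
    let ?Z = "PiE {..<k} (\<lambda>_. \<int> :: real set)"
    have "countable ?Z" by (intro countable_PiE) (auto simp: countable_int Ints_def)
    moreover have "\<Union> (cube ` ?Z) = space \<nu>"
    proof (intro equalityI subsetI)
      fix y assume "y \<in> space \<nu>"
      then have y: "y \<in> extensional {..<k}"
        using sets_eq_imp_space_eq[OF sets\<nu>] by (simp add: space_PiM PiE_iff)
      have "y l \<in> {of_int \<lfloor>y l\<rfloor>..of_int \<lfloor>y l\<rfloor> + 1}" for l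
        unfolding atLeastAtMost_iff by linarith
      then have "y \<in> cube (\<lambda>l\<in>{..<k}. of_int \<lfloor>y l\<rfloor>)"
        using y unfolding cube_def PiE_iff by simp
      then show "y \<in> \<Union> (cube ` ?Z)" by (intro UN_I[of "\<lambda>l\<in>{..<k}. of_int \<lfloor>y l\<rfloor>"]) auto
    next
      fix y assume "y \<in> \<Union> (cube ` ?Z)"
      then show "y \<in> space \<nu>"
        using sets_eq_imp_space_eq[OF sets\<nu>] by (auto simp: cube_def space_PiM PiE_iff)
    qed
    ultimately show "\<exists>A. countable A \<and> A \<subseteq> sets \<nu> \<and> \<Union> A = space \<nu> \<and> (\<forall>a\<in>A. emeasure \<nu> a \<noteq> \<infinity>)"
      using cm cfin by (intro exI[of _ "cube ` ?Z"]) auto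
  qed
  define c where "c = enn2real (emeasure \<nu> (unit_cube k))"
  have c: "c > 0" "emeasure \<nu> (unit_cube k) = ennreal c"
    using pos fin by (auto simp: c_def enn2real_positive_iff)
  have "distr ?L borel (aff k x v) = density ?H (\<lambda>p. ennreal (indicator ?P p / c))"
  proof (rule measure_eqI)
    fix E assume "E \<in> sets (distr ?L borel (aff k x v))"
    then have E: "E \<in> sets borel" by simp
    define B where "B = aff k x v -` E \<inter> space ?L"
    have B: "B \<in> sets ?L" unfolding B_def using measurable_sets[OF measurable_aff E] by simp
    have PE: "{p\<in>?P. ?f p \<in> B} = ?P \<inter> E"
      using aff_frame_coords[OF ind] by (auto simp: B_def frame_coords_def space_PiM)
    have "ennreal c * emeasure ?L B = hausdorff_outer k (?P \<inter> E)"
      using translation_invariant_measure_unique[OF sets\<nu> sf inv B] \<nu>[OF B] c(2) by (simp add: PE)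
    also have "\<dots> = emeasure ?H (?P \<inter> E)" using P E by (subst emeasure_hausdorff) auto
    finally have *: "ennreal c * emeasure ?L B = emeasure ?H (?P \<inter> E)" .
    have "emeasure (distr ?L borel (aff k x v)) E = emeasure ?L B"
      unfolding B_def using E by (subst emeasure_distr) auto
    also have "\<dots> = ennreal (1/c) * (ennreal c * emeasure ?L B)"
      using c(1) by (simp add: mult.assoc[symmetric] ennreal_mult[symmetric])
    also have "\<dots> = ennreal (1/c) * emeasure ?H (?P \<inter> E)" by (simp add: *)
    also have "\<dots> = (\<integral>\<^sup>+p. ennreal (1/c) * indicator (?P \<inter> E) p \<partial>?H)"
      using P E by (subst nn_integral_cmult_indicator) auto
    also have "\<dots> = (\<integral>\<^sup>+p. ennreal (indicator ?P p / c) * indicator E p \<partial>?H)"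
      by (intro nn_integral_cong) (auto simp: indicator_def)
    also have "\<dots> = emeasure (density ?H (\<lambda>p. ennreal (indicator ?P p / c))) E"
      using E by (subst emeasure_density) auto
    finally show "emeasure (distr ?L borel (aff k x v)) E = emeasure (density ?H (\<lambda>p. ennreal (indicator ?P p / c))) E" .
  qed simp
  with c(1) show ?thesis by blast
qed

section \<open>Alternating forms\<close>

definition leibniz :: "nat \<Rightarrow> (nat \<Rightarrow> nat \<Rightarrow> real) \<Rightarrow> real" where
  "leibniz k M = (\<Sum>\<pi> | \<pi> permutes {..<k}. of_int (sign \<pi>) * (\<Prod>j<k. M j (\<pi> j)))"

lemma wedge_nth:
  "wedge k v $ I = (if card I = k then leibniz k (\<lambda>j i. v j $ (sorted_list_of_set I ! i)) else 0)"
  by (simp add: wedge_def leibniz_def)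

text \<open>
  Only adjacent equal arguments are asked to give \<open>0\<close>; this is easier to verify, and the general case follows
  by transpositions.
\<close>

definition alternating_form :: "nat \<Rightarrow> ((nat \<Rightarrow> 'a::real_vector) \<Rightarrow> real) \<Rightarrow> bool" where
  "alternating_form k f \<longleftrightarrow>
     (\<forall>v j a b. j < k \<longrightarrow> f (v(j := a + b)) = f (v(j := a)) + f (v(j := b))) \<and>
     (\<forall>v j c a. j < k \<longrightarrow> f (v(j := c *\<^sub>R a)) = c * f (v(j := a))) \<and>
     (\<forall>v w. (\<forall>j<k. v j = w j) \<longrightarrow> f v = f w) \<and>
     (\<forall>v i. Suc i < k \<longrightarrow> v i = v (Suc i) \<longrightarrow> f v = 0)"

lemma alternating_formD:
  assumes "alternating_form k f"
  shows "j < k \<Longrightarrow> f (v(j := a + b)) = f (v(j := a)) + f (v(j := b))"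
    and "j < k \<Longrightarrow> f (v(j := c *\<^sub>R a)) = c * f (v(j := a))"
    and "(\<And>j. j < k \<Longrightarrow> v j = w j) \<Longrightarrow> f v = f w"
    and "Suc i < k \<Longrightarrow> v i = v (Suc i) \<Longrightarrow> f v = 0"
  using assms[unfolded alternating_form_def, THEN conjunct1]
    assms[unfolded alternating_form_def, THEN conjunct2, THEN conjunct1]
    assms[unfolded alternating_form_def, THEN conjunct2, THEN conjunct2, THEN conjunct1]
    assms[unfolded alternating_form_def, THEN conjunct2, THEN conjunct2, THEN conjunct2]
  by simp_all

lemma leibniz_permute:
  assumes "\<sigma> permutes {..<k}"
  shows "leibniz k (\<lambda>j. M (\<sigma> j)) = of_int (sign \<sigma>) * leibniz k M"
proof -
  have "leibniz k (\<lambda>j. M (\<sigma> j)) =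
      (\<Sum>\<pi> | \<pi> permutes {..<k}. of_int (sign (\<pi> \<circ> \<sigma>)) * (\<Prod>j<k. M (\<sigma> j) ((\<pi> \<circ> \<sigma>) j)))"
    unfolding leibniz_def by (rule sum_permutations_compose_right[OF assms])
  also have "\<dots> = (\<Sum>\<pi> | \<pi> permutes {..<k}. of_int (sign \<sigma>) * (of_int (sign \<pi>) * (\<Prod>j<k. M j (\<pi> j))))"
  proof (intro sum.cong refl)
    fix \<pi> assume "\<pi> \<in> {\<pi>. \<pi> permutes {..<k}}"
    then have "permutation \<pi>" "permutation \<sigma>"
      using assms by (auto intro: permutes_imp_permutation[of "{..<k}"])
    moreover have "(\<Prod>j<k. M (\<sigma> j) ((\<pi> \<circ> \<sigma>) j)) = (\<Prod>j<k. M j (\<pi> j))"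
      using prod.permute[OF assms, of "\<lambda>j. M j (\<pi> j)"] by (simp add: comp_def)
    ultimately show "of_int (sign (\<pi> \<circ> \<sigma>)) * (\<Prod>j<k. M (\<sigma> j) ((\<pi> \<circ> \<sigma>) j)) =
        of_int (sign \<sigma>) * (of_int (sign \<pi>) * (\<Prod>j<k. M j (\<pi> j)))"
      by (simp add: sign_compose)
  qed
  finally show ?thesis by (simp add: leibniz_def sum_distrib_left)
qed

lemma leibniz_delta: "leibniz k (\<lambda>j i. if i = j then 1 else 0) = 1"
proof -
  have "of_int (sign \<pi>) * (\<Prod>j<k. if \<pi> j = j then 1 else 0) = (if \<pi> = id then 1 else (0::real))"
    if "\<pi> permutes {..<k}" for \<pi> :: "nat \<Rightarrow> nat"
  proof (cases "\<pi> = id")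
    case False
    then obtain j where "\<pi> j \<noteq> j" by (auto simp: fun_eq_iff)
    moreover then have "j < k" using that by (auto simp: permutes_def)
    ultimately have "(\<Prod>j<k. if \<pi> j = j then 1 else (0::real)) = 0" by (auto intro!: prod_zero bexI[of _ j])
    with False show ?thesis by simp
  qed (simp add: sign_id)
  then have "leibniz k (\<lambda>j i. if i = j then 1 else 0) = (\<Sum>\<pi> | \<pi> permutes {..<k}. if \<pi> = id then 1 else (0::real))"
    unfolding leibniz_def by (intro sum.cong) auto
  also have "\<dots> = 1"
    by (subst sum.delta) (auto simp: finite_permutations permutes_id)
  finally show ?thesis .
qed

lemma leibniz_cong: "(\<And>j i. j < k \<Longrightarrow> i < k \<Longrightarrow> M j i = N j i) \<Longrightarrow> leibniz k M = leibniz k N"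
  unfolding leibniz_def
  by (intro sum.cong refl arg_cong2[where f="(*)"] prod.cong) (auto simp: permutes_in_image[where S="{..<k}", simplified])

lemma alternating_form_leibniz:
  assumes lin: "\<And>i. linear (\<phi> i)"
  shows "alternating_form k (\<lambda>v. leibniz k (\<lambda>j i. \<phi> i (v j)))"
proof -
  have split: "(\<Prod>m<k. \<phi> (\<pi> m) ((v(j := a)) m)) = \<phi> (\<pi> j) a * (\<Prod>m\<in>{..<k} - {j}. \<phi> (\<pi> m) (v m))"
    if "j < k" for \<pi> v j a
    using that by (subst prod.remove[of _ j]) auto
  show ?thesis unfolding alternating_form_def
  proof (intro conjI allI impI)
    fix v :: "nat \<Rightarrow> 'a" and j a b assume j: "j < k"
    show "leibniz k (\<lambda>m i. \<phi> i ((v(j := a + b)) m)) =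
        leibniz k (\<lambda>m i. \<phi> i ((v(j := a)) m)) + leibniz k (\<lambda>m i. \<phi> i ((v(j := b)) m))"
      unfolding leibniz_def split[OF j] sum.distrib[symmetric]
      by (intro sum.cong refl) (simp add: linear_add[OF lin] algebra_simps)
  next
    fix v :: "nat \<Rightarrow> 'a" and j a and c :: real assume j: "j < k"
    show "leibniz k (\<lambda>m i. \<phi> i ((v(j := c *\<^sub>R a)) m)) = c * leibniz k (\<lambda>m i. \<phi> i ((v(j := a)) m))"
      unfolding leibniz_def split[OF j] sum_distrib_left
      by (intro sum.cong refl) (simp add: linear_scale[OF lin] algebra_simps)
  next
    fix v w :: "nat \<Rightarrow> 'a" assume "\<forall>j<k. v j = w j"
    then show "leibniz k (\<lambda>m i. \<phi> i (v m)) = leibniz k (\<lambda>m i. \<phi> i (w m))"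
      by (intro leibniz_cong) auto
  next
    fix v :: "nat \<Rightarrow> 'a" and i assume i: "Suc i < k" and eq: "v i = v (Suc i)"
    let ?t = "Transposition.transpose i (Suc i)"
    have t: "?t permutes {..<k}" using i by (intro permutes_swap_id) auto
    have vt: "v (?t j) = v j" for j using eq by (auto simp: Transposition.transpose_def)
    have "leibniz k (\<lambda>j i. \<phi> i (v j)) = of_int (sign ?t) * leibniz k (\<lambda>j i. \<phi> i (v j))"
      using leibniz_permute[OF t, of "\<lambda>j i. \<phi> i (v j)"] unfolding vt .
    then show "leibniz k (\<lambda>j i. \<phi> i (v j)) = 0" by (simp add: sign_swap_id)
  qed
qed

lemma alternating_form_wedge_nth: "alternating_form k (\<lambda>v. wedge k v $ I)"
proof (cases "card I = k")
  case True
  have "linear (\<lambda>x :: real ^ 'n. x $ i)" for i by (intro bounded_linear.linear bounded_linear_vec_nth)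
  then have "alternating_form k (\<lambda>v. leibniz k (\<lambda>j i. (\<lambda>i x. x $ (sorted_list_of_set I ! i)) i (v j)))"
    by (rule alternating_form_leibniz)
  then show ?thesis using True by (simp add: wedge_nth)
qed (simp add: alternating_form_def wedge_nth)

lemma alternating_form_zero: "alternating_form k f \<Longrightarrow> j < k \<Longrightarrow> f (v(j := 0)) = 0"
  using alternating_formD(2)[of k f j v 0 0] by simp

lemma alternating_form_sum:
  assumes f: "alternating_form k f" and j: "j < k"
  shows "f (v(j := (\<Sum>b\<in>B. c b *\<^sub>R u b))) = (\<Sum>b\<in>B. c b * f (v(j := u b)))"
proof (induction B rule: infinite_finite_induct)
  case (insert b B)
  show ?case
    unfolding sum.insert[OF insert(1,2)] alternating_formD(1)[OF f j] alternating_formD(2)[OF f j] insert(3) ..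
next
  case (infinite B)
  show ?case unfolding sum.infinite[OF infinite] by (rule alternating_form_zero[OF f j])
next
  case empty
  show ?case unfolding sum.empty by (rule alternating_form_zero[OF f j])
qed

lemma alternating_form_swap_Suc:
  assumes f: "alternating_form k f" and i: "Suc i < k"
  shows "f (v(i := b, Suc i := a)) = - f (v(i := a, Suc i := b))"
proof -
  have add: "f (v(i := x + y, Suc i := z)) = f (v(i := x, Suc i := z)) + f (v(i := y, Suc i := z))" for x y z
    using alternating_formD(1)[OF f, of i "v(Suc i := z)" x y] i by (simp add: fun_upd_twist)
  have add': "f (v(i := z, Suc i := x + y)) = f (v(i := z, Suc i := x)) + f (v(i := z, Suc i := y))" for x y z
    using alternating_formD(1)[OF f, of "Suc i" "v(i := z)" x y] i by simp
  have z: "f (v(i := x, Suc i := x)) = 0" for x by (rule alternating_formD(4)[OF f i]) simp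
  have "f (v(i := a + b, Suc i := a + b)) = f (v(i := a, Suc i := a)) + f (v(i := a, Suc i := b)) +
      (f (v(i := b, Suc i := a)) + f (v(i := b, Suc i := b)))" unfolding add add' by (simp only: ac_simps)
  then show ?thesis using z[of "a + b"] z[of a] z[of b] by linarith
qed

lemma alternating_form_eq_zero:
  assumes f: "alternating_form k f" and "i < j" "j < k" "v i = v j"
  shows "f v = 0"
  using assms(2-4)
proof (induction j arbitrary: v)
  case (Suc j)
  show ?case
  proof (cases "i = j")
    case True then show ?thesis using Suc alternating_formD(4)[OF f] by blast
  next
    case False
    let ?w = "v(j := v (Suc j), Suc j := v j)"
    have "f ?w = 0" using False Suc.prems by (intro Suc.IH) auto
    moreover have "v(j := v j, Suc j := v (Suc j)) = v" by simp
    ultimately show ?thesis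
      using alternating_form_swap_Suc[OF f, of j v "v (Suc j)" "v j"] Suc.prems(2) by simp
  qed
qed simp

lemma alternating_form_swap:
  assumes f: "alternating_form k f" and ij: "i \<noteq> j" "i < k" "j < k"
  shows "f (v(i := b, j := a)) = - f (v(i := a, j := b))"
proof -
  have add: "f (v(i := x + y, j := z)) = f (v(i := x, j := z)) + f (v(i := y, j := z))" for x y z
    using alternating_formD(1)[OF f, of i "v(j := z)" x y] ij by (simp add: fun_upd_twist)
  have add': "f (v(i := z, j := x + y)) = f (v(i := z, j := x)) + f (v(i := z, j := y))" for x y z
    using alternating_formD(1)[OF f, of j "v(i := z)" x y] ij by simp
  have z: "f (v(i := x, j := x)) = 0" for x
    using alternating_form_eq_zero[OF f, of "min i j" "max i j" "v(i := x, j := x)"] ij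
    by (auto simp: min_def max_def)
  have "f (v(i := a + b, j := a + b)) = f (v(i := a, j := a)) + f (v(i := a, j := b)) +
      (f (v(i := b, j := a)) + f (v(i := b, j := b)))" unfolding add add' by (simp only: ac_simps)
  then show ?thesis using z[of "a + b"] z[of a] z[of b] by linarith
qed

lemma alternating_form_permute:
  assumes f: "alternating_form k f" and \<sigma>: "\<sigma> permutes {..<k}"
  shows "f (v \<circ> \<sigma>) = of_int (sign \<sigma>) * f v"
  using finite_lessThan \<sigma>
proof (induction arbitrary: v rule: permutes_rev_induct)
  case id then show ?case by (simp add: sign_id)
next
  case (swap a b p v)
  show ?case
  proof (cases "a = b")
    case False
    have "v \<circ> p \<circ> Transposition.transpose a b = (v \<circ> p)(a := (v \<circ> p) b, b := (v \<circ> p) a)"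
      by (auto simp: Transposition.transpose_def fun_eq_iff)
    then have "f (v \<circ> p \<circ> Transposition.transpose a b) = f ((v \<circ> p)(a := (v \<circ> p) b, b := (v \<circ> p) a))"
      by (rule arg_cong)
    also have "\<dots> = - f ((v \<circ> p)(a := (v \<circ> p) a, b := (v \<circ> p) b))"
      by (rule alternating_form_swap[OF f False]) (use swap(1,2) in auto)
    also have "(v \<circ> p)(a := (v \<circ> p) a, b := (v \<circ> p) b) = v \<circ> p" by (rule ext) auto
    finally have 1: "f (v \<circ> (p \<circ> Transposition.transpose a b)) = - f (v \<circ> p)" unfolding comp_assoc .
    have 2: "sign (p \<circ> Transposition.transpose a b) = - sign p"
      using False swap(4) permutes_imp_permutation[of "{..<k}" p]
      by (simp add: sign_compose permutation_swap_id sign_swap_id)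
    show ?thesis unfolding 1 2 swap(5) by simp
  qed (use swap(3) in simp)
qed

text \<open>
  Multilinear expansion: a summand for every choice of one basis vector in every slot.
\<close>

lemma alternating_form_expand:
  assumes f: "alternating_form k f" and B: "finite B"
  shows "f (\<lambda>j. \<Sum>b\<in>B. A j b *\<^sub>R u b) = (\<Sum>g\<in>PiE {..<k} (\<lambda>_. B). (\<Prod>j<k. A j (g j)) * f (\<lambda>j. u (g j)))"
proof -
  have "f (\<lambda>j. if j < m then \<Sum>b\<in>B. A j b *\<^sub>R u b else w j) =
     (\<Sum>g\<in>PiE {..<m} (\<lambda>_. B). (\<Prod>j<m. A j (g j)) * f (\<lambda>j. if j < m then u (g j) else w j))"
    if "m \<le> k" for m w
    using that
  proof (induction m arbitrary: w)
    case (Suc m)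
    define w' where "w' = w(m := \<Sum>b\<in>B. A m b *\<^sub>R u b)"
    have "f (\<lambda>j. if j < Suc m then \<Sum>b\<in>B. A j b *\<^sub>R u b else w j) =
        f (\<lambda>j. if j < m then \<Sum>b\<in>B. A j b *\<^sub>R u b else w' j)"
      by (rule arg_cong[of _ _ f]) (auto simp: w'_def fun_eq_iff less_Suc_eq)
    also have "\<dots> = (\<Sum>g\<in>PiE {..<m} (\<lambda>_. B). (\<Prod>j<m. A j (g j)) * f (\<lambda>j. if j < m then u (g j) else w' j))"
      using Suc by simp
    also have "\<dots> = (\<Sum>g\<in>PiE {..<m} (\<lambda>_. B). \<Sum>b\<in>B. (\<Prod>j<m. A j (g j)) * A m b *
        f ((\<lambda>j. if j < m then u (g j) else w j)(m := u b)))"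
    proof (intro sum.cong refl)
      fix g
      have "(\<lambda>j. if j < m then u (g j) else w' j) =
         (\<lambda>j. if j < m then u (g j) else w j)(m := \<Sum>b\<in>B. A m b *\<^sub>R u b)"
        by (auto simp: w'_def fun_eq_iff)
      then show "(\<Prod>j<m. A j (g j)) * f (\<lambda>j. if j < m then u (g j) else w' j) =
         (\<Sum>b\<in>B. (\<Prod>j<m. A j (g j)) * A m b * f ((\<lambda>j. if j < m then u (g j) else w j)(m := u b)))"
        using Suc.prems by (simp only: alternating_form_sum[OF f] Suc_le_eq sum_distrib_left mult.assoc)
    qed
    also have "\<dots> = (\<Sum>(b, g)\<in>B \<times> PiE {..<m} (\<lambda>_. B). (\<Prod>j<m. A j (g j)) * A m b *
        f ((\<lambda>j. if j < m then u (g j) else w j)(m := u b)))"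
      by (subst sum.swap) (simp add: sum.cartesian_product)
    also have "\<dots> = (\<Sum>g\<in>(\<lambda>(b, g). g(m := b)) ` (B \<times> PiE {..<m} (\<lambda>_. B)).
        (\<Prod>j<Suc m. A j (g j)) * f (\<lambda>j. if j < Suc m then u (g j) else w j))"
    proof (subst sum.reindex)
      show "inj_on (\<lambda>(b, g). g(m := b)) (B \<times> PiE {..<m} (\<lambda>_. B))"
        using inj_combinator[of m "{..<m}" "\<lambda>_. B"] by simp
      have "f ((\<lambda>j. if j < m then u (g j) else w j)(m := u b)) =
          f (\<lambda>j. if j < Suc m then u ((g(m := b)) j) else w j)" for g b
        by (rule arg_cong[of _ _ f]) (auto simp: fun_eq_iff less_Suc_eq)
      moreover have "(\<Prod>j<m. A j (g j)) = (\<Prod>j<m. A j ((g(m := b)) j))" for g b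
        by (rule prod.cong) auto
      ultimately show "(\<Sum>(b, g)\<in>B \<times> PiE {..<m} (\<lambda>_. B). (\<Prod>j<m. A j (g j)) * A m b *
          f ((\<lambda>j. if j < m then u (g j) else w j)(m := u b))) =
        sum ((\<lambda>g. (\<Prod>j<Suc m. A j (g j)) * f (\<lambda>j. if j < Suc m then u (g j) else w j)) \<circ> (\<lambda>(b, g). g(m := b)))
          (B \<times> PiE {..<m} (\<lambda>_. B))"
        by (intro sum.cong refl) auto
    qed
    also have "(\<lambda>(b, g). g(m := b)) ` (B \<times> PiE {..<m} (\<lambda>_. B)) = PiE {..<Suc m} (\<lambda>_. B)"
      using PiE_insert_eq[of m "{..<m}" "\<lambda>_. B"] by (simp add: lessThan_Suc)
    finally show ?case .
  qed simp
  from this[of k "\<lambda>_. 0"]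
  have "f (\<lambda>j. if j < k then \<Sum>b\<in>B. A j b *\<^sub>R u b else 0) =
     (\<Sum>g\<in>PiE {..<k} (\<lambda>_. B). (\<Prod>j<k. A j (g j)) * f (\<lambda>j. if j < k then u (g j) else 0))" by simp
  moreover have "f (\<lambda>j. if j < k then \<Sum>b\<in>B. A j b *\<^sub>R u b else 0) = f (\<lambda>j. \<Sum>b\<in>B. A j b *\<^sub>R u b)"
    by (rule alternating_formD(3)[OF f]) simp
  moreover have "f (\<lambda>j. if j < k then u (g j) else 0) = f (\<lambda>j. u (g j))" for g
    by (rule alternating_formD(3)[OF f]) simp
  ultimately show ?thesis by simp
qed

lemma alternating_form_not_inj:
  assumes f: "alternating_form k f" and "\<not> inj_on v {..<k}"
  shows "f v = 0"
proof -
  obtain i j where ij: "i < k" "j < k" "i \<noteq> j" "v i = v j" using assms(2) by (auto simp: inj_on_def)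
  then show ?thesis
    using alternating_form_eq_zero[OF f, of i j v] alternating_form_eq_zero[OF f, of j i v] by (cases "i < j") auto
qed

lemma bij_betw_sorted_nth:
  assumes "card (I :: 'n::{finite,linorder} set) = k"
  shows "bij_betw (\<lambda>i. sorted_list_of_set I ! i) {..<k} I"
  using assms by (intro bij_betw_nth) auto

text \<open>
  An injective tuple of indices is the increasing enumeration of its range followed by a permutation; this
  groups the terms of the multilinear expansion into minors.
\<close>

lemma bij_betw_injective_tuples:
  "bij_betw (\<lambda>(I, \<pi>). \<lambda>j\<in>{..<k}. sorted_list_of_set I ! \<pi> j)
     ({I :: 'n::{finite,linorder} set. card I = k} \<times> {\<pi>. \<pi> permutes {..<k}})
     {g \<in> PiE {..<k} (\<lambda>_. UNIV). inj_on g {..<k}}"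
proof -
  let ?l = "\<lambda>(I :: 'n set) i. sorted_list_of_set I ! i"
  let ?F = "\<lambda>(I :: 'n set, \<pi>). \<lambda>j\<in>{..<k}. ?l I (\<pi> j)"
  have img: "(\<lambda>j\<in>{..<k}. ?l I (\<pi> j)) ` {..<k} = I" if "card I = k" "\<pi> permutes {..<k}" for I \<pi>
  proof -
    have "(\<lambda>j\<in>{..<k}. ?l I (\<pi> j)) ` {..<k} = ?l I ` (\<pi> ` {..<k})" by auto
    also have "\<dots> = I" using bij_betw_sorted_nth[OF that(1)] permutes_image[OF that(2)] by (simp add: bij_betw_def)
    finally show ?thesis .
  qed
  show ?thesis unfolding bij_betw_def
  proof (intro conjI)
    show "inj_on ?F ({I. card I = k} \<times> {\<pi>. \<pi> permutes {..<k}})"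
    proof (rule inj_onI, clarify)
      fix I J :: "'n set" and \<pi> \<rho> :: "nat \<Rightarrow> nat"
      assume I: "card J = card I" "k = card I" and p: "\<pi> permutes {..<card I}" "\<rho> permutes {..<card I}"
        and eq: "(\<lambda>j\<in>{..<card I}. ?l I (\<pi> j)) = (\<lambda>j\<in>{..<card I}. ?l J (\<rho> j))"
      have "I = (\<lambda>j\<in>{..<card I}. ?l I (\<pi> j)) ` {..<card I}" using img[of I \<pi>] I p(1) by simp
      also have "\<dots> = J" unfolding eq using img[of J \<rho>] I p(2) by simp
      finally have IJ: "I = J" .
      have "\<pi> j = \<rho> j" for j
      proof (cases "j < k")
        case True
        then have "j < card I" using I(2) by simp
        then have "?l I (\<pi> j) = ?l J (\<rho> j)" using fun_cong[OF eq, of j] by simp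
        then have "?l I (\<pi> j) = ?l I (\<rho> j)" unfolding IJ .
        moreover have "\<pi> j < k" "\<rho> j < k"
          using True I permutes_in_image[OF p(1), of j] permutes_in_image[OF p(2), of j] by simp_all
        ultimately show ?thesis using bij_betw_sorted_nth[of I k] I by (auto simp: bij_betw_def inj_on_def)
      next
        case False
        then show ?thesis using p I by (simp add: permutes_def)
      qed
      with IJ show "I = J \<and> \<pi> = \<rho>" by auto
    qed
    show "?F ` ({I. card I = k} \<times> {\<pi>. \<pi> permutes {..<k}}) = {g \<in> PiE {..<k} (\<lambda>_. UNIV). inj_on g {..<k}}"
    proof (intro equalityI subsetI)
      fix g assume "g \<in> ?F ` ({I. card I = k} \<times> {\<pi>. \<pi> permutes {..<k}})"
      then obtain I \<pi> where g: "g = (\<lambda>j\<in>{..<k}. ?l I (\<pi> j))" and I: "card I = k" and p: "\<pi> permutes {..<k}" by auto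
      have "inj_on (?l I \<circ> \<pi>) {..<k}"
        using bij_betw_sorted_nth[OF I] permutes_image[OF p] permutes_inj_on[OF p]
        by (intro comp_inj_on) (auto simp: bij_betw_def)
      then show "g \<in> {g \<in> PiE {..<k} (\<lambda>_. UNIV). inj_on g {..<k}}" unfolding g by (auto simp: inj_on_def)
    next
      fix g :: "nat \<Rightarrow> 'n" assume "g \<in> {g \<in> PiE {..<k} (\<lambda>_. UNIV). inj_on g {..<k}}"
      then have g: "g \<in> extensional {..<k}" "inj_on g {..<k}" by (auto simp: PiE_iff)
      define I where "I = g ` {..<k}"
      have I: "card I = k" using g(2) by (simp add: I_def card_image)
      define \<pi> where "\<pi> = (\<lambda>j. if j < k then inv_into {..<k} (?l I) (g j) else j)"
      have b1: "bij_betw g {..<k} I" using g(2) by (simp add: I_def bij_betw_def)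
      have "bij_betw (inv_into {..<k} (?l I) \<circ> g) {..<k} {..<k}"
        by (rule bij_betw_trans[OF b1 bij_betw_inv_into[OF bij_betw_sorted_nth[OF I]]])
      then have "bij_betw \<pi> {..<k} {..<k}" by (rule bij_betw_cong[THEN iffD1, rotated]) (simp add: \<pi>_def)
      then have p: "\<pi> permutes {..<k}" by (rule bij_imp_permutes) (simp add: \<pi>_def)
      have "?l I (\<pi> j) = g j" if "j < k" for j
        using that bij_betw_inv_into_right[OF bij_betw_sorted_nth[OF I], of "g j"] by (simp add: \<pi>_def I_def)
      then have "g = (\<lambda>j\<in>{..<k}. ?l I (\<pi> j))" using g(1) by (auto simp: extensional_def fun_eq_iff)
      then show "g \<in> ?F ` ({I. card I = k} \<times> {\<pi>. \<pi> permutes {..<k}})"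
        using I p by (intro image_eqI[of _ _ "(I, \<pi>)"]) auto
    qed
  qed
qed

text \<open>The universal property of the exterior power, in coordinates.\<close>

lemma alternating_form_eq_wedge:
  fixes f :: "(nat \<Rightarrow> real ^ 'n::{finite,linorder}) \<Rightarrow> real"
  assumes f: "alternating_form k f"
  shows "f v = (\<Sum>I | card I = k. wedge k v $ I * f (\<lambda>j. axis (sorted_list_of_set I ! j) 1))"
proof -
  let ?l = "\<lambda>(I :: 'n set) i. sorted_list_of_set I ! i"
  let ?G = "{g \<in> PiE {..<k} (\<lambda>_. UNIV :: 'n set). inj_on g {..<k}}"
  let ?T = "\<lambda>g. (\<Prod>j<k. v j $ g j) * f (\<lambda>j. axis (g j) 1)"
  have fin: "finite (PiE {..<k} (\<lambda>_. UNIV :: 'n set))" by (intro finite_PiE) auto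
  have "f v = f (\<lambda>j. \<Sum>b\<in>UNIV. (v j $ b) *\<^sub>R axis b 1)"
    by (simp add: basis_expansion scalar_mult_eq_scaleR[symmetric])
  also have "\<dots> = (\<Sum>g\<in>PiE {..<k} (\<lambda>_. UNIV). ?T g)"
    by (rule alternating_form_expand[OF f]) simp
  also have "\<dots> = (\<Sum>g\<in>?G. ?T g)"
  proof (rule sum.mono_neutral_right[OF fin])
    show "\<forall>g\<in>PiE {..<k} (\<lambda>_. UNIV) - ?G. ?T g = 0"
    proof
      fix g assume "g \<in> PiE {..<k} (\<lambda>_. UNIV :: 'n set) - ?G"
      then have "\<not> inj_on g {..<k}" by blast
      then have "\<not> inj_on (\<lambda>j. axis (g j) (1::real)) {..<k}" by (auto simp: inj_on_def axis_eq_axis)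
      then show "?T g = 0" using alternating_form_not_inj[OF f] by simp
    qed
  qed auto
  also have "\<dots> = (\<Sum>(I, \<pi>)\<in>{I. card I = k} \<times> {\<pi>. \<pi> permutes {..<k}}. ?T (\<lambda>j\<in>{..<k}. ?l I (\<pi> j)))"
    by (subst sum.reindex_bij_betw[OF bij_betw_injective_tuples, symmetric]) (simp add: case_prod_beta)
  also have "\<dots> = (\<Sum>I | card I = k. \<Sum>\<pi> | \<pi> permutes {..<k}. ?T (\<lambda>j\<in>{..<k}. ?l I (\<pi> j)))"
    by (simp add: sum.cartesian_product)
  also have "\<dots> = (\<Sum>I | card I = k. wedge k v $ I * f (\<lambda>j. axis (?l I j) 1))"
  proof (intro sum.cong refl)
    fix I :: "'n set" assume I: "I \<in> {I. card I = k}"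
    have "?T (\<lambda>j\<in>{..<k}. ?l I (\<pi> j)) = (of_int (sign \<pi>) * (\<Prod>j<k. v j $ ?l I (\<pi> j))) * f (\<lambda>j. axis (?l I j) 1)"
      if p: "\<pi> permutes {..<k}" for \<pi>
    proof -
      have "f (\<lambda>j. axis ((\<lambda>j\<in>{..<k}. ?l I (\<pi> j)) j) 1) = f ((\<lambda>j. axis (?l I j) 1) \<circ> \<pi>)"
        by (rule alternating_formD(3)[OF f]) simp
      also have "\<dots> = of_int (sign \<pi>) * f (\<lambda>j. axis (?l I j) 1)"
        by (rule alternating_form_permute[OF f p])
      finally show ?thesis by simp
    qed
    then have "(\<Sum>\<pi> | \<pi> permutes {..<k}. ?T (\<lambda>j\<in>{..<k}. ?l I (\<pi> j))) =
        (\<Sum>\<pi> | \<pi> permutes {..<k}. of_int (sign \<pi>) * (\<Prod>j<k. v j $ ?l I (\<pi> j))) * f (\<lambda>j. axis (?l I j) 1)"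
      unfolding sum_distrib_right by (intro sum.cong refl) (simp only: mem_Collect_eq)
    then show "(\<Sum>\<pi> | \<pi> permutes {..<k}. ?T (\<lambda>j\<in>{..<k}. ?l I (\<pi> j))) = wedge k v $ I * f (\<lambda>j. axis (?l I j) 1)"
      using I by (simp add: wedge_nth leibniz_def)
  qed
  finally show ?thesis .
qed

lemma wedge_cong: "(\<And>j. j < k \<Longrightarrow> v j = w j) \<Longrightarrow> wedge k v = wedge k w"
  using alternating_formD(3)[OF alternating_form_wedge_nth] by (metis vec_eq_iff)

lemma wedge_permute: "\<sigma> permutes {..<k} \<Longrightarrow> wedge k (v \<circ> \<sigma>) = of_int (sign \<sigma>) *\<^sub>R wedge k v"
  by (simp add: vec_eq_iff alternating_form_permute[OF alternating_form_wedge_nth])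

lemma wedge_add: "j < k \<Longrightarrow> wedge k (v(j := a + b)) = wedge k (v(j := a)) + wedge k (v(j := b))"
  by (simp add: vec_eq_iff alternating_formD(1)[OF alternating_form_wedge_nth])

lemma wedge_scale: "j < k \<Longrightarrow> wedge k (v(j := c *\<^sub>R a)) = c *\<^sub>R wedge k (v(j := a))"
  by (simp add: vec_eq_iff alternating_formD(2)[OF alternating_form_wedge_nth])

lemma wedge_eq_zero: "i \<noteq> j \<Longrightarrow> i < k \<Longrightarrow> j < k \<Longrightarrow> v i = v j \<Longrightarrow> wedge k v = 0"
  using alternating_form_not_inj[OF alternating_form_wedge_nth, of v k]
  by (auto simp: vec_eq_iff inj_on_def)

lemma wedge_shear:
  assumes "i \<noteq> j" "i < k" "j < k"
  shows "wedge k (v(j := v j + v i)) = wedge k v"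
proof -
  have "wedge k (v(j := v i)) = 0" using assms by (intro wedge_eq_zero[of i j]) auto
  then show ?thesis using wedge_add[OF assms(3), of v "v j" "v i"] by simp
qed

lemma wedge_scale_all: "wedge k (\<lambda>j. r *\<^sub>R v j) = r ^ k *\<^sub>R wedge k v"
  by (simp add: vec_eq_iff wedge_nth leibniz_def prod.distrib sum_distrib_left mult.left_commute)

text \<open>
  Expand \<open>w\<close> in the frame \<open>v\<close>; the factor is the determinant of the coefficients.
\<close>

lemma wedge_parallel:
  fixes v w :: "nat \<Rightarrow> real ^ 'n::{finite,linorder}"
  assumes v: "indep_frame k v" and w: "\<And>j. j < k \<Longrightarrow> w j \<in> span (v ` {..<k})"
  shows "\<exists>s. wedge k w = s *\<^sub>R wedge k v"
proof -
  have "\<exists>A. w j = (\<Sum>i<k. A i *\<^sub>R v i)" if "j < k" for j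
  proof -
    have "w j \<in> plane k 0 v" using w[OF that] by (simp add: plane_def)
    then show ?thesis using plane_eq_range_aff[OF v] by (auto simp: aff_def)
  qed
  then obtain A where A: "\<And>j. j < k \<Longrightarrow> w j = (\<Sum>i<k. A j i *\<^sub>R v i)" by metis
  have "\<exists>s. \<forall>I. wedge k (\<lambda>j. v (g j)) $ I = s * wedge k v $ I" if g: "g \<in> PiE {..<k} (\<lambda>_. {..<k})" for g
  proof (cases "inj_on g {..<k}")
    case True
    define \<pi> where "\<pi> = (\<lambda>j. if j < k then g j else j)"
    have "g ` {..<k} = {..<k}" using g True by (intro card_subset_eq) (auto simp: card_image)
    then have "bij_betw g {..<k} {..<k}" using True by (simp add: bij_betw_def)
    then have "bij_betw \<pi> {..<k} {..<k}"
      by (rule bij_betw_cong[THEN iffD1, rotated]) (simp add: \<pi>_def)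
    then have p: "\<pi> permutes {..<k}" by (rule bij_imp_permutes) (simp add: \<pi>_def)
    have "wedge k (\<lambda>j. v (g j)) = wedge k (v \<circ> \<pi>)" by (rule wedge_cong) (simp add: \<pi>_def)
    then show ?thesis using wedge_permute[OF p, of v] by (metis vector_scaleR_component real_scaleR_def)
  next
    case False
    then have "\<not> inj_on (\<lambda>j. v (g j)) {..<k}" unfolding inj_on_def by metis
    then have "wedge k (\<lambda>j. v (g j)) $ I = 0" for I
      using alternating_form_not_inj[OF alternating_form_wedge_nth] by blast
    then show ?thesis by (intro exI[of _ 0]) simp
  qed
  then obtain s where s: "\<And>g I. g \<in> PiE {..<k} (\<lambda>_. {..<k}) \<Longrightarrow> wedge k (\<lambda>j. v (g j)) $ I = s g * wedge k v $ I"
    by metis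
  have "wedge k w $ I = (\<Sum>g\<in>PiE {..<k} (\<lambda>_. {..<k}). (\<Prod>j<k. A j (g j)) * s g) * wedge k v $ I" for I
  proof -
    have "wedge k w $ I = wedge k (\<lambda>j. \<Sum>i<k. A j i *\<^sub>R v i) $ I"
      by (rule arg_cong[of _ _ "\<lambda>x. x $ I"], rule wedge_cong) (simp add: A)
    also have "\<dots> = (\<Sum>g\<in>PiE {..<k} (\<lambda>_. {..<k}). (\<Prod>j<k. A j (g j)) * wedge k (\<lambda>j. v (g j)) $ I)"
      by (rule alternating_form_expand[OF alternating_form_wedge_nth]) simp
    also have "\<dots> = (\<Sum>g\<in>PiE {..<k} (\<lambda>_. {..<k}). (\<Prod>j<k. A j (g j)) * s g * wedge k v $ I)"
      by (intro sum.cong) (auto simp: s)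
    finally show ?thesis by (simp add: sum_distrib_right)
  qed
  then have "wedge k w = (\<Sum>g\<in>PiE {..<k} (\<lambda>_. {..<k}). (\<Prod>j<k. A j (g j)) * s g) *\<^sub>R wedge k v"
    unfolding vec_eq_iff vector_scaleR_component real_scaleR_def by blast
  then show ?thesis by blast
qed

lemma wedge_eq_zero_iff:
  fixes v :: "nat \<Rightarrow> real ^ 'n::{finite,linorder}"
  shows "wedge k v = 0 \<longleftrightarrow> \<not> indep_frame k v"
proof
  assume "\<not> indep_frame k v"
  show "wedge k v = 0"
  proof (cases "inj_on v {..<k}")
    case False
    then show ?thesis
      using alternating_form_not_inj[OF alternating_form_wedge_nth] by (auto simp: vec_eq_iff)
  next
    case True
    with \<open>\<not> indep_frame k v\<close> have "dependent (v ` {..<k})" by (simp add: indep_frame_def)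
    then obtain j where j: "j < k" "v j \<in> span (v ` {..<k} - {v j})" by (auto simp: dependent_def)
    have "v ` {..<k} - {v j} = v ` ({..<k} - {j})" using True j(1) by (auto simp: inj_on_def)
    with j(2) have "v j \<in> span (v ` ({..<k} - {j}))" by simp
    then obtain u where "v j = (\<Sum>b\<in>v ` ({..<k} - {j}). u b *\<^sub>R b)"
      unfolding span_finite[OF finite_imageI[OF finite_Diff[OF finite_lessThan]]] by auto
    also have "\<dots> = (\<Sum>i\<in>{..<k} - {j}. u (v i) *\<^sub>R v i)"
      using True by (subst sum.reindex) (auto simp: inj_on_def)
    finally have e: "v(j := (\<Sum>i\<in>{..<k} - {j}. u (v i) *\<^sub>R v i)) = v" by auto
    have "wedge k v $ I = 0" for I
    proof -
      have "wedge k v $ I = wedge k (v(j := (\<Sum>i\<in>{..<k} - {j}. u (v i) *\<^sub>R v i))) $ I" by (simp only: e)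
      also have "\<dots> = (\<Sum>i\<in>{..<k} - {j}. u (v i) * wedge k (v(j := v i)) $ I)"
        by (rule alternating_form_sum[OF alternating_form_wedge_nth j(1)])
      also have "\<dots> = 0"
      proof (intro sum.neutral ballI)
        fix i assume "i \<in> {..<k} - {j}"
        then have "wedge k (v(j := v i)) = 0" using j(1) by (intro wedge_eq_zero[of i j]) auto
        then show "u (v i) * wedge k (v(j := v i)) $ I = 0" by simp
      qed
      finally show ?thesis .
    qed
    then show ?thesis by (simp add: vec_eq_iff)
  qed
next
  assume z: "wedge k v = 0"
  show "\<not> indep_frame k v"
  proof
    assume ind: "indep_frame k v"
    have alt: "alternating_form k (\<lambda>v'. leibniz k (\<lambda>j i. dual_frame k v i (v' j)))"
      by (intro alternating_form_leibniz linear_dual_frame[OF ind])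
    have "leibniz k (\<lambda>j i. dual_frame k v i (v j)) = leibniz k (\<lambda>j i. if i = j then 1 else 0)"
      by (rule leibniz_cong) (simp add: dual_frame_frame[OF ind])
    then show False using alternating_form_eq_wedge[OF alt, of v] by (simp add: leibniz_delta z)
  qed
qed

lemma norm_wedge_le:
  fixes v :: "nat \<Rightarrow> real ^ 'n::{finite,linorder}"
  shows "norm (wedge k v) \<le> (real (CARD('n set)) * fact k) * (\<Prod>j<k. norm (v j))"
proof -
  have "\<bar>wedge k v $ I\<bar> \<le> fact k * (\<Prod>j<k. norm (v j))" for I
  proof -
    have "\<bar>leibniz k (\<lambda>j i. v j $ (sorted_list_of_set I ! i))\<bar> \<le>
       (\<Sum>\<pi> | \<pi> permutes {..<k}. (\<Prod>j<k. norm (v j)))"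
      unfolding leibniz_def
    proof (rule order_trans[OF sum_abs sum_mono])
      fix \<pi> :: "nat \<Rightarrow> nat"
      have "(\<Prod>j<k. \<bar>v j $ (sorted_list_of_set I ! \<pi> j)\<bar>) \<le> (\<Prod>j<k. norm (v j))"
        by (intro prod_mono) (auto simp: component_le_norm_cart)
      then show "\<bar>of_int (sign \<pi>) * (\<Prod>j<k. v j $ (sorted_list_of_set I ! \<pi> j))\<bar> \<le> (\<Prod>j<k. norm (v j))"
        by (simp add: abs_mult abs_prod sign_def)
    qed
    also have "\<dots> = fact k * (\<Prod>j<k. norm (v j))" by (simp add: card_permutations)
    finally show ?thesis by (simp add: wedge_nth prod_nonneg)
  qed
  then have "(\<Sum>I\<in>UNIV. \<bar>wedge k v $ I\<bar>) \<le> (\<Sum>I\<in>(UNIV :: 'n set set). fact k * (\<Prod>j<k. norm (v j)))"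
    by (intro sum_mono) auto
  then show ?thesis using norm_le_l1_cart[of "wedge k v"] by simp
qed

section \<open>Contraction of an exterior derivative with a simple multivector\<close>

definition skip :: "nat \<Rightarrow> nat \<Rightarrow> nat" where
  "skip j i = (if i < j then i else Suc i)"

lemma wedge_axis:
  fixes m :: "nat \<Rightarrow> 'n::{finite,linorder}"
  assumes m: "strict_mono_on {..<k} m"
  shows "wedge k (\<lambda>i. axis (m i) 1) = axis (m ` {..<k}) 1"
proof -
  have inj: "inj_on m {..<k}" using m by (rule strict_mono_on_imp_inj_on)
  have srt: "sorted_list_of_set (m ` {..<k}) = map m [0..<k]"
  proof -
    have "sorted_list_of_set (set (map m [0..<k])) = map m [0..<k]"
    proof (rule sorted_list_of_set.idem_if_sorted_distinct)
      show "sorted (map m [0..<k])"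
        using strict_mono_on_leD[OF m] by (auto simp: sorted_iff_nth_mono)
      show "distinct (map m [0..<k])" using inj by (simp add: distinct_map atLeast0LessThan)
    qed
    then show ?thesis by (simp add: atLeast0LessThan)
  qed
  have "wedge k (\<lambda>i. axis (m i) 1) $ I = axis (m ` {..<k}) 1 $ I" for I
  proof (cases "I = m ` {..<k}")
    case True
    have "leibniz k (\<lambda>j i. axis (m j) 1 $ (sorted_list_of_set I ! i)) = leibniz k (\<lambda>j i. if i = j then 1 else 0)"
      using inj by (intro leibniz_cong) (auto simp: True srt axis_def inj_on_def)
    then show ?thesis using True inj by (simp add: wedge_nth card_image leibniz_delta)
  next
    case False
    have "leibniz k (\<lambda>j i. axis (m j) 1 $ (sorted_list_of_set I ! i)) = 0" if I: "card I = k"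
      unfolding leibniz_def
    proof (intro sum.neutral ballI)
      fix \<pi> assume "\<pi> \<in> {\<pi>. \<pi> permutes {..<k}}"
      then have p: "\<pi> permutes {..<k}" by simp
      have "\<exists>j<k. sorted_list_of_set I ! \<pi> j \<noteq> m j"
      proof (rule ccontr)
        assume "\<not> ?thesis"
        then have "m ` {..<k} = (\<lambda>i. sorted_list_of_set I ! i) ` (\<pi> ` {..<k})" by (auto simp: image_iff)
        also have "\<dots> = I" using bij_betw_sorted_nth[OF I] permutes_image[OF p] by (simp add: bij_betw_def)
        finally show False using False by simp
      qed
      then show "of_int (sign \<pi>) * (\<Prod>j<k. axis (m j) 1 $ (sorted_list_of_set I ! \<pi> j)) = (0::real)"
        by (auto simp: axis_def)
    qed
    then show ?thesis using False by (simp add: wedge_nth axis_def)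
  qed
  then show ?thesis by (simp add: vec_eq_iff)
qed

lemma alternating_form_contraction:
  fixes D :: "real ^ 'n::{finite,linorder} \<Rightarrow> real ^ ('n set)"
  assumes D: "linear D"
  shows "alternating_form (Suc k) (\<lambda>v. \<Sum>j<Suc k. (-1)^j * (D (v j) \<bullet> wedge k (v \<circ> skip j)))"
    (is "alternating_form _ ?f")
proof -
  have upd: "(v(a := x)) \<circ> skip j = (if j = a then v \<circ> skip j else (v \<circ> skip j)((if a < j then a else a - 1) := x))"
    for v :: "nat \<Rightarrow> (real, 'n) vec" and a x j
    by (auto simp: fun_eq_iff skip_def)
  have slot: "\<exists>T. (\<forall>x y. T (x + y) = T x + T y) \<and> (\<forall>c x. T (c *\<^sub>R x) = c * T x) \<and>
       (\<forall>x. D ((v(a := x)) j) \<bullet> wedge k ((v(a := x)) \<circ> skip j) = T x)"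
    if a: "a < Suc k" and j: "j < Suc k" for v a j
  proof (cases "j = a")
    case True
    then show ?thesis using D
      by (intro exI[of _ "\<lambda>x. D x \<bullet> wedge k (v \<circ> skip j)"])
        (auto simp: upd linear_add linear_scale inner_add_left)
  next
    case False
    then have a': "(if a < j then a else a - 1) < k" using a j by auto
    show ?thesis using False
      by (intro exI[of _ "\<lambda>x. D (v j) \<bullet> wedge k ((v \<circ> skip j)((if a < j then a else a - 1) := x))"])
        (simp only: upd wedge_add[OF a'] wedge_scale[OF a'], simp add: inner_add_right)
  qed
  show ?thesis unfolding alternating_form_def
  proof (intro conjI allI impI)
    fix v a x y assume a: "a < Suc k"
    have "D ((v(a := x + y)) j) \<bullet> wedge k ((v(a := x + y)) \<circ> skip j) =
      D ((v(a := x)) j) \<bullet> wedge k ((v(a := x)) \<circ> skip j) + D ((v(a := y)) j) \<bullet> wedge k ((v(a := y)) \<circ> skip j)"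
      if "j < Suc k" for j using slot[OF a that, of v] by metis
    then show "?f (v(a := x + y)) = ?f (v(a := x)) + ?f (v(a := y))"
      unfolding sum.distrib[symmetric] by (intro sum.cong refl) (simp only: lessThan_iff distrib_left)
  next
    fix v a x and c :: real assume a: "a < Suc k"
    have "D ((v(a := c *\<^sub>R x)) j) \<bullet> wedge k ((v(a := c *\<^sub>R x)) \<circ> skip j) =
      c * (D ((v(a := x)) j) \<bullet> wedge k ((v(a := x)) \<circ> skip j))"
      if "j < Suc k" for j using slot[OF a that, of v] by metis
    then show "?f (v(a := c *\<^sub>R x)) = c * ?f (v(a := x))"
      unfolding sum_distrib_left by (intro sum.cong refl) (simp only: lessThan_iff mult.left_commute)
  next
    fix v w :: "nat \<Rightarrow> (real, 'n) vec" assume "\<forall>j<Suc k. v j = w j"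
    then show "?f v = ?f w"
      by (intro sum.cong refl arg_cong2[where f="(*)"] arg_cong2[where f="(\<bullet>)"] wedge_cong) (auto simp: skip_def)
  next
    fix v :: "nat \<Rightarrow> (real, 'n) vec" and i assume i: "Suc i < Suc k" and eq: "v i = v (Suc i)"
    have z: "wedge k (v \<circ> skip j) = 0" if j: "j < Suc k" "j \<noteq> i" "j \<noteq> Suc i" for j
    proof (cases "j < i")
      case True
      then show ?thesis using i eq by (intro wedge_eq_zero[of "i - 1" i]) (auto simp: skip_def)
    next
      case False
      then show ?thesis using i eq j by (intro wedge_eq_zero[of "i" "Suc i"]) (auto simp: skip_def)
    qed
    have same: "v \<circ> skip i = v \<circ> skip (Suc i)" using eq by (auto simp: fun_eq_iff skip_def less_Suc_eq)
    have "?f v = (\<Sum>j\<in>{i, Suc i}. (-1)^j * (D (v j) \<bullet> wedge k (v \<circ> skip j)))"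
      using i z by (intro sum.mono_neutral_right) auto
    also have "\<dots> = 0" using eq same by simp
    finally show "?f v = 0" .
  qed
qed

text \<open>
  Both sides are alternating in \<open>v\<close>, so they need to be compared only on increasing tuples of basis vectors.
\<close>

lemma contraction_formula:
  fixes D :: "real ^ 'n::{finite,linorder} \<Rightarrow> real ^ ('n set)"
  assumes D: "linear D"
  shows "(\<chi> I. \<Sum>i\<in>I. (-1) ^ card {j\<in>I. j < i} * D (axis i 1) $ (I - {i})) \<bullet> wedge (Suc k) v =
    (\<Sum>j<Suc k. (-1)^j * (D (v j) \<bullet> wedge k (v \<circ> skip j)))" (is "?E \<bullet> _ = ?f v")
proof -
  let ?l = "\<lambda>(I :: 'n set) i. sorted_list_of_set I ! i"
  have ev: "?f (\<lambda>j. axis (?l I j) 1) = ?E $ I" if I: "card I = Suc k" for I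
  proof -
    have sm: "strict_mono_on {..<Suc k} (?l I)"
      using strict_sorted_list_of_set[of I] I by (auto simp: strict_mono_on_def sorted_wrt_iff_nth_less)
    have inj: "inj_on (?l I) {..<Suc k}" using bij_betw_sorted_nth[OF I] by (simp add: bij_betw_def)
    have img: "?l I ` {..<Suc k} = I" using bij_betw_sorted_nth[OF I] by (simp add: bij_betw_def)
    have trm: "(-1)^j * (D (axis (?l I j) 1) \<bullet> wedge k ((\<lambda>j. axis (?l I j) 1) \<circ> skip j)) =
       (-1) ^ card {x\<in>I. x < ?l I j} * D (axis (?l I j) 1) $ (I - {?l I j})" if j: "j < Suc k" for j
    proof -
      have "strict_mono_on {..<k} (?l I \<circ> skip j)"
        using sm by (auto simp: strict_mono_on_def skip_def)
      from wedge_axis[OF this]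
      have w: "wedge k ((\<lambda>j. axis (?l I j) 1) \<circ> skip j) = axis ((?l I \<circ> skip j) ` {..<k}) (1::real)"
        by (simp add: comp_def)
      have "skip j ` {..<k} = {..<Suc k} - {j}"
      proof (intro equalityI subsetI)
        fix i assume i: "i \<in> {..<Suc k} - {j}"
        then show "i \<in> skip j ` {..<k}"
          by (intro image_eqI[of _ _ "if i < j then i else i - 1"]) (use j in \<open>auto simp: skip_def\<close>)
      qed (auto simp: skip_def)
      then have "(?l I \<circ> skip j) ` {..<k} = ?l I ` ({..<Suc k} - {j})" by (simp only: image_comp[symmetric])
      also have "\<dots> = I - {?l I j}"
        using inj j img by (subst inj_on_image_set_diff[of _ "{..<Suc k}"]) auto
      finally have w': "wedge k ((\<lambda>j. axis (?l I j) 1) \<circ> skip j) = axis (I - {?l I j}) (1::real)" using w by simp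
      have "{x\<in>I. x < ?l I j} = ?l I ` {..<j}"
      proof (intro equalityI subsetI)
        fix x assume x: "x \<in> {x\<in>I. x < ?l I j}"
        then obtain i where i: "i < Suc k" "x = ?l I i" using img by blast
        have "i < j"
        proof (rule ccontr)
          assume "\<not> i < j"
          then have "?l I j \<le> ?l I i" using sm i j by (cases "i = j") (auto simp: strict_mono_on_def less_imp_le)
          moreover have "?l I i < ?l I j" using x i by simp
          ultimately show False by (meson leD)
        qed
        then show "x \<in> ?l I ` {..<j}" using i by blast
      next
        fix x assume "x \<in> ?l I ` {..<j}"
        then show "x \<in> {x\<in>I. x < ?l I j}" using sm j img by (auto simp: strict_mono_on_def)
      qed
      then have "card {x\<in>I. x < ?l I j} = j"
        using inj j by (simp add: card_image inj_on_subset[of _ "{..<Suc k}"] subset_iff)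
      then show ?thesis by (simp add: w' inner_axis)
    qed
    have "?f (\<lambda>j. axis (?l I j) 1) =
        (\<Sum>j<Suc k. (-1) ^ card {x\<in>I. x < ?l I j} * D (axis (?l I j) 1) $ (I - {?l I j}))"
      by (intro sum.cong refl trm) simp
    also have "\<dots> = (\<Sum>i\<in>?l I ` {..<Suc k}. (-1) ^ card {x\<in>I. x < i} * D (axis i 1) $ (I - {i}))"
      using inj by (simp add: sum.reindex)
    finally show ?thesis by (simp add: img)
  qed
  have "?f v = (\<Sum>I | card I = Suc k. wedge (Suc k) v $ I * ?E $ I)"
    unfolding alternating_form_eq_wedge[OF alternating_form_contraction[OF D], of v]
    by (intro sum.cong refl) (simp only: mem_Collect_eq ev)
  also have "\<dots> = (\<Sum>I\<in>UNIV. wedge (Suc k) v $ I * ?E $ I)"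
    by (rule sum.mono_neutral_left) (auto simp: wedge_nth)
  finally have "?f v = (\<Sum>I\<in>UNIV. wedge (Suc k) v $ I * ?E $ I)" .
  moreover have "?E \<bullet> wedge (Suc k) v = (\<Sum>I\<in>UNIV. wedge (Suc k) v $ I * ?E $ I)"
    unfolding inner_vec_def by (intro sum.cong refl) (simp only: inner_real_def mult.commute)
  ultimately show ?thesis by (simp only:)
qed

section \<open>Smooth forms\<close>

lemma Cm_SucI:
  assumes "\<And>x. (f has_derivative f' x) (at x)" "\<And>b. b \<in> Basis \<Longrightarrow> Cm m (\<lambda>x. f' x b)"
  shows "Cm (Suc m) f"
proof -
  have "frechet_derivative f (at x) = f' x" for x
    using frechet_derivative_at[OF assms(1)] by simp
  then show ?thesis using assms by (auto simp: differentiable_def)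
qed

lemma Cm_SucD:
  assumes "Cm (Suc m) f"
  shows "(f has_derivative frechet_derivative f (at x)) (at x)"
    and "b \<in> Basis \<Longrightarrow> Cm m (\<lambda>x. frechet_derivative f (at x) b)"
  using assms frechet_derivative_works[of f "at x"] by simp_all

lemma Cm_Suc_imp: "Cm (Suc m) f \<Longrightarrow> Cm m f"
proof (induction m arbitrary: f)
  case 0
  then show ?case
    by (auto simp: continuous_on_eq_continuous_at intro: differentiable_imp_continuous_within)
next
  case (Suc m)
  then show ?case by (subst Cm.simps) (use Suc.prems in \<open>auto\<close>)
qed

lemma Cm_imp_continuous: "Cm m f \<Longrightarrow> continuous_on UNIV f"
proof (induction m)
  case (Suc m) then show ?case using Cm_Suc_imp by blast
qed simp

lemma Cm_const: "Cm m (\<lambda>x. c)"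
proof (induction m arbitrary: c)
  case (Suc m) then show ?case by (intro Cm_SucI[where f'="\<lambda>_ _. 0"]) auto
qed simp

lemma Cm_bounded_linear_compose: "bounded_linear L \<Longrightarrow> Cm m f \<Longrightarrow> Cm m (\<lambda>x. L (f x))"
proof (induction m arbitrary: f)
  case 0 then show ?case by (auto intro: bounded_linear.continuous_on)
next
  case (Suc m)
  show ?case
  proof (rule Cm_SucI[where f'="\<lambda>x h. L (frechet_derivative f (at x) h)"])
    show "((\<lambda>x. L (f x)) has_derivative (\<lambda>h. L (frechet_derivative f (at x) h))) (at x)" for x
      by (rule bounded_linear.has_derivative[OF Suc.prems(1) Cm_SucD(1)[OF Suc.prems(2)]])
    show "Cm m (\<lambda>x. L (frechet_derivative f (at x) b))" if "b \<in> Basis" for b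
      by (rule Suc.IH[OF Suc.prems(1) Cm_SucD(2)[OF Suc.prems(2) that]])
  qed
qed

lemma Cm_linear: "bounded_linear L \<Longrightarrow> Cm m L"
proof (induction m)
  case 0 then show ?case by (auto intro: linear_continuous_on)
next
  case (Suc m)
  then show ?case by (intro Cm_SucI[where f'="\<lambda>x h. L h"]) (auto simp: bounded_linear_imp_has_derivative Cm_const)
qed

lemma Cm_add: "Cm m f \<Longrightarrow> Cm m g \<Longrightarrow> Cm m (\<lambda>x. f x + g x)"
proof (induction m arbitrary: f g)
  case 0 then show ?case by (auto intro: continuous_intros)
next
  case (Suc m)
  show ?case
  proof (rule Cm_SucI[where f'="\<lambda>x h. frechet_derivative f (at x) h + frechet_derivative g (at x) h"])
    show "((\<lambda>x. f x + g x) has_derivative (\<lambda>h. frechet_derivative f (at x) h + frechet_derivative g (at x) h)) (at x)" for x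
      by (intro has_derivative_add Cm_SucD(1)[OF Suc.prems(1)] Cm_SucD(1)[OF Suc.prems(2)])
    show "Cm m (\<lambda>x. frechet_derivative f (at x) b + frechet_derivative g (at x) b)" if "b \<in> Basis" for b
      by (intro Suc.IH Cm_SucD(2)[OF Suc.prems(1) that] Cm_SucD(2)[OF Suc.prems(2) that])
  qed
qed

lemma Cm_sum: "(\<And>i. i \<in> S \<Longrightarrow> Cm m (f i)) \<Longrightarrow> Cm m (\<lambda>x. \<Sum>i\<in>S. f i x)"
  by (induction S rule: infinite_finite_induct) (auto simp: Cm_const intro: Cm_add)

lemma Cm_mult:
  fixes f g :: "'a::euclidean_space \<Rightarrow> real"
  shows "Cm m f \<Longrightarrow> Cm m g \<Longrightarrow> Cm m (\<lambda>x. f x * g x)"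
proof (induction m arbitrary: f g)
  case 0 then show ?case by (auto intro: continuous_intros)
next
  case (Suc m)
  show ?case
  proof (rule Cm_SucI[where f'="\<lambda>x h. f x * frechet_derivative g (at x) h + frechet_derivative f (at x) h * g x"])
    show "((\<lambda>x. f x * g x) has_derivative (\<lambda>h. f x * frechet_derivative g (at x) h + frechet_derivative f (at x) h * g x)) (at x)" for x
      by (intro has_derivative_mult Cm_SucD(1)[OF Suc.prems(1)] Cm_SucD(1)[OF Suc.prems(2)])
    show "Cm m (\<lambda>x. f x * frechet_derivative g (at x) b + frechet_derivative f (at x) b * g x)" if "b \<in> Basis" for b
      by (rule Cm_add[OF Suc.IH[OF Cm_Suc_imp[OF Suc.prems(1)] Cm_SucD(2)[OF Suc.prems(2) that]]
            Suc.IH[OF Cm_SucD(2)[OF Suc.prems(1) that] Cm_Suc_imp[OF Suc.prems(2)]]])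
  qed
qed

lemma has_derivative_compose_affine:
  fixes f :: "'a::real_normed_vector \<Rightarrow> 'b::real_normed_vector"
  assumes "\<And>x. (f has_derivative f' x) (at x)"
  shows "((\<lambda>x. f (r *\<^sub>R x + u)) has_derivative (\<lambda>h. r *\<^sub>R f' (r *\<^sub>R x + u) h)) (at x)"
proof -
  have "((\<lambda>x. r *\<^sub>R x + u) has_derivative (\<lambda>h. r *\<^sub>R h)) (at x)"
    using has_derivative_add[OF has_derivative_scaleR_right[OF has_derivative_ident[of "at x"], of r] has_derivative_const[of u]]
    by simp
  from has_derivative_compose[OF this assms]
  have "((\<lambda>x. f (r *\<^sub>R x + u)) has_derivative (\<lambda>h. f' (r *\<^sub>R x + u) (r *\<^sub>R h))) (at x)" .
  moreover have "f' (r *\<^sub>R x + u) (r *\<^sub>R h) = r *\<^sub>R f' (r *\<^sub>R x + u) h" for h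
    using has_derivative_linear[OF assms] by (rule linear_scale)
  ultimately show ?thesis by simp
qed

lemma Cm_compose_affine: "Cm m f \<Longrightarrow> Cm m (\<lambda>x. f (r *\<^sub>R x + u))"
proof (induction m arbitrary: f)
  case 0 then show ?case
    by (auto intro!: continuous_on_compose2[of UNIV f] continuous_intros)
next
  case (Suc m)
  show ?case
  proof (rule Cm_SucI[where f'="\<lambda>x h. r *\<^sub>R frechet_derivative f (at (r *\<^sub>R x + u)) h"])
    show "((\<lambda>x. f (r *\<^sub>R x + u)) has_derivative (\<lambda>h. r *\<^sub>R frechet_derivative f (at (r *\<^sub>R x + u)) h)) (at x)" for x
      by (rule has_derivative_compose_affine[OF Cm_SucD(1)[OF Suc.prems]])
    show "Cm m (\<lambda>x. r *\<^sub>R frechet_derivative f (at (r *\<^sub>R x + u)) b)" if "b \<in> Basis" for b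
      by (rule Cm_bounded_linear_compose[OF bounded_linear_scaleR_right Suc.IH[OF Cm_SucD(2)[OF Suc.prems that]]])
  qed
qed

lemma Cm_real_polynomial_function: "real_polynomial_function p \<Longrightarrow> Cm m p"
  by (induction rule: real_polynomial_function.induct) (auto intro: Cm_linear Cm_const Cm_add Cm_mult)

lemma smooth_formsD:
  assumes "\<omega> \<in> smooth_forms k"
  shows "Cm m \<omega>" "continuous_on UNIV \<omega>" "\<omega> x \<in> kvectors k"
    "(\<omega> has_derivative frechet_derivative \<omega> (at x)) (at x)"
    "b \<in> Basis \<Longrightarrow> Cm m (\<lambda>x. frechet_derivative \<omega> (at x) b)"
  using assms Cm_imp_continuous[of 0 \<omega>] Cm_SucD[of m \<omega>] unfolding smooth_forms_def by blast+

lemma smooth_formsI: "(\<And>m. Cm m \<omega>) \<Longrightarrow> (\<And>x. \<omega> x \<in> kvectors k) \<Longrightarrow> \<omega> \<in> smooth_forms k"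
  by (auto simp: smooth_forms_def)

lemma smooth_forms_polynomial:
  fixes I :: "'n::finite set"
  assumes "real_polynomial_function p" "card I = k"
  shows "(\<lambda>x. p x *\<^sub>R axis I 1) \<in> smooth_forms k"
proof (rule smooth_formsI)
  show "Cm m (\<lambda>x. p x *\<^sub>R axis I 1)" for m
    by (rule Cm_bounded_linear_compose[OF bounded_linear_scaleR_left Cm_real_polynomial_function[OF assms(1)]])
qed (use assms(2) in \<open>auto simp: kvectors_def axis_def\<close>)

lemma kvectors_wedge: "wedge k v \<in> kvectors k"
  by (simp add: kvectors_def wedge_nth)

lemma subspace_kvectors: "subspace (kvectors k)"
  by (auto simp: subspace_def kvectors_def)

lemma G0_kvectors: "\<xi> \<in> G0 k \<Longrightarrow> \<xi> \<in> kvectors k"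
  by (auto simp: G0_def simple_kvector_def intro: subspace_scale[OF subspace_kvectors] kvectors_wedge)

text \<open>Symmetry of second derivatives, by the mean value theorem for a second difference.\<close>

lemma second_difference_mean_value:
  fixes f :: "'a::real_normed_vector \<Rightarrow> real"
  assumes f: "\<And>x. (f has_derivative f' x) (at x)"
    and g: "\<And>x. ((\<lambda>x. f' x a) has_derivative g' x) (at x)" and h: "h > 0"
  shows "\<exists>s t. 0 < s \<and> s < h \<and> 0 < t \<and> t < h \<and>
    f (x + h *\<^sub>R a + h *\<^sub>R b) - f (x + h *\<^sub>R a) - f (x + h *\<^sub>R b) + f x = h * h * g' (x + s *\<^sub>R a + t *\<^sub>R b) b"
proof -
  have line: "((\<lambda>s. F (y + s *\<^sub>R c)) has_real_derivative F' (y + s *\<^sub>R c) c) (at s)"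
    if F: "\<And>x. (F has_derivative F' x) (at x)" for F :: "'a \<Rightarrow> real" and F' y c s
  proof -
    have "((\<lambda>s. y + s *\<^sub>R c) has_derivative (\<lambda>h. h *\<^sub>R c)) (at s)"
      using has_derivative_add[OF has_derivative_const[of y] has_derivative_scaleR_left[OF has_derivative_ident[of "at s"], of c]]
      by simp
    from has_derivative_compose[OF this F]
    have "((\<lambda>s. F (y + s *\<^sub>R c)) has_derivative (\<lambda>h. F' (y + s *\<^sub>R c) (h *\<^sub>R c))) (at s)" .
    moreover have "F' (y + s *\<^sub>R c) (h *\<^sub>R c) = F' (y + s *\<^sub>R c) c * h" for h
      using linear_scale[OF has_derivative_linear[OF F]] by (simp add: mult.commute)
    ultimately show ?thesis by (simp add: has_field_derivative_def mult.commute[of _ "F' _ c"])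
  qed
  define \<phi> where "\<phi> = (\<lambda>s. f ((x + h *\<^sub>R b) + s *\<^sub>R a) - f (x + s *\<^sub>R a))"
  have "(\<phi> has_real_derivative (f' ((x + h *\<^sub>R b) + s *\<^sub>R a) a - f' (x + s *\<^sub>R a) a)) (at s)" for s
    unfolding \<phi>_def by (intro DERIV_diff line f)
  then obtain s where s: "0 < s" "s < h"
      "\<phi> h - \<phi> 0 = (h - 0) * (f' ((x + h *\<^sub>R b) + s *\<^sub>R a) a - f' (x + s *\<^sub>R a) a)"
    using MVT2[OF h, of \<phi> "\<lambda>s. f' ((x + h *\<^sub>R b) + s *\<^sub>R a) a - f' (x + s *\<^sub>R a) a"] by blast
  have "((\<lambda>t. f' (x + s *\<^sub>R a + t *\<^sub>R b) a) has_real_derivative g' (x + s *\<^sub>R a + t *\<^sub>R b) b) (at t)" for t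
    using line[OF g, of "x + s *\<^sub>R a" b t] .
  then obtain t where t: "0 < t" "t < h"
      "f' (x + s *\<^sub>R a + h *\<^sub>R b) a - f' (x + s *\<^sub>R a + 0 *\<^sub>R b) a = (h - 0) * g' (x + s *\<^sub>R a + t *\<^sub>R b) b"
    using MVT2[OF h, of "\<lambda>t. f' (x + s *\<^sub>R a + t *\<^sub>R b) a" "\<lambda>t. g' (x + s *\<^sub>R a + t *\<^sub>R b) b"] by blast
  have "f (x + h *\<^sub>R a + h *\<^sub>R b) - f (x + h *\<^sub>R a) - f (x + h *\<^sub>R b) + f x = \<phi> h - \<phi> 0"
    by (simp add: \<phi>_def algebra_simps)
  also have "\<dots> = h * (h * g' (x + s *\<^sub>R a + t *\<^sub>R b) b)"
    using s(3) t(3) by (simp add: algebra_simps)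
  finally show ?thesis using s t by (intro exI[of _ s] exI[of _ t]) simp
qed

lemma second_derivative_symmetric:
  fixes f :: "'a::real_normed_vector \<Rightarrow> real"
  assumes f: "\<And>x. (f has_derivative f' x) (at x)"
    and ga: "\<And>x. ((\<lambda>x. f' x a) has_derivative ga x) (at x)" and gb: "\<And>x. ((\<lambda>x. f' x b) has_derivative gb x) (at x)"
    and ca: "continuous_on UNIV (\<lambda>x. ga x b)" and cb: "continuous_on UNIV (\<lambda>x. gb x a)"
  shows "ga x b = gb x a"
proof (rule ccontr)
  assume ne: "ga x b \<noteq> gb x a"
  define e where "e = \<bar>ga x b - gb x a\<bar> / 2"
  have e: "e > 0" using ne by (simp add: e_def)
  obtain d1 where d1: "d1 > 0" "\<And>y. dist y x < d1 \<Longrightarrow> dist (ga y b) (ga x b) < e"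
    using ca e unfolding continuous_on_iff by (metis UNIV_I)
  obtain d2 where d2: "d2 > 0" "\<And>y. dist y x < d2 \<Longrightarrow> dist (gb y a) (gb x a) < e"
    using cb e unfolding continuous_on_iff by (metis UNIV_I)
  define d where "d = min d1 d2"
  define h where "h = d / (norm a + norm b + 1)"
  have N: "norm a + norm b + 1 > 0" by (simp add: add_nonneg_pos)
  have h: "h > 0" using d1 d2 N by (simp add: h_def d_def)
  have near: "norm (s *\<^sub>R a + t *\<^sub>R b) < d" if "0 < s" "s < h" "0 < t" "t < h" for s t
  proof -
    have "norm (s *\<^sub>R a + t *\<^sub>R b) \<le> s * norm a + t * norm b"
      using that by (intro order_trans[OF norm_triangle_ineq]) auto
    also have "\<dots> \<le> h * norm a + h * norm b" using that by (intro add_mono mult_right_mono) auto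
    also have "\<dots> < h * (norm a + norm b + 1)" using h by (simp add: algebra_simps)
    also have "\<dots> = d" using N by (simp add: h_def)
    finally show ?thesis .
  qed
  obtain s t where st: "0 < s" "s < h" "0 < t" "t < h"
    "f (x + h *\<^sub>R a + h *\<^sub>R b) - f (x + h *\<^sub>R a) - f (x + h *\<^sub>R b) + f x = h * h * ga (x + s *\<^sub>R a + t *\<^sub>R b) b"
    using second_difference_mean_value[OF f ga h, of x b] by blast
  obtain s' t' where st': "0 < s'" "s' < h" "0 < t'" "t' < h"
    "f (x + h *\<^sub>R b + h *\<^sub>R a) - f (x + h *\<^sub>R b) - f (x + h *\<^sub>R a) + f x = h * h * gb (x + s' *\<^sub>R b + t' *\<^sub>R a) a"
    using second_difference_mean_value[OF f gb h, of x a] by blast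
  have sw: "x + h *\<^sub>R b + h *\<^sub>R a = x + h *\<^sub>R a + h *\<^sub>R b" by simp
  have "h * h * ga (x + s *\<^sub>R a + t *\<^sub>R b) b = h * h * gb (x + s' *\<^sub>R b + t' *\<^sub>R a) a"
    using st(5) st'(5) unfolding sw by linarith
  then have eq: "ga (x + s *\<^sub>R a + t *\<^sub>R b) b = gb (x + s' *\<^sub>R b + t' *\<^sub>R a) a" using h by simp
  have "dist (ga (x + s *\<^sub>R a + t *\<^sub>R b) b) (ga x b) < e"
    by (rule d1(2)) (use near[of s t] st in \<open>auto simp: dist_norm d_def add.assoc\<close>)
  moreover have "dist (gb (x + s' *\<^sub>R b + t' *\<^sub>R a) a) (gb x a) < e"
    by (rule d2(2)) (use near[of t' s'] st' in \<open>auto simp: dist_norm d_def add.assoc add.commute\<close>)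
  moreover define V where "V = gb (x + s' *\<^sub>R b + t' *\<^sub>R a) a"
  ultimately have "\<bar>V - ga x b\<bar> < e" "\<bar>V - gb x a\<bar> < e" unfolding eq dist_real_def by simp_all
  moreover have "\<bar>ga x b - gb x a\<bar> \<le> \<bar>V - ga x b\<bar> + \<bar>V - gb x a\<bar>" by linarith
  ultimately show False unfolding e_def by (smt (verit) field_sum_of_halves)
qed

lemma ext_deriv_smooth:
  fixes \<phi> :: "real ^ 'n::{finite,linorder} \<Rightarrow> real ^ ('n set)"
  assumes \<phi>: "\<phi> \<in> smooth_forms k"
  shows "ext_deriv \<phi> \<in> smooth_forms (Suc k)"
proof (rule smooth_formsI)
  have bas: "axis i 1 \<in> (Basis :: ((real, 'n) vec) set)" for i by (auto simp: Basis_vec_def)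
  fix m
  have "Cm m (\<lambda>x. \<Sum>I\<in>UNIV. \<Sum>i\<in>I. ((-1) ^ card {j\<in>I. j < i} * frechet_derivative \<phi> (at x) (axis i 1) $ (I - {i})) *\<^sub>R (axis I 1 :: (real, 'n set) vec))"
  proof (intro Cm_sum)
    fix I :: "'n set" and i
    have "bounded_linear (\<lambda>y :: (real, 'n set) vec. ((-1) ^ card {j\<in>I. j < i} * y $ (I - {i})) *\<^sub>R (axis I 1 :: (real, 'n set) vec))"
      by (intro bounded_linear_compose[OF bounded_linear_scaleR_left] bounded_linear_compose[OF bounded_linear_mult_right] bounded_linear_vec_nth)
    from Cm_bounded_linear_compose[OF this smooth_formsD(5)[OF \<phi> bas[of i]]]
    show "Cm m (\<lambda>x. ((-1) ^ card {j\<in>I. j < i} * frechet_derivative \<phi> (at x) (axis i 1) $ (I - {i})) *\<^sub>R (axis I 1 :: (real, 'n set) vec))" .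
  qed
  moreover have eq: "ext_deriv \<phi> x = (\<Sum>I\<in>UNIV. \<Sum>i\<in>I. ((-1) ^ card {j\<in>I. j < i} * frechet_derivative \<phi> (at x) (axis i 1) $ (I - {i})) *\<^sub>R (axis I 1 :: (real, 'n set) vec))" for x
  proof -
    have "(\<Sum>I\<in>UNIV. \<Sum>i\<in>I. ((-1) ^ card {j\<in>I. j < i} * frechet_derivative \<phi> (at x) (axis i 1) $ (I - {i})) *\<^sub>R (axis I 1 :: (real, 'n set) vec))
      = (\<Sum>I\<in>UNIV. (ext_deriv \<phi> x $ I) *\<^sub>R axis I 1)"
      by (simp add: ext_deriv_def scaleR_left.sum)
    also have "\<dots> = ext_deriv \<phi> x" by (simp add: basis_expansion scalar_mult_eq_scaleR[symmetric])
    finally show ?thesis ..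
  qed
  ultimately show "Cm m (ext_deriv \<phi>)" unfolding eq[abs_def] by simp
next
  fix x
  have "frechet_derivative \<phi> (at x) h $ J = 0" if J: "card J \<noteq> k" for h J
  proof -
    have "((\<lambda>x. \<phi> x $ J) has_derivative (\<lambda>h. frechet_derivative \<phi> (at x) h $ J)) (at x)"
      by (rule bounded_linear.has_derivative[OF bounded_linear_vec_nth smooth_formsD(4)[OF \<phi>]])
    moreover have "(\<lambda>x. \<phi> x $ J) = (\<lambda>x. 0)" using smooth_formsD(3)[OF \<phi>] J by (auto simp: kvectors_def)
    ultimately have "((\<lambda>x. 0) has_derivative (\<lambda>h. frechet_derivative \<phi> (at x) h $ J)) (at x)"
      by (simp only:)
    then have "(\<lambda>h. frechet_derivative \<phi> (at x) h $ J) = (\<lambda>h. 0)"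
      by (rule has_derivative_unique[OF _ has_derivative_const])
    then show ?thesis by meson
  qed
  moreover have "card (I - {i}) \<noteq> k" if "i \<in> I" "card I \<noteq> Suc k" for I :: "'n set" and i
    using that by (metis card_Suc_Diff1 finite)
  ultimately show "ext_deriv \<phi> x \<in> kvectors (Suc k)"
    unfolding kvectors_def ext_deriv_def by (auto intro!: sum.neutral)
qed

lemma ext_deriv_ext_deriv:
  fixes \<phi> :: "real ^ 'n::{finite,linorder} \<Rightarrow> real ^ ('n set)"
  assumes \<phi>: "\<phi> \<in> smooth_forms k"
  shows "ext_deriv (ext_deriv \<phi>) x = 0"
proof -
  have bas: "axis i 1 \<in> (Basis :: ((real, 'n) vec) set)" for i by (auto simp: Basis_vec_def)
  define d where "d = (\<lambda>i x. frechet_derivative \<phi> (at x) (axis i 1))"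
  have dC: "Cm m (d i)" for m i unfolding d_def by (rule smooth_formsD(5)[OF \<phi> bas])
  define dd where "dd = (\<lambda>i l x. frechet_derivative (d l) (at x) (axis i 1))"
  have ddC: "Cm m (dd i l)" for m i l unfolding dd_def using Cm_SucD(2)[OF dC bas] .
  have dder: "((\<lambda>x. d l x $ J) has_derivative (\<lambda>h. frechet_derivative (d l) (at x) h $ J)) (at x)" for l x J
    by (rule bounded_linear.has_derivative[OF bounded_linear_vec_nth Cm_SucD(1)[OF dC]])
  have sym: "dd i l x $ J = dd l i x $ J" for i l x J
    unfolding dd_def
  proof (rule second_derivative_symmetric[where f="\<lambda>x. \<phi> x $ J" and f'="\<lambda>x h. frechet_derivative \<phi> (at x) h $ J"])
    show "((\<lambda>x. \<phi> x $ J) has_derivative (\<lambda>h. frechet_derivative \<phi> (at x) h $ J)) (at x)" for x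
      by (rule bounded_linear.has_derivative[OF bounded_linear_vec_nth smooth_formsD(4)[OF \<phi>]])
    show "((\<lambda>x. frechet_derivative \<phi> (at x) (axis l 1) $ J) has_derivative (\<lambda>h. frechet_derivative (d l) (at x) h $ J)) (at x)"
      "((\<lambda>x. frechet_derivative \<phi> (at x) (axis i 1) $ J) has_derivative (\<lambda>h. frechet_derivative (d i) (at x) h $ J)) (at x)" for x
      unfolding d_def by (rule dder[unfolded d_def])+
    show "continuous_on UNIV (\<lambda>x. frechet_derivative (d l) (at x) (axis i 1) $ J)" for i l
      using Cm_imp_continuous[OF ddC[of 0 i l]] unfolding dd_def by (intro continuous_on_component)
    then show "continuous_on UNIV (\<lambda>x. frechet_derivative (d i) (at x) (axis l 1) $ J)" .
  qed
  have e1: "ext_deriv \<phi> y $ K = (\<Sum>l\<in>K. (-1) ^ card {j\<in>K. j < l} * d l y $ (K - {l}))" for y K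
    by (simp add: ext_deriv_def d_def)
  have e1': "frechet_derivative (ext_deriv \<phi>) (at x) h $ K =
      (\<Sum>l\<in>K. (-1) ^ card {j\<in>K. j < l} * frechet_derivative (d l) (at x) h $ (K - {l}))" for x h K
  proof -
    have 1: "((\<lambda>y. ext_deriv \<phi> y $ K) has_derivative (\<lambda>h. frechet_derivative (ext_deriv \<phi>) (at x) h $ K)) (at x)"
      by (rule bounded_linear.has_derivative[OF bounded_linear_vec_nth smooth_formsD(4)[OF ext_deriv_smooth[OF \<phi>]]])
    have 2: "((\<lambda>y. ext_deriv \<phi> y $ K) has_derivative
        (\<lambda>h. \<Sum>l\<in>K. (-1) ^ card {j\<in>K. j < l} * frechet_derivative (d l) (at x) h $ (K - {l}))) (at x)"
      unfolding e1 by (intro has_derivative_sum bounded_linear.has_derivative[OF bounded_linear_mult_right] dder)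
    show ?thesis using fun_cong[OF has_derivative_unique[OF 1 2], of h] .
  qed
  have "ext_deriv (ext_deriv \<phi>) x $ I = 0" for I
  proof -
    define s where "s = (\<lambda>i l. (-1) ^ card {j\<in>I. j < i} * (-1) ^ card {j\<in>I - {i}. j < l} :: real)"
    have anti: "s i l = - s l i" if "i \<in> I" "l \<in> I" "i < l" for i l
    proof -
      have "{j\<in>I - {l}. j < i} = {j\<in>I. j < i}" using that by auto
      moreover have "{j\<in>I. j < l} = insert i {j\<in>I - {i}. j < l}" using that by auto
      then have "card {j\<in>I. j < l} = Suc (card {j\<in>I - {i}. j < l})" by simp
      ultimately show ?thesis by (simp add: s_def)
    qed
    define t where "t = (\<lambda>(i, l). s i l * dd i l x $ (I - {i} - {l}))"
    have t_less: "t (l, i) = - t (i, l)" if "i \<in> I" "l \<in> I" "i < l" for i l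
    proof -
      have "I - {l} - {i} = I - {i} - {l}" by auto
      then show ?thesis using anti[OF that] sym[of i l x] by (simp add: t_def)
    qed
    have t_anti: "t (l, i) = - t (i, l)" if "i \<in> I" "l \<in> I" "i \<noteq> l" for i l
      using t_less[of i l] t_less[of l i] that by (cases "i < l") auto
    let ?P = "SIGMA i:I. I - {i}"
    have "ext_deriv (ext_deriv \<phi>) x $ I = (\<Sum>i\<in>I. \<Sum>l\<in>I - {i}. t (i, l))"
      unfolding ext_deriv_def[of "ext_deriv \<phi>"] vec_lambda_beta e1'
      by (simp add: t_def s_def dd_def sum_distrib_left mult.assoc)
    also have "\<dots> = sum t ?P" by (simp add: sum.Sigma case_prod_beta)
    finally have *: "ext_deriv (ext_deriv \<phi>) x $ I = sum t ?P" .
    have "sum t ?P = (\<Sum>p\<in>?P. t (prod.swap p))"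
      by (rule sum.reindex_bij_witness[of _ prod.swap prod.swap]) auto
    also have "\<dots> = (\<Sum>p\<in>?P. - t p)"     proof (intro sum.cong refl)
      fix p assume "p \<in> ?P"
      then obtain i l where "p = (i, l)" "i \<in> I" "l \<in> I" "i \<noteq> l" by blast
      then show "t (prod.swap p) = - t p" using t_anti[of i l] by simp
    qed
    finally show ?thesis unfolding * by (simp add: sum_negf)
  qed
  then show ?thesis by (simp add: vec_eq_iff)
qed

section \<open>Currents with integrable densities\<close>

lemma integrable_continuous_mult:
  fixes u :: "'a::euclidean_space \<Rightarrow> real" and F :: "'a \<Rightarrow> 'b::euclidean_space"
  assumes M[measurable_cong]: "sets M = sets borel" and F: "integrable M F" and supp: "\<And>x. R < norm x \<Longrightarrow> F x = 0"
    and u: "continuous_on UNIV u"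
  shows "integrable M (\<lambda>x. u x *\<^sub>R F x)"
proof -
  have [measurable]: "u \<in> borel_measurable borel" using u by (rule borel_measurable_continuous_onI)
  have "compact (u ` cball 0 R)" by (intro compact_continuous_image continuous_on_subset[OF u]) auto
  then obtain C where "\<forall>y\<in>u ` cball 0 R. norm y \<le> C"
    using compact_imp_bounded bounded_iff by blast
  then have C: "\<And>x. x \<in> cball 0 R \<Longrightarrow> \<bar>u x\<bar> \<le> C" by auto
  have "norm (u x *\<^sub>R F x) \<le> norm (C *\<^sub>R F x)" for x
  proof (cases "R < norm x")
    case False
    then have "\<bar>u x\<bar> \<le> \<bar>C\<bar>" using C[of x] by force
    then show ?thesis by (simp add: mult_right_mono)
  qed (simp add: supp)
  moreover have "u \<in> borel_measurable M" by measurable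
  ultimately show ?thesis
    using borel_measurable_integrable[OF F]
    by (intro Bochner_Integration.integrable_bound[OF integrable_scaleR_right[OF F, of C]]
        borel_measurable_scaleR AE_I2) simp_all
qed

lemma integrable_inner_continuous:
  fixes \<omega> F :: "'a::euclidean_space \<Rightarrow> 'b::euclidean_space"
  assumes M: "sets M = sets borel" and F: "integrable M F" and supp: "\<And>x. R < norm x \<Longrightarrow> F x = 0"
    and \<omega>: "continuous_on UNIV \<omega>"
  shows "integrable M (\<lambda>x. \<omega> x \<bullet> F x)"
proof -
  have "integrable M (\<lambda>x. (\<omega> x \<bullet> b) *\<^sub>R (F x \<bullet> b))" for b
  proof (rule integrable_continuous_mult[OF M, where R=R])
    show "integrable M (\<lambda>x. F x \<bullet> b)" using F by simp
    show "continuous_on UNIV (\<lambda>x. \<omega> x \<bullet> b)" using \<omega> by (intro continuous_intros)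
  qed (simp add: supp)
  then have "integrable M (\<lambda>x. \<Sum>b\<in>Basis. (\<omega> x \<bullet> b) * (F x \<bullet> b))"
    by (intro Bochner_Integration.integrable_sum) simp
  moreover have "(\<lambda>x. \<Sum>b\<in>Basis. (\<omega> x \<bullet> b) * (F x \<bullet> b)) = (\<lambda>x. \<omega> x \<bullet> F x)"
    by (rule ext, rule euclidean_inner[symmetric])
  ultimately show ?thesis by simp
qed

text \<open>
  By the Stone-Weierstrass theorem the moments vanish for all continuous functions, by dominated convergence for
  indicators of closed sets, and then for indicators of all Borel sets.
\<close>

lemma zero_density_if_polynomial_moments_zero:
  fixes h :: "'a::euclidean_space \<Rightarrow> real"
  assumes M[measurable_cong]: "sets M = sets borel" and h: "integrable M h" and supp: "\<And>x. R < norm x \<Longrightarrow> h x = 0"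
    and zero: "\<And>p. real_polynomial_function p \<Longrightarrow> (LINT x|M. p x * h x) = 0"
  shows "AE x in M. h x = 0"
proof -
  have int: "integrable M (\<lambda>x. u x * h x)" if "continuous_on UNIV u" for u
    using integrable_continuous_mult[OF M h supp that] by simp
  have cont: "(LINT x|M. u x * h x) = 0" if u: "continuous_on UNIV u" for u
  proof -
    have "\<bar>LINT x|M. u x * h x\<bar> \<le> 0 + e" if e: "e > 0" for e
    proof -
      define e' where "e' = e / ((LINT x|M. \<bar>h x\<bar>) + 1)"
      have A: "(LINT x|M. \<bar>h x\<bar>) \<ge> 0" by simp
      then have e': "e' > 0" using e by (simp add: e'_def add_nonneg_pos)
      obtain g where g: "real_polynomial_function g" "\<And>x. x \<in> cball 0 R \<Longrightarrow> \<bar>u x - g x\<bar> < e'"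
        using Stone_Weierstrass_real_polynomial_function[of "cball 0 R" u e'] u e'
        by (metis compact_cball continuous_on_subset subset_UNIV)
      have gc: "continuous_on UNIV g" using g(1) by (simp add: continuous_on_polymonial_function real_polynomial_function_eq)
      have "\<bar>LINT x|M. u x * h x\<bar> = \<bar>(LINT x|M. u x * h x) - (LINT x|M. g x * h x)\<bar>" using zero[OF g(1)] by simp
      also have "\<dots> = \<bar>LINT x|M. u x * h x - g x * h x\<bar>"
        using int[OF u] int[OF gc] by simp
      also have "\<dots> \<le> (LINT x|M. \<bar>u x * h x - g x * h x\<bar>)" by (rule integral_abs_bound)
      also have "\<dots> \<le> (LINT x|M. e' * \<bar>h x\<bar>)"
      proof (rule integral_mono)
        fix x
        show "\<bar>u x * h x - g x * h x\<bar> \<le> e' * \<bar>h x\<bar>"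
        proof (cases "R < norm x")
          case False
          then have "\<bar>u x - g x\<bar> \<le> e'" using g(2)[of x] by (simp add: less_imp_le)
          then have "\<bar>u x - g x\<bar> * \<bar>h x\<bar> \<le> e' * \<bar>h x\<bar>" by (rule mult_right_mono) simp
          then show ?thesis by (simp add: left_diff_distrib[symmetric] abs_mult)
        qed (simp add: supp)
      qed (use int[OF u] int[OF gc] h in auto)
      also have "\<dots> = e' * (LINT x|M. \<bar>h x\<bar>)" by simp
      also have "\<dots> \<le> e' * ((LINT x|M. \<bar>h x\<bar>) + 1)" using e' by simp
      also have "\<dots> = e"
      proof -
        have "(LINT x|M. \<bar>h x\<bar>) + 1 \<noteq> 0" using A by linarith
        then show ?thesis by (simp add: e'_def)
      qed
      finally show ?thesis by simp
    qed
    then have "\<bar>LINT x|M. u x * h x\<bar> \<le> 0" by (rule field_le_epsilon)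
    then show ?thesis by simp
  qed
  have sp: "space M = UNIV" using sets_eq_imp_space_eq[OF M] by simp
  have closed0: "(LINT x|M. indicator B x * h x) = 0" if B: "closed B" for B
  proof (cases "B = {}")
    case False
    define u where "u = (\<lambda>(n::nat) x. max 0 (1 - real n * infdist x B))"
    have uc: "continuous_on UNIV (u n)" for n unfolding u_def by (intro continuous_intros)
    have [measurable]: "u n \<in> borel_measurable borel" "B \<in> sets borel" for n
      using borel_measurable_continuous_onI[OF uc] B by auto
    have "(\<lambda>n. LINT x|M. u n x * h x) \<longlonglongrightarrow> (LINT x|M. indicator B x * h x)"
    proof (rule integral_dominated_convergence[where w="\<lambda>x. \<bar>h x\<bar>"])
      show "AE x in M. (\<lambda>n. u n x * h x) \<longlonglongrightarrow> indicator B x * h x"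
      proof (intro AE_I2 tendsto_mult tendsto_const)
        fix x
        show "(\<lambda>n. u n x) \<longlonglongrightarrow> indicator B x"
        proof (cases "x \<in> B")
          case True then show ?thesis by (simp add: u_def)
        next
          case F: False
          then have pos: "infdist x B > 0"
            using B False by (metis in_closed_iff_infdist_zero infdist_nonneg less_eq_real_def)
          obtain N :: nat where N: "real N > 1 / infdist x B" using reals_Archimedean2 by blast
          have "u n x = 0" if "n \<ge> N" for n
          proof -
            have "real n > 1 / infdist x B" using N that by linarith
            then have "1 \<le> real n * infdist x B" using pos by (simp add: field_simps)
            then show ?thesis by (simp add: u_def)
          qed
          then have "eventually (\<lambda>n. u n x = 0) sequentially" unfolding eventually_sequentially by blast
          then show ?thesis using F by (simp add: tendsto_eventually)
        qed
      qed
      show "AE x in M. norm (u n x * h x) \<le> \<bar>h x\<bar>" for n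
      proof (rule AE_I2)
        fix x
        have "0 \<le> u n x" "u n x \<le> 1" by (simp_all add: u_def infdist_nonneg)
        then show "norm (u n x * h x) \<le> \<bar>h x\<bar>" by (simp add: abs_mult mult_left_le_one_le)
      qed
    qed (use h in auto)
    moreover have "(\<lambda>n. LINT x|M. u n x * h x) = (\<lambda>_. 0)" using cont[OF uc] by auto
    ultimately show ?thesis using LIMSEQ_unique[OF _ tendsto_const] by metis
  qed simp
  have inth: "integrable M (\<lambda>x. indicator A x * h x)" if "A \<in> sets borel" for A
    using integrable_mult_indicator[of A M h] that h M by simp
  have tot: "(LINT x|M. h x) = 0" using closed0[of UNIV] by simp
  have all: "(LINT x|M. indicator A x * h x) = 0" if "A \<in> sets borel" for A
  proof -
    have "A \<in> sigma_sets UNIV {S. closed S}" using that by (simp add: borel_eq_closed)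
    have G: "Int_stable {S :: 'a set. closed S}" "{S :: 'a set. closed S} \<subseteq> Pow UNIV"
      by (auto intro!: Int_stableI)
    from \<open>A \<in> sigma_sets UNIV {S. closed S}\<close>
    have "(LINT x|M. indicator A x * h x) = 0 \<and> A \<in> sets borel"
    proof (induction rule: sigma_sets_induct_disjoint[OF G, consumes 1, case_names basic empty compl union])
      case (compl A)
      have "(LINT x|M. indicator (UNIV - A) x * h x) = (LINT x|M. h x - indicator A x * h x)"
        by (rule Bochner_Integration.integral_cong) (auto simp: indicator_def)
      also have "\<dots> = 0" using compl h inth tot by simp
      finally show ?case using compl by auto
    next
      case (union A)
      then have A: "\<And>i. A i \<in> sets borel" by auto
      have "(LINT x:(\<Union>i. A i)|M. h x) = (\<Sum>i. LINT x:A i|M. h x)"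
      proof (rule lebesgue_integral_countable_add)
        show "set_integrable M (\<Union>i. A i) h"
          unfolding set_integrable_def using inth[of "\<Union>i. A i"] A by simp
      qed (use A M union(1) in \<open>auto simp: disjoint_family_on_def\<close>)
      then show ?case using union A by (auto simp: set_lebesgue_integral_def)
    next
      case (basic A) then show ?case using closed0[of A] by auto
    qed auto
    then show ?thesis by blast
  qed
  show ?thesis
    by (rule density_unique_real[OF h integrable_zero]) (use all M in \<open>auto simp: set_lebesgue_integral_def\<close>)
qed

text \<open>
  A representation by a triple \<open>(M, \<tau>, \<Theta>)\<close> amounts to the density \<open>\<Theta> \<tau>\<close> on \<open>M\<close>.  In contrast to triples,
  densities of currents with different supports can simply be added, and they are unique almost everywhere.
\<close>

definition has_density :: "nat \<Rightarrow> 'n::{finite,linorder} current \<Rightarrow> (real ^ 'n::{finite,linorder} \<Rightarrow> real ^ ('n set)) \<Rightarrow> bool" where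
  "has_density k T F \<longleftrightarrow> integrable (hausdorff_measure k) F \<and> (\<exists>R. \<forall>x. R < norm x \<longrightarrow> F x = 0) \<and>
     (\<forall>x. F x \<in> kvectors k) \<and>
     (\<forall>\<omega>\<in>smooth_forms k. T \<omega> = (LINT x|hausdorff_measure k. \<omega> x \<bullet> F x))"

lemma has_densityD:
  assumes "has_density k T F"
  shows "integrable (hausdorff_measure k) F" "F x \<in> kvectors k"
    "\<omega> \<in> smooth_forms k \<Longrightarrow> T \<omega> = (LINT x|hausdorff_measure k. \<omega> x \<bullet> F x)"
    "continuous_on UNIV \<omega> \<Longrightarrow> integrable (hausdorff_measure k) (\<lambda>x. \<omega> x \<bullet> F x)"
  using assms integrable_inner_continuous[OF sets_hausdorff, of k F _ \<omega>] unfolding has_density_def by blast+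

lemma has_density_add:
  fixes T U :: "'n::{finite,linorder} current"
  assumes "has_density k T F" "has_density k U G"
  shows "has_density k (\<lambda>\<omega>. T \<omega> + U \<omega>) (\<lambda>x. F x + G x)"
  unfolding has_density_def
proof (intro conjI allI ballI)
  obtain R1 R2 where "\<And>x. R1 < norm x \<Longrightarrow> F x = 0" "\<And>x. R2 < norm x \<Longrightarrow> G x = 0"
    using assms unfolding has_density_def by blast
  then have "\<forall>x. max R1 R2 < norm x \<longrightarrow> F x + G x = 0" by simp
  then show "\<exists>R. \<forall>x. R < norm x \<longrightarrow> F x + G x = 0" by blast
  show "F x + G x \<in> kvectors k" for x
    using has_densityD(2)[OF assms(1)] has_densityD(2)[OF assms(2)] by (intro subspace_add[OF subspace_kvectors])
  fix \<omega> :: "(real, 'n) vec \<Rightarrow> (real, 'n set) vec" assume \<omega>: "\<omega> \<in> smooth_forms k"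
  show "T \<omega> + U \<omega> = (LINT x|hausdorff_measure k. \<omega> x \<bullet> (F x + G x))"
    using has_densityD(3,4)[OF assms(1)] has_densityD(3,4)[OF assms(2)] \<omega> smooth_formsD(2)[OF \<omega>]
    by (simp add: inner_add_right)
qed (use has_densityD(1)[OF assms(1)] has_densityD(1)[OF assms(2)] in simp)

lemma has_density_scale:
  assumes "has_density k T F"
  shows "has_density k (\<lambda>\<omega>. a * T \<omega>) (\<lambda>x. a *\<^sub>R F x)"
  using assms unfolding has_density_def by (auto intro: subspace_scale[OF subspace_kvectors])

lemma has_density_zero: "has_density k (\<lambda>\<omega>. 0) (\<lambda>x. 0)"
  unfolding has_density_def by (auto intro: subspace_0[OF subspace_kvectors])

text \<open>
  Polynomials times constant covectors are smooth forms, so two densities have the same polynomial moments.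
\<close>

lemma has_density_unique:
  fixes T :: "'a::{finite,linorder} current"
  assumes F: "has_density k T F" and G: "has_density k T G"
  shows "AE x in hausdorff_measure k. F x = G x"
proof -
  let ?H = "hausdorff_measure k :: ((real, 'a) vec) measure"
  have "AE x in ?H. F x $ I - G x $ I = 0" for I
  proof (cases "card I = k")
    case True
    obtain R1 R2 where R: "\<And>x. R1 < norm x \<Longrightarrow> F x = 0" "\<And>x. R2 < norm x \<Longrightarrow> G x = 0"
      using F G unfolding has_density_def by blast
    have int: "integrable ?H (\<lambda>x. F x $ I)" "integrable ?H (\<lambda>x. G x $ I)"
      using has_densityD(1)[OF F] has_densityD(1)[OF G]
      by (auto intro: integrable_bounded_linear[OF bounded_linear_vec_nth])
    show ?thesis
    proof (rule zero_density_if_polynomial_moments_zero[where R="max R1 R2"])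
      fix p :: "(real, 'a) vec \<Rightarrow> real" assume p: "real_polynomial_function p"
      have s: "(\<lambda>x. p x *\<^sub>R axis I 1) \<in> smooth_forms k" by (rule smooth_forms_polynomial[OF p True])
      have i: "(p x *\<^sub>R axis I 1) \<bullet> y = p x * y $ I" for x and y :: "(real, 'a set) vec"
        by (simp add: inner_axis' )
      have "(LINT x|?H. p x * F x $ I) = (LINT x|?H. p x * G x $ I)"
        using has_densityD(3)[OF F s] has_densityD(3)[OF G s] unfolding i by simp
      moreover have "integrable ?H (\<lambda>x. p x * F x $ I)" "integrable ?H (\<lambda>x. p x * G x $ I)"
        using has_densityD(4)[OF F smooth_formsD(2)[OF s]] has_densityD(4)[OF G smooth_formsD(2)[OF s]] unfolding i by auto
      ultimately show "(LINT x|?H. p x * (F x $ I - G x $ I)) = 0" by (simp add: right_diff_distrib)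
    qed (use int R in auto)
  next
    case False
    then show ?thesis using has_densityD(2)[OF F] has_densityD(2)[OF G] by (auto simp: kvectors_def)
  qed
  then have "AE x in ?H. \<forall>I. F x $ I - G x $ I = 0" by (simp add: AE_all_countable)
  then show ?thesis by eventually_elim (simp add: vec_eq_iff)
qed

section \<open>Energy in terms of the density\<close>

lemma represents_has_density:
  fixes T :: "'a::{finite,linorder} current"
  assumes rep: "represents k T M \<tau> \<Theta>"
  shows "has_density k T (\<lambda>x. indicator M x *\<^sub>R (\<Theta> x *\<^sub>R \<tau> x))"
proof -
  let ?H = "hausdorff_measure k :: ((real, 'a) vec) measure"
  have M: "M \<in> sets borel" "bounded M" and \<tau>m: "\<tau> \<in> borel_measurable (restrict_space borel M)"
    and \<tau>G: "\<And>x. x \<in> M \<Longrightarrow> \<tau> x \<in> G0 k" and \<Theta>: "set_integrable ?H M \<Theta>"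
    and T: "\<And>\<omega>. \<omega> \<in> smooth_forms k \<Longrightarrow> T \<omega> = (LINT x:M|?H. \<Theta> x * (\<omega> x \<bullet> \<tau> x))"
    using rep unfolding represents_def rectifiable_set_def orientation_def by auto
  have [measurable]: "(\<lambda>x. indicator M x *\<^sub>R \<tau> x) \<in> borel_measurable borel"
    using \<tau>m M by (subst (asm) borel_measurable_restrict_space_iff) auto
  have i: "integrable ?H (\<lambda>x. indicator M x * \<Theta> x)" using \<Theta> by (simp add: set_integrable_def)
  then have [measurable]: "(\<lambda>x. indicator M x * \<Theta> x) \<in> borel_measurable borel" by auto
  have eq: "indicator M x *\<^sub>R (\<Theta> x *\<^sub>R \<tau> x) = (indicator M x * \<Theta> x) *\<^sub>R (indicator M x *\<^sub>R \<tau> x)" for x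
    by (simp add: indicator_def)
  have "integrable ?H (\<lambda>x. indicator M x *\<^sub>R (\<Theta> x *\<^sub>R \<tau> x))"
  proof (rule Bochner_Integration.integrable_bound[OF i])
    show "(\<lambda>x. indicator M x *\<^sub>R (\<Theta> x *\<^sub>R \<tau> x)) \<in> borel_measurable ?H" unfolding eq by measurable
    show "AE x in ?H. norm (indicator M x *\<^sub>R (\<Theta> x *\<^sub>R \<tau> x)) \<le> norm (indicator M x * \<Theta> x)"
      using \<tau>G by (intro AE_I2) (auto simp: indicator_def G0_def)
  qed
  moreover obtain R where "\<And>x. x \<in> M \<Longrightarrow> norm x \<le> R" using M(2) by (auto simp: bounded_iff)
  then have "\<forall>x. R < norm x \<longrightarrow> indicator M x *\<^sub>R (\<Theta> x *\<^sub>R \<tau> x) = 0" by (force simp: indicator_def)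
  moreover have "indicator M x *\<^sub>R (\<Theta> x *\<^sub>R \<tau> x) \<in> kvectors k" for x
    using G0_kvectors[OF \<tau>G]
    by (auto simp: indicator_def intro: subspace_scale[OF subspace_kvectors] subspace_0[OF subspace_kvectors])
  moreover have "T \<omega> = (LINT x|?H. \<omega> x \<bullet> (indicator M x *\<^sub>R (\<Theta> x *\<^sub>R \<tau> x)))" if "\<omega> \<in> smooth_forms k" for \<omega>
    unfolding T[OF that] set_lebesgue_integral_def
    by (rule Bochner_Integration.integral_cong) (auto simp: indicator_def)
  ultimately show ?thesis unfolding has_density_def by blast
qed

lemma rayI: "\<xi> \<in> A \<Longrightarrow> 0 \<le> t \<Longrightarrow> t *\<^sub>R \<xi> \<in> ray A"
  unfolding ray_def by blast

text \<open>
  The extension \<open>h\<close> of \<open>\<Psi>\<close> absorbs the multiplicity by homogeneity, and the right-hand side does not depend on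
  the representation.
\<close>

lemma represented_energy_eq:
  fixes T :: "'a::{finite,linorder} current"
  assumes rep: "represents k T M \<tau> \<Theta>" and F: "has_density k T F"
    and h[measurable]: "h \<in> borel_measurable borel" and h0: "h 0 = 0"
    and hom: "\<And>\<xi> t. \<xi> \<in> G0 k \<Longrightarrow> 0 < t \<Longrightarrow> h (t *\<^sub>R \<xi>) = t * \<Psi> \<xi>"
  shows "(LINT x:M|hausdorff_measure k. \<Theta> x * \<Psi> (\<tau> x)) = (LINT x|hausdorff_measure k. h (F x))"
proof -
  let ?H = "hausdorff_measure k :: ((real, 'a) vec) measure"
  let ?F0 = "\<lambda>x. indicator M x *\<^sub>R (\<Theta> x *\<^sub>R \<tau> x)"
  have D0: "has_density k T ?F0" by (rule represents_has_density[OF rep])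
  have \<tau>G: "\<And>x. x \<in> M \<Longrightarrow> \<tau> x \<in> G0 k" and \<Theta>: "\<And>x. x \<in> M \<Longrightarrow> 0 < \<Theta> x"
    using rep unfolding represents_def orientation_def by auto
  have "(LINT x:M|?H. \<Theta> x * \<Psi> (\<tau> x)) = (LINT x|?H. h (?F0 x))"
    unfolding set_lebesgue_integral_def using \<tau>G \<Theta> hom h0
    by (intro Bochner_Integration.integral_cong) (auto simp: indicator_def)
  also have "\<dots> = (LINT x|?H. h (F x))"
  proof (rule integral_cong_AE)
    have [measurable]: "?F0 \<in> borel_measurable borel" "F \<in> borel_measurable borel"
      using has_densityD(1)[OF D0] has_densityD(1)[OF F] by auto
    show "(\<lambda>x. h (?F0 x)) \<in> borel_measurable ?H" "(\<lambda>x. h (F x)) \<in> borel_measurable ?H" by measurable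
    show "AE x in ?H. h (?F0 x) = h (F x)"
      using has_density_unique[OF D0 F] by eventually_elim simp
  qed
  finally show ?thesis .
qed

lemma energy_eq:
  assumes rep: "represents k T M \<tau> \<Theta>" and F: "has_density k T F"
    and h: "h \<in> borel_measurable borel" "h 0 = 0" "\<And>\<xi> t. \<xi> \<in> G0 k \<Longrightarrow> 0 < t \<Longrightarrow> h (t *\<^sub>R \<xi>) = t * \<Psi> \<xi>"
  shows "energy k \<Psi> T = (LINT x|hausdorff_measure k. h (F x))"
  unfolding energy_def using represented_energy_eq[OF _ F h] rep by (intro the_equality) metis+

lemma mass_eq:
  assumes rep: "represents k T M \<tau> \<Theta>" and F: "has_density k T F"
  shows "mass k T = (LINT x|hausdorff_measure k. norm (F x))"
proof -
  have "(LINT x:M|hausdorff_measure k. \<Theta> x) = (LINT x|hausdorff_measure k. norm (F x))"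
    if "represents k T M \<tau> \<Theta>" for M \<tau> \<Theta>
    using represented_energy_eq[OF that F, of norm "\<lambda>_. 1"] by (simp add: G0_def)
  then show ?thesis unfolding mass_def using rep by (intro the_equality) metis+
qed

section \<open>Cells\<close>

definition cell :: "nat \<Rightarrow> (nat \<Rightarrow> real) set \<Rightarrow> real ^ 'n::{finite,linorder} \<Rightarrow> (nat \<Rightarrow> real ^ 'n::{finite,linorder}) \<Rightarrow> 'n current" where
  "cell k A x v = push_current k (aff k x v) A"

lemma cell_apply:
  "cell k A x v \<omega> = (if \<omega> \<in> smooth_forms k then LINT y:A|leb_Rk k. \<omega> (aff k x v y) \<bullet> wedge k v else 0)"
proof -
  have "aff k x v (unit_coord k j) - aff k x v (zero_coord k) = v j" if "j < k" for j
  proof -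
    have "(\<Sum>i<k. unit_coord k j i *\<^sub>R v i) = (\<Sum>i<k. if i = j then v i else 0)"
      by (rule sum.cong) (auto simp: unit_coord_def)
    then show ?thesis using that by (simp add: aff_def zero_coord_def)
  qed
  then have "wedge k (\<lambda>j. aff k x v (unit_coord k j) - aff k x v (zero_coord k)) = wedge k v"
    by (rule wedge_cong)
  then show ?thesis by (simp add: cell_def push_current_def)
qed

lemma cell_cong: "(\<And>j. j < k \<Longrightarrow> v j = w j) \<Longrightarrow> cell k A x v = cell k A x w"
  using wedge_cong[of k v w] by (auto simp: fun_eq_iff cell_apply aff_def)

lemma unit_cube_sets [measurable]: "unit_cube k \<in> sets (leb_Rk k)"
  unfolding unit_cube_def by (auto intro!: sets_PiM_I_finite)

lemma emeasure_unit_cube: "emeasure (leb_Rk k) (unit_cube k) = 1"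
  by (simp add: unit_cube_def emeasure_leb_Rk_box)

lemma measurable_leb_Rk_component: "j < k \<Longrightarrow> (\<lambda>y. y j) \<in> borel_measurable (leb_Rk k)"
  using measurable_component_singleton[of j "{..<k}" "\<lambda>_. lborel :: real measure"] by simp

lemma aff_unit_cube_bound:
  assumes "y \<in> unit_cube k"
  shows "norm (aff k x v y) \<le> norm x + (\<Sum>j<k. norm (v j))"
proof -
  have "norm (\<Sum>j<k. y j *\<^sub>R v j) \<le> (\<Sum>j<k. norm (v j))"
  proof (rule sum_norm_le)
    fix j assume "j \<in> {..<k}"
    then have "\<bar>y j\<bar> \<le> 1" using assms by (auto simp: unit_cube_def PiE_iff)
    then show "norm (y j *\<^sub>R v j) \<le> norm (v j)" by (simp add: mult_left_le_one_le)
  qed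
  then show ?thesis unfolding aff_def by (intro order_trans[OF norm_triangle_ineq]) simp
qed

lemma integrable_cell:
  fixes g :: "'a::euclidean_space \<Rightarrow> real"
  assumes g: "continuous_on UNIV g" and A: "A \<in> sets (leb_Rk k)" "A \<subseteq> unit_cube k"
  shows "set_integrable (leb_Rk k) A (\<lambda>y. g (aff k x v y))"
proof -
  define R where "R = norm x + (\<Sum>j<k. norm (v j))"
  have [measurable]: "g \<in> borel_measurable borel" using g by (rule borel_measurable_continuous_onI)
  have "compact (g ` cball 0 R)" by (intro compact_continuous_image continuous_on_subset[OF g]) auto
  then obtain C where "\<forall>y\<in>g ` cball 0 R. norm y \<le> C" using compact_imp_bounded bounded_iff by blast
  then have C: "\<bar>g (aff k x v y)\<bar> \<le> C" if "y \<in> A" for y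
    using aff_unit_cube_bound[of y k x v] A(2) that by (auto simp: R_def)
  have "emeasure (leb_Rk k) A \<le> emeasure (leb_Rk k) (unit_cube k)"
    using A by (intro emeasure_mono) auto
  then have fin: "emeasure (leb_Rk k) A < \<infinity>"
    unfolding emeasure_unit_cube by (metis ennreal_one_less_top infinity_ennreal_def order_le_less_trans)
  show ?thesis unfolding set_integrable_def
  proof (rule integrableI_bounded_set_indicator[where B=C])
    show "(\<lambda>y. g (aff k x v y)) \<in> borel_measurable (leb_Rk k)" by measurable
  qed (use A fin C in auto)
qed

text \<open>
  Inserting \<open>s\<close> as the coordinate \<open>j\<close>; the inverse operation on indices is \<open>skip j\<close>.
\<close>

definition ins :: "nat \<Rightarrow> nat \<Rightarrow> real \<Rightarrow> (nat \<Rightarrow> real) \<Rightarrow> nat \<Rightarrow> real" where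
  "ins k j s y = (\<lambda>i\<in>{..<Suc k}. if i < j then y i else if i = j then s else y (i - 1))"

lemma ins_same: "j < Suc k \<Longrightarrow> ins k j s y j = s"
  by (simp add: ins_def)

lemma ins_skip: "i < k \<Longrightarrow> ins k j s y (skip j i) = y i"
  by (auto simp: ins_def skip_def)

lemma bij_betw_skip: "j < Suc k \<Longrightarrow> bij_betw (skip j) {..<k} ({..<Suc k} - {j})"
proof (rule bij_betw_imageI)
  show "inj_on (skip j) {..<k}" by (auto simp: inj_on_def skip_def split: if_splits)
  assume j: "j < Suc k"
  show "skip j ` {..<k} = {..<Suc k} - {j}"
  proof (intro equalityI subsetI)
    fix i assume i: "i \<in> {..<Suc k} - {j}"
    then show "i \<in> skip j ` {..<k}"
      by (intro image_eqI[of _ _ "if i < j then i else i - 1"]) (use j in \<open>auto simp: skip_def\<close>)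
  qed (auto simp: skip_def)
qed

lemma aff_ins:
  assumes j: "j < Suc k"
  shows "aff (Suc k) x V (ins k j s y) = aff k x (V \<circ> skip j) y + s *\<^sub>R V j"
proof -
  have "(\<Sum>i<Suc k. ins k j s y i *\<^sub>R V i) = ins k j s y j *\<^sub>R V j + (\<Sum>i\<in>{..<Suc k} - {j}. ins k j s y i *\<^sub>R V i)"
    using j by (intro sum.remove) auto
  also have "(\<Sum>i\<in>{..<Suc k} - {j}. ins k j s y i *\<^sub>R V i) = (\<Sum>i<k. ins k j s y (skip j i) *\<^sub>R V (skip j i))"
    by (rule sum.reindex_bij_betw[OF bij_betw_skip[OF j], symmetric])
  also have "\<dots> = (\<Sum>i<k. y i *\<^sub>R (V \<circ> skip j) i)" by (intro sum.cong) (auto simp: ins_skip)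
  finally show ?thesis by (simp add: aff_def ins_same[OF j] del: sum.lessThan_Suc)
qed

text \<open>
  Fubini's theorem for the coordinate \<open>j\<close>.
\<close>

lemma distr_ins:
  assumes j: "j < Suc k"
  shows "(\<lambda>(y, s). ins k j s y) \<in> measurable (leb_Rk k \<Otimes>\<^sub>M lborel) (leb_Rk (Suc k))"
    and "distr (leb_Rk k \<Otimes>\<^sub>M lborel) (leb_Rk (Suc k)) (\<lambda>(y, s). ins k j s y) = leb_Rk (Suc k)"
proof -
  show m: "(\<lambda>(y, s). ins k j s y) \<in> measurable (leb_Rk k \<Otimes>\<^sub>M lborel) (leb_Rk (Suc k))"
    unfolding ins_def case_prod_beta
  proof (rule measurable_restrict)
    fix i assume i: "i \<in> {..<Suc k}"
    consider "i < j" | "i = j" | "j < i" by linarith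
    then show "(\<lambda>p. if i < j then fst p i else if i = j then snd p else fst p (i - 1))
        \<in> measurable (leb_Rk k \<Otimes>\<^sub>M lborel) lborel"
    proof cases
      case 1
      then show ?thesis using j measurable_compose[OF measurable_fst measurable_leb_Rk_component[of i k]] by simp
    next
      case 3
      then show ?thesis using i measurable_compose[OF measurable_fst measurable_leb_Rk_component[of "i - 1" k]] by simp
    qed simp
  qed
  show "distr (leb_Rk k \<Otimes>\<^sub>M lborel) (leb_Rk (Suc k)) (\<lambda>(y, s). ins k j s y) = leb_Rk (Suc k)" (is "?D = _")
  proof (rule lborels.PiM_eqI)
    fix A :: "nat \<Rightarrow> real set" assume A: "\<And>i. i \<in> {..<Suc k} \<Longrightarrow> A i \<in> sets lborel"
    have skA: "A (skip j i) \<in> sets lborel" if "i < k" for i using that A by (auto simp: skip_def)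
    have pre: "(\<lambda>(y, s). ins k j s y) -` PiE {..<Suc k} A \<inter> space (leb_Rk k \<Otimes>\<^sub>M lborel) =
       PiE {..<k} (\<lambda>i. A (skip j i)) \<times> A j"
    proof -
      have "ins k j s y \<in> PiE {..<Suc k} A \<longleftrightarrow> (\<forall>i<k. y i \<in> A (skip j i)) \<and> s \<in> A j" for y s
      proof -
        have "{..<Suc k} = insert j (skip j ` {..<k})"
          using bij_betw_skip[OF j] j by (auto simp: bij_betw_def)
        then have "ins k j s y \<in> PiE {..<Suc k} A \<longleftrightarrow> (\<forall>i\<in>insert j (skip j ` {..<k}). ins k j s y i \<in> A i)"
          by (simp add: PiE_iff) (simp add: ins_def)
        then show ?thesis using ins_same[OF j] ins_skip by auto
      qed
      then show ?thesis by (auto simp: space_pair_measure space_PiM PiE_iff)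
    qed
    interpret S: sigma_finite_measure "lborel :: real measure" by (rule sigma_finite_lborel)
    have "emeasure ?D (PiE {..<Suc k} A) = emeasure (leb_Rk k \<Otimes>\<^sub>M lborel) (PiE {..<k} (\<lambda>i. A (skip j i)) \<times> A j)"
      using m A by (subst emeasure_distr) (auto simp: pre intro!: sets_PiM_I_finite)
    also have "\<dots> = emeasure (leb_Rk k) (PiE {..<k} (\<lambda>i. A (skip j i))) * emeasure lborel (A j)"
      using A j skA by (intro sigma_finite_measure.emeasure_pair_measure_Times[OF sigma_finite_lborel] sets_PiM_I_finite) auto
    also have "\<dots> = (\<Prod>i<k. emeasure lborel (A (skip j i))) * emeasure lborel (A j)"
      using skA by (subst emeasure_leb_Rk_box) auto
    also have "(\<Prod>i<k. emeasure lborel (A (skip j i))) = (\<Prod>i\<in>{..<Suc k} - {j}. emeasure lborel (A i))"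
      by (rule prod.reindex_bij_betw[OF bij_betw_skip[OF j]])
    also have "\<dots> * emeasure lborel (A j) = (\<Prod>i<Suc k. emeasure lborel (A i))"
      using j by (subst (2) prod.remove[of _ j]) (auto simp: mult.commute)
    finally show "emeasure ?D (PiE {..<Suc k} A) = (\<Prod>i<Suc k. emeasure lborel (A i))" .
  qed auto
qed

lemma integral_leb_Rk_Suc:
  fixes f :: "(nat \<Rightarrow> real) \<Rightarrow> real"
  assumes j: "j < Suc k" and f: "integrable (leb_Rk (Suc k)) f"
  shows "(LINT y|leb_Rk (Suc k). f y) = (LINT y|leb_Rk k. LINT s|lborel. f (ins k j s y))"
proof -
  interpret L: sigma_finite_measure "leb_Rk k" by (rule sigma_finite_leb_Rk)
  interpret S: sigma_finite_measure "lborel :: real measure" by (rule sigma_finite_lborel)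
  interpret P: pair_sigma_finite "leb_Rk k" "lborel :: real measure" ..
  let ?i = "\<lambda>(y, s). ins k j s y"
  have fm: "f \<in> borel_measurable (leb_Rk (Suc k))" using f by auto
  have "integrable (distr (leb_Rk k \<Otimes>\<^sub>M lborel) (leb_Rk (Suc k)) ?i) f" unfolding distr_ins[OF j] by (rule f)
  then have int: "integrable (leb_Rk k \<Otimes>\<^sub>M lborel) (\<lambda>p. f (?i p))"
    using integrable_distr_eq[OF distr_ins(1)[OF j] fm] by simp
  have "(LINT y|leb_Rk (Suc k). f y) = (LINT y|(distr (leb_Rk k \<Otimes>\<^sub>M lborel) (leb_Rk (Suc k)) ?i). f y)"
    unfolding distr_ins(2)[OF j] ..
  also have "\<dots> = (LINT p|(leb_Rk k \<Otimes>\<^sub>M lborel). f (?i p))"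
    by (rule integral_distr[OF distr_ins(1)[OF j] fm])
  also have "\<dots> = (LINT y|leb_Rk k. LINT s|lborel. f (ins k j s y))"
    using P.integral_fst'[OF int] by simp
  finally show ?thesis .
qed

text \<open>The fundamental theorem of calculus in the \<open>j\<close>-th coordinate of a cell with interval fibres.\<close>

lemma cell_integral_derivative:
  fixes G :: "'a::euclidean_space \<Rightarrow> real"
  assumes j: "j < Suc k" and A: "A \<in> sets (leb_Rk (Suc k))" "A \<subseteq> unit_cube (Suc k)"
    and G: "\<And>p. (G has_derivative G' p) (at p)" and cont: "continuous_on UNIV (\<lambda>p. G' p (V j))"
    and fib: "\<And>y s. y \<in> space (leb_Rk k) \<Longrightarrow> ins k j s y \<in> A \<longleftrightarrow> y \<in> B \<and> lo y \<le> s \<and> s \<le> hi y"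
    and lohi: "\<And>y. y \<in> B \<Longrightarrow> lo y \<le> hi y"
  shows "(LINT y:A|leb_Rk (Suc k). G' (aff (Suc k) x V y) (V j)) =
    (LINT y:B|leb_Rk k. G (aff k x (V \<circ> skip j) y + hi y *\<^sub>R V j) - G (aff k x (V \<circ> skip j) y + lo y *\<^sub>R V j))"
proof -
  let ?f = "\<lambda>y. indicator A y *\<^sub>R G' (aff (Suc k) x V y) (V j)"
  have int: "integrable (leb_Rk (Suc k)) ?f"
    using integrable_cell[OF cont A] unfolding set_integrable_def .
  have "(LINT y:A|leb_Rk (Suc k). G' (aff (Suc k) x V y) (V j)) = (LINT y|leb_Rk (Suc k). ?f y)"
    by (simp add: set_lebesgue_integral_def)
  also have "\<dots> = (LINT y|leb_Rk k. LINT s|lborel. ?f (ins k j s y))"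
    by (rule integral_leb_Rk_Suc[OF j int])
  also have "\<dots> = (LINT y:B|leb_Rk k. G (aff k x (V \<circ> skip j) y + hi y *\<^sub>R V j) - G (aff k x (V \<circ> skip j) y + lo y *\<^sub>R V j))"
    unfolding set_lebesgue_integral_def
  proof (rule Bochner_Integration.integral_cong[OF refl])
    fix y assume y: "y \<in> space (leb_Rk k)"
    let ?p = "\<lambda>s. aff k x (V \<circ> skip j) y + s *\<^sub>R V j"
    show "(LINT s|lborel. ?f (ins k j s y)) = indicator B y *\<^sub>R (G (?p (hi y)) - G (?p (lo y)))"
    proof (cases "y \<in> B")
      case True
      have "(LINT s|lborel. ?f (ins k j s y)) = (LINT s|lborel. G' (?p s) (V j) * indicator {lo y..hi y} s)"
        using fib[OF y] True by (intro Bochner_Integration.integral_cong) (auto simp: aff_ins[OF j] indicator_def)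
      also have "\<dots> = G (?p (hi y)) - G (?p (lo y))"
      proof (rule integral_FTC_Icc_real[OF lohi[OF True]])
        fix s
        have "(?p has_derivative (\<lambda>h. h *\<^sub>R V j)) (at s)"
          using has_derivative_add[OF has_derivative_const has_derivative_scaleR_left[OF has_derivative_ident[of "at s"], of "V j"]]
          by simp
        from has_derivative_compose[OF this G]
        have "((\<lambda>s. G (?p s)) has_derivative (\<lambda>h. G' (?p s) (h *\<^sub>R V j))) (at s)" .
        moreover have "G' (?p s) (h *\<^sub>R V j) = G' (?p s) (V j) * h" for h
          using linear_scale[OF has_derivative_linear[OF G]] by (simp add: mult.commute)
        ultimately show "((\<lambda>s. G (?p s)) has_real_derivative G' (?p s) (V j)) (at s)"
          by (simp add: has_field_derivative_def)
        have "continuous_on UNIV (\<lambda>s. G' (?p s) (V j))"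
          by (rule continuous_on_compose2[OF cont]) (auto intro!: continuous_intros)
        then show "isCont (\<lambda>s. G' (?p s) (V j)) s" by (simp add: continuous_on_eq_continuous_at)
      qed
      finally show ?thesis using True by simp
    next
      case False
      then have "(\<lambda>s. ?f (ins k j s y)) = (\<lambda>s. 0)" using fib[OF y] by (auto simp: indicator_def)
      then show ?thesis using False by (simp only: integral_zero) simp
    qed
  qed
  finally show ?thesis .
qed

text \<open>
  The product of a triangle in the first two coordinates with a cube in the others.
\<close>

definition prism :: "nat \<Rightarrow> (nat \<Rightarrow> real) set" where
  "prism k = {y \<in> unit_cube k. y 1 \<le> y 0}"

lemma prism_sets: "2 \<le> k \<Longrightarrow> prism k \<in> sets (leb_Rk k)"
proof -
  assume k: "2 \<le> k"
  have [measurable]: "(\<lambda>y. y 0) \<in> borel_measurable (leb_Rk k)" "(\<lambda>y. y 1) \<in> borel_measurable (leb_Rk k)"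
    using k by (auto intro!: measurable_leb_Rk_component)
  have "prism k = unit_cube k \<inter> {y \<in> space (leb_Rk k). y 1 \<le> y 0}"
    using sets.sets_into_space[OF unit_cube_sets] by (auto simp: prism_def)
  also have "\<dots> \<in> sets (leb_Rk k)" by measurable
  finally show ?thesis .
qed

lemma prism_subset: "prism k \<subseteq> unit_cube k"
  by (auto simp: prism_def)

lemma ins_unit_cube:
  assumes j: "j < Suc k" and y: "y \<in> space (leb_Rk k)"
  shows "ins k j s y \<in> unit_cube (Suc k) \<longleftrightarrow> y \<in> unit_cube k \<and> 0 \<le> s \<and> s \<le> 1"
proof -
  have "{..<Suc k} = insert j (skip j ` {..<k})"
    using bij_betw_skip[OF j] j by (auto simp: bij_betw_def)
  then have "ins k j s y \<in> unit_cube (Suc k) \<longleftrightarrow> (\<forall>i\<in>insert j (skip j ` {..<k}). ins k j s y i \<in> {0..1})"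
    unfolding unit_cube_def PiE_iff by (simp add: ins_def)
  then show ?thesis using y ins_same[OF j, of s y] ins_skip[of _ k j s y]
    by (auto simp: unit_cube_def PiE_iff space_PiM)
qed

lemma ext_deriv_inner_wedge:
  fixes \<omega> :: "real ^ 'n::{finite,linorder} \<Rightarrow> real ^ ('n set)"
  assumes \<omega>: "\<omega> \<in> smooth_forms k"
  shows "ext_deriv \<omega> p \<bullet> wedge (Suc k) V =
    (\<Sum>j<Suc k. (-1)^j * (frechet_derivative \<omega> (at p) (V j) \<bullet> wedge k (V \<circ> skip j)))"
proof -
  have "ext_deriv \<omega> p = (\<chi> I. \<Sum>i\<in>I. (-1) ^ card {j\<in>I. j < i} * frechet_derivative \<omega> (at p) (axis i 1) $ (I - {i}))"
    by (simp add: vec_eq_iff ext_deriv_def)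
  then show ?thesis using contraction_formula[OF has_derivative_linear[OF smooth_formsD(4)[OF \<omega>]], of p k V] by simp
qed

lemma continuous_frechet_derivative:
  fixes \<omega> :: "real ^ 'n::{finite,linorder} \<Rightarrow> real ^ ('n set)"
  assumes \<omega>: "\<omega> \<in> smooth_forms k"
  shows "continuous_on UNIV (\<lambda>p. frechet_derivative \<omega> (at p) c)"
proof -
  have "frechet_derivative \<omega> (at p) c = (\<Sum>b\<in>Basis. (c \<bullet> b) *\<^sub>R frechet_derivative \<omega> (at p) b)" for p
  proof -
    have lin: "linear (frechet_derivative \<omega> (at p))" by (rule has_derivative_linear[OF smooth_formsD(4)[OF \<omega>]])
    have "frechet_derivative \<omega> (at p) c = frechet_derivative \<omega> (at p) (\<Sum>b\<in>Basis. (c \<bullet> b) *\<^sub>R b)"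
      by (simp only: euclidean_representation)
    then show ?thesis by (simp add: linear_sum[OF lin] linear_scale[OF lin])
  qed
  moreover have "continuous_on UNIV (\<lambda>p. \<Sum>b\<in>Basis. (c \<bullet> b) *\<^sub>R frechet_derivative \<omega> (at p) b)"
    by (intro continuous_on_sum continuous_on_scaleR continuous_on_const Cm_imp_continuous[OF smooth_formsD(5)[OF \<omega>, where m=0]])
  ultimately show ?thesis by simp
qed

text \<open>
  Stokes' theorem for a prism over a triangle: two of the faces are the cells spanned by \<open>V 1, V 2, \<dots>\<close>
  and \<open>V 0, V 2, \<dots>\<close>, the slanted face is spanned by \<open>V 0 + V 1, V 2, \<dots>\<close>, and the remaining faces
  come in pairs of translates.
\<close>

lemma prism_stokes:
  fixes \<omega> :: "real ^ 'n::{finite,linorder} \<Rightarrow> real ^ ('n set)" and V :: "nat \<Rightarrow> real ^ 'n::{finite,linorder}"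
  assumes k: "1 \<le> k" and \<omega>: "\<omega> \<in> smooth_forms k"
  shows "cell (Suc k) (prism (Suc k)) x V (ext_deriv \<omega>) =
    cell k (unit_cube k) (x + V 0) (V \<circ> skip 0) \<omega> + cell k (unit_cube k) x (V \<circ> skip 1) \<omega>
    - cell k (unit_cube k) x ((V \<circ> skip 0)(0 := V 0 + V 1)) \<omega>
    + (\<Sum>j\<in>{2..k}. (-1)^j * (cell k (prism k) (x + V j) (V \<circ> skip j) \<omega> - cell k (prism k) x (V \<circ> skip j) \<omega>))"
proof -
  let ?L = "leb_Rk (Suc k)"
  define P where "P = prism (Suc k)"
  have P: "P \<in> sets ?L" "P \<subseteq> unit_cube (Suc k)" using k by (auto simp: P_def prism_sets prism_subset)
  define G where "G = (\<lambda>j p. \<omega> p \<bullet> wedge k (V \<circ> skip j))"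
  define G' where "G' = (\<lambda>j p h. frechet_derivative \<omega> (at p) h \<bullet> wedge k (V \<circ> skip j))"
  have der: "(G j has_derivative G' j p) (at p)" for j p
    unfolding G_def G'_def
    by (rule bounded_linear.has_derivative[OF bounded_linear_inner_left smooth_formsD(4)[OF \<omega>]])
  have cont: "continuous_on UNIV (\<lambda>p. G' j p c)" for j c
    unfolding G'_def by (intro continuous_intros continuous_frechet_derivative[OF \<omega>])
  have contG: "continuous_on UNIV (G j)" for j
    unfolding G_def by (intro continuous_intros smooth_formsD(2)[OF \<omega>])
  have d\<omega>: "ext_deriv \<omega> \<in> smooth_forms (Suc k)" by (rule ext_deriv_smooth[OF \<omega>])
  define I where "I = (\<lambda>j. LINT y:P|?L. G' j (aff (Suc k) x V y) (V j))"
  have "cell (Suc k) (prism (Suc k)) x V (ext_deriv \<omega>) =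
      (LINT y:P|?L. (\<Sum>j<Suc k. (-1)^j * G' j (aff (Suc k) x V y) (V j)))"
    unfolding cell_apply G'_def ext_deriv_inner_wedge[OF \<omega>] P_def[symmetric] using d\<omega> by simp
  also have "\<dots> = (\<Sum>j<Suc k. (-1)^j * I j)"
  proof -
    have "set_integrable ?L P (\<lambda>y. (-1)^j * G' j (aff (Suc k) x V y) (V j))" for j
      by (intro set_integrable_mult_right integrable_cell[OF cont P])
    then have "(LINT y:P|?L. (\<Sum>j<Suc k. (-1)^j * G' j (aff (Suc k) x V y) (V j))) =
       (\<Sum>j<Suc k. LINT y:P|?L. (-1)^j * G' j (aff (Suc k) x V y) (V j))"
      unfolding set_lebesgue_integral_def set_integrable_def scaleR_sum_right
      by (rule Bochner_Integration.integral_sum)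
    then show ?thesis by (simp add: I_def del: sum.lessThan_Suc)
  qed
  also have "\<dots> = I 0 - I 1 + (\<Sum>j\<in>{2..k}. (-1)^j * I j)"
  proof -
    have "{..<Suc k} = insert 0 (insert 1 {2..k})" using k by auto
    then show ?thesis by (simp del: sum.lessThan_Suc)
  qed
  finally have main: "cell (Suc k) (prism (Suc k)) x V (ext_deriv \<omega>) = I 0 - I 1 + (\<Sum>j\<in>{2..k}. (-1)^j * I j)" .
  define W where "W = (V \<circ> skip 0)(0 := V 0 + V 1)"
  have W: "W = (V \<circ> skip 1)(0 := V 0 + V 1)" by (auto simp: W_def fun_eq_iff skip_def)
  have affW: "aff k x (v(0 := a + v 0)) y = aff k x v y + y 0 *\<^sub>R a" for v :: "nat \<Rightarrow> (real, 'n) vec" and a y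
  proof -
    have "{..<k} = insert 0 {1..<k}" using k by auto
    then show ?thesis by (simp add: aff_def algebra_simps)
  qed
  have affW0: "aff k x (V \<circ> skip 0) y + y 0 *\<^sub>R V 0 = aff k x W y" for y
    using affW[of "V \<circ> skip 0" "V 0" y] by (simp add: W_def skip_def)
  have affW1: "aff k x (V \<circ> skip 1) y + y 0 *\<^sub>R V 1 = aff k x W y" for y
    using affW[of "V \<circ> skip 1" "V 1" y] by (simp add: W skip_def add.commute)
  have k0: "0 < k" using k by simp
  have wW: "wedge k W = wedge k (V \<circ> skip 0) + wedge k (V \<circ> skip 1)"
  proof -
    have "wedge k W = wedge k ((V \<circ> skip 0)(0 := V 0)) + wedge k ((V \<circ> skip 0)(0 := V 1))"
      unfolding W_def by (rule wedge_add[OF k0])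
    also have "(V \<circ> skip 0)(0 := V 0) = V \<circ> skip 1" by (auto simp: fun_eq_iff skip_def)
    also have "(V \<circ> skip 0)(0 := V 1) = V \<circ> skip 0" by (auto simp: fun_eq_iff skip_def)
    finally show ?thesis by (simp only: add.commute)
  qed
  let ?C = "unit_cube k"
  have intC: "set_integrable (leb_Rk k) ?C (\<lambda>y. G j (aff k z v y))" for j z v
    by (rule integrable_cell[OF contG]) auto
  have aff_shift: "aff k x v y + c = aff k (x + c) v y" for v :: "nat \<Rightarrow> (real, 'n) vec" and c y
    by (simp add: aff_def)
  have c01: "0 \<le> y 0 \<and> y 0 \<le> 1" if "y \<in> ?C" for y
    using that k by (auto simp: unit_cube_def PiE_iff)
  have I0: "I 0 = (LINT y:?C|leb_Rk k. G 0 (aff k (x + V 0) (V \<circ> skip 0) y)) - (LINT y:?C|leb_Rk k. G 0 (aff k x W y))"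
  proof -
    have "I 0 = (LINT y:?C|leb_Rk k. G 0 (aff k x (V \<circ> skip 0) y + 1 *\<^sub>R V 0) - G 0 (aff k x (V \<circ> skip 0) y + y 0 *\<^sub>R V 0))"
      unfolding I_def
    proof (rule cell_integral_derivative[OF _ P der cont, where lo="\<lambda>y. y 0" and hi="\<lambda>_. 1"])
      fix y s assume y: "y \<in> space (leb_Rk k)"
      have "ins k 0 s y 0 = s" "ins k 0 s y 1 = y 0" using k by (auto simp: ins_def)
      then show "(ins k 0 s y \<in> P) = (y \<in> ?C \<and> y 0 \<le> s \<and> s \<le> 1)"
        unfolding P_def prism_def mem_Collect_eq ins_unit_cube[of 0 k y s, OF zero_less_Suc y]
        using c01[of y] by auto
    next
      fix y assume "y \<in> ?C"
      then show "y 0 \<le> 1" using c01 by blast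
    qed simp
    then show ?thesis unfolding affW0 unfolding aff_shift using intC by (simp add: set_integral_diff)
  qed
  have I1: "I 1 = (LINT y:?C|leb_Rk k. G 1 (aff k x W y)) - (LINT y:?C|leb_Rk k. G 1 (aff k x (V \<circ> skip 1) y))"
  proof -
    have "I 1 = (LINT y:?C|leb_Rk k. G 1 (aff k x (V \<circ> skip 1) y + y 0 *\<^sub>R V 1) - G 1 (aff k x (V \<circ> skip 1) y + 0 *\<^sub>R V 1))"
      unfolding I_def
    proof (rule cell_integral_derivative[OF _ P der cont, where lo="\<lambda>_. 0" and hi="\<lambda>y. y 0"])
      fix y s assume y: "y \<in> space (leb_Rk k)"
      have "ins k 1 s y 0 = y 0" "ins k 1 s y 1 = s" using k by (auto simp: ins_def)
      then show "(ins k 1 s y \<in> P) = (y \<in> ?C \<and> 0 \<le> s \<and> s \<le> y 0)"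
        unfolding P_def prism_def mem_Collect_eq using ins_unit_cube[of 1 k y s] y k c01[of y] by auto
    next
      fix y assume "y \<in> ?C"
      then show "0 \<le> y 0" using c01 by blast
    qed (use k in simp)
    then show ?thesis unfolding affW1 using intC by (simp add: set_integral_diff)
  qed
  have Ij: "I j = cell k (prism k) (x + V j) (V \<circ> skip j) \<omega> - cell k (prism k) x (V \<circ> skip j) \<omega>"
    if j: "j \<in> {2..k}" for j
  proof -
    have pr: "prism k \<in> sets (leb_Rk k)" using j by (intro prism_sets) auto
    have "I j = (LINT y:prism k|leb_Rk k. G j (aff k x (V \<circ> skip j) y + 1 *\<^sub>R V j) - G j (aff k x (V \<circ> skip j) y + 0 *\<^sub>R V j))"
      unfolding I_def
    proof (rule cell_integral_derivative[OF _ P der cont, where lo="\<lambda>_. 0" and hi="\<lambda>_. 1"])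
      fix y s assume y: "y \<in> space (leb_Rk k)"
      have "ins k j s y 0 = y 0" "ins k j s y 1 = y 1" using j by (auto simp: ins_def)
      then show "(ins k j s y \<in> P) = (y \<in> prism k \<and> 0 \<le> s \<and> s \<le> 1)"
        unfolding P_def prism_def using ins_unit_cube[of j k y s] y j by auto
    qed (use j in auto)
    moreover have "set_integrable (leb_Rk k) (prism k) (\<lambda>y. G j (aff k z v y))" for z v
      by (rule integrable_cell[OF contG pr prism_subset])
    ultimately have "I j = (LINT y:prism k|leb_Rk k. G j (aff k (x + V j) (V \<circ> skip j) y)) -
        (LINT y:prism k|leb_Rk k. G j (aff k x (V \<circ> skip j) y))"
      unfolding aff_shift by (simp add: set_integral_diff)
    then show ?thesis using \<omega> by (simp add: cell_apply G_def)
  qed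
  have "cell k ?C x W \<omega> = (LINT y:?C|leb_Rk k. G 0 (aff k x W y)) + (LINT y:?C|leb_Rk k. G 1 (aff k x W y))"
  proof -
    have "cell k ?C x W \<omega> = (LINT y:?C|leb_Rk k. G 0 (aff k x W y) + G 1 (aff k x W y))"
      using \<omega> by (simp add: cell_apply wW inner_add_right G_def)
    also have "\<dots> = (LINT y:?C|leb_Rk k. G 0 (aff k x W y)) + (LINT y:?C|leb_Rk k. G 1 (aff k x W y))"
      by (rule set_integral_add(2)[OF intC intC])
    finally show ?thesis .
  qed
  moreover have "cell k ?C (x + V 0) (V \<circ> skip 0) \<omega> = (LINT y:?C|leb_Rk k. G 0 (aff k (x + V 0) (V \<circ> skip 0) y))"
    "cell k ?C x (V \<circ> skip 1) \<omega> = (LINT y:?C|leb_Rk k. G 1 (aff k x (V \<circ> skip 1) y))"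
    using \<omega> by (simp_all add: cell_apply G_def)
  moreover have "(\<Sum>j\<in>{2..k}. (-1)^j * I j) =
      (\<Sum>j\<in>{2..k}. (-1)^j * (cell k (prism k) (x + V j) (V \<circ> skip j) \<omega> - cell k (prism k) x (V \<circ> skip j) \<omega>))"
    by (intro sum.cong refl) (simp only: Ij)
  ultimately show ?thesis unfolding main I0 I1 W_def[symmetric] by simp
qed

section \<open>Triangulation of cubes and prisms\<close>

lemma zero_polyhedral: "(\<lambda>\<omega>. 0) \<in> polyhedral_currents k"
  unfolding polyhedral_currents_def by (rule CollectI, rule exI[of _ 0]) auto

lemma polyhedral_scale:
  assumes "T \<in> polyhedral_currents k"
  shows "(\<lambda>\<omega>. c * T \<omega>) \<in> polyhedral_currents k"
proof -
  obtain N a v where T: "T = (\<lambda>\<omega>. \<Sum>i<N. a i * simplex_current k (v i) \<omega>)"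
    and v: "\<forall>i<(N::nat). inj_on (v i) {..k} \<and> \<not> affine_dependent (v i ` {..k})"
    using assms unfolding polyhedral_currents_def by auto
  then show ?thesis unfolding polyhedral_currents_def
    by (intro CollectI exI[of _ N] exI[of _ "\<lambda>i. c * a i"] exI[of _ v]) (auto simp: sum_distrib_left mult.assoc)
qed

lemma polyhedral_add:
  assumes "S \<in> polyhedral_currents k" "T \<in> polyhedral_currents k"
  shows "(\<lambda>\<omega>. S \<omega> + T \<omega>) \<in> polyhedral_currents k"
proof -
  obtain N a v where S: "S = (\<lambda>\<omega>. \<Sum>i<N. a i * simplex_current k (v i) \<omega>)"
    and v: "\<forall>i<(N::nat). inj_on (v i) {..k} \<and> \<not> affine_dependent (v i ` {..k})"
    using assms(1) unfolding polyhedral_currents_def by auto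
  obtain M b w where T: "T = (\<lambda>\<omega>. \<Sum>i<M. b i * simplex_current k (w i) \<omega>)"
    and w: "\<forall>i<(M::nat). inj_on (w i) {..k} \<and> \<not> affine_dependent (w i ` {..k})"
    using assms(2) unfolding polyhedral_currents_def by auto
  define c where "c = (\<lambda>i. if i < N then a i else b (i - N))"
  define u where "u = (\<lambda>i. if i < N then v i else w (i - N))"
  have "(\<Sum>i<N + M. c i * simplex_current k (u i) \<omega>) =
      (\<Sum>i<N. a i * simplex_current k (v i) \<omega>) + (\<Sum>i<M. b i * simplex_current k (w i) \<omega>)" for \<omega>
  proof -
    have "{..<N + M} = {..<N} \<union> {N..<N + M}" by auto
    then have "(\<Sum>i<N + M. c i * simplex_current k (u i) \<omega>) =
        (\<Sum>i<N. c i * simplex_current k (u i) \<omega>) + (\<Sum>i\<in>{N..<N + M}. c i * simplex_current k (u i) \<omega>)"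
      by (simp add: sum.union_disjoint ivl_disj_int)
    also have "(\<Sum>i\<in>{N..<N + M}. c i * simplex_current k (u i) \<omega>) = (\<Sum>i<M. c (i + N) * simplex_current k (u (i + N)) \<omega>)"
      using sum.shift_bounds_nat_ivl[of "\<lambda>i. c i * simplex_current k (u i) \<omega>" 0 N M]
      by (simp add: atLeast0LessThan add.commute)
    finally show ?thesis by (simp add: c_def u_def)
  qed
  then have "(\<lambda>\<omega>. S \<omega> + T \<omega>) = (\<lambda>\<omega>. \<Sum>i<N + M. c i * simplex_current k (u i) \<omega>)"
    unfolding S T by simp
  moreover have "\<forall>i<N + M. inj_on (u i) {..k} \<and> \<not> affine_dependent (u i ` {..k})"
    using v w by (auto simp: u_def)
  ultimately show ?thesis unfolding polyhedral_currents_def by blast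
qed

lemma polyhedral_sum:
  "(\<And>i. i \<in> I \<Longrightarrow> T i \<in> polyhedral_currents k) \<Longrightarrow> (\<lambda>\<omega>. \<Sum>i\<in>I. T i \<omega>) \<in> polyhedral_currents k"
  by (induction I rule: infinite_finite_induct) (auto simp: zero_polyhedral intro: polyhedral_add)

lemma cell_dependent: "\<not> indep_frame k v \<Longrightarrow> cell k A x v = (\<lambda>\<omega>. 0)"
  using wedge_eq_zero_iff[of k v] by (auto simp: cell_apply fun_eq_iff)

lemma std_simplex_cell_polyhedral: "cell k (std_simplex k) x v \<in> polyhedral_currents k"
proof (cases "indep_frame k v")
  case False
  then show ?thesis by (simp add: cell_dependent zero_polyhedral)
next
  case True
  define w where "w = (\<lambda>i. if i = 0 then x else x + v (i - 1))"
  have "aff k x v = (\<lambda>y. w 0 + (\<Sum>j<k. y j *\<^sub>R (w (Suc j) - w 0)))"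
    by (auto simp: aff_def w_def fun_eq_iff)
  then have c: "cell k (std_simplex k) x v = simplex_current k w"
    by (simp add: cell_def simplex_current_def)
  have ind: "inj_on v {..<k}" "independent (v ` {..<k})" using True by (auto simp: indep_frame_def)
  have nz: "v j \<noteq> 0" if "j < k" for j
    using ind(2) that dependent_zero[of "v ` {..<k}"] by (metis imageI lessThan_iff)
  have "inj_on w {..k}"
  proof (rule inj_onI)
    fix i j assume ij: "i \<in> {..k}" "j \<in> {..k}" "w i = w j"
    consider "i = 0" "j = 0" | "i = 0" "j > 0" | "i > 0" "j = 0" | "i > 0" "j > 0" by linarith
    then show "i = j"
    proof cases
      case 2
      then have "j - 1 < k" using ij by auto
      then show ?thesis using 2 ij nz[of "j - 1"] by (simp add: w_def)
    next
      case 3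
      then have "i - 1 < k" using ij by auto
      then show ?thesis using 3 ij nz[of "i - 1"] by (simp add: w_def)
    next
      case 4
      then have "v (i - 1) = v (j - 1)" using ij by (simp add: w_def)
      moreover have "i - 1 \<in> {..<k}" "j - 1 \<in> {..<k}" using 4 ij by auto
      ultimately have "i - 1 = j - 1" by (rule inj_onD[OF ind(1)])
      then show ?thesis using 4 by simp
    qed simp
  qed
  moreover have "\<not> affine_dependent (w ` {..k})"
  proof -
    have "{..k} = insert 0 (Suc ` {..<k})" using lessThan_Suc_eq_insert_0[of k] by (simp add: lessThan_Suc_atMost)
    moreover have "w 0 = x" "\<And>j. w (Suc j) = x + v j" by (simp_all add: w_def)
    ultimately have "w ` {..k} = insert x ((\<lambda>j. x + v j) ` {..<k})" by (simp only: image_insert image_image)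
    moreover have "x \<notin> (\<lambda>j. x + v j) ` {..<k}" using nz by auto
    moreover have "(\<lambda>p. - x + p) ` ((\<lambda>j. x + v j) ` {..<k}) = v ` {..<k}" by (simp add: image_image)
    ultimately show ?thesis using ind(2) by (simp add: affine_dependent_iff_dependent)
  qed
  ultimately show ?thesis unfolding c polyhedral_currents_def
    by (intro CollectI exI[of _ "1::nat"] exI[of _ "\<lambda>_. 1"] exI[of _ "\<lambda>_. w"]) auto
qed

lemma distr_pair_shear:
  fixes h :: "'a \<Rightarrow> real"
  assumes M: "sigma_finite_measure M" and h[measurable]: "h \<in> borel_measurable M"
  shows "distr (M \<Otimes>\<^sub>M lborel) (M \<Otimes>\<^sub>M lborel) (\<lambda>(y, s). (y, s + h y)) = M \<Otimes>\<^sub>M lborel"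
proof (rule measure_eqI)
  let ?P = "M \<Otimes>\<^sub>M (lborel :: real measure)"
  interpret S: sigma_finite_measure M by (rule M)
  have m: "(\<lambda>(y, s). (y, s + h y)) \<in> measurable ?P ?P" by measurable
  fix E assume "E \<in> sets (distr ?P ?P (\<lambda>(y, s). (y, s + h y)))"
  then have E: "E \<in> sets ?P" by simp
  let ?E' = "(\<lambda>(y, s). (y, s + h y)) -` E \<inter> space ?P"
  have E': "?E' \<in> sets ?P" using measurable_sets[OF m E] .
  have "emeasure (distr ?P ?P (\<lambda>(y, s). (y, s + h y))) E = emeasure ?P ?E'"
    using m E by (subst emeasure_distr) auto
  also have "\<dots> = (\<integral>\<^sup>+y. emeasure lborel (Pair y -` ?E') \<partial>M)"
    by (rule sigma_finite_measure.emeasure_pair_measure_alt[OF sigma_finite_lborel E'])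
  also have "\<dots> = (\<integral>\<^sup>+y. emeasure lborel (Pair y -` E) \<partial>M)"
  proof (rule nn_integral_cong)
    fix y assume y: "y \<in> space M"
    have Ey: "Pair y -` E \<in> sets lborel" using E by (rule sets_Pair1)
    have "Pair y -` ?E' = (\<lambda>s. h y + s) -` (Pair y -` E) \<inter> space lborel"
      using y by (auto simp: space_pair_measure add.commute)
    then have "emeasure lborel (Pair y -` ?E') = emeasure (distr lborel borel (\<lambda>s. h y + s)) (Pair y -` E)"
      using Ey by (subst emeasure_distr) auto
    then show "emeasure lborel (Pair y -` ?E') = emeasure lborel (Pair y -` E)" by (simp add: lborel_distr_plus)
  qed
  also have "\<dots> = emeasure ?P E"
    by (rule sigma_finite_measure.emeasure_pair_measure_alt[OF sigma_finite_lborel E, symmetric])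
  finally show "emeasure (distr ?P ?P (\<lambda>(y, s). (y, s + h y))) E = emeasure ?P E" .
qed simp

text \<open>
  A shear changes one coordinate by another one, which for fixed values of the others is a translation.
\<close>

lemma distr_leb_Rk_shear:
  assumes ij: "i \<noteq> j" "i < k" "j < k"
  shows "(\<lambda>y. \<lambda>l\<in>{..<k}. if l = j then y j + y i else y l) \<in> measurable (leb_Rk k) (leb_Rk k)"
    and "distr (leb_Rk k) (leb_Rk k) (\<lambda>y. \<lambda>l\<in>{..<k}. if l = j then y j + y i else y l) = leb_Rk k"
proof -
  let ?sh = "\<lambda>y. \<lambda>l\<in>{..<k}. if l = j then y j + y i else (y l :: real)"
  have [measurable]: "(\<lambda>y. y l) \<in> borel_measurable (leb_Rk k)" if "l < k" for l
    using that by (rule measurable_leb_Rk_component)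
  show m: "?sh \<in> measurable (leb_Rk k) (leb_Rk k)"
  proof (rule measurable_restrict)
    fix l assume "l \<in> {..<k}"
    then have "(\<lambda>y. if l = j then y j + y i else y l) \<in> borel_measurable (leb_Rk k)"
      using ij by (cases "l = j") auto
    then show "(\<lambda>y. if l = j then y j + y i else y l) \<in> measurable (leb_Rk k) lborel" by simp
  qed
  obtain k' where k': "k = Suc k'" using ij by (cases k) auto
  have j: "j < Suc k'" using ij k' by simp
  define i' where "i' = (if i < j then i else i - 1)"
  have i': "i' < k'" "skip j i' = i" using ij k' by (auto simp: i'_def skip_def)
  let ?P = "leb_Rk k' \<Otimes>\<^sub>M (lborel :: real measure)"
  let ?ins = "\<lambda>(y, s). ins k' j s y" and ?\<phi> = "\<lambda>(y :: nat \<Rightarrow> real, s). (y, s + y i')"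
  have hm: "(\<lambda>y. y i') \<in> borel_measurable (leb_Rk k')" using i'(1) by (rule measurable_leb_Rk_component)
  have \<phi>m: "?\<phi> \<in> measurable ?P ?P" using hm by measurable
  have d: "distr ?P ?P ?\<phi> = ?P" by (rule distr_pair_shear[OF sigma_finite_leb_Rk hm])
  have comp: "?sh (?ins p) = ?ins (?\<phi> p)" for p
  proof -
    have "ins k' j (snd p) (fst p) i = fst p i'" using ins_skip[OF i'(1), of j "snd p" "fst p"] i'(2) by simp
    moreover have "ins k' j (snd p) (fst p) j = snd p" by (rule ins_same[OF j])
    ultimately show ?thesis by (auto simp: case_prod_beta ins_def k' fun_eq_iff)
  qed
  have "distr (leb_Rk k) (leb_Rk k) ?sh = distr (distr ?P (leb_Rk k) ?ins) (leb_Rk k) ?sh"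
    using distr_ins(2)[OF j] by (simp add: k')
  also have "\<dots> = distr ?P (leb_Rk k) (?sh \<circ> ?ins)"
    using m distr_ins(1)[OF j] by (intro distr_distr) (auto simp: k')
  also have "?sh \<circ> ?ins = ?ins \<circ> ?\<phi>" using comp by (auto simp: fun_eq_iff)
  also have "distr ?P (leb_Rk k) (?ins \<circ> ?\<phi>) = distr (distr ?P ?P ?\<phi>) (leb_Rk k) ?ins"
    using \<phi>m distr_ins(1)[OF j] by (intro distr_distr[symmetric]) (auto simp: k')
  also have "\<dots> = leb_Rk k" unfolding d using distr_ins(2)[OF j] by (simp add: k')
  finally show "distr (leb_Rk k) (leb_Rk k) ?sh = leb_Rk k" .
qed

lemma cell_change_of_variables:
  fixes v w :: "nat \<Rightarrow> real ^ 'n::{finite,linorder}"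
  assumes t: "t \<in> measurable (leb_Rk k) (leb_Rk k)" "distr (leb_Rk k) (leb_Rk k) t = leb_Rk k"
    and A: "A \<in> sets (leb_Rk k)" and aff: "\<And>y. y \<in> space (leb_Rk k) \<Longrightarrow> aff k x v (t y) = aff k x w y"
    and wedge: "wedge k w = c *\<^sub>R wedge k v"
  shows "cell k {y \<in> space (leb_Rk k). t y \<in> A} x w = (\<lambda>\<omega>. c * cell k A x v \<omega>)"
proof
  fix \<omega>
  show "cell k {y \<in> space (leb_Rk k). t y \<in> A} x w \<omega> = c * cell k A x v \<omega>"
  proof (cases "\<omega> \<in> smooth_forms k")
    case True
    have [measurable]: "\<omega> \<in> borel_measurable borel"
      using smooth_formsD(2)[OF True] by (rule borel_measurable_continuous_onI)
    let ?f = "\<lambda>y. indicator A y *\<^sub>R (\<omega> (aff k x v y) \<bullet> wedge k v)"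
    have fm: "?f \<in> borel_measurable (leb_Rk k)" using A by measurable
    have "cell k A x v \<omega> = (LINT y|distr (leb_Rk k) (leb_Rk k) t. ?f y)"
      unfolding t(2) using True by (simp add: cell_apply set_lebesgue_integral_def)
    also have "\<dots> = (LINT y|leb_Rk k. ?f (t y))" by (rule integral_distr[OF t(1) fm])
    finally have "c * cell k A x v \<omega> = (LINT y|leb_Rk k. c * ?f (t y))" by simp
    also have "\<dots> = (LINT y|leb_Rk k. indicator {y \<in> space (leb_Rk k). t y \<in> A} y *\<^sub>R (\<omega> (aff k x w y) \<bullet> wedge k w))"
      using aff by (intro Bochner_Integration.integral_cong) (auto simp: wedge indicator_def)
    also have "\<dots> = cell k {y \<in> space (leb_Rk k). t y \<in> A} x w \<omega>"
      using True by (simp add: cell_apply set_lebesgue_integral_def)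
    finally show ?thesis ..
  qed (simp add: cell_apply)
qed

definition order_simplex :: "nat \<Rightarrow> (nat \<Rightarrow> real) set" where
  "order_simplex k = {y \<in> unit_cube k. \<forall>j. Suc j < k \<longrightarrow> y (Suc j) \<le> y j}"

text \<open>The shears \<open>y m := y m + y (Suc m)\<close>, applied from the last coordinate on, map the standard simplex onto the order simplex.\<close>

definition partial_order_simplex :: "nat \<Rightarrow> nat \<Rightarrow> (nat \<Rightarrow> real) set" where
  "partial_order_simplex k m = {y \<in> PiE {..<k} (\<lambda>_. {0..}). (\<forall>j. m \<le> j \<and> Suc j < k \<longrightarrow> y (Suc j) \<le> y j) \<and>
     (\<Sum>i<Suc m. y i) \<le> 1}"

lemma partial_order_simplex_sets:
  assumes "m < k"
  shows "partial_order_simplex k m \<in> sets (leb_Rk k)"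
proof -
  have [measurable]: "(\<lambda>y. y l) \<in> borel_measurable (leb_Rk k)" if "l < k" for l
    using that by (rule measurable_leb_Rk_component)
  have 1: "{y \<in> space (leb_Rk k). Suc j < k \<longrightarrow> y (Suc j) \<le> y j} \<in> sets (leb_Rk k)" for j
    by (cases "Suc j < k") auto
  have 2: "{y \<in> space (leb_Rk k). (\<Sum>i<Suc m. y i) \<le> 1} \<in> sets (leb_Rk k)"
  proof -
    have [measurable]: "(\<lambda>y. \<Sum>i<Suc m. y i) \<in> borel_measurable (leb_Rk k)"
      using assms by (intro borel_measurable_sum measurable_leb_Rk_component) auto
    show ?thesis by measurable
  qed
  have "partial_order_simplex k m = PiE {..<k} (\<lambda>_. {0..}) \<inter>
     {y \<in> space (leb_Rk k). (\<Sum>i<Suc m. y i) \<le> 1} \<inter>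
     (\<Inter>j\<in>{m..m + k}. {y \<in> space (leb_Rk k). Suc j < k \<longrightarrow> y (Suc j) \<le> y j})"
    (is "_ = ?B \<inter> ?C \<inter> ?D")
  proof (rule set_eqI)
    fix y
    have sp: "y \<in> ?B \<Longrightarrow> y \<in> space (leb_Rk k)" by (simp add: space_PiM PiE_iff)
    have b: "(\<forall>j. m \<le> j \<and> Suc j < k \<longrightarrow> y (Suc j) \<le> y j) \<longleftrightarrow> (\<forall>j\<in>{m..m + k}. Suc j < k \<longrightarrow> y (Suc j) \<le> y j)"
      by auto
    show "y \<in> partial_order_simplex k m \<longleftrightarrow> y \<in> ?B \<inter> ?C \<inter> ?D"
    proof (cases "y \<in> ?B")
      case True
      have C: "y \<in> ?C \<longleftrightarrow> (\<Sum>i<Suc m. y i) \<le> 1" using sp[OF True] by simp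
      have D: "y \<in> ?D \<longleftrightarrow> (\<forall>j\<in>{m..m + k}. Suc j < k \<longrightarrow> y (Suc j) \<le> y j)" using sp[OF True] by simp
      show ?thesis unfolding Int_iff C D unfolding partial_order_simplex_def mem_Collect_eq b
        by (simp only: conj_ac)
    next
      case False
      then show ?thesis unfolding partial_order_simplex_def by simp
    qed
  qed
  also have "\<dots> \<in> sets (leb_Rk k)"
  proof (intro sets.Int)
    show "?B \<in> sets (leb_Rk k)" by (rule sets_PiM_I_finite) auto
    show "?C \<in> sets (leb_Rk k)" by (rule 2)
    show "?D \<in> sets (leb_Rk k)"
    proof (rule sets.finite_INT)
      show "{y \<in> space (leb_Rk k). Suc j < k \<longrightarrow> y (Suc j) \<le> y j} \<in> sets (leb_Rk k)" for j by (rule 1)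
    qed auto
  qed
  finally show ?thesis .
qed

text \<open>
  Downward from \<open>m = k - 1\<close>, the standard simplex, to \<open>m = 0\<close>, the order simplex: each step is one shear of the
  coordinates, compensated by a shear of the frame.
\<close>

lemma partial_order_simplex_polyhedral:
  fixes v :: "nat \<Rightarrow> real ^ 'n::{finite,linorder}"
  assumes "m < k"
  shows "cell k (partial_order_simplex k m) x v \<in> polyhedral_currents k"
  using assms
proof (induction "k - 1 - m" arbitrary: m v)
  case 0
  then have m: "Suc m = k" by simp
  have "partial_order_simplex k m = std_simplex k"
  proof (rule set_eqI)
    fix y :: "nat \<Rightarrow> real"
    have "\<forall>j. m \<le> j \<and> Suc j < k \<longrightarrow> y (Suc j) \<le> y j" using m by linarith
    then show "y \<in> partial_order_simplex k m \<longleftrightarrow> y \<in> std_simplex k"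
      unfolding partial_order_simplex_def std_simplex_def m by blast
  qed
  then show ?case by (simp add: std_simplex_cell_polyhedral)
next
  case (Suc d)
  then have m: "Suc m < k" by simp
  let ?sh = "\<lambda>y. \<lambda>l\<in>{..<k}. if l = m then y m + y (Suc m) else (y l :: real)"
  let ?w = "v(Suc m := v (Suc m) + v m)"
  have sh: "?sh \<in> measurable (leb_Rk k) (leb_Rk k)" "distr (leb_Rk k) (leb_Rk k) ?sh = leb_Rk k"
    using distr_leb_Rk_shear[of "Suc m" m k] m by auto
  have "cell k {y \<in> space (leb_Rk k). ?sh y \<in> partial_order_simplex k m} x ?w =
      (\<lambda>\<omega>. 1 * cell k (partial_order_simplex k m) x v \<omega>)"
  proof (rule cell_change_of_variables[OF sh])
    show "partial_order_simplex k m \<in> sets (leb_Rk k)" using m by (intro partial_order_simplex_sets) simp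
    show "wedge k ?w = 1 *\<^sub>R wedge k v" using m by (simp add: wedge_shear)
    fix y :: "nat \<Rightarrow> real"
    let ?R = "{..<k} - {m} - {Suc m}"
    have split: "(\<Sum>l<k. f l) = f m + (f (Suc m) + (\<Sum>l\<in>?R. f l))" for f :: "nat \<Rightarrow> (real, 'n) vec"
      using m by (simp add: sum.remove[of "{..<k}" m] sum.remove[of "{..<k} - {m}" "Suc m"])
    have "(\<Sum>l\<in>?R. ?sh y l *\<^sub>R v l) = (\<Sum>l\<in>?R. y l *\<^sub>R ?w l)" by (rule sum.cong) auto
    then show "aff k x v (?sh y) = aff k x ?w y" using m
      unfolding aff_def split by (simp add: algebra_simps)
  qed
  moreover have "{y \<in> space (leb_Rk k). ?sh y \<in> partial_order_simplex k m} = partial_order_simplex k (Suc m)"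
  proof (rule set_eqI)
    fix y
    have *: "(\<forall>l<k. 0 \<le> ?sh y l) \<and> (\<forall>j. m \<le> j \<and> Suc j < k \<longrightarrow> ?sh y (Suc j) \<le> ?sh y j) \<longleftrightarrow>
        (\<forall>l<k. 0 \<le> y l) \<and> (\<forall>j. Suc m \<le> j \<and> Suc j < k \<longrightarrow> y (Suc j) \<le> y j)" (is "?l \<longleftrightarrow> ?r")
    proof
      assume l: ?l
      have a: "0 \<le> y l" if "l < k" for l
      proof (cases "l = m")
        case True
        have "?sh y (Suc m) \<le> ?sh y m" using l m by blast
        then show ?thesis using True m by simp
      next
        case False then show ?thesis using l that by auto
      qed
      have "y (Suc j) \<le> y j" if "Suc m \<le> j" "Suc j < k" for j
      proof -
        have "?sh y (Suc j) \<le> ?sh y j"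
          by (rule l[THEN conjunct2, rule_format]) (use that in auto)
        then show ?thesis using that by simp
      qed
      with a show ?r by blast
    next
      assume r: ?r
      have "0 \<le> ?sh y l" if "l < k" for l using r that m by simp
      moreover have "?sh y (Suc j) \<le> ?sh y j" if "m \<le> j" "Suc j < k" for j
        using r that m by (cases "j = m") auto
      ultimately show ?l by blast
    qed
    have "(\<Sum>i<Suc m. ?sh y i) = (\<Sum>i<m. y i) + (y m + y (Suc m))"
      using m by (simp add: sum.lessThan_Suc)
    then have "(\<Sum>i<Suc m. ?sh y i) = (\<Sum>i<Suc (Suc m). y i)" by simp
    note S = this
    have A: "?sh y \<in> PiE {..<k} (\<lambda>_. {0..}) \<longleftrightarrow> (\<forall>l<k. 0 \<le> ?sh y l)" unfolding PiE_iff by auto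
    have B: "y \<in> space (leb_Rk k) \<longleftrightarrow> y \<in> extensional {..<k}" by (simp add: space_PiM PiE_iff)
    have C: "y \<in> PiE {..<k} (\<lambda>_. {0..}) \<longleftrightarrow> (\<forall>l<k. 0 \<le> y l) \<and> y \<in> extensional {..<k}"
      unfolding PiE_iff by auto
    have rearr: "(e \<and> (a \<and> b \<and> c)) = ((a' \<and> e) \<and> b' \<and> c)" if "(a \<and> b) = (a' \<and> b')" for a b a' b' c e
      using that by blast
    show "y \<in> {y \<in> space (leb_Rk k). ?sh y \<in> partial_order_simplex k m} \<longleftrightarrow> y \<in> partial_order_simplex k (Suc m)"
      unfolding partial_order_simplex_def mem_Collect_eq A B C S by (rule rearr[OF *])
  qed
  ultimately have "cell k (partial_order_simplex k m) x v = cell k (partial_order_simplex k (Suc m)) x ?w"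
    by (auto simp: fun_eq_iff)
  then show ?case using Suc.hyps(1)[of "Suc m" ?w] Suc.hyps(2) m by simp
qed

lemma order_simplex_polyhedral: "cell k (order_simplex k) x v \<in> polyhedral_currents k"
proof (cases "k = 0")
  case True
  then have "order_simplex k = std_simplex k"
    by (auto simp: order_simplex_def std_simplex_def unit_cube_def)
  then show ?thesis by (simp add: std_simplex_cell_polyhedral)
next
  case False
  have "order_simplex k = partial_order_simplex k 0"
  proof (intro equalityI subsetI)
    fix y assume y: "y \<in> partial_order_simplex k 0"
    have "y l \<le> y 0" if "l < k" for l using that
    proof (induction l)
      case (Suc l)
      then show ?case using y by (auto simp: partial_order_simplex_def intro: order_trans[of _ "y l"])
    qed simp
    then have "y l \<le> 1" if "l < k" for l using that y by (force simp: partial_order_simplex_def)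
    then show "y \<in> order_simplex k" using y by (auto simp: partial_order_simplex_def order_simplex_def unit_cube_def PiE_iff)
  qed (use False in \<open>auto simp: partial_order_simplex_def order_simplex_def unit_cube_def PiE_iff\<close>)
  then show ?thesis using partial_order_simplex_polyhedral[of 0 k] False by simp
qed

lemma order_simplex_sets: "order_simplex k \<in> sets (leb_Rk k)"
proof -
  have [measurable]: "(\<lambda>y. y l) \<in> borel_measurable (leb_Rk k)" if "l < k" for l
    using that by (rule measurable_leb_Rk_component)
  have 1: "{y \<in> space (leb_Rk k). Suc j < k \<longrightarrow> y (Suc j) \<le> y j} \<in> sets (leb_Rk k)" for j
    by (cases "Suc j < k") auto
  have "order_simplex k = unit_cube k \<inter> (\<Inter>j\<in>{..k}. {y \<in> space (leb_Rk k). Suc j < k \<longrightarrow> y (Suc j) \<le> y j})"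
    using sets.sets_into_space[OF unit_cube_sets[of k]] by (auto simp: order_simplex_def)
  also have "\<dots> \<in> sets (leb_Rk k)" 
  proof (rule sets.Int[OF unit_cube_sets])
    show "(\<Inter>j\<in>{..k}. {y \<in> space (leb_Rk k). Suc j < k \<longrightarrow> y (Suc j) \<le> y j}) \<in> sets (leb_Rk k)"
    proof (rule sets.finite_INT)
      show "{y \<in> space (leb_Rk k). Suc j < k \<longrightarrow> y (Suc j) \<le> y j} \<in> sets (leb_Rk k)" for j by (rule 1)
    qed auto
  qed
  finally show ?thesis .
qed

text \<open>
  Along the coordinate \<open>j\<close> the set has at most one point on every line.
\<close>

lemma hyperplane_null:
  assumes j: "j < k" "b j \<noteq> 0"
  shows "{y \<in> space (leb_Rk k). (\<Sum>i<k. b i * y i) = c} \<in> null_sets (leb_Rk k)"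
proof -
  obtain k' where k': "k = Suc k'" using j by (cases k) auto
  have j': "j < Suc k'" using j k' by simp
  let ?H = "{y \<in> space (leb_Rk k). (\<Sum>i<k. b i * y i) = c}"
  let ?P = "leb_Rk k' \<Otimes>\<^sub>M (lborel :: real measure)" and ?ins = "\<lambda>(y, s). ins k' j s y"
  have [measurable]: "(\<lambda>y. \<Sum>i<k. b i * y i) \<in> borel_measurable (leb_Rk k)"
    by (intro borel_measurable_sum borel_measurable_times measurable_leb_Rk_component) auto
  have H: "?H \<in> sets (leb_Rk k)" by measurable
  let ?E = "?ins -` ?H \<inter> space ?P"
  have im: "?ins \<in> measurable ?P (leb_Rk k)" using distr_ins(1)[OF j'] by (simp add: k')
  have E: "?E \<in> sets ?P" using measurable_sets[OF im H] .
  have "emeasure (leb_Rk k) ?H = emeasure (distr ?P (leb_Rk k) ?ins) ?H" using distr_ins(2)[OF j'] by (simp add: k')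
  also have "\<dots> = emeasure ?P ?E" by (rule emeasure_distr[OF im H])
  also have "\<dots> = (\<integral>\<^sup>+y. emeasure lborel (Pair y -` ?E) \<partial>leb_Rk k')"
    by (rule sigma_finite_measure.emeasure_pair_measure_alt[OF sigma_finite_lborel E])
  also have "\<dots> = (\<integral>\<^sup>+y. 0 \<partial>leb_Rk k')"
  proof (rule nn_integral_cong)
    fix y
    define r where "r = (\<Sum>i<k'. b (skip j i) * y i)"
    have "(\<Sum>i<k. b i * ins k' j s y i) = b j * s + r" for s
    proof -
      have "(\<Sum>i<k. b i * ins k' j s y i) = b j * ins k' j s y j + (\<Sum>i\<in>{..<Suc k'} - {j}. b i * ins k' j s y i)"
        unfolding k' using j' by (intro sum.remove) auto
      also have "(\<Sum>i\<in>{..<Suc k'} - {j}. b i * ins k' j s y i) = (\<Sum>i<k'. b (skip j i) * ins k' j s y (skip j i))"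
        by (rule sum.reindex_bij_betw[OF bij_betw_skip[OF j'], symmetric])
      finally show ?thesis by (simp add: ins_same[OF j'] ins_skip r_def)
    qed
    then have "Pair y -` ?E \<subseteq> {(c - r) / b j}" using j(2) by (auto simp: field_simps)
    then have "emeasure lborel (Pair y -` ?E) \<le> emeasure lborel {(c - r) / b j}" by (intro emeasure_mono) auto
    then show "emeasure lborel (Pair y -` ?E) = 0" by simp
  qed
  finally show ?thesis using H by (auto simp: null_sets_def)
qed

lemma AE_leb_Rk_inj: "AE y in leb_Rk k. inj_on y {..<k}"
proof -
  have 1: "AE y in leb_Rk k. y i \<noteq> y j" if ij: "i < k" "j < k" "i \<noteq> j" for i j
  proof -
    define b where "b = (\<lambda>l. if l = i then 1 else if l = j then - 1 else (0::real))"
    have "(\<Sum>l<k. b l * y l) = y i - y j" for y :: "nat \<Rightarrow> real"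
    proof -
      have "(\<Sum>l<k. b l * y l) = (\<Sum>l\<in>{i, j}. b l * y l)"
        using ij by (intro sum.mono_neutral_right) (auto simp: b_def)
      then show ?thesis using ij by (simp add: b_def)
    qed
    then have "{y \<in> space (leb_Rk k). y i - y j = 0} \<in> null_sets (leb_Rk k)"
      using hyperplane_null[of i k b 0] ij by (simp add: b_def)
    then show ?thesis by (rule AE_I') auto
  qed
  have "AE y in leb_Rk k. \<forall>i\<in>{..<k}. \<forall>j\<in>{..<k}. i \<noteq> j \<longrightarrow> y i \<noteq> y j"
  proof (intro AE_finite_allI)
    fix i j assume "i \<in> {..<k}" "j \<in> {..<k}"
    then show "AE y in leb_Rk k. i \<noteq> j \<longrightarrow> y i \<noteq> y j" using 1[of i j] by (cases "i = j") auto
  qed auto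
  then show ?thesis by eventually_elim (auto simp: inj_on_def)
qed

definition permuted_simplex :: "nat \<Rightarrow> (nat \<Rightarrow> nat) \<Rightarrow> (nat \<Rightarrow> real) set" where
  "permuted_simplex k \<pi> = {y \<in> space (leb_Rk k). (\<lambda>j\<in>{..<k}. y (\<pi> j)) \<in> order_simplex k}"

lemma permuted_simplex_sets:
  assumes "\<pi> permutes {..<k}"
  shows "permuted_simplex k \<pi> \<in> sets (leb_Rk k)"
proof -
  have "(\<lambda>y. \<lambda>i\<in>{..<k}. y (\<pi> i)) \<in> measurable (leb_Rk k) (leb_Rk k)"
    using distr_leb_Rk_coordinatewise(2)[of k "\<lambda>_ y. y" \<pi>] assms by (simp add: distr_id2)
  from measurable_sets[OF this order_simplex_sets]
  show ?thesis by (simp add: permuted_simplex_def vimage_def Int_def conj_commute)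
qed

lemma permuted_simplex_polyhedral:
  fixes v :: "nat \<Rightarrow> real ^ 'n::{finite,linorder}"
  assumes p: "\<pi> permutes {..<k}"
  shows "cell k (permuted_simplex k \<pi>) x v \<in> polyhedral_currents k"
proof -
  let ?t = "\<lambda>y. \<lambda>i\<in>{..<k}. (y (\<pi> i) :: real)"
  have t: "?t \<in> measurable (leb_Rk k) (leb_Rk k)" "distr (leb_Rk k) (leb_Rk k) ?t = leb_Rk k"
    using distr_leb_Rk_coordinatewise[of k "\<lambda>_ y. y" \<pi>] p by (simp_all add: distr_id2)
  have "cell k {y \<in> space (leb_Rk k). ?t y \<in> order_simplex k} x v =
      (\<lambda>\<omega>. of_int (sign \<pi>) * cell k (order_simplex k) x (v \<circ> \<pi>) \<omega>)"
  proof (rule cell_change_of_variables[OF t order_simplex_sets])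
    show "wedge k v = of_int (sign \<pi>) *\<^sub>R wedge k (v \<circ> \<pi>)"
      by (simp add: wedge_permute[OF p] sign_def)
    show "aff k x (v \<circ> \<pi>) (?t y) = aff k x v y" for y
      using sum.permute[OF p, of "\<lambda>j. y j *\<^sub>R v j"] by (simp add: aff_def comp_def)
  qed
  then show ?thesis unfolding permuted_simplex_def by (simp add: polyhedral_scale order_simplex_polyhedral)
qed

lemma mem_permuted_simplex:
  assumes p: "\<pi> permutes {..<k}"
  shows "y \<in> permuted_simplex k \<pi> \<longleftrightarrow> y \<in> unit_cube k \<and> (\<forall>j. Suc j < k \<longrightarrow> y (\<pi> (Suc j)) \<le> y (\<pi> j))"
proof -
  have "(\<forall>j<k. y (\<pi> j) \<in> {0..1}) \<longleftrightarrow> (\<forall>j<k. y j \<in> {0..1})"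
  proof -
    have "(\<forall>j\<in>{..<k}. y (\<pi> j) \<in> {0..1}) \<longleftrightarrow> (\<forall>j\<in>\<pi> ` {..<k}. y j \<in> {0..1})" by blast
    then show ?thesis unfolding permutes_image[OF p] by (simp only: Ball_def lessThan_iff)
  qed
  then show ?thesis
    unfolding permuted_simplex_def order_simplex_def unit_cube_def by (auto simp: PiE_iff space_PiM)
qed

lemma sorting_permutation_exists:
  fixes y :: "nat \<Rightarrow> real"
  shows "\<exists>\<pi>. \<pi> permutes {..<k} \<and> (\<forall>j. Suc j < k \<longrightarrow> y (\<pi> (Suc j)) \<le> y (\<pi> j))"
proof -
  define xs where "xs = sort_key (\<lambda>i. - y i) [0..<k]"
  have xs: "distinct xs" "set xs = {..<k}" "length xs = k" "sorted (map (\<lambda>i. - y i) xs)"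
    by (auto simp: xs_def)
  define \<pi> where "\<pi> = (\<lambda>j. if j < k then xs ! j else j)"
  have "bij_betw (\<lambda>j. xs ! j) {..<k} {..<k}" using xs by (intro bij_betw_nth) auto
  then have "bij_betw \<pi> {..<k} {..<k}" by (rule bij_betw_cong[THEN iffD1, rotated]) (simp add: \<pi>_def)
  then have "\<pi> permutes {..<k}" by (rule bij_imp_permutes) (simp add: \<pi>_def)
  moreover have "y (\<pi> (Suc j)) \<le> y (\<pi> j)" if "Suc j < k" for j
    using sorted_nth_mono[OF xs(4), of j "Suc j"] that xs(3) by (simp add: \<pi>_def)
  ultimately show ?thesis by blast
qed

lemma sorting_permutation_unique:
  fixes y :: "nat \<Rightarrow> real"
  assumes y: "inj_on y {..<k}" and p: "\<pi> permutes {..<k}" "\<rho> permutes {..<k}"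
    and s: "\<And>j. Suc j < k \<Longrightarrow> y (\<pi> (Suc j)) \<le> y (\<pi> j)" "\<And>j. Suc j < k \<Longrightarrow> y (\<rho> (Suc j)) \<le> y (\<rho> j)"
  shows "\<pi> = \<rho>"
proof -
  have srt: "sorted (map (\<lambda>j. - y (\<sigma> j)) [0..<k])" if "\<And>j. Suc j < k \<Longrightarrow> y (\<sigma> (Suc j)) \<le> y (\<sigma> j)" for \<sigma>
    unfolding sorted_iff_nth_Suc using that by simp
  have dst: "distinct (map (\<lambda>j. - y (\<sigma> j)) [0..<k])" if "\<sigma> permutes {..<k}" for \<sigma>
  proof -
    have "inj_on (y \<circ> \<sigma>) {..<k}" using that y permutes_inj_on[OF that] permutes_image[OF that] by (intro comp_inj_on) auto
    then show ?thesis by (auto simp: distinct_map inj_on_def)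
  qed
  have set: "set (map (\<lambda>j. - y (\<sigma> j)) [0..<k]) = (\<lambda>i. - y i) ` {..<k}" if "\<sigma> permutes {..<k}" for \<sigma>
  proof -
    have "set (map (\<lambda>j. - y (\<sigma> j)) [0..<k]) = (\<lambda>i. - y i) ` (\<sigma> ` {..<k})" by (auto simp: image_image atLeast0LessThan)
    then show ?thesis by (simp only: permutes_image[OF that])
  qed
  have eq: "map (\<lambda>j. - y (\<pi> j)) [0..<k] = map (\<lambda>j. - y (\<rho> j)) [0..<k]"
    by (rule sorted_distinct_set_unique) (use srt[of \<pi>, OF s(1)] srt[of \<rho>, OF s(2)] dst p set in auto)
  show ?thesis
  proof
    fix j show "\<pi> j = \<rho> j"
    proof (cases "j < k")
      case True
      then have "y (\<pi> j) = y (\<rho> j)" using eq by simp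
      then show ?thesis using y permutes_in_image[OF p(1), of j] permutes_in_image[OF p(2), of j] True
        by (auto dest: inj_onD)
    next
      case False then show ?thesis using p by (simp add: permutes_def)
    qed
  qed
qed

lemma indicator_cube_sum:
  fixes y :: "nat \<Rightarrow> real"
  assumes y: "inj_on y {..<k}" and Q: "A \<subseteq> unit_cube k"
    and A: "\<And>\<pi>. \<pi> permutes {..<k} \<Longrightarrow> y \<in> permuted_simplex k \<pi> \<Longrightarrow> y \<in> A \<longleftrightarrow> \<pi> \<in> Ps"
  shows "indicator A y = (\<Sum>\<pi> | \<pi> permutes {..<k} \<and> \<pi> \<in> Ps. indicator (permuted_simplex k \<pi>) y :: real)"
proof (cases "y \<in> unit_cube k")
  case False
  then show ?thesis using Q mem_permuted_simplex[of _ k y] by (auto simp: indicator_def intro!: sum.neutral[symmetric])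
next
  case True
  obtain \<pi> where p: "\<pi> permutes {..<k}" "\<And>j. Suc j < k \<Longrightarrow> y (\<pi> (Suc j)) \<le> y (\<pi> j)"
    using sorting_permutation_exists by blast
  have mem: "y \<in> permuted_simplex k \<rho> \<longleftrightarrow> \<rho> = \<pi>" if "\<rho> permutes {..<k}" for \<rho>
    using mem_permuted_simplex[OF that, of y] True sorting_permutation_unique[OF y that p(1)] p(2) by blast
  have "(\<Sum>\<rho> | \<rho> permutes {..<k} \<and> \<rho> \<in> Ps. indicator (permuted_simplex k \<rho>) y :: real) =
      (\<Sum>\<rho> | \<rho> permutes {..<k} \<and> \<rho> \<in> Ps. if \<rho> = \<pi> then 1 else 0)"
    using mem by (intro sum.cong) (auto simp: indicator_def)
  also have "\<dots> = (if \<pi> \<in> Ps then 1 else 0)"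
    using p(1) by (subst sum.delta) (auto simp: finite_permutations)
  also have "\<dots> = indicator A y" using A[OF p(1)] mem[OF p(1)] by (auto simp: indicator_def)
  finally show ?thesis ..
qed

text \<open>
  Kuhn's triangulation: the order of its coordinates assigns almost every point of the cube to exactly one
  simplex.
\<close>

lemma cell_sum_permuted_simplices:
  fixes v :: "nat \<Rightarrow> real ^ 'n::{finite,linorder}"
  assumes Q: "A \<subseteq> unit_cube k" "A \<in> sets (leb_Rk k)"
    and A: "\<And>\<pi> y. \<pi> permutes {..<k} \<Longrightarrow> inj_on y {..<k} \<Longrightarrow> y \<in> permuted_simplex k \<pi> \<Longrightarrow> y \<in> A \<longleftrightarrow> \<pi> \<in> Ps"
  shows "cell k A x v \<in> polyhedral_currents k"
proof -
  let ?S = "{\<pi>. \<pi> permutes {..<k} \<and> \<pi> \<in> Ps}"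
  have eq: "cell k A x v = (\<lambda>\<omega>. \<Sum>\<pi>\<in>?S. cell k (permuted_simplex k \<pi>) x v \<omega>)"
  proof
    fix \<omega>
    show "cell k A x v \<omega> = (\<Sum>\<pi>\<in>?S. cell k (permuted_simplex k \<pi>) x v \<omega>)"
    proof (cases "\<omega> \<in> smooth_forms k")
      case True
      let ?g = "\<lambda>y. \<omega> (aff k x v y) \<bullet> wedge k v"
      have gc: "continuous_on UNIV (\<lambda>p. \<omega> p \<bullet> wedge k v)" by (intro continuous_intros smooth_formsD(2)[OF True])
      have gi: "set_integrable (leb_Rk k) B ?g" if "B \<in> sets (leb_Rk k)" "B \<subseteq> unit_cube k" for B
        using integrable_cell[OF gc that] .
      have psub: "permuted_simplex k \<pi> \<subseteq> unit_cube k" if "\<pi> \<in> ?S" for \<pi>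
        using mem_permuted_simplex[of \<pi> k] that by auto
      have "(LINT y:A|leb_Rk k. ?g y) = (LINT y|leb_Rk k. (\<Sum>\<pi>\<in>?S. indicator (permuted_simplex k \<pi>) y *\<^sub>R ?g y))"
        unfolding set_lebesgue_integral_def
      proof (rule integral_cong_AE)
        show "(\<lambda>y. indicator A y *\<^sub>R ?g y) \<in> borel_measurable (leb_Rk k)"
          using gi[OF Q(2,1)] by (auto simp: set_integrable_def)
        show "(\<lambda>y. \<Sum>\<pi>\<in>?S. indicator (permuted_simplex k \<pi>) y *\<^sub>R ?g y) \<in> borel_measurable (leb_Rk k)"
          using gi[OF permuted_simplex_sets psub] by (intro borel_measurable_sum) (auto simp: set_integrable_def)
        show "AE y in leb_Rk k. indicator A y *\<^sub>R ?g y = (\<Sum>\<pi>\<in>?S. indicator (permuted_simplex k \<pi>) y *\<^sub>R ?g y)"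
          using AE_leb_Rk_inj
        proof eventually_elim
          case (elim y)
          show ?case using indicator_cube_sum[OF elim Q(1), of Ps] A elim
            by (simp add: scaleR_sum_left[symmetric] del: real_scaleR_def)
        qed
      qed
      also have "\<dots> = (\<Sum>\<pi>\<in>?S. LINT y|leb_Rk k. indicator (permuted_simplex k \<pi>) y *\<^sub>R ?g y)"
        using gi[OF permuted_simplex_sets psub] by (intro Bochner_Integration.integral_sum) (auto simp: set_integrable_def)
      finally show ?thesis using True by (simp add: cell_apply set_lebesgue_integral_def)
    qed (simp add: cell_apply)
  qed
  show ?thesis unfolding eq by (rule polyhedral_sum) (auto intro: permuted_simplex_polyhedral)
qed

lemma cube_polyhedral: "cell k (unit_cube k) x v \<in> polyhedral_currents k"
  by (rule cell_sum_permuted_simplices[where Ps=UNIV]) (auto simp: mem_permuted_simplex)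

lemma prism_polyhedral:
  assumes k: "2 \<le> k"
  shows "cell k (prism k) x v \<in> polyhedral_currents k"
proof (rule cell_sum_permuted_simplices[where Ps="{\<pi>. inv \<pi> 0 < inv \<pi> 1}"])
  fix \<pi> and y :: "nat \<Rightarrow> real"
  assume p: "\<pi> permutes {..<k}" and inj: "inj_on y {..<k}" and y: "y \<in> permuted_simplex k \<pi>"
  have y': "y \<in> unit_cube k" "\<And>j. Suc j < k \<Longrightarrow> y (\<pi> (Suc j)) \<le> y (\<pi> j)"
    using y mem_permuted_simplex[OF p, of y] by auto
  have mono: "y (\<pi> j) \<le> y (\<pi> i)" if "i \<le> j" "j < k" for i j
    using that
  proof (induction j)
    case (Suc j)
    then show ?case using y'(2)[of j] by (cases "i = Suc j") (auto intro: order_trans[of _ "y (\<pi> j)"])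
  qed simp
  have i: "inv \<pi> i < k" "\<pi> (inv \<pi> i) = i" if "i < k" for i
    using permutes_in_image[OF permutes_inv[OF p], of i] permutes_inverses(1)[OF p] that by auto
  have ne: "y 0 \<noteq> y 1" using inj k by (auto dest: inj_onD)
  show "y \<in> prism k \<longleftrightarrow> \<pi> \<in> {\<pi>. inv \<pi> 0 < inv \<pi> 1}"
  proof -
    have ik: "inv \<pi> 0 < k" "inv \<pi> 1 < k" "\<pi> (inv \<pi> 0) = 0" "\<pi> (inv \<pi> 1) = 1" using i[of 0] i[of 1] k by auto
    then have "inv \<pi> 0 \<noteq> inv \<pi> 1" by (metis zero_neq_one)
    then consider "inv \<pi> 0 < inv \<pi> 1" | "inv \<pi> 1 < inv \<pi> 0" by linarith
    then show ?thesis
    proof cases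
      case 1
      then have "y 1 \<le> y 0" using mono[of "inv \<pi> 0" "inv \<pi> 1"] ik by simp
      then show ?thesis using 1 y'(1) by (simp add: prism_def)
    next
      case 2
      then have "y 0 \<le> y 1" using mono[of "inv \<pi> 1" "inv \<pi> 0"] ik by simp
      then show ?thesis using 2 ne by (simp add: prism_def)
    qed
  qed
qed (use k in \<open>auto simp: prism_subset prism_sets\<close>)

section \<open>The vector space of currents\<close>

instantiation "fun" :: (type, real_vector) real_vector
begin

definition scaleR_fun_def: "r *\<^sub>R f = (\<lambda>x. r *\<^sub>R f x)"

instance
  by standard (auto simp: scaleR_fun_def fun_eq_iff scaleR_add_right scaleR_add_left)

end

lemma scaleR_fun_apply: "(r *\<^sub>R f) x = r *\<^sub>R f x"
  by (simp add: scaleR_fun_def)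

lemmas fun_apply_simps = plus_fun_apply zero_fun_apply minus_apply uminus_apply scaleR_fun_apply

text \<open>
  Currents are functions; as simplification rules, the pointwise equations would expand the vector
  space operations between currents.
\<close>

declare plus_fun_apply [simp del] zero_fun_apply [simp del] minus_apply [simp del] uminus_apply [simp del]

lemma sum_fun_apply: "(\<Sum>i\<in>I. f i) x = (\<Sum>i\<in>I. f i x)"
  by (induction I rule: infinite_finite_induct) (auto simp: fun_apply_simps)

lemma linear_sum_list: "linear L \<Longrightarrow> L (\<Sum>x\<leftarrow>xs. f x) = (\<Sum>x\<leftarrow>xs. L (f x))"
  by (induction xs) (auto simp: linear_0 linear_add)

lemma sum_list_add: "(\<Sum>x\<leftarrow>xs. f x + g x) = (\<Sum>x\<leftarrow>xs. f x) + (\<Sum>x\<leftarrow>xs. g x :: 'a::ab_group_add)"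
  by (induction xs) auto

lemma sum_list_diff: "(\<Sum>x\<leftarrow>xs. f x - g x) = (\<Sum>x\<leftarrow>xs. f x) - (\<Sum>x\<leftarrow>xs. g x :: 'a::ab_group_add)"
  by (induction xs) auto

lemma sum_list_const_scaleR: "(\<Sum>x\<leftarrow>xs. c) = real (length xs) *\<^sub>R (c :: 'a::real_vector)"
  by (induction xs) (auto simp: scaleR_add_left)

lemma sum_list_concat: "(\<Sum>x\<leftarrow>concat xss. f x) = (\<Sum>xs\<leftarrow>xss. \<Sum>x\<leftarrow>xs. f x :: 'a::comm_monoid_add)"
  by (induction xss) auto

text \<open>
  A purely algebraic form of the Hahn-Banach theorem: no topology on the space of currents is involved.
\<close>

lemma linear_functional_separating:
  fixes T :: "'a::real_vector"
  assumes N: "subspace N" and T: "T \<notin> N"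
  shows "\<exists>l :: 'a \<Rightarrow> real. linear l \<and> (\<forall>S\<in>N. l S = 0) \<and> l T \<noteq> 0"
proof -
  obtain B where B: "B \<subseteq> N" "independent B" "N \<subseteq> span B" using maximal_independent_subset by blast
  have sp: "span B = N" using B span_minimal[OF B(1) N] by blast
  then have TB: "T \<notin> span B" using T by simp
  then have ind: "independent (insert T B)" using B(2) by (simp add: independent_insert)
  obtain l :: "'a \<Rightarrow> real" where l: "linear l" "\<forall>x\<in>insert T B. l x = (if x = T then 1 else 0)"
    using linear_independent_extend[OF ind, of "\<lambda>x. if x = T then 1 else 0"] by blast
  have "T \<notin> B" using TB span_base by blast
  then have "l b = 0" if "b \<in> B" for b using l(2) that by auto
  then have "l S = 0" if "S \<in> span B" for S
    using linear_eq_0_on_span[OF l(1)] that by blast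
  then show ?thesis using l sp by (intro exI[of _ l]) auto
qed

text \<open>
  For \<open>k = 0\<close> this is augmentation zero, in accordance with the augmented boundary operator.
\<close>

definition cycle :: "nat \<Rightarrow> 'n::{finite,linorder} current \<Rightarrow> bool" where
  "cycle k T \<longleftrightarrow> (if k = 0 then T (\<lambda>x. axis {} 1) = 0 else \<forall>\<phi>\<in>smooth_forms (k - 1). T (ext_deriv \<phi>) = 0)"

lemma boundary_eq_iff_cycle: "boundary k S = boundary k T \<longleftrightarrow> cycle k (S - T)"
  by (auto simp: boundary_def cycle_def fun_eq_iff fun_apply_simps)

lemma subspace_cycle: "subspace {T. cycle k T}"
  by (auto simp: subspace_def cycle_def fun_apply_simps)

lemma cycle_add: "cycle k S \<Longrightarrow> cycle k T \<Longrightarrow> cycle k (S + T)"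
  and cycle_diff: "cycle k S \<Longrightarrow> cycle k T \<Longrightarrow> cycle k (S - T)"
  and cycle_scaleR: "cycle k T \<Longrightarrow> cycle k (c *\<^sub>R T)"
  and cycle_0: "cycle k 0"
  using subspace_cycle[of k] subspace_add subspace_diff subspace_scale subspace_0 by blast+

lemma cycle_sum_list: "(\<And>x. x \<in> set xs \<Longrightarrow> cycle k (f x)) \<Longrightarrow> cycle k (\<Sum>x\<leftarrow>xs. f x)"
  by (induction xs) (auto simp: cycle_0 intro: cycle_add)

lemma smooth_forms_affine:
  fixes \<omega> :: "real ^ 'n::finite \<Rightarrow> real ^ ('n set)"
  assumes \<omega>: "\<omega> \<in> smooth_forms k"
  shows "(\<lambda>x. c *\<^sub>R \<omega> (r *\<^sub>R x + u)) \<in> smooth_forms k"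
proof (rule smooth_formsI)
  show "Cm m (\<lambda>x. c *\<^sub>R \<omega> (r *\<^sub>R x + u))" for m
    by (rule Cm_bounded_linear_compose[OF bounded_linear_scaleR_right Cm_compose_affine[OF smooth_formsD(1)[OF \<omega>]]])
  show "c *\<^sub>R \<omega> (r *\<^sub>R x + u) \<in> kvectors k" for x
    by (rule subspace_scale[OF subspace_kvectors smooth_formsD(3)[OF \<omega>]])
qed

text \<open>The pushforward under \<open>x \<mapsto> r x + u\<close>.\<close>

definition aff_push :: "nat \<Rightarrow> real \<Rightarrow> real ^ 'n::{finite,linorder} \<Rightarrow> 'n current \<Rightarrow> 'n current" where
  "aff_push k r u T = (\<lambda>\<omega>. if \<omega> \<in> smooth_forms k then T (\<lambda>x. r ^ k *\<^sub>R \<omega> (r *\<^sub>R x + u)) else 0)"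

lemma linear_aff_push: "linear (aff_push k r u)"
  by (rule linearI) (auto simp: aff_push_def fun_eq_iff fun_apply_simps)

lemma aff_push_cell: "aff_push k r u (cell k A x v) = cell k A (r *\<^sub>R x + u) (\<lambda>j. r *\<^sub>R v j)"
proof
  fix \<omega>
  have "r *\<^sub>R aff k x v y + u = aff k (r *\<^sub>R x + u) (\<lambda>j. r *\<^sub>R v j) y" for y
    by (simp add: aff_def scaleR_add_right scaleR_sum_right mult.commute)
  then show "aff_push k r u (cell k A x v) \<omega> = cell k A (r *\<^sub>R x + u) (\<lambda>j. r *\<^sub>R v j) \<omega>"
    using smooth_forms_affine[of \<omega> k "r ^ k" r u]
    by (simp add: aff_push_def cell_apply wedge_scale_all)
qed

lemma aff_push_translate_twice: "aff_push k 1 u (aff_push k 1 w T) = aff_push k 1 (u + w) T"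
proof
  fix \<omega> :: "(real, 'a) vec \<Rightarrow> (real, 'a set) vec"
  show "aff_push k 1 u (aff_push k 1 w T) \<omega> = aff_push k 1 (u + w) T \<omega>"
    using smooth_forms_affine[of \<omega> k 1 1 u] by (simp add: aff_push_def add.assoc add.commute[of w])
qed

lemma cycle_aff_push:
  assumes "cycle k T"
  shows "cycle k (aff_push k r u T)"
proof (cases "k = 0")
  case True
  have "(\<lambda>x. axis {} 1) \<in> (smooth_forms 0 :: ((real, 'a) vec \<Rightarrow> (real, 'a set) vec) set)"
    by (intro smooth_formsI Cm_const) (auto simp: kvectors_def axis_def)
  then show ?thesis using assms True by (simp add: cycle_def aff_push_def)
next
  case False
  have "aff_push k r u T (ext_deriv \<phi>) = 0" if \<phi>: "\<phi> \<in> smooth_forms (k - 1)" for \<phi>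
  proof -
    let ?\<psi> = "\<lambda>x. r ^ (k - 1) *\<^sub>R \<phi> (r *\<^sub>R x + u)"
    have \<psi>: "?\<psi> \<in> smooth_forms (k - 1)" by (rule smooth_forms_affine[OF \<phi>])
    have "(?\<psi> has_derivative (\<lambda>h. r ^ (k - 1) *\<^sub>R (r *\<^sub>R frechet_derivative \<phi> (at (r *\<^sub>R x + u)) h))) (at x)" for x
      by (intro has_derivative_scaleR_right has_derivative_compose_affine smooth_formsD(4)[OF \<phi>])
    from frechet_derivative_at[OF this, symmetric]
    have "frechet_derivative ?\<psi> (at x) = (\<lambda>h. r ^ k *\<^sub>R frechet_derivative \<phi> (at (r *\<^sub>R x + u)) h)" for x
      using False by (simp add: power_eq_if[of r k] mult.commute)
    then have "ext_deriv ?\<psi> = (\<lambda>x. r ^ k *\<^sub>R ext_deriv \<phi> (r *\<^sub>R x + u))"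
      by (auto simp: fun_eq_iff vec_eq_iff ext_deriv_def sum_distrib_left mult.left_commute)
    moreover have "T (ext_deriv ?\<psi>) = 0" using assms \<psi> False by (simp add: cycle_def)
    ultimately show ?thesis by (simp add: aff_push_def)
  qed
  then show ?thesis using False by (simp add: cycle_def)
qed

text \<open>
  Combinations of cubes and prisms with mass at most \<open>r\<close>; the number \<open>r\<close> bounds the sum of the masses of the cells,
  which avoids any discussion of how they overlap.
\<close>

inductive small_chain :: "nat \<Rightarrow> real \<Rightarrow> 'n::{finite,linorder} current \<Rightarrow> bool" for k where
  small_chain_0: "0 \<le> r \<Longrightarrow> small_chain k r 0"
| small_chain_cell: "small_chain k r T \<Longrightarrow> A = unit_cube k \<or> 2 \<le> k \<and> A = prism k \<Longrightarrow>
    \<bar>b\<bar> * norm (wedge k v) \<le> s \<Longrightarrow> small_chain k (r + s) (T + b *\<^sub>R cell k A x v)"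

lemma small_chain_mono: "small_chain k r T \<Longrightarrow> r \<le> s \<Longrightarrow> small_chain k s T"
proof (induction arbitrary: s rule: small_chain.induct)
  case (small_chain_0 r) then show ?case by (intro small_chain.small_chain_0) simp
next
  case (small_chain_cell r T A b v t x)
  then show ?case using small_chain.small_chain_cell[of k r T A b v "s - r" x] by simp
qed

lemma small_chain_add:
  assumes "small_chain k r S" "small_chain k s T"
  shows "small_chain k (r + s) (S + T)"
  using assms(2,1)
proof (induction rule: small_chain.induct)
  case (small_chain_0 s)
  then show ?case using small_chain_mono[of k r S "r + s"] by simp
next
  case (small_chain_cell r' T A b v t x)
  then show ?case using small_chain.small_chain_cell[of k "r + r'" "S + T" A b v t x] by (simp add: add.assoc)
qed

lemma small_chain_scaleR: "small_chain k r T \<Longrightarrow> small_chain k (\<bar>c\<bar> * r) (c *\<^sub>R T)"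
proof (induction rule: small_chain.induct)
  case (small_chain_0 r) then show ?case by (simp add: small_chain.small_chain_0)
next
  case (small_chain_cell r T A b v s x)
  have "\<bar>c * b\<bar> * norm (wedge k v) \<le> \<bar>c\<bar> * s"
    using small_chain_cell by (simp add: abs_mult mult.assoc mult_left_mono)
  from small_chain.small_chain_cell[OF small_chain_cell.IH small_chain_cell.hyps(2) this, of x]
  show ?case by (simp add: distrib_left scaleR_add_right)
qed

lemma small_chain_aff_push: "small_chain k r T \<Longrightarrow> small_chain k (\<bar>c\<bar> ^ k * r) (aff_push k c u T)"
proof (induction rule: small_chain.induct)
  case (small_chain_0 r) then show ?case by (simp add: small_chain.small_chain_0 linear_0[OF linear_aff_push])
next
  case (small_chain_cell r T A b v s x)
  have "\<bar>b\<bar> * norm (wedge k (\<lambda>j. c *\<^sub>R v j)) \<le> \<bar>c\<bar> ^ k * s"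
    using mult_left_mono[OF small_chain_cell.hyps(3), of "\<bar>c\<bar> ^ k"]
    by (simp add: wedge_scale_all power_abs mult.left_commute)
  from small_chain.small_chain_cell[OF small_chain_cell.IH small_chain_cell.hyps(2) this, of "c *\<^sub>R x + u"]
  show ?case by (simp add: distrib_left linear_add[OF linear_aff_push] linear_scale[OF linear_aff_push] aff_push_cell)
qed

lemma small_chain_translate: "small_chain k r T \<Longrightarrow> small_chain k r (aff_push k 1 u T)"
  using small_chain_aff_push[of k r T 1 u] by simp

lemma small_chain_single: "A = unit_cube k \<or> 2 \<le> k \<and> A = prism k \<Longrightarrow> small_chain k (norm (wedge k v)) (cell k A x v)"
  using small_chain_cell[OF small_chain_0[of 0 k], of A 1 v "norm (wedge k v)" x] by simp

lemma small_chain_sum_list: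
  "(\<And>x. x \<in> set xs \<Longrightarrow> small_chain k (r x) (T x)) \<Longrightarrow> small_chain k (\<Sum>x\<leftarrow>xs. r x) (\<Sum>x\<leftarrow>xs. T x)"
  by (induction xs) (auto simp: small_chain_0 intro: small_chain_add)

lemma small_chain_sum:
  "finite I \<Longrightarrow> (\<And>i. i \<in> I \<Longrightarrow> small_chain k (r i) (T i)) \<Longrightarrow> small_chain k (\<Sum>i\<in>I. r i) (\<Sum>i\<in>I. T i)"
  by (induction I rule: finite_induct) (auto simp: small_chain_0 intro: small_chain_add)

lemma small_chain_diff: "small_chain k r S \<Longrightarrow> small_chain k s T \<Longrightarrow> small_chain k (r + s) (S - T)"
  using small_chain_add[of k r S s "(-1) *\<^sub>R T"] small_chain_scaleR[of k s T "-1"] by simp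

section \<open>Currents that become negligible after averaging over translations\<close>

definition avg :: "nat \<Rightarrow> (real ^ 'n::{finite,linorder}) list \<Rightarrow> 'n current \<Rightarrow> 'n current" where
  "avg k us T = (1 / real (length us)) *\<^sub>R (\<Sum>u\<leftarrow>us. aff_push k 1 u T)"

lemma linear_avg: "linear (avg k us)"
  unfolding avg_def
  by (rule linearI)
    (simp_all add: linear_add[OF linear_aff_push] linear_scale[OF linear_aff_push] sum_list_add
      scaleR_add_right linear_sum_list[OF linear_scaleR, symmetric] scaleR_left_commute)

lemma cycle_avg: "cycle k T \<Longrightarrow> cycle k (avg k us T)"
  unfolding avg_def by (intro cycle_scaleR cycle_sum_list cycle_aff_push)

lemma small_chain_avg:
  assumes "small_chain k r T" "us \<noteq> []"
  shows "small_chain k r (avg k us T)"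
proof -
  have "small_chain k (\<Sum>u\<leftarrow>us. r) (\<Sum>u\<leftarrow>us. aff_push k 1 u T)"
    by (intro small_chain_sum_list small_chain_translate assms(1))
  from small_chain_scaleR[OF this, of "1 / real (length us)"]
  show ?thesis using assms(2) by (simp add: avg_def sum_list_const_scaleR)
qed

lemma avg_avg: "avg k us (avg k ws T) = avg k (concat (map (\<lambda>u. map (\<lambda>w. u + w) ws) us)) T"
proof -
  have "(\<Sum>u\<leftarrow>us. aff_push k 1 u (avg k ws T)) = (1 / real (length ws)) *\<^sub>R (\<Sum>u\<leftarrow>us. \<Sum>w\<leftarrow>ws. aff_push k 1 (u + w) T)"
    unfolding avg_def
    by (simp add: linear_scale[OF linear_aff_push] linear_sum_list[OF linear_aff_push] aff_push_translate_twice
        linear_sum_list[OF linear_scaleR])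
  moreover have "length (concat (map (\<lambda>u. map (\<lambda>w. u + w) ws) us)) = length us * length ws"
    by (induction us) auto
  ultimately show ?thesis
    unfolding avg_def[of k us] avg_def[of k "concat _"]
    by (simp add: sum_list_concat comp_def)
qed

lemma avg_commute: "avg k us (avg k ws T) = avg k ws (avg k us T)"
proof -
  have "avg k us (avg k ws T) = (1 / (real (length us) * real (length ws))) *\<^sub>R (\<Sum>u\<leftarrow>us. \<Sum>w\<leftarrow>ws. aff_push k 1 (u + w) T)"
    for us ws
  proof -
    have "length (concat (map (\<lambda>u. map (\<lambda>w. u + w) ws) us)) = length us * length ws"
      by (induction us) auto
    then show ?thesis unfolding avg_avg by (simp add: avg_def sum_list_concat comp_def)
  qed
  moreover have "(\<Sum>u\<leftarrow>us. \<Sum>w\<leftarrow>ws. aff_push k 1 (u + w) T) = (\<Sum>w\<leftarrow>ws. \<Sum>u\<leftarrow>us. aff_push k 1 (w + u) T)"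
    by (induction us) (auto simp: sum_list_add add.commute)
  ultimately show ?thesis by (simp add: mult.commute)
qed

text \<open>
  Averages occur because a current and its translate differ by an amount that need not be small, whereas after
  averaging over many translations of the current the difference is.
\<close>

definition negligible_currents :: "nat \<Rightarrow> 'n::{finite,linorder} current set" where
  "negligible_currents k = {T. \<forall>\<epsilon>>0. \<exists>us Q. us \<noteq> [] \<and> small_chain k \<epsilon> Q \<and> cycle k (avg k us T - Q)}"

lemma negligible_currentsD:
  assumes "T \<in> negligible_currents k" "\<epsilon> > 0"
  obtains us Q where "us \<noteq> []" "small_chain k \<epsilon> Q" "cycle k (avg k us T - Q)"
  using assms unfolding negligible_currents_def by blast

text \<open>
  Averages commute, so both currents can be averaged over the sums of the two families of translations.
\<close>

lemma negligible_add:
  assumes S: "S \<in> negligible_currents k" and T: "T \<in> negligible_currents k"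
  shows "S + T \<in> negligible_currents k"
  unfolding negligible_currents_def
proof (intro CollectI allI impI)
  fix \<epsilon> :: real assume "\<epsilon> > 0"
  then have e: "\<epsilon>/2 > 0" by simp
  obtain us P where us: "us \<noteq> []" "small_chain k (\<epsilon>/2) P" "cycle k (avg k us S - P)" using S e by (rule negligible_currentsD)
  obtain ws Q where ws: "ws \<noteq> []" "small_chain k (\<epsilon>/2) Q" "cycle k (avg k ws T - Q)" using T e by (rule negligible_currentsD)
  let ?c = "concat (map (\<lambda>u. map (\<lambda>w. u + w) ws) us)"
  let ?Q = "avg k ws P + avg k us Q"
  have "?c \<noteq> []" using us(1) ws(1) by (cases us; cases ws) auto
  moreover have "small_chain k \<epsilon> ?Q"
    using small_chain_add[OF small_chain_avg[OF us(2) ws(1)] small_chain_avg[OF ws(2) us(1)]] by simp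
  moreover have "avg k ?c (S + T) - ?Q = avg k ws (avg k us S - P) + avg k us (avg k ws T - Q)"
    unfolding avg_avg[symmetric]
    by (simp add: linear_add[OF linear_avg] linear_diff[OF linear_avg] avg_commute[of k us ws S])
  then have "cycle k (avg k ?c (S + T) - ?Q)" using us(3) ws(3) by (simp add: cycle_add cycle_avg)
  ultimately show "\<exists>us Q. us \<noteq> [] \<and> small_chain k \<epsilon> Q \<and> cycle k (avg k us (S + T) - Q)" by blast
qed

lemma negligible_cycle: "cycle k T \<Longrightarrow> T \<in> negligible_currents k"
  unfolding negligible_currents_def
  by (intro CollectI allI impI exI[of _ "[0]"] exI[of _ 0]) (auto simp: cycle_avg small_chain_0)

lemma negligible_scaleR:
  assumes T: "T \<in> negligible_currents k"
  shows "c *\<^sub>R T \<in> negligible_currents k"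
proof (cases "c = 0")
  case True then show ?thesis by (simp add: negligible_cycle cycle_0)
next
  case False
  show ?thesis unfolding negligible_currents_def
  proof (intro CollectI allI impI)
    fix \<epsilon> :: real assume "\<epsilon> > 0"
    then have e: "\<epsilon> / \<bar>c\<bar> > 0" using False by simp
    obtain us Q where us: "us \<noteq> []" "small_chain k (\<epsilon> / \<bar>c\<bar>) Q" "cycle k (avg k us T - Q)" using T e by (rule negligible_currentsD)
    have "small_chain k \<epsilon> (c *\<^sub>R Q)" using small_chain_scaleR[OF us(2), of c] False by simp
    moreover have "cycle k (avg k us (c *\<^sub>R T) - c *\<^sub>R Q)"
      using cycle_scaleR[OF us(3), of c] by (simp add: linear_scale[OF linear_avg] scaleR_diff_right)
    ultimately show "\<exists>us Q. us \<noteq> [] \<and> small_chain k \<epsilon> Q \<and> cycle k (avg k us (c *\<^sub>R T) - Q)" using us(1) by blast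
  qed
qed

lemma subspace_negligible: "subspace (negligible_currents k)"
  by (simp add: subspace_def negligible_add negligible_scaleR negligible_cycle cycle_0)

lemma negligible_diff: "S \<in> negligible_currents k \<Longrightarrow> T \<in> negligible_currents k \<Longrightarrow> S - T \<in> negligible_currents k"
  using subspace_diff[OF subspace_negligible] by blast

text \<open>Averaging along the direction of a translation makes the difference telescope.\<close>

lemma translation_difference_negligible:
  assumes T: "small_chain k r T"
  shows "aff_push k 1 u T - T \<in> negligible_currents k"
  unfolding negligible_currents_def
proof (intro CollectI allI impI)
  fix \<epsilon> :: real assume \<epsilon>: "\<epsilon> > 0"
  obtain M :: nat where M: "real M > 2 * r / \<epsilon>" "M > 0"
    using reals_Archimedean2[of "max (2 * r / \<epsilon>) 0"] by (metis max_less_iff_conj of_nat_0_less_iff)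
  define us where "us = map (\<lambda>i. real i *\<^sub>R u) [0..<M]"
  have "(\<Sum>i\<leftarrow>[0..<M]. aff_push k 1 (real i *\<^sub>R u) (aff_push k 1 u T - T)) =
      aff_push k 1 (real M *\<^sub>R u) T - aff_push k 1 0 T" for M
  proof (induction M)
    case (Suc M)
    have "real M *\<^sub>R u + u = real (Suc M) *\<^sub>R u" by (simp add: scaleR_add_left)
    then show ?case using Suc by (simp add: linear_diff[OF linear_aff_push] aff_push_translate_twice del: of_nat_Suc)
  qed simp
  then have a: "avg k us (aff_push k 1 u T - T) = (1 / real M) *\<^sub>R (aff_push k 1 (real M *\<^sub>R u) T - aff_push k 1 0 T)"
    by (simp add: avg_def us_def comp_def)
  have "small_chain k (\<bar>1 / real M\<bar> * (r + r)) (avg k us (aff_push k 1 u T - T))"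
    unfolding a by (intro small_chain_scaleR small_chain_diff small_chain_translate T)
  moreover have "\<bar>1 / real M\<bar> * (r + r) \<le> \<epsilon>" using M \<epsilon> by (simp add: field_simps)
  ultimately have "small_chain k \<epsilon> (avg k us (aff_push k 1 u T - T))" by (rule small_chain_mono)
  moreover have "us \<noteq> []" using M(2) by (simp add: us_def)
  ultimately show "\<exists>us Q. us \<noteq> [] \<and> small_chain k \<epsilon> Q \<and> cycle k (avg k us (aff_push k 1 u T - T) - Q)"
    using cycle_0 by (metis diff_self)
qed

lemma negligible_closed:
  assumes "\<And>\<epsilon>. \<epsilon> > 0 \<Longrightarrow> \<exists>S. T - S \<in> negligible_currents k \<and> small_chain k \<epsilon> S"
  shows "T \<in> negligible_currents k"
  unfolding negligible_currents_def
proof (intro CollectI allI impI)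
  fix \<epsilon> :: real assume "\<epsilon> > 0"
  then have e: "\<epsilon>/2 > 0" by simp
  obtain S where S: "T - S \<in> negligible_currents k" "small_chain k (\<epsilon>/2) S" using assms[OF e] by blast
  obtain us Q where us: "us \<noteq> []" "small_chain k (\<epsilon>/2) Q" "cycle k (avg k us (T - S) - Q)" using S(1) e by (rule negligible_currentsD)
  have "small_chain k \<epsilon> (Q + avg k us S)" using small_chain_add[OF us(2) small_chain_avg[OF S(2) us(1)]] by simp
  moreover have "cycle k (avg k us T - (Q + avg k us S))"
    using us(3) by (simp add: linear_diff[OF linear_avg] algebra_simps)
  ultimately show "\<exists>us Q. us \<noteq> [] \<and> small_chain k \<epsilon> Q \<and> cycle k (avg k us T - Q)" using us(1) by blast
qed

abbreviation cube_cell :: "nat \<Rightarrow> real ^ 'n::{finite,linorder} \<Rightarrow> (nat \<Rightarrow> real ^ 'n::{finite,linorder}) \<Rightarrow> 'n current" where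
  "cube_cell k \<equiv> cell k (unit_cube k)"

lemma cell_wedge_zero: "wedge k v = 0 \<Longrightarrow> cell k A x v = 0"
  using cell_dependent[of k v A x] by (simp add: wedge_eq_zero_iff zero_fun_def)

lemma cube_cell_permute:
  assumes p: "\<sigma> permutes {..<k}"
  shows "cube_cell k x v = of_int (sign \<sigma>) *\<^sub>R cube_cell k x (v \<circ> \<sigma>)"
proof -
  let ?t = "\<lambda>y. \<lambda>i\<in>{..<k}. (y (\<sigma> i) :: real)"
  have t: "?t \<in> measurable (leb_Rk k) (leb_Rk k)" "distr (leb_Rk k) (leb_Rk k) ?t = leb_Rk k"
    using distr_leb_Rk_coordinatewise[of k "\<lambda>_ y. y" \<sigma>] p by (simp_all add: distr_id2)
  have "cell k {y \<in> space (leb_Rk k). ?t y \<in> unit_cube k} x v = (\<lambda>\<omega>. of_int (sign \<sigma>) * cube_cell k x (v \<circ> \<sigma>) \<omega>)"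
  proof (rule cell_change_of_variables[OF t unit_cube_sets])
    show "wedge k v = of_int (sign \<sigma>) *\<^sub>R wedge k (v \<circ> \<sigma>)"
      by (simp add: wedge_permute[OF p] sign_def)
    show "aff k x (v \<circ> \<sigma>) (?t y) = aff k x v y" for y
      using sum.permute[OF p, of "\<lambda>j. y j *\<^sub>R v j"] by (simp add: aff_def comp_def)
  qed
  moreover have "{y \<in> space (leb_Rk k). ?t y \<in> unit_cube k} = unit_cube k"
  proof (rule set_eqI)
    fix y :: "nat \<Rightarrow> real"
    have "(\<forall>j\<in>{..<k}. y (\<sigma> j) \<in> {0..1}) \<longleftrightarrow> (\<forall>j\<in>\<sigma> ` {..<k}. y j \<in> {0..1})" by blast
    then have "(\<forall>j\<in>{..<k}. y (\<sigma> j) \<in> {0..1}) \<longleftrightarrow> (\<forall>j\<in>{..<k}. y j \<in> {0..1})"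
      unfolding permutes_image[OF p] .
    then show "y \<in> {y \<in> space (leb_Rk k). ?t y \<in> unit_cube k} \<longleftrightarrow> y \<in> unit_cube k"
      unfolding unit_cube_def PiE_iff mem_Collect_eq by (auto simp: space_PiM PiE_iff)
  qed
  ultimately show ?thesis by (simp add: fun_eq_iff fun_apply_simps)
qed

definition slot_frame :: "'a \<Rightarrow> 'a \<Rightarrow> (nat \<Rightarrow> 'a) \<Rightarrow> nat \<Rightarrow> 'a" where
  "slot_frame a b v i = (if i = 0 then a else if i = 1 then b else v (i - 1))"

definition prism_walls :: "nat \<Rightarrow> real ^ 'n::{finite,linorder} \<Rightarrow> (nat \<Rightarrow> real ^ 'n::{finite,linorder}) \<Rightarrow> 'n current" where
  "prism_walls k x V = (\<Sum>j\<in>{2..k}. (-1)^j *\<^sub>R (cell k (prism k) (x + V j) (V \<circ> skip j) - cell k (prism k) x (V \<circ> skip j)))"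

text \<open>
  The boundary of a prism is a cycle, because \<open>d d = 0\<close>.  Up to the walls, it says that cubes are
  additive in the edge \<open>0\<close>.
\<close>

lemma prism_cycle:
  fixes v :: "nat \<Rightarrow> real ^ 'n::{finite,linorder}"
  assumes k: "1 \<le> k"
  shows "cycle k (cube_cell k (x + a) (v(0 := b)) + cube_cell k x (v(0 := a)) - cube_cell k x (v(0 := a + b))
    + prism_walls k x (slot_frame a b v))"
proof -
  let ?V = "slot_frame a b v"
  have c: "cube_cell k y (?V \<circ> skip 0) = cube_cell k y (v(0 := b))" "cube_cell k y (?V \<circ> skip 1) = cube_cell k y (v(0 := a))"
    "cube_cell k y ((?V \<circ> skip 0)(0 := a + b)) = cube_cell k y (v(0 := a + b))" for y
    by (auto intro!: cell_cong simp: slot_frame_def skip_def)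
  have "(cube_cell k (x + a) (v(0 := b)) + cube_cell k x (v(0 := a)) - cube_cell k x (v(0 := a + b))
    + prism_walls k x ?V) (ext_deriv \<phi>) = 0" if \<phi>: "\<phi> \<in> smooth_forms (k - 1)" for \<phi>
  proof -
    have d: "ext_deriv \<phi> \<in> smooth_forms k" using ext_deriv_smooth[OF \<phi>] k by simp
    have "cell (Suc k) (prism (Suc k)) x ?V (ext_deriv (ext_deriv \<phi>)) = 0"
      using ext_deriv_ext_deriv[OF \<phi>] by (simp add: cell_apply)
    moreover have "?V 0 = a" "?V 1 = b" by (simp_all add: slot_frame_def)
    ultimately show ?thesis
      using prism_stokes[OF k d, of x ?V] c[of x] c[of "x + a"]
      by (simp add: prism_walls_def sum_fun_apply fun_apply_simps)
  qed
  then show ?thesis using k by (simp add: cycle_def)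
qed

text \<open>
  The walls come in pairs of translates with opposite signs.
\<close>

lemma prism_walls_negligible: "prism_walls k x V \<in> negligible_currents k"
  unfolding prism_walls_def
proof (rule subspace_sum[OF subspace_negligible])
  fix j assume j: "j \<in> {2..k}"
  have "cell k (prism k) (x + V j) (V \<circ> skip j) = aff_push k 1 (V j) (cell k (prism k) x (V \<circ> skip j))"
    by (simp add: aff_push_cell comp_def)
  moreover have "small_chain k (norm (wedge k (V \<circ> skip j))) (cell k (prism k) x (V \<circ> skip j))"
    using j by (intro small_chain_single) auto
  ultimately show "(-1)^j *\<^sub>R (cell k (prism k) (x + V j) (V \<circ> skip j) - cell k (prism k) x (V \<circ> skip j)) \<in> negligible_currents k"
    using translation_difference_negligible by (auto intro!: negligible_scaleR)
qed

lemma small_chain_prism_walls: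
  assumes "\<And>j. j \<in> {2..k} \<Longrightarrow> norm (wedge k (V \<circ> skip j)) \<le> c j"
  shows "small_chain k (\<Sum>j\<in>{2..k}. 2 * c j) (prism_walls k x V)"
  unfolding prism_walls_def
proof (rule small_chain_sum)
  fix j assume j: "j \<in> {2..k}"
  have s: "small_chain k (c j) (cell k (prism k) y (V \<circ> skip j))" for y
    by (rule small_chain_mono[OF small_chain_single assms[OF j]]) (use j in auto)
  show "small_chain k (2 * c j) ((-1)^j *\<^sub>R (cell k (prism k) (x + V j) (V \<circ> skip j) - cell k (prism k) x (V \<circ> skip j)))"
    using small_chain_scaleR[OF small_chain_diff[OF s s], of "(-1)^j"] by simp
qed simp

lemma translate_cube_cell: "aff_push k 1 u (cube_cell k x v) = cube_cell k (x + u) v"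
  by (simp add: aff_push_cell)

lemma cube_cell_translation_negligible: "cube_cell k x v - cube_cell k 0 v \<in> negligible_currents k"
  using translation_difference_negligible[OF small_chain_single[of "unit_cube k" k v 0], of x] by (simp add: translate_cube_cell)

lemma cube_cell_additive_negligible:
  fixes v :: "nat \<Rightarrow> real ^ 'n::{finite,linorder}"
  assumes k: "1 \<le> k"
  shows "cube_cell k 0 (v(0 := a + b)) - cube_cell k 0 (v(0 := a)) - cube_cell k 0 (v(0 := b)) \<in> negligible_currents k"
proof -
  let ?Z = "cube_cell k (0 + a) (v(0 := b)) + cube_cell k 0 (v(0 := a)) - cube_cell k 0 (v(0 := a + b))
    + prism_walls k 0 (slot_frame a b v)"
  have "?Z \<in> negligible_currents k" by (rule negligible_cycle[OF prism_cycle[OF k]])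
  from negligible_diff[OF negligible_diff[OF prism_walls_negligible[of k 0 "slot_frame a b v"] this] negligible_scaleR[OF cube_cell_translation_negligible[of k a "v(0 := b)"], of "-1"]]
  show ?thesis by (simp add: algebra_simps)
qed

text \<open>
  Additivity gives homogeneity for rational factors.  For real \<open>t\<close>, the remainder after approximation with denominator
  \<open>N\<close> consists of cells of mass of order \<open>1 / N\<close>.
\<close>

lemma cube_cell_homogeneous_negligible:
  fixes v :: "nat \<Rightarrow> real ^ 'n::{finite,linorder}"
  assumes k: "1 \<le> k" and t: "0 \<le> t"
  shows "cube_cell k 0 (v(0 := t *\<^sub>R a)) - t *\<^sub>R cube_cell k 0 (v(0 := a)) \<in> negligible_currents k"
proof (rule negligible_closed)
  fix \<epsilon> :: real assume \<epsilon>: "\<epsilon> > 0"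
  define W where "W = norm (wedge k (v(0 := a)))"
  obtain N :: nat where N: "real N > 2 * W / \<epsilon>" "N > 0"
    using reals_Archimedean2[of "max (2 * W / \<epsilon>) 0"] by (metis max_less_iff_conj of_nat_0_less_iff)
  define n where "n = nat \<lfloor>real N * t\<rfloor>"
  \<comment> \<open>\<open>N t = n + s\<close> with \<open>n\<close> the integral part; the cell with edge \<open>s a\<close> is the error.\<close>
  define s where "s = real N * t - real n"
  have n: "real n = of_int \<lfloor>real N * t\<rfloor>" using t by (simp add: n_def)
  have s: "0 \<le> s" "s \<le> 1" unfolding s_def n by linarith+
  define G where "G = (\<lambda>b. cube_cell k 0 (v(0 := b)))"
  define S where "S = (1 / real N) *\<^sub>R G (s *\<^sub>R a) - (s / real N) *\<^sub>R G a"
  have w: "norm (wedge k (v(0 := s *\<^sub>R a))) \<le> W"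
    using k s wedge_scale[of 0 k v s a] by (simp add: W_def mult_left_le_one_le)
  have wa: "small_chain k W (cube_cell k 0 (v(0 := a)))" unfolding W_def by (rule small_chain_single) simp
  have "small_chain k (\<bar>1 / real N\<bar> * W + \<bar>s / real N\<bar> * W) S"
    unfolding S_def G_def
    by (intro small_chain_diff small_chain_scaleR small_chain_mono[OF small_chain_single w] wa) auto
  moreover have "\<bar>1 / real N\<bar> * W + \<bar>s / real N\<bar> * W \<le> \<epsilon>"
  proof -
    have "s * W \<le> W" using s by (simp add: W_def mult_left_le_one_le)
    then have "(W + s * W) / real N \<le> 2 * W / real N"
      using N(2) by (intro divide_right_mono) auto
    then have "\<bar>1 / real N\<bar> * W + \<bar>s / real N\<bar> * W \<le> 2 * W / real N"
      using s(1) by (simp add: add_divide_distrib)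
    also have "\<dots> \<le> \<epsilon>" using N \<epsilon> by (simp add: field_simps)
    finally show ?thesis .
  qed
  ultimately have small: "small_chain k \<epsilon> S" by (rule small_chain_mono)
  have "G (t *\<^sub>R a) - t *\<^sub>R G a - S \<in> negligible_currents k"
  proof (rule ccontr)
    assume "\<not> ?thesis"
    then obtain l :: "'n current \<Rightarrow> real" where l0: "linear l" "\<forall>T\<in>negligible_currents k. l T = 0"
      and ne: "l (G (t *\<^sub>R a) - t *\<^sub>R G a - S) \<noteq> 0"
      using linear_functional_separating[OF subspace_negligible] by blast
    have l: "linear l" "\<And>T. T \<in> negligible_currents k \<Longrightarrow> l T = 0" using l0 by blast+
    have add: "l (G (b + c)) = l (G b) + l (G c)" for b c
      using l(2)[OF cube_cell_additive_negligible[OF k, of v b c]] by (simp add: linear_diff[OF l(1)] G_def)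
    have nat_scale: "l (G (real m *\<^sub>R b)) = real m * l (G b)" for m b
    proof (induction m)
      case 0
      show ?case using add[of 0 0] by simp
    next
      case (Suc m)
      have "real (Suc m) *\<^sub>R b = real m *\<^sub>R b + b" by (simp add: scaleR_add_left)
      then show ?case using Suc add by (simp add: algebra_simps)
    qed
    have "real N *\<^sub>R (t *\<^sub>R a) = real n *\<^sub>R a + s *\<^sub>R a" by (simp add: s_def scaleR_add_left[symmetric])
    then have "real N * l (G (t *\<^sub>R a)) = real n * l (G a) + l (G (s *\<^sub>R a))"
      using nat_scale[of N "t *\<^sub>R a"] nat_scale[of n a] add by simp
    then have gt: "l (G (t *\<^sub>R a)) = (real n * l (G a) + l (G (s *\<^sub>R a))) / real N" using N(2) by (simp add: field_simps)
    have ns: "real n = real N * t - s" by (simp add: s_def)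
    have "l (G (t *\<^sub>R a) - t *\<^sub>R G a - S) = l (G (t *\<^sub>R a)) - t * l (G a) - (l (G (s *\<^sub>R a)) / real N - s / real N * l (G a))"
      unfolding S_def linear_diff[OF l(1)] linear_scale[OF l(1)] by simp
    also have "\<dots> = 0" unfolding gt ns using N(2) by (simp add: field_simps)
    finally have "l (G (t *\<^sub>R a) - t *\<^sub>R G a - S) = 0" .
    with ne show False by simp
  qed
  with small show "\<exists>S. cube_cell k 0 (v(0 := t *\<^sub>R a)) - t *\<^sub>R cube_cell k 0 (v(0 := a)) - S \<in> negligible_currents k \<and> small_chain k \<epsilon> S"
    unfolding G_def by blast
qed

text \<open>
  A linear functional that vanishes on negligible currents sees a cube only through its multivector:
  its values on cubes form an alternating form.
\<close>

lemma alternating_form_functional: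
  fixes l :: "'n::{finite,linorder} current \<Rightarrow> real"
  assumes l: "linear l" and neg: "\<And>T. T \<in> negligible_currents k \<Longrightarrow> l T = 0"
  shows "alternating_form k (\<lambda>v. l (cube_cell k 0 v))"
proof -
  define f where "f = (\<lambda>v. l (cube_cell k 0 v))"
  have add0: "f (v(0 := a + b)) = f (v(0 := a)) + f (v(0 := b))" if "1 \<le> k" for v a b
    using neg[OF cube_cell_additive_negligible[OF that, of v a b]] by (simp add: linear_diff[OF l] f_def)
  have scale0: "f (v(0 := c *\<^sub>R a)) = c * f (v(0 := a))" if "1 \<le> k" for v c a
  proof -
    have nn: "f (v(0 := t *\<^sub>R b)) = t * f (v(0 := b))" if "0 \<le> t" for t b
      using neg[OF cube_cell_homogeneous_negligible[OF \<open>1 \<le> k\<close> that, of v b]]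
      by (simp add: linear_diff[OF l] linear_scale[OF l] f_def)
    have z: "f (v(0 := 0)) = 0" using nn[of 0 0] by simp
    have "f (v(0 := - b)) = - f (v(0 := b))" for b
      using add0[OF \<open>1 \<le> k\<close>, of v b "- b"] z by simp
    then show ?thesis using nn[of c a] nn[of "- c" "- a"] by (cases "0 \<le> c") simp_all
  qed
  have swap: "f v = of_int (sign (Transposition.transpose 0 j)) * f (v \<circ> Transposition.transpose 0 j)" if "j < k" for v j
  proof -
    have p: "Transposition.transpose 0 j permutes {..<k}" using that by (intro permutes_swap_id) auto
    show ?thesis unfolding f_def by (subst cube_cell_permute[OF p]) (simp add: linear_scale[OF l])
  qed
  have upd: "(v(j := x)) \<circ> Transposition.transpose 0 j = (v \<circ> Transposition.transpose 0 j)(0 := x)"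
    for v :: "nat \<Rightarrow> (real, 'n) vec" and j x
    by (auto simp: fun_eq_iff Transposition.transpose_def)
  have "alternating_form k f"
    unfolding alternating_form_def
  proof (intro conjI allI impI)
    fix v j a b assume j: "j < k"
    then have k: "1 \<le> k" by simp
    show "f (v(j := a + b)) = f (v(j := a)) + f (v(j := b))"
      by (subst (1 2 3) swap[OF j]) (simp only: upd add0[OF k] distrib_left)
  next
    fix v j a and c :: real assume j: "j < k"
    then have k: "1 \<le> k" by simp
    show "f (v(j := c *\<^sub>R a)) = c * f (v(j := a))"
      by (subst (1 2) swap[OF j]) (simp only: upd scale0[OF k] mult.left_commute)
  next
    fix v w :: "nat \<Rightarrow> (real, 'n) vec" assume "\<forall>j<k. v j = w j"
    then show "f v = f w" unfolding f_def using cell_cong[of k v w] by simp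
  next
    fix v :: "nat \<Rightarrow> (real, 'n) vec" and i assume "Suc i < k" "v i = v (Suc i)"
    then have "wedge k v = 0" by (intro wedge_eq_zero[of i "Suc i"]) auto
    then show "f v = 0" by (simp add: f_def cell_wedge_zero linear_0[OF l])
  qed
  then show ?thesis unfolding f_def .
qed

text \<open>
  The functional of the preceding lemma is a linear function of the multivector, by the universal property of the
  exterior power, and therefore cannot separate the combination from the negligible currents.
\<close>

theorem negligible_combination_of_cubes:
  fixes v :: "'i \<Rightarrow> nat \<Rightarrow> real ^ 'n::{finite,linorder}"
  assumes z: "(\<Sum>i\<in>I. c i *\<^sub>R wedge k (v i)) = 0"
  shows "(\<Sum>i\<in>I. c i *\<^sub>R cube_cell k 0 (v i)) \<in> negligible_currents k"
proof (rule ccontr)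
  assume "\<not> ?thesis"
  then obtain l :: "'n current \<Rightarrow> real" where l0: "linear l" "\<forall>T\<in>negligible_currents k. l T = 0"
    and ne: "l (\<Sum>i\<in>I. c i *\<^sub>R cube_cell k 0 (v i)) \<noteq> 0"
    using linear_functional_separating[OF subspace_negligible] by blast
  have l: "linear l" "\<And>T. T \<in> negligible_currents k \<Longrightarrow> l T = 0" using l0 by blast+
  define f where "f = (\<lambda>v. l (cube_cell k 0 v))"
  have alt: "alternating_form k f" unfolding f_def by (rule alternating_form_functional[OF l])
  let ?e = "\<lambda>J. f (\<lambda>j. axis (sorted_list_of_set J ! j) 1)"
  have "l (\<Sum>i\<in>I. c i *\<^sub>R cube_cell k 0 (v i)) = (\<Sum>i\<in>I. c i * f (v i))"
    by (simp add: linear_sum[OF l(1)] linear_scale[OF l(1)] f_def)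
  also have "\<dots> = (\<Sum>i\<in>I. \<Sum>J | card J = k. c i * (wedge k (v i) $ J * ?e J))"
    by (subst alternating_form_eq_wedge[OF alt]) (simp add: sum_distrib_left)
  also have "\<dots> = (\<Sum>J | card J = k. (\<Sum>i\<in>I. c i *\<^sub>R wedge k (v i)) $ J * ?e J)"
    by (subst sum.swap) (simp add: sum_distrib_right sum_component mult.assoc)
  also have "\<dots> = 0" by (simp add: z)
  finally show False using ne by simp
qed

section \<open>Tiling and filling\<close>

lemma norm_wedge_slot_le:
  fixes w :: "nat \<Rightarrow> real ^ 'n::{finite,linorder}"
  assumes i: "i < k"
  shows "\<exists>C\<ge>0. \<forall>u. norm (wedge k (w(i := u))) \<le> C * norm u"
proof -
  let ?K = "real (CARD('n set)) * fact k"
  define C where "C = ?K * (\<Prod>j\<in>{..<k} - {i}. norm (w j))"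
  have "norm (wedge k (w(i := u))) \<le> C * norm u" for u
  proof -
    have "(\<Prod>j<k. norm ((w(i := u)) j)) = norm u * (\<Prod>j\<in>{..<k} - {i}. norm (w j))"
      using i by (subst prod.remove[of _ i]) auto
    then show ?thesis using norm_wedge_le[of k "w(i := u)"] by (simp add: C_def mult_ac)
  qed
  moreover have "C \<ge> 0" by (simp add: C_def prod_nonneg)
  ultimately show ?thesis by blast
qed

lemma small_prism_walls_slot:
  fixes V :: "(real, 'n) vec \<Rightarrow> nat \<Rightarrow> (real, 'n::{finite,linorder}) vec"
  assumes slot: "\<And>j. j \<in> {2..k} \<Longrightarrow> \<exists>i<k. \<exists>w. \<forall>u. V u \<circ> skip j = w(i := u)"
  shows "\<exists>C\<ge>0. \<forall>x u. small_chain k (C * norm u) (prism_walls k x (V u))"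
proof -
  have "\<exists>c\<ge>0. \<forall>u. norm (wedge k (V u \<circ> skip j)) \<le> c * norm u" if j: "j \<in> {2..k}" for j
  proof -
    obtain i w where i: "i < k" and w: "\<And>u. V u \<circ> skip j = w(i := u)" using slot[OF j] by blast
    show ?thesis using norm_wedge_slot_le[OF i, of w] unfolding w .
  qed
  then obtain c where c: "\<And>j. j \<in> {2..k} \<Longrightarrow> 0 \<le> c j"
    "\<And>j u. j \<in> {2..k} \<Longrightarrow> norm (wedge k (V u \<circ> skip j)) \<le> c j * norm u" by metis
  define C where "C = (\<Sum>j\<in>{2..k}. 2 * c j)"
  have "small_chain k (C * norm u) (prism_walls k x (V u))" for x u
    using small_chain_prism_walls[of k "V u" "\<lambda>j. c j * norm u" x] c(2)
    by (simp add: C_def sum_distrib_right mult.assoc)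
  moreover have "C \<ge> 0" unfolding C_def by (rule sum_nonneg) (use c(1) in auto)
  ultimately show ?thesis by blast
qed

text \<open>A small translation of a cell changes it by a cycle and walls of small mass.\<close>

lemma translation_walls:
  fixes v :: "nat \<Rightarrow> real ^ 'n::{finite,linorder}"
  shows "\<exists>C\<ge>0. \<forall>x u. \<exists>Q. small_chain k (C * norm u) Q \<and> cycle k (cube_cell k (x + u) v - cube_cell k x v - Q)"
proof (cases "k = 0")
  case True
  have "(\<lambda>x. axis {} 1) \<in> (smooth_forms 0 :: ((real, 'n) vec \<Rightarrow> (real, 'n set) vec) set)"
    by (intro smooth_formsI Cm_const) (auto simp: kvectors_def axis_def)
  then have "cycle k (cube_cell k (x + u) v - cube_cell k x v - 0)" for x u
    using True by (simp add: cycle_def fun_apply_simps cell_apply)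
  then show ?thesis by (intro exI[of _ 0]) (auto intro: exI[of _ 0] small_chain_0)
next
  case False
  then have k: "1 \<le> k" and k0: "0 < k" by auto
  obtain C0 where C0: "C0 \<ge> 0" "\<And>u. norm (wedge k (v(0 := u))) \<le> C0 * norm u" using norm_wedge_slot_le[OF k0] by blast
  have "\<exists>i<k. \<exists>w. \<forall>u. slot_frame (v 0) u v \<circ> skip j = w(i := u)" if "j \<in> {2..k}" for j
    by (rule exI[of _ 1]) (use that in \<open>auto intro!: exI[of _ "slot_frame (v 0) 0 v \<circ> skip j"] simp: fun_eq_iff slot_frame_def skip_def\<close>)
  from small_prism_walls_slot[OF this]
  obtain C1 where C1: "C1 \<ge> 0" "\<And>x u. small_chain k (C1 * norm u) (prism_walls k x (slot_frame (v 0) u v))" by blast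
  have "\<exists>i<k. \<exists>w. \<forall>u. slot_frame u (v 0) v \<circ> skip j = w(i := u)" if "j \<in> {2..k}" for j
    by (rule exI[of _ 0]) (use that in \<open>auto intro!: exI[of _ "slot_frame 0 (v 0) v \<circ> skip j"] simp: fun_eq_iff slot_frame_def skip_def\<close>)
  from small_prism_walls_slot[OF this]
  obtain C2 where C2: "C2 \<ge> 0" "\<And>x u. small_chain k (C2 * norm u) (prism_walls k x (slot_frame u (v 0) v))" by blast
  have "\<exists>Q. small_chain k ((2 * C0 + C1 + C2) * norm u) Q \<and> cycle k (cube_cell k (x + u) v - cube_cell k x v - Q)" for x u
  proof -
    let ?E1 = "prism_walls k x (slot_frame (v 0) u v)" and ?E2 = "prism_walls k x (slot_frame u (v 0) v)"
    let ?Z1 = "cube_cell k (x + v 0) (v(0 := u)) + cube_cell k x (v(0 := v 0)) - cube_cell k x (v(0 := v 0 + u)) + ?E1"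
    let ?Z2 = "cube_cell k (x + u) (v(0 := v 0)) + cube_cell k x (v(0 := u)) - cube_cell k x (v(0 := u + v 0)) + ?E2"
    define Q where "Q = cube_cell k (x + v 0) (v(0 := u)) - cube_cell k x (v(0 := u)) + (?E1 - ?E2)"
    have "cycle k (?Z2 - ?Z1)" by (rule cycle_diff[OF prism_cycle[OF k] prism_cycle[OF k]])
    moreover have "?Z2 - ?Z1 = cube_cell k (x + u) v - cube_cell k x v - Q"
    proof -
      have "(Cu + E - B + F2) - (A + G - B + F1) = Cu - G - (A - E + (F1 - F2))" for A B Cu E F1 F2 G :: "'n current"
        by (simp only: algebra_simps)
      from this[of "cube_cell k (x + u) v" "cube_cell k x (v(0 := u))" "cube_cell k x (v(0 := v 0 + u))" ?E2 "cube_cell k (x + v 0) (v(0 := u))" "cube_cell k x v" ?E1]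
      show ?thesis by (simp only: Q_def add.commute[of u "v 0"] fun_upd_triv)
    qed
    ultimately have cyc: "cycle k (cube_cell k (x + u) v - cube_cell k x v - Q)" by (simp only:)
    have c: "small_chain k (C0 * norm u) (cube_cell k y (v(0 := u)))" for y
      by (rule small_chain_mono[OF small_chain_single C0(2)]) simp
    have "small_chain k ((C0 * norm u + C0 * norm u) + (C1 * norm u + C2 * norm u)) Q"
      unfolding Q_def by (intro small_chain_add small_chain_diff c C1(2) C2(2))
    moreover have "(C0 * norm u + C0 * norm u) + (C1 * norm u + C2 * norm u) = (2 * C0 + C1 + C2) * norm u"
      by (simp add: algebra_simps)
    ultimately show ?thesis using cyc by metis
  qed
  then show ?thesis using C0(1) C1(1) C2(1) by (intro exI[of _ "2 * C0 + C1 + C2"]) auto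
qed

text \<open>
  For parallel edges the walls degenerate, and additivity is exact up to cycles.
\<close>

lemma cycle_add_parallel:
  fixes v :: "nat \<Rightarrow> real ^ 'n::{finite,linorder}"
  assumes k: "1 \<le> k"
  shows "cycle k (cube_cell k (x + s *\<^sub>R a) (v(0 := a)) + cube_cell k x (v(0 := s *\<^sub>R a)) - cube_cell k x (v(0 := (s + 1) *\<^sub>R a)))"
proof -
  have "prism_walls k x (slot_frame (s *\<^sub>R a) a v) = 0"
    unfolding prism_walls_def
  proof (rule sum.neutral, rule ballI)
    fix j assume j: "j \<in> {2..k}"
    define w where "w = slot_frame a a v \<circ> skip j"
    have e: "slot_frame (s *\<^sub>R a) a v \<circ> skip j = w(0 := s *\<^sub>R a)"
      using j by (auto simp: w_def fun_eq_iff slot_frame_def skip_def)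
    have "w(0 := a) = w" using j by (auto simp: w_def fun_eq_iff slot_frame_def skip_def)
    moreover have "wedge k w = 0"
      using j by (intro wedge_eq_zero[of 0 1]) (auto simp: w_def slot_frame_def skip_def)
    ultimately have "wedge k (slot_frame (s *\<^sub>R a) a v \<circ> skip j) = 0"
      unfolding e using k wedge_scale[of 0 k w s a] by simp
    then show "(-1)^j *\<^sub>R (cell k (prism k) (x + slot_frame (s *\<^sub>R a) a v j) (slot_frame (s *\<^sub>R a) a v \<circ> skip j) -
        cell k (prism k) x (slot_frame (s *\<^sub>R a) a v \<circ> skip j)) = 0"
      by (simp add: cell_wedge_zero)
  qed
  then show ?thesis using prism_cycle[OF k, of x "s *\<^sub>R a" v a] by (simp add: scaleR_add_left)
qed

lemma cycle_stack_slot_0: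
  fixes v :: "nat \<Rightarrow> real ^ 'n::{finite,linorder}"
  assumes k: "1 \<le> k"
  shows "cycle k (cube_cell k x (v(0 := real n *\<^sub>R a)) - (\<Sum>i\<leftarrow>[0..<n]. cube_cell k (x + real i *\<^sub>R a) (v(0 := a))))"
proof (induction n)
  case 0
  have "wedge k (v(0 := 0)) = 0" using k wedge_scale[of 0 k v 0 0] by simp
  then have "cube_cell k x (v(0 := 0)) = 0" by (rule cell_wedge_zero)
  then show ?case by (simp add: cycle_0 del: fun_upd_apply)
next
  case (Suc n)
  define f where "f = (\<lambda>i. cube_cell k (x + real i *\<^sub>R a) (v(0 := a)))"
  define c where "c = (\<lambda>t. cube_cell k x (v(0 := t *\<^sub>R a)))"
  have "cycle k ((c (real n) - (\<Sum>i\<leftarrow>[0..<n]. f i)) - (f n + c (real n) - c (real n + 1)))"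
    unfolding f_def c_def by (rule cycle_diff[OF Suc cycle_add_parallel[OF k]])
  moreover have "(c (real n) - (\<Sum>i\<leftarrow>[0..<n]. f i)) - (f n + c (real n) - c (real n + 1)) = c (real (Suc n)) - (\<Sum>i\<leftarrow>[0..<Suc n]. f i)"
    by (simp add: algebra_simps)
  ultimately show ?case unfolding f_def c_def by (simp only:)
qed

lemma cycle_stack:
  fixes v :: "nat \<Rightarrow> real ^ 'n::{finite,linorder}"
  assumes j: "j < k"
  shows "cycle k (cube_cell k x (v(j := real n *\<^sub>R a)) - (\<Sum>i\<leftarrow>[0..<n]. cube_cell k (x + real i *\<^sub>R a) (v(j := a))))"
proof -
  let ?t = "Transposition.transpose 0 j"
  have k: "1 \<le> k" using j by simp
  have p: "?t permutes {..<k}" using j by (intro permutes_swap_id) auto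
  define s :: real where "s = of_int (sign ?t)"
  have upd: "(v(j := y)) \<circ> ?t = (v \<circ> ?t)(0 := y)" for y
    by (auto simp: fun_eq_iff Transposition.transpose_def)
  have e: "cube_cell k z (v(j := y)) = s *\<^sub>R cube_cell k z ((v \<circ> ?t)(0 := y))" for z y
    using cube_cell_permute[OF p, of z "v(j := y)"] unfolding upd s_def .
  show ?thesis unfolding e
    using cycle_scaleR[OF cycle_stack_slot_0[OF k, of x "v \<circ> ?t" n a], of s]
    by (simp add: scaleR_diff_right linear_sum_list[OF linear_scaleR])
qed

lemma cycle_sum_list_diff:
  "(\<And>x. x \<in> set xs \<Longrightarrow> cycle k (f x - g x)) \<Longrightarrow> cycle k ((\<Sum>x\<leftarrow>xs. f x) - (\<Sum>x\<leftarrow>xs. g x))"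
  using cycle_sum_list[of xs k "\<lambda>x. f x - g x"] by (simp add: sum_list_diff)

lemma cycle_trans: "cycle k (S - T) \<Longrightarrow> cycle k (T - U) \<Longrightarrow> cycle k (S - U)"
  using cycle_add[of k "S - T" "T - U"] by simp

lemma tiling:
  fixes v :: "nat \<Rightarrow> real ^ 'n::{finite,linorder}"
  assumes N: "N > 0"
  shows "\<exists>zs. length zs = N ^ k \<and>
    (\<forall>x. cycle k (cube_cell k x v - (\<Sum>z\<leftarrow>zs. cube_cell k (x + z) (\<lambda>j. (1 / real N) *\<^sub>R v j))))"
proof -
  define D where "D = (\<lambda>m j. if j < m then (1 / real N) *\<^sub>R v j else v j)"
  have "\<exists>zs. length zs = N ^ m \<and> (\<forall>x. cycle k (cube_cell k x v - (\<Sum>z\<leftarrow>zs. cube_cell k (x + z) (D m))))"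
    if "m \<le> k" for m
    using that
  proof (induction m)
    case 0
    have "D 0 = v" by (auto simp: D_def)
    then show ?case by (intro exI[of _ "[0]"]) (simp add: cycle_0)
  next
    case (Suc m)
    then obtain zs where zs: "length zs = N ^ m" "\<And>x. cycle k (cube_cell k x v - (\<Sum>z\<leftarrow>zs. cube_cell k (x + z) (D m)))" by auto
    let ?a = "(1 / real N) *\<^sub>R v m"
    define zs' where "zs' = concat (map (\<lambda>z. map (\<lambda>i. z + real i *\<^sub>R ?a) [0..<N]) zs)"
    have "length zs' = N ^ Suc m"
    proof -
      have "length (concat (map (\<lambda>z. map (\<lambda>i. z + real i *\<^sub>R ?a) [0..<N]) zs)) = length zs * N" for zs
        by (induction zs) auto
      then show ?thesis by (simp add: zs'_def zs(1))
    qed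
    moreover have "cycle k (cube_cell k x v - (\<Sum>z\<leftarrow>zs'. cube_cell k (x + z) (D (Suc m))))" for x
    proof (rule cycle_trans[OF zs(2)])
      have D1: "(D m)(m := real N *\<^sub>R ?a) = D m" "(D m)(m := ?a) = D (Suc m)"
        using N by (auto simp: D_def fun_eq_iff less_Suc_eq)
      have "cycle k (cube_cell k y (D m) - (\<Sum>i\<leftarrow>[0..<N]. cube_cell k (y + real i *\<^sub>R ?a) (D (Suc m))))" for y
        using cycle_stack[of m k y "D m" N ?a] Suc.prems unfolding D1 by simp
      then have "cycle k ((\<Sum>z\<leftarrow>zs. cube_cell k (x + z) (D m)) -
          (\<Sum>z\<leftarrow>zs. \<Sum>i\<leftarrow>[0..<N]. cube_cell k ((x + z) + real i *\<^sub>R ?a) (D (Suc m))))"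
        by (intro cycle_sum_list_diff)
      then show "cycle k ((\<Sum>z\<leftarrow>zs. cube_cell k (x + z) (D m)) - (\<Sum>z\<leftarrow>zs'. cube_cell k (x + z) (D (Suc m))))"
        by (simp add: zs'_def sum_list_concat comp_def add.assoc)
    qed
    ultimately show ?case by blast
  qed
  from this[of k] obtain zs where zs: "length zs = N ^ k"
    "\<And>x. cycle k (cube_cell k x v - (\<Sum>z\<leftarrow>zs. cube_cell k (x + z) (D k)))" by auto
  have "cube_cell k y (D k) = cube_cell k y (\<lambda>j. (1 / real N) *\<^sub>R v j)" for y
    by (rule cell_cong) (simp add: D_def)
  then show ?thesis using zs by auto
qed

text \<open>
  The entries of the list are a weight, a base point and a frame.  A list allows cells to occur repeatedly.
\<close>

definition cells :: "nat \<Rightarrow> (real \<times> (real ^ 'n::{finite,linorder}) \<times> (nat \<Rightarrow> real ^ 'n::{finite,linorder})) list \<Rightarrow> 'n current" where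
  "cells k ps = (\<Sum>(b, x, v)\<leftarrow>ps. b *\<^sub>R cube_cell k x v)"

text \<open>
  The difference between the cube and the combination is negligible: its average over some
  translations \<open>us\<close> is small up to cycles.  The cube is tiled by \<open>N\<^sup>k\<close> copies of itself scaled by \<open>1 / N\<close>, and
  each of them is treated by the scaled average.  The errors scale by \<open>N\<^sup>-\<^sup>k\<close> and occur \<open>N\<^sup>k\<close> times, so they stay
  small, whereas the translations become as short as \<open>|u| / N\<close>; moving the averaged tilings back to
  the original position then costs little.  The claim about \<open>g\<close> expresses that the cells are parallel to the given
  multivectors and have the right total weight.
\<close>

theorem cube_filling:
  fixes e :: "nat \<Rightarrow> real ^ 'n::{finite,linorder}" and w :: "nat \<Rightarrow> nat \<Rightarrow> real ^ 'n::{finite,linorder}"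
  assumes comb: "wedge k e = (\<Sum>i<n. b i *\<^sub>R wedge k (w i))" and \<epsilon>: "\<epsilon> > 0"
  obtains ps Q where "small_chain k \<epsilon> Q" "cycle k (cube_cell k 0 e - cells k ps - Q)"
    "\<And>g :: real ^ ('n set) \<Rightarrow> real. (\<And>t \<xi>. simple_kvector k \<xi> \<Longrightarrow> 0 \<le> t \<Longrightarrow> g (t *\<^sub>R \<xi>) = t * g \<xi>) \<Longrightarrow>
       (\<Sum>(b, x, v)\<leftarrow>ps. g (b *\<^sub>R wedge k v)) = (\<Sum>i<n. g (b i *\<^sub>R wedge k (w i)))"
proof -
  define X where "X = cube_cell k 0 e - (\<Sum>i<n. b i *\<^sub>R cube_cell k 0 (w i))"
  have "X \<in> negligible_currents k"
  proof -
    define c where "c = (\<lambda>i. if i < n then - b i else 1)"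
    define v where "v = (\<lambda>i. if i < n then w i else e)"
    have sp: "(\<Sum>i<Suc n. c i *\<^sub>R f (v i)) = f e - (\<Sum>i<n. b i *\<^sub>R f (w i))" for f :: "(nat \<Rightarrow> (real, 'n) vec) \<Rightarrow> 'b::real_vector"
    proof -
      have "(\<Sum>i<n. c i *\<^sub>R f (v i)) = (\<Sum>i<n. - (b i *\<^sub>R f (w i)))" by (rule sum.cong) (auto simp: c_def v_def)
      then show ?thesis by (simp add: c_def v_def sum_negf)
    qed
    have "(\<Sum>i<Suc n. c i *\<^sub>R wedge k (v i)) = 0" unfolding sp by (simp add: comb)
    from negligible_combination_of_cubes[OF this]
    show ?thesis unfolding sp X_def .
  qed
  then obtain us Q1 where us: "us \<noteq> []" "small_chain k (\<epsilon>/2) Q1" "cycle k (avg k us X - Q1)"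
    using \<epsilon> by (auto elim: negligible_currentsD[of X k "\<epsilon>/2"])
  obtain C where C: "C \<ge> 0" "\<And>x u. \<exists>Q. small_chain k (C * norm u) Q \<and> cycle k (cube_cell k (x + u) e - cube_cell k x e - Q)"
    using translation_walls[of k e] by blast
  define R where "R = Max (norm ` set us)"
  have R: "norm u \<le> R" if "u \<in> set us" for u using that by (simp add: R_def)
  have R0: "R \<ge> 0" using R us(1) by (meson hd_in_set norm_ge_zero order_trans)
  \<comment> \<open>Translations by vectors of length at most \<open>R / N\<close> cost at most \<open>\<epsilon> / 2\<close>.\<close>
  obtain N :: nat where N: "real N > 2 * C * R / \<epsilon>" "N > 0"
    using reals_Archimedean2[of "max (2 * C * R / \<epsilon>) 0"] by (metis max_less_iff_conj of_nat_0_less_iff)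
  obtain zs where zs: "length zs = N ^ k"
    "\<And>x. cycle k (cube_cell k x e - (\<Sum>z\<leftarrow>zs. cube_cell k (x + z) (\<lambda>j. (1 / real N) *\<^sub>R e j)))"
    using tiling[OF N(2), of k e] by blast
  define r where "r = 1 / real N"
  define L where "L = real (length us)"
  have L: "L > 0" using us(1) by (simp add: L_def)
  have r: "r > 0" using N(2) by (simp add: r_def)
  \<comment> \<open>Scaling by \<open>1 / N\<close>, followed by distribution over the tiling.\<close>
  define push where "push = (\<lambda>T. \<Sum>z\<leftarrow>zs. aff_push k 1 z (aff_push k r 0 T) :: 'n current)"
  have lin: "linear push"
    unfolding push_def by (rule linearI)
      (simp_all add: linear_add[OF linear_aff_push] linear_scale[OF linear_aff_push] sum_list_add linear_sum_list[OF linear_scaleR])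
  have push_cell: "push (cube_cell k u v) = (\<Sum>z\<leftarrow>zs. cube_cell k (r *\<^sub>R u + z) (\<lambda>j. r *\<^sub>R v j))" for u v
    unfolding push_def by (simp add: aff_push_cell)
  have push_cycle: "cycle k T \<Longrightarrow> cycle k (push T)" for T
    unfolding push_def by (intro cycle_sum_list cycle_aff_push)
  have smallQ1: "small_chain k (\<epsilon>/2) (push Q1)"
  proof -
    have "small_chain k (\<Sum>z\<leftarrow>zs. \<bar>r\<bar> ^ k * (\<epsilon>/2)) (push Q1)"
      unfolding push_def by (intro small_chain_sum_list small_chain_translate small_chain_aff_push us(2))
    moreover have "(\<Sum>z\<leftarrow>zs. \<bar>r\<bar> ^ k * (\<epsilon>/2)) = \<epsilon>/2"
      using N(2) zs(1) by (simp add: sum_list_const_scaleR r_def power_divide)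
    ultimately show ?thesis by (simp only:)
  qed
  have avgX: "avg k us X = (1 / L) *\<^sub>R (\<Sum>u\<leftarrow>us. cube_cell k u e) - (1 / L) *\<^sub>R (\<Sum>u\<leftarrow>us. \<Sum>i<n. b i *\<^sub>R cube_cell k u (w i))"
    by (simp add: avg_def X_def L_def linear_diff[OF linear_aff_push] linear_sum[OF linear_aff_push]
        linear_scale[OF linear_aff_push] aff_push_cell sum_list_diff scaleR_diff_right)
  define ps where "ps = concat (map (\<lambda>u. concat (map (\<lambda>z. map (\<lambda>i. (b i / L, r *\<^sub>R u + z, \<lambda>j. r *\<^sub>R w i j)) [0..<n]) zs)) us)"
  have ps_sum: "(\<Sum>p\<leftarrow>ps. F p) = (\<Sum>u\<leftarrow>us. \<Sum>z\<leftarrow>zs. \<Sum>i<n. F (b i / L, r *\<^sub>R u + z, \<lambda>j. r *\<^sub>R w i j))"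
    for F :: "_ \<Rightarrow> 'b::comm_monoid_add"
    by (simp add: ps_def sum_list_concat comp_def interv_sum_list_conv_sum_set_nat atLeast0LessThan)
  have cells_ps: "cells k ps = push ((1 / L) *\<^sub>R (\<Sum>u\<leftarrow>us. \<Sum>i<n. b i *\<^sub>R cube_cell k u (w i)))"
  proof -
    have "(\<Sum>z\<leftarrow>zs. \<Sum>i<n. (b i / L) *\<^sub>R cube_cell k (r *\<^sub>R u + z) (\<lambda>j. r *\<^sub>R w i j)) =
        (1 / L) *\<^sub>R (\<Sum>i<n. b i *\<^sub>R push (cube_cell k u (w i)))" for u
    proof -
      have "(\<Sum>z\<leftarrow>zs. \<Sum>i<n. (b i / L) *\<^sub>R cube_cell k (r *\<^sub>R u + z) (\<lambda>j. r *\<^sub>R w i j)) =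
          (\<Sum>i<n. \<Sum>z\<leftarrow>zs. (b i / L) *\<^sub>R cube_cell k (r *\<^sub>R u + z) (\<lambda>j. r *\<^sub>R w i j))"
        by (induction zs) (auto simp: sum.distrib)
      also have "\<dots> = (\<Sum>i<n. (b i / L) *\<^sub>R push (cube_cell k u (w i)))"
        by (simp add: push_cell linear_sum_list[OF linear_scaleR])
      finally show ?thesis by (simp add: scaleR_sum_right)
    qed
    then show ?thesis
      by (simp add: cells_def ps_sum linear_scale[OF lin] linear_sum_list[OF lin] linear_sum[OF lin] linear_sum_list[OF linear_scaleR])
  qed
  have "\<exists>Q. small_chain k (\<epsilon>/2) Q \<and> cycle k (push ((1 / L) *\<^sub>R (\<Sum>u\<leftarrow>us. cube_cell k u e)) - cube_cell k 0 e - Q)"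
  proof -
    obtain Qw where Qw: "\<And>u. small_chain k (C * norm (r *\<^sub>R u)) (Qw u)"
      "\<And>u. cycle k (cube_cell k (0 + r *\<^sub>R u) e - cube_cell k 0 e - Qw u)"
    proof -
      have "\<forall>u. \<exists>Q. small_chain k (C * norm (r *\<^sub>R u)) Q \<and> cycle k (cube_cell k (0 + r *\<^sub>R u) e - cube_cell k 0 e - Q)"
        using C(2) by (intro allI)
      then show ?thesis using that by (auto dest!: choice)
    qed
    define Q where "Q = (1 / L) *\<^sub>R (\<Sum>u\<leftarrow>us. Qw u)"
    have "cycle k (push (cube_cell k u e) - (cube_cell k 0 e + Qw u))" for u
    proof -
      have "cycle k (push (cube_cell k u e) - cube_cell k (r *\<^sub>R u) e)"
        using cycle_scaleR[OF zs(2)[of "r *\<^sub>R u"], of "-1"] by (simp add: push_cell r_def)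
      moreover have "cycle k (cube_cell k (r *\<^sub>R u) e - (cube_cell k 0 e + Qw u))"
        using Qw(2)[of u] by (simp add: algebra_simps)
      ultimately show ?thesis by (rule cycle_trans)
    qed
    then have "cycle k ((1 / L) *\<^sub>R ((\<Sum>u\<leftarrow>us. push (cube_cell k u e)) - (\<Sum>u\<leftarrow>us. cube_cell k 0 e + Qw u)))"
      by (intro cycle_scaleR cycle_sum_list_diff)
    moreover have "(1 / L) *\<^sub>R (\<Sum>u\<leftarrow>us. cube_cell k 0 e + Qw u) = cube_cell k 0 e + Q"
      using L by (simp add: sum_list_add scaleR_add_right Q_def sum_list_const_scaleR L_def)
    ultimately have "cycle k (push ((1 / L) *\<^sub>R (\<Sum>u\<leftarrow>us. cube_cell k u e)) - cube_cell k 0 e - Q)"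
      by (simp add: linear_scale[OF lin] linear_sum_list[OF lin] scaleR_diff_right algebra_simps)
    moreover have "small_chain k (\<epsilon>/2) Q"
    proof -
      have b: "C * norm (r *\<^sub>R u) \<le> \<epsilon>/2" if "u \<in> set us" for u
      proof -
        have "C * norm (r *\<^sub>R u) \<le> C * R / real N"
          using mult_left_mono[OF R[OF that] C(1)] N(2) by (simp add: r_def divide_right_mono)
        also have "\<dots> \<le> \<epsilon>/2" using N \<epsilon> by (simp add: field_simps)
        finally show ?thesis .
      qed
      have "small_chain k (\<Sum>u\<leftarrow>us. \<epsilon>/2) (\<Sum>u\<leftarrow>us. Qw u)"
        by (intro small_chain_sum_list small_chain_mono[OF Qw(1) b])
      from small_chain_scaleR[OF this, of "1 / L"] show ?thesis
        using L by (simp add: Q_def sum_list_const_scaleR L_def)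
    qed
    ultimately show ?thesis by blast
  qed
  then obtain Q2 where Q2: "small_chain k (\<epsilon>/2) Q2"
    "cycle k (push ((1 / L) *\<^sub>R (\<Sum>u\<leftarrow>us. cube_cell k u e)) - cube_cell k 0 e - Q2)" by blast
  show ?thesis
  proof (rule that[of "push Q1 - Q2" ps])
    show "small_chain k \<epsilon> (push Q1 - Q2)" using small_chain_diff[OF smallQ1 Q2(1)] by simp
    have "cycle k (push (avg k us X - Q1))" by (rule push_cycle[OF us(3)])
    then have "cycle k (push ((1 / L) *\<^sub>R (\<Sum>u\<leftarrow>us. cube_cell k u e)) - cells k ps - push Q1)"
      unfolding avgX cells_ps by (simp add: linear_diff[OF lin])
    from cycle_diff[OF this Q2(2)]
    show "cycle k (cube_cell k 0 e - cells k ps - (push Q1 - Q2))" by (simp add: algebra_simps)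
    fix g :: "real ^ ('n set) \<Rightarrow> real"
    assume g: "\<And>t \<xi>. simple_kvector k \<xi> \<Longrightarrow> 0 \<le> t \<Longrightarrow> g (t *\<^sub>R \<xi>) = t * g \<xi>"
    have gi: "g ((b i / L) *\<^sub>R wedge k (\<lambda>j. r *\<^sub>R w i j)) = (r ^ k / L) * g (b i *\<^sub>R wedge k (w i))" for i
    proof -
      have 1: "simple_kvector k (b i *\<^sub>R wedge k (w i))" unfolding simple_kvector_def by blast
      have 2: "0 \<le> r ^ k / L" using L r by simp
      have 3: "(b i / L) *\<^sub>R wedge k (\<lambda>j. r *\<^sub>R w i j) = (r ^ k / L) *\<^sub>R (b i *\<^sub>R wedge k (w i))"
        by (simp add: wedge_scale_all mult.commute)
      show ?thesis unfolding 3 by (rule g[OF 1 2])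
    qed
    define G where "G = (\<Sum>i<n. g (b i *\<^sub>R wedge k (w i)))"
    have "(\<Sum>(b, x, v)\<leftarrow>ps. g (b *\<^sub>R wedge k v)) = (\<Sum>u\<leftarrow>us. \<Sum>z\<leftarrow>zs. \<Sum>i<n. (r ^ k / L) * g (b i *\<^sub>R wedge k (w i)))"
      by (simp add: ps_sum gi)
    also have "\<dots> = (\<Sum>u\<leftarrow>us. \<Sum>z\<leftarrow>zs. (r ^ k / L) * G)" unfolding G_def by (simp only: sum_distrib_left)
    also have "\<dots> = L * real (N ^ k) * ((r ^ k / L) * G)"
      unfolding sum_list_const_scaleR zs(1) L_def by (simp only: real_scaleR_def mult.assoc)
    also have "\<dots> = G" using L N(2) by (simp add: r_def power_divide)
    also have "\<dots> = (\<Sum>i<n. g (b i *\<^sub>R wedge k (w i)))" unfolding G_def ..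
    finally show "(\<Sum>(b, x, v)\<leftarrow>ps. g (b *\<^sub>R wedge k v)) = (\<Sum>i<n. g (b i *\<^sub>R wedge k (w i)))" .
  qed
qed

section \<open>Densities of cells\<close>

lemma borel_plane: "plane k x (v :: nat \<Rightarrow> 'a::euclidean_space) \<in> sets borel"
  using closed_plane by (rule borel_closed)

text \<open>
  So orientations of the cells in one plane are proportional.
\<close>

lemma plane_eq_imp_span_eq:
  fixes v w :: "nat \<Rightarrow> 'a::real_vector"
  assumes "plane k x v = plane k y w"
  shows "span (v ` {..<k}) = span (w ` {..<k})"
proof -
  have "u \<in> span (w ` {..<k})" if P: "plane k x v = plane k y w" and u: "u \<in> span (v ` {..<k})" for u x y and v w :: "nat \<Rightarrow> 'a"
  proof -
    have "x + u \<in> plane k y w" using u unfolding P[symmetric] by (simp add: plane_def)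
    moreover have "x \<in> plane k y w" unfolding P[symmetric] by (rule base_in_plane)
    ultimately have "(x + u - y) - (x - y) \<in> span (w ` {..<k})" unfolding plane_def mem_Collect_eq by (rule span_diff)
    then show ?thesis by simp
  qed
  from this[OF assms] this[OF assms[symmetric]] show ?thesis by blast
qed

lemma dim_span_frame:
  fixes v :: "nat \<Rightarrow> 'a::euclidean_space"
  assumes "indep_frame k v"
  shows "dim (span (v ` {..<k})) = k"
  using assms dim_eq_card_independent[of "v ` {..<k}"] by (simp add: indep_frame_def card_image)

text \<open>
  The area of the parallelepiped spanned by the frame.
\<close>

definition area_factor :: "nat \<Rightarrow> 'a::euclidean_space \<Rightarrow> (nat \<Rightarrow> 'a) \<Rightarrow> real" where
  "area_factor k x v = (SOME c. c > 0 \<and> distr (leb_Rk k) borel (aff k x v) =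
    density (hausdorff_measure k) (\<lambda>p. ennreal (indicator (plane k x v) p / c)))"

lemma area_factor:
  assumes "indep_frame k v"
  shows "area_factor k x v > 0" "distr (leb_Rk k) borel (aff k x v) =
    density (hausdorff_measure k) (\<lambda>p. ennreal (indicator (plane k x v) p / area_factor k x v))"
  using someI_ex[OF hausdorff_plane[OF assms, of x, unfolded Bex_def], folded area_factor_def] by auto

context
  fixes k and x :: "'a::euclidean_space" and v c
  assumes ind: "indep_frame k v"
  defines "c \<equiv> area_factor k x v"
begin

text \<open>
  Integration over a cell with respect to Lebesgue measure of the parameters is integration over its
  image with respect to Hausdorff measure, up to a constant factor.
\<close>

lemma cell_integral:
  fixes u :: "'a \<Rightarrow> real"
  assumes A: "A \<in> sets (leb_Rk k)" and u[measurable]: "u \<in> borel_measurable borel"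
  shows "(LINT y:A|leb_Rk k. u (aff k x v y)) = (LINT p|hausdorff_measure k. indicator (aff k x v ` A) p / c * u p)"
    and "set_integrable (leb_Rk k) A (\<lambda>y. u (aff k x v y)) \<Longrightarrow>
      integrable (hausdorff_measure k) (\<lambda>p. indicator (aff k x v ` A) p / c * u p)"
proof -
  let ?H = "hausdorff_measure k :: 'a measure" and ?P = "plane k x v"
  note c = area_factor[OF ind, of x, folded c_def]
  note [measurable] = borel_plane[of k x v]
  have Pm: "(\<lambda>p. indicator ?P p / c) \<in> borel_measurable ?H" by measurable
  have P0: "AE p in ?H. 0 \<le> indicator ?P p / c" using c(1) by (simp add: indicator_def)
  have eq: "indicator ?P p / c * (indicator (aff k x v ` A) p * u) = indicator (aff k x v ` A) p / c * (u :: real)" for A p u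
    using aff_in_plane[of k x v] by (auto simp: indicator_def)
  have ai: "aff k x v y \<in> aff k x v ` A \<longleftrightarrow> y \<in> A" if A: "A \<in> sets (leb_Rk k)" and y: "y \<in> space (leb_Rk k)" for A y
  proof
    assume "aff k x v y \<in> aff k x v ` A"
    then obtain z where z: "z \<in> A" "aff k x v y = aff k x v z" by blast
    then have "restrict y {..<k} = restrict z {..<k}" using frame_coords_aff[OF ind, of x] by metis
    moreover have "restrict y {..<k} = y" "restrict z {..<k} = z"
      using y z(1) sets.sets_into_space[OF A] by (auto simp: space_PiM PiE_def extensional_restrict)
    ultimately show "y \<in> A" using z(1) by simp
  qed simp
  have [measurable]: "aff k x v ` A \<in> sets borel" by (rule borel_aff_image[OF ind A])
  let ?U = "\<lambda>p. indicator (aff k x v ` A) p * u p"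
  have U: "?U \<in> borel_measurable borel" by measurable
  have ind_eq: "indicator (aff k x v ` A) (aff k x v y) = (indicator A y :: real)" if "y \<in> space (leb_Rk k)" for y
    using ai[OF A that] by (simp add: indicator_def)
  have "(LINT y:A|leb_Rk k. u (aff k x v y)) = (LINT y|leb_Rk k. ?U (aff k x v y))"
    unfolding set_lebesgue_integral_def by (rule Bochner_Integration.integral_cong) (simp_all add: ind_eq)
  also have "\<dots> = (LINT p|distr (leb_Rk k) borel (aff k x v). ?U p)"
    by (rule integral_distr[OF measurable_aff U, symmetric])
  also have "\<dots> = (LINT p|?H. (indicator ?P p / c) *\<^sub>R ?U p)"
    unfolding c(2) by (rule integral_density[OF _ Pm P0]) (use U in simp)
  also have "\<dots> = (LINT p|?H. indicator (aff k x v ` A) p / c * u p)" by (simp only: real_scaleR_def eq)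
  finally show "(LINT y:A|leb_Rk k. u (aff k x v y)) = (LINT p|?H. indicator (aff k x v ` A) p / c * u p)" .
  assume "set_integrable (leb_Rk k) A (\<lambda>y. u (aff k x v y))"
  then have "integrable (leb_Rk k) (\<lambda>y. ?U (aff k x v y))"
    unfolding set_integrable_def by (subst Bochner_Integration.integrable_cong[OF refl]) (simp_all add: ind_eq)
  then have "integrable (distr (leb_Rk k) borel (aff k x v)) ?U"
    using integrable_distr_eq[OF measurable_aff U] by simp
  then have "integrable ?H (\<lambda>p. (indicator ?P p / c) *\<^sub>R ?U p)"
    unfolding c(2) by (subst (asm) integrable_density[OF _ Pm P0]) (use U in simp_all)
  then show "integrable ?H (\<lambda>p. indicator (aff k x v ` A) p / c * u p)" by (simp only: real_scaleR_def eq)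
qed

lemma null_set_in_plane:
  assumes E[measurable]: "E \<in> sets borel" "E \<subseteq> plane k x v" and null: "{y \<in> space (leb_Rk k). aff k x v y \<in> E} \<in> null_sets (leb_Rk k)"
  shows "E \<in> null_sets (hausdorff_measure k)"
proof -
  let ?H = "hausdorff_measure k :: 'a measure" and ?P = "plane k x v"
  note c = area_factor[OF ind, of x, folded c_def]
  note [measurable] = borel_plane[of k x v]
  have "emeasure (distr (leb_Rk k) borel (aff k x v)) E = 0"
  proof -
    have "aff k x v -` E \<inter> space (leb_Rk k) = {y \<in> space (leb_Rk k). aff k x v y \<in> E}" by auto
    then show ?thesis using null E(1) by (subst emeasure_distr) auto
  qed
  then have "(\<integral>\<^sup>+p. ennreal (indicator ?P p / c) * indicator E p \<partial>?H) = 0"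
    unfolding c(2) using E(1) by (subst (asm) emeasure_density) auto
  then have "AE p in ?H. ennreal (indicator ?P p / c) * indicator E p = 0"
    by (subst (asm) nn_integral_0_iff_AE) auto
  then have "AE p in ?H. p \<notin> E"
    by (rule AE_mp) (use E(2) c(1) in \<open>auto intro!: AE_I2 simp: indicator_def\<close>)
  then show "E \<in> null_sets ?H" using E(1) by (intro AE_iff_null_sets[THEN iffD2]) auto
qed

lemma cell_integral_const:
  assumes A: "A \<in> sets (leb_Rk k)" "A \<subseteq> unit_cube k"
  shows "integrable (hausdorff_measure k) (\<lambda>p. indicator (aff k x v ` A) p / c * s)"
    and "(LINT p|hausdorff_measure k. indicator (aff k x v ` A) p / c * s) = measure (leb_Rk k) A * s"
proof -
  show "integrable (hausdorff_measure k) (\<lambda>p. indicator (aff k x v ` A) p / c * s)"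
    by (rule cell_integral(2)[OF A(1)]) (use integrable_cell[where g="\<lambda>_. s" and x=x and v=v, OF continuous_on_const A] in auto)
  have "(LINT y:A|leb_Rk k. s) = measure (leb_Rk k) A * s"
    using sets.Int_space_eq2[OF A(1)] by (simp add: set_lebesgue_integral_def)
  then show "(LINT p|hausdorff_measure k. indicator (aff k x v ` A) p / c * s) = measure (leb_Rk k) A * s"
    using cell_integral(1)[OF A(1), of "\<lambda>_. s"] by simp
qed

end

lemma integrable_indicator_density:
  fixes K :: "'a::metric_space set"
  assumes "integrable M (\<lambda>p. indicator K p / c * (1::real))"
  shows "integrable M (\<lambda>p. indicator K p *\<^sub>R ((1 / c) *\<^sub>R (\<xi> :: 'b::{banach,second_countable_topology})))"
  using integrable_scaleR_left[OF assms, of \<xi>] by simp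

lemma bounded_aff_image:
  fixes v :: "nat \<Rightarrow> 'a::euclidean_space"
  assumes "A \<subseteq> unit_cube k"
  shows "\<exists>R. \<forall>p\<in>aff k x v ` A. norm p \<le> R"
  using aff_unit_cube_bound[of _ k x v] assms by (intro exI[of _ "norm x + (\<Sum>j<k. norm (v j))"]) blast

lemma cell_has_density:
  fixes v :: "nat \<Rightarrow> real ^ 'n::{finite,linorder}"
  assumes ind: "indep_frame k v" and A: "A \<in> sets (leb_Rk k)" "A \<subseteq> unit_cube k"
  shows "has_density k (cell k A x v) (\<lambda>p. indicator (aff k x v ` A) p *\<^sub>R ((1 / area_factor k x v) *\<^sub>R wedge k v))"
  unfolding has_density_def
proof (intro conjI ballI allI)
  let ?H = "hausdorff_measure k :: ((real, 'n) vec) measure"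
  define c where "c = area_factor k x v"
  show "integrable ?H (\<lambda>p. indicator (aff k x v ` A) p *\<^sub>R ((1 / area_factor k x v) *\<^sub>R wedge k v))"
    by (rule integrable_indicator_density[OF cell_integral_const(1)[OF ind A]])
  obtain R where R: "\<forall>p\<in>aff k x v ` A. norm p \<le> R" using bounded_aff_image[OF A(2)] by blast
  then have "p \<notin> aff k x v ` A" if "R < norm p" for p using that by force
  then show "\<exists>R. \<forall>p. R < norm p \<longrightarrow> indicator (aff k x v ` A) p *\<^sub>R ((1 / area_factor k x v) *\<^sub>R wedge k v) = 0"
    by (intro exI[of _ R]) (simp add: indicator_def)
  show "indicator (aff k x v ` A) p *\<^sub>R ((1 / area_factor k x v) *\<^sub>R wedge k v) \<in> kvectors k" for p
    by (intro subspace_scale[OF subspace_kvectors] kvectors_wedge)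
  fix \<omega> :: "(real, 'n) vec \<Rightarrow> (real, 'n set) vec" assume \<omega>: "\<omega> \<in> smooth_forms k"
  have "(\<lambda>p. \<omega> p \<bullet> wedge k v) \<in> borel_measurable borel"
    by (intro borel_measurable_continuous_onI continuous_intros smooth_formsD(2)[OF \<omega>])
  from cell_integral(1)[OF ind A(1) this, of x, folded c_def]
  have "cell k A x v \<omega> = (LINT p|?H. indicator (aff k x v ` A) p / c * (\<omega> p \<bullet> wedge k v))"
    using \<omega> by (simp add: cell_apply)
  also have "\<dots> = (LINT p|?H. \<omega> p \<bullet> (indicator (aff k x v ` A) p *\<^sub>R ((1 / c) *\<^sub>R wedge k v)))" by simp
  finally show "cell k A x v \<omega> = (LINT p|?H. \<omega> p \<bullet> (indicator (aff k x v ` A) p *\<^sub>R ((1 / area_factor k x v) *\<^sub>R wedge k v)))"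
    unfolding c_def .
qed

lemma measure_unit_cube_subset:
  assumes "A \<in> sets (leb_Rk k)" "A \<subseteq> unit_cube k"
  shows "measure (leb_Rk k) A \<le> 1"
proof -
  have "measure (leb_Rk k) A \<le> measure (leb_Rk k) (unit_cube k)"
    using assms by (intro measure_mono_fmeasurable) (auto simp: fmeasurable_def emeasure_unit_cube)
  then show ?thesis by (simp add: measure_def emeasure_unit_cube)
qed

lemma has_density_scaleR: "has_density k T F \<Longrightarrow> has_density k (b *\<^sub>R T) (\<lambda>p. b *\<^sub>R F p)"
  using has_density_scale[of k T F b] by (simp add: scaleR_fun_def)

lemma has_density_plus: "has_density k T F \<Longrightarrow> has_density k U G \<Longrightarrow> has_density k (T + U) (\<lambda>p. F p + G p)"
  using has_density_add[of k T F U G] by (simp add: plus_fun_def)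

lemma has_density_0: "has_density k 0 (\<lambda>p. 0)"
  using has_density_zero[of k] by (simp add: zero_fun_def)

lemma small_chain_density:
  "small_chain k r Q \<Longrightarrow> Q \<in> polyhedral_currents k \<and>
     (\<exists>F. has_density k Q F \<and> (LINT p|hausdorff_measure k. norm (F p)) \<le> r)"
proof (induction rule: small_chain.induct)
  case (small_chain_0 r)
  then show ?case using zero_polyhedral[of k] has_density_0[of k] by (auto simp: zero_fun_def intro!: exI[of _ "\<lambda>p. 0"])
next
  case (small_chain_cell r T A b v s x)
  let ?H = "hausdorff_measure k :: ((real, 'a) vec) measure"
  have A: "A \<in> sets (leb_Rk k)" "A \<subseteq> unit_cube k" and poly: "cell k A x v \<in> polyhedral_currents k"
    using small_chain_cell.hyps(2) cube_polyhedral prism_polyhedral unit_cube_sets prism_sets prism_subset[of k] by auto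
  obtain F where F: "has_density k T F" "(LINT p|?H. norm (F p)) \<le> r" using small_chain_cell.IH by blast
  have "\<exists>G. has_density k (b *\<^sub>R cell k A x v) G \<and> (LINT p|?H. norm (G p)) \<le> s"
  proof (cases "indep_frame k v")
    case False
    then have "has_density k (b *\<^sub>R cell k A x v) (\<lambda>p. 0)"
      using has_density_scaleR[OF has_density_zero, of k b] by (simp add: cell_dependent)
    moreover have "0 \<le> s" using small_chain_cell.hyps(3) by (meson abs_ge_zero mult_nonneg_nonneg norm_ge_zero order_trans)
    ultimately show ?thesis by (intro exI[of _ "\<lambda>p. 0"]) simp
  next
    case True
    define c where "c = area_factor k x v"
    note c = area_factor(1)[OF True, of x, folded c_def] cell_has_density[OF True A, of x, folded c_def]
      cell_integral_const(2)[OF True A, of x, folded c_def]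
    have "norm (b *\<^sub>R (indicator (aff k x v ` A) p *\<^sub>R ((1 / c) *\<^sub>R wedge k v))) =
        indicator (aff k x v ` A) p / c * (\<bar>b\<bar> * norm (wedge k v))" for p
      using c(1) by (simp add: indicator_def)
    then have "(LINT p|?H. norm (b *\<^sub>R (indicator (aff k x v ` A) p *\<^sub>R ((1 / c) *\<^sub>R wedge k v)))) =
        measure (leb_Rk k) A * (\<bar>b\<bar> * norm (wedge k v))" by (simp only: c(3))
    also have "\<dots> \<le> 1 * s"
      using measure_unit_cube_subset[OF A] small_chain_cell.hyps(3) by (intro mult_mono) auto
    finally show ?thesis using has_density_scaleR[OF c(2), of b] by auto
  qed
  then obtain G where G: "has_density k (b *\<^sub>R cell k A x v) G" "(LINT p|?H. norm (G p)) \<le> s" by blast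
  have "(LINT p|?H. norm (F p + G p)) \<le> (LINT p|?H. norm (F p) + norm (G p))"
    using has_densityD(1)[OF F(1)] has_densityD(1)[OF G(1)]
    by (intro integral_mono integrable_norm Bochner_Integration.integrable_add norm_triangle_ineq)
  also have "\<dots> \<le> r + s"
    using F(2) G(2) has_densityD(1)[OF F(1)] has_densityD(1)[OF G(1)] by simp
  finally have "(LINT p|?H. norm (F p + G p)) \<le> r + s" .
  moreover have "T + b *\<^sub>R cell k A x v \<in> polyhedral_currents k"
    using polyhedral_add[OF conjunct1[OF small_chain_cell.IH] polyhedral_scale[OF poly, of b]]
    by (simp add: plus_fun_def scaleR_fun_def)
  ultimately show ?case using has_density_plus[OF F(1) G(1)] by blast
qed

text \<open>
  Two different \<open>k\<close>-planes meet in a null set: in one of them the other is contained in a hyperplane,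
  unless the planes are parallel.
\<close>

lemma null_plane_inter:
  fixes v w :: "nat \<Rightarrow> real ^ 'n::{finite,linorder}"
  assumes v: "indep_frame k v" and w: "indep_frame k w" and ne: "plane k x v \<noteq> plane k y w"
  shows "plane k x v \<inter> plane k y w \<in> null_sets (hausdorff_measure k)"
proof (cases "\<forall>l<k. v l \<in> span (w ` {..<k})")
  case True
  have sub: "span (v ` {..<k}) \<subseteq> span (w ` {..<k})" by (rule span_minimal) (use True in auto)
  have eq: "span (v ` {..<k}) = span (w ` {..<k})"
    by (rule subspace_dim_equal[OF subspace_span subspace_span sub]) (simp only: dim_span_frame[OF v] dim_span_frame[OF w])
  have "p \<notin> plane k y w" if p: "p \<in> plane k x v" for p
  proof
    assume p': "p \<in> plane k y w"
    have d: "(p - y) - (p - x) \<in> span (w ` {..<k})" using p p' unfolding plane_def eq mem_Collect_eq by (rule span_diff[rotated])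
    have "q \<in> plane k x v \<longleftrightarrow> q \<in> plane k y w" for q
    proof -
      have "q - y = (q - x) + ((p - y) - (p - x))" by simp
      then have "q - x \<in> span (w ` {..<k}) \<longleftrightarrow> q - y \<in> span (w ` {..<k})"
        using span_add_eq2[OF d, of "q - x"] by simp
      then show ?thesis unfolding plane_def eq by simp
    qed
    with ne show False by blast
  qed
  then have "plane k x v \<inter> plane k y w = {}" by blast
  then show ?thesis by simp
next
  case False
  then obtain l where l: "l < k" "v l \<notin> span (w ` {..<k})" by blast
  obtain \<phi> :: "(real, 'n) vec \<Rightarrow> real" where \<phi>: "linear \<phi>" "\<And>u. u \<in> span (w ` {..<k}) \<Longrightarrow> \<phi> u = 0" "\<phi> (v l) \<noteq> 0"
    using linear_functional_separating[OF subspace_span l(2)] by blast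
  have null: "{z \<in> space (leb_Rk k). (\<Sum>i<k. \<phi> (v i) * z i) = \<phi> y - \<phi> x} \<in> null_sets (leb_Rk k)"
    using hyperplane_null[of l k "\<lambda>i. \<phi> (v i)" "\<phi> y - \<phi> x"] l(1) \<phi>(3) by simp
  have Em: "plane k x v \<inter> plane k y w \<in> sets borel" by (intro sets.Int borel_plane)
  have "{z \<in> space (leb_Rk k). aff k x v z \<in> plane k x v \<inter> plane k y w} \<in> null_sets (leb_Rk k)"
  proof (rule null_sets_subset[OF null])
    show "{z \<in> space (leb_Rk k). aff k x v z \<in> plane k x v \<inter> plane k y w} \<in> sets (leb_Rk k)"
      using measurable_sets[OF measurable_aff[of k x v] Em] by (simp add: vimage_def Int_def conj_commute)
    show "{z \<in> space (leb_Rk k). aff k x v z \<in> plane k x v \<inter> plane k y w} \<subseteq>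
        {z \<in> space (leb_Rk k). (\<Sum>i<k. \<phi> (v i) * z i) = \<phi> y - \<phi> x}"
    proof safe
      fix z assume "aff k x v z \<in> plane k y w"
      then have "\<phi> (aff k x v z - y) = 0" using \<phi>(2) by (simp add: plane_def)
      then have "\<phi> x + (\<Sum>i<k. z i * \<phi> (v i)) - \<phi> y = 0"
        by (simp add: aff_def linear_diff[OF \<phi>(1)] linear_add[OF \<phi>(1)] linear_sum[OF \<phi>(1)] linear_scale[OF \<phi>(1)])
      then show "(\<Sum>i<k. \<phi> (v i) * z i) = \<phi> y - \<phi> x" by (simp add: mult.commute)
    qed
  qed
  then show ?thesis by (rule null_set_in_plane[OF v Em inf_le1])
qed

section \<open>Polyhedral currents are rectifiable\<close>

lemma std_simplex_subset_unit_cube: "std_simplex k \<subseteq> unit_cube k"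
proof
  fix y assume y: "y \<in> std_simplex k"
  then have nn: "\<And>j. j < k \<Longrightarrow> 0 \<le> y j" by (auto simp: std_simplex_def PiE_def Pi_def)
  have "y j \<le> 1" if "j < k" for j
    using member_le_sum[of j "{..<k}" y] nn that y by (force simp: std_simplex_def)
  then show "y \<in> unit_cube k" using y nn by (auto simp: std_simplex_def unit_cube_def PiE_def)
qed

lemma std_simplex_eq: "std_simplex k = {y \<in> space (leb_Rk k). (\<forall>j\<in>{..<k}. 0 \<le> y j) \<and> (\<Sum>j<k. y j) \<le> 1}"
  by (auto simp: std_simplex_def space_PiM PiE_def Pi_def)

lemma std_simplex_sets: "std_simplex k \<in> sets (leb_Rk k)"
proof -
  have [measurable]: "(\<lambda>y. y l) \<in> borel_measurable (leb_Rk k)" if "l \<in> {..<k}" for l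
    using that by (intro measurable_leb_Rk_component) simp
  show ?thesis unfolding std_simplex_eq by measurable
qed

definition simplex_cell :: "nat \<Rightarrow> 'a::real_vector \<Rightarrow> (nat \<Rightarrow> 'a) \<Rightarrow> 'a set" where
  "simplex_cell k x v = aff k x v ` std_simplex k"

definition simplex_rel_boundary :: "nat \<Rightarrow> 'a::real_vector \<Rightarrow> (nat \<Rightarrow> 'a) \<Rightarrow> 'a set" where
  "simplex_rel_boundary k x v = {p \<in> simplex_cell k x v.
     (\<exists>j\<in>{..<k}. dual_frame k v j (p - x) = 0) \<or> (\<Sum>j<k. dual_frame k v j (p - x)) = 1}"

lemma continuous_dual_frame:
  fixes v :: "nat \<Rightarrow> 'a::euclidean_space"
  assumes "indep_frame k v"
  shows "continuous_on UNIV (\<lambda>p. dual_frame k v j (p - x))"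
  using linear_continuous_on_compose[OF continuous_on_diff[OF continuous_on_id continuous_on_const] linear_dual_frame[OF assms]]
  by simp

lemma simplex_cell_eq:
  fixes v :: "nat \<Rightarrow> 'a::euclidean_space"
  assumes ind: "indep_frame k v"
  shows "simplex_cell k x v = {p \<in> plane k x v. (\<forall>j\<in>{..<k}. 0 \<le> dual_frame k v j (p - x)) \<and> (\<Sum>j<k. dual_frame k v j (p - x)) \<le> 1}"
proof -
  have "frame_coords k x v p \<in> std_simplex k \<longleftrightarrow>
      (\<forall>j\<in>{..<k}. 0 \<le> dual_frame k v j (p - x)) \<and> (\<Sum>j<k. dual_frame k v j (p - x)) \<le> 1" for p
    by (simp add: std_simplex_eq frame_coords_def space_PiM)
  then show ?thesis
    unfolding simplex_cell_def using aff_image_eq[OF ind, of "std_simplex k" x] sets.sets_into_space[OF std_simplex_sets[of k]]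
    by auto
qed

lemma closed_simplex_cell:
  fixes v :: "nat \<Rightarrow> 'a::euclidean_space"
  assumes ind: "indep_frame k v"
  shows "closed (simplex_cell k x v)"
proof -
  have "simplex_cell k x v = plane k x v \<inter> ((\<Inter>j\<in>{..<k}. {p. 0 \<le> dual_frame k v j (p - x)}) \<inter> {p. (\<Sum>j<k. dual_frame k v j (p - x)) \<le> 1})"
    unfolding simplex_cell_eq[OF ind] by auto
  then show ?thesis
    by (simp only:) (intro closed_Int closed_plane closed_INT ballI closed_Collect_le continuous_on_const continuous_on_sum continuous_dual_frame[OF ind])
qed

lemma closed_simplex_rel_boundary:
  fixes v :: "nat \<Rightarrow> 'a::euclidean_space"
  assumes ind: "indep_frame k v"
  shows "closed (simplex_rel_boundary k x v)"
proof -
  have "simplex_rel_boundary k x v = simplex_cell k x v \<inter>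
      ((\<Union>j\<in>{..<k}. {p. dual_frame k v j (p - x) = 0}) \<union> {p. (\<Sum>j<k. dual_frame k v j (p - x)) = 1})"
    unfolding simplex_rel_boundary_def by auto
  then show ?thesis
    by (simp only:) (intro closed_Int closed_Un closed_UN finite_lessThan ballI closed_simplex_cell[OF ind] closed_Collect_eq
        continuous_on_const continuous_on_sum continuous_dual_frame[OF ind])
qed

lemma simplex_cell_subset_plane: "simplex_cell k x v \<subseteq> plane k x v"
  by (auto simp: simplex_cell_def aff_in_plane)

lemma null_simplex_rel_boundary:
  fixes v :: "nat \<Rightarrow> real ^ 'n::{finite,linorder}"
  assumes ind: "indep_frame k v"
  shows "simplex_rel_boundary k x v \<in> null_sets (hausdorff_measure k)"
proof -
  have Em: "simplex_rel_boundary k x v \<in> sets borel" by (rule borel_closed[OF closed_simplex_rel_boundary[OF ind]])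
  have sub: "simplex_rel_boundary k x v \<subseteq> plane k x v" using simplex_cell_subset_plane[of k x v] by (auto simp: simplex_rel_boundary_def)
  let ?Z = "(\<Union>l\<in>{..<k}. {y \<in> space (leb_Rk k). (\<Sum>i<k. (if i = l then 1 else 0) * y i) = 0}) \<union>
    {y \<in> space (leb_Rk k). 0 < k \<and> (\<Sum>i<k. 1 * y i) = 1}"
  have "{y \<in> space (leb_Rk k). (\<Sum>i<k. (if i = l then 1 else 0) * y i) = 0} \<in> null_sets (leb_Rk k)" if "l \<in> {..<k}" for l
    by (rule hyperplane_null[of l]) (use that in auto)
  moreover have "{y \<in> space (leb_Rk k). 0 < k \<and> (\<Sum>i<k. 1 * y i) = 1} \<in> null_sets (leb_Rk k)"
  proof (cases "0 < k")
    case True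
    then show ?thesis using hyperplane_null[of 0 k "\<lambda>_. 1" 1] by simp
  qed simp
  ultimately have Z: "?Z \<in> null_sets (leb_Rk k)" by (intro null_sets.Un null_sets.finite_UN) auto
  have "{y \<in> space (leb_Rk k). aff k x v y \<in> simplex_rel_boundary k x v} \<in> null_sets (leb_Rk k)"
  proof (rule null_sets_subset[OF Z])
    show "{y \<in> space (leb_Rk k). aff k x v y \<in> simplex_rel_boundary k x v} \<in> sets (leb_Rk k)"
      using measurable_sets[OF measurable_aff[of k x v] Em] by (simp add: vimage_def Int_def conj_commute)
    have d: "(\<Sum>j<k. dual_frame k v j (aff k x v y - x)) = (\<Sum>j<k. y j)" for y
      by (rule sum.cong) (auto simp: dual_frame_aff[OF ind])
    show "{y \<in> space (leb_Rk k). aff k x v y \<in> simplex_rel_boundary k x v} \<subseteq> ?Z"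
    proof
      fix y assume "y \<in> {y \<in> space (leb_Rk k). aff k x v y \<in> simplex_rel_boundary k x v}"
      then have y: "y \<in> space (leb_Rk k)" "(\<exists>j\<in>{..<k}. y j = 0) \<or> (\<Sum>j<k. y j) = 1"
        by (auto simp: simplex_rel_boundary_def d dual_frame_aff[OF ind])
      have pick: "(\<Sum>i<k. (if i = l then 1 else 0) * y i) = y l" if "l < k" for l
      proof -
        have "(\<Sum>i<k. (if i = l then 1 else 0) * y i) = (\<Sum>i<k. if i = l then y i else 0)" by (rule sum.cong) auto
        then show ?thesis using that by simp
      qed
      from y(2) show "y \<in> ?Z"
      proof
        assume "\<exists>j\<in>{..<k}. y j = 0"
        then show ?thesis using y(1) pick by auto
      next
        assume s: "(\<Sum>j<k. y j) = 1"
        then have "0 < k" by (cases k) auto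
        then show ?thesis using s y(1) by simp
      qed
    qed
  qed
  then show ?thesis by (rule null_set_in_plane[OF ind Em sub])
qed

text \<open>Away from its relative boundary, a simplex is a relatively open subset of its plane.\<close>

lemma eventually_plane_in_simplex:
  fixes v :: "nat \<Rightarrow> 'a::euclidean_space"
  assumes ind: "indep_frame k v" and p: "p \<in> simplex_cell k x v" "p \<notin> simplex_rel_boundary k x v"
  shows "\<forall>\<^sub>F q in nhds p. q \<in> plane k x v \<longrightarrow> q \<in> simplex_cell k x v"
proof -
  define d where "d = (\<lambda>j q. dual_frame k v j (q - x))"
  have cont: "continuous_on UNIV (d j)" for j unfolding d_def by (rule continuous_dual_frame[OF ind])
  have pos: "\<forall>j\<in>{..<k}. 0 < d j p" "(\<Sum>j<k. d j p) < 1"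
    using p unfolding simplex_rel_boundary_def simplex_cell_eq[OF ind] d_def by (auto simp: less_le)
  have "open ((\<Inter>j\<in>{..<k}. {q. 0 < d j q}) \<inter> {q. (\<Sum>j<k. d j q) < 1})"
    by (intro open_Int open_INT finite_lessThan ballI open_Collect_less continuous_on_const continuous_on_sum cont)
  moreover have "p \<in> (\<Inter>j\<in>{..<k}. {q. 0 < d j q}) \<inter> {q. (\<Sum>j<k. d j q) < 1}" using pos by auto
  ultimately have "\<forall>\<^sub>F q in nhds p. q \<in> (\<Inter>j\<in>{..<k}. {q. 0 < d j q}) \<inter> {q. (\<Sum>j<k. d j q) < 1}"
    by (rule eventually_nhds_in_open)
  then show ?thesis
  proof eventually_elim
    case (elim q)
    then have "\<forall>j\<in>{..<k}. 0 \<le> d j q" "(\<Sum>j<k. d j q) \<le> 1" by (auto intro: less_imp_le)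
    then show ?case unfolding simplex_cell_eq[OF ind] d_def by simp
  qed
qed

text \<open>A set that agrees with a plane near a point has this plane as its tangent space there.\<close>

lemma approx_tangent_space_plane:
  fixes V :: "'a::euclidean_space set"
  assumes V: "subspace V" "dim V = k" and near: "\<forall>\<^sub>F q in nhds x. q \<in> M \<longleftrightarrow> q - x \<in> V"
  shows "approx_tangent_space k M x V"
  unfolding approx_tangent_space_def
proof (intro conjI V allI impI)
  fix f :: "'a \<Rightarrow> real" assume f: "continuous_on UNIV f" and bd: "bounded {y. f y \<noteq> 0}"
  let ?H = "hausdorff_measure k :: 'a measure"
  have [measurable]: "f \<in> borel_measurable borel" "V \<in> sets borel"
    using borel_measurable_continuous_onI[OF f] borel_closed[OF closed_subspace[OF V(1)]] by auto
  obtain R where R: "R > 0" "\<And>y. f y \<noteq> 0 \<Longrightarrow> norm y \<le> R" using bd by (auto simp: bounded_pos)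
  obtain \<delta> where \<delta>: "\<delta> > 0" "\<And>q. dist q x < \<delta> \<Longrightarrow> q \<in> M \<longleftrightarrow> q - x \<in> V" using near unfolding eventually_nhds_metric by blast
  have "(LINT y:M|?H. f ((y - x) /\<^sub>R r)) / r ^ k = (LINT y:V|?H. f y)" if r: "0 < r" "r < \<delta> / R" for r
  proof -
    have eq: "indicator M y *\<^sub>R f ((y - x) /\<^sub>R r) = indicator V ((y - x) /\<^sub>R r) *\<^sub>R f ((y - x) /\<^sub>R r)" for y
    proof (cases "f ((y - x) /\<^sub>R r) = 0")
      case False
      then have "norm (y - x) / r \<le> R" using R(2)[OF False] r(1) by (simp add: divide_inverse mult.commute)
      then have "norm (y - x) \<le> R * r" using r(1) by (simp add: field_simps)
      also have "\<dots> < \<delta>" using r(2) R(1) by (simp add: field_simps)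
      finally have "y \<in> M \<longleftrightarrow> y - x \<in> V" using \<delta>(2) by (simp add: dist_norm)
      moreover have "y - x \<in> V \<longleftrightarrow> (y - x) /\<^sub>R r \<in> V"
        using subspace_scale[OF V(1), of "y - x" "inverse r"] subspace_scale[OF V(1), of "(y - x) /\<^sub>R r" r] r(1) by auto
      ultimately show ?thesis by (simp add: indicator_def)
    qed simp
    have "(LINT y:M|?H. f ((y - x) /\<^sub>R r)) = r ^ k * (LINT y:V|?H. f y)"
      unfolding set_lebesgue_integral_def eq
      by (rule integral_hausdorff_rescale[OF r(1), of "\<lambda>y. indicator V y *\<^sub>R f y" k x]) measurable
    then show ?thesis using r(1) by simp
  qed
  then have "\<forall>\<^sub>F r in at_right 0. (LINT y:M|?H. f ((y - x) /\<^sub>R r)) / r ^ k = (LINT y:V|?H. f y)"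
    unfolding eventually_at_right_field using \<delta>(1) R(1) by (intro exI[of _ "\<delta> / R"]) auto
  then show "((\<lambda>r. (LINT y:M|?H. f ((y - x) /\<^sub>R r)) / r ^ k) \<longlongrightarrow> (LINT y:V|?H. f y)) (at_right 0)"
    by (rule tendsto_eventually)
qed

lemma lipschitz_aff:
  fixes v :: "nat \<Rightarrow> 'a::real_normed_vector"
  shows "lipschitz_Rk k A (aff k x v)"
  unfolding lipschitz_Rk_def
proof (intro exI ballI)
  fix y z :: "nat \<Rightarrow> real"
  have "dist (aff k x v y) (aff k x v z) \<le> (\<Sum>j<k. \<bar>y j - z j\<bar> * norm (v j))"
    using norm_aff_diff_le[of k x v y z] by (simp add: dist_norm)
  also have "\<dots> \<le> (\<Sum>j<k. L2_set (\<lambda>j. y j - z j) {..<k} * norm (v j))"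
  proof (intro sum_mono mult_right_mono)
    fix j assume j: "j \<in> {..<k}"
    have "(\<bar>y j - z j\<bar>)\<^sup>2 \<le> (\<Sum>j<k. (y j - z j)\<^sup>2)"
      using member_le_sum[of j "{..<k}" "\<lambda>j. (y j - z j)\<^sup>2"] j by simp
    then show "\<bar>y j - z j\<bar> \<le> L2_set (\<lambda>j. y j - z j) {..<k}" unfolding L2_set_def by (rule real_le_rsqrt)
  qed simp
  finally show "dist (aff k x v y) (aff k x v z) \<le> (\<Sum>j<k. norm (v j)) * L2_set (\<lambda>j. y j - z j) {..<k}"
    by (simp add: sum_distrib_right mult.commute)
qed

text \<open>
  The set \<open>M\<close> consists of the points where the sum of the densities of the simplices does not vanish, without the
  closed null set \<open>Z\<close> of relative boundaries and of intersections of different planes.  Near a point outside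
  \<open>Z\<close>, all simplices through the point lie in one plane and fill it, so that \<open>M\<close> coincides there with this plane, or
  is empty.  This gives the tangent space, without any measure theoretic density theorem.
\<close>

theorem simplex_sum_represents:
  fixes x :: "nat \<Rightarrow> real ^ 'n::{finite,linorder}" and v :: "nat \<Rightarrow> nat \<Rightarrow> real ^ 'n::{finite,linorder}"
  assumes ind: "\<And>i. i < N \<Longrightarrow> indep_frame k (v i)"
    and S: "S = (\<lambda>\<omega>. \<Sum>i<N. a i * cell k (std_simplex k) (x i) (v i) \<omega>)"
  obtains M \<tau> \<Theta> F where "represents k S M \<tau> \<Theta>" "has_density k S F" "finite (range F)"
    "\<And>p. F p \<noteq> 0 \<Longrightarrow> (1 / norm (F p)) *\<^sub>R F p \<in> G0 k"
proof -
  let ?H = "hausdorff_measure k :: ((real, 'n) vec) measure"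
  define \<Delta> where "\<Delta> = (\<lambda>i. simplex_cell k (x i) (v i))"
  define P where "P = (\<lambda>i. plane k (x i) (v i))"
  define c where "c = (\<lambda>i. area_factor k (x i) (v i))"
  have dens: "has_density k (cell k (std_simplex k) (x i) (v i)) (\<lambda>p. indicator (\<Delta> i) p *\<^sub>R ((1 / c i) *\<^sub>R wedge k (v i)))"
    if "i < N" for i
    unfolding \<Delta>_def simplex_cell_def c_def
    by (rule cell_has_density[OF ind[OF that] std_simplex_sets std_simplex_subset_unit_cube])
  define w where "w = (\<lambda>i. (a i / c i) *\<^sub>R wedge k (v i))"
  define F0 where "F0 = (\<lambda>p. \<Sum>i<N. indicator (\<Delta> i) p *\<^sub>R w i)"
  have dens0: "has_density k S F0"
  proof -
    have "has_density k (\<lambda>\<omega>. \<Sum>i<m. a i * cell k (std_simplex k) (x i) (v i) \<omega>) (\<lambda>p. \<Sum>i<m. indicator (\<Delta> i) p *\<^sub>R w i)" if "m \<le> N" for m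
      using that
    proof (induction m)
      case 0 then show ?case by (simp add: has_density_zero)
    next
      case (Suc m)
      have "has_density k (\<lambda>\<omega>. a m * cell k (std_simplex k) (x m) (v m) \<omega>) (\<lambda>p. indicator (\<Delta> m) p *\<^sub>R w m)"
        using has_density_scale[OF dens[of m], of "a m"] Suc.prems by (simp add: w_def mult_ac)
      from has_density_add[OF Suc.IH this] Suc.prems show ?case by simp
    qed
    then show ?thesis by (simp add: S F0_def)
  qed
  define Z where "Z = (\<Union>i\<in>{..<N}. simplex_rel_boundary k (x i) (v i)) \<union> (\<Union>i\<in>{..<N}. \<Union>j\<in>{j\<in>{..<N}. P i \<noteq> P j}. P i \<inter> P j)"
  have Zc: "closed Z"
    unfolding Z_def P_def by (intro closed_Un closed_UN closed_Int closed_plane ballI closed_simplex_rel_boundary) (auto intro: ind)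
  have Zn: "Z \<in> null_sets ?H"
    unfolding Z_def P_def
    by (intro null_sets.Un null_sets.finite_UN null_simplex_rel_boundary null_plane_inter) (auto intro: ind)
  define M where "M = {p. F0 p \<noteq> 0} - Z"
  have [measurable]: "F0 \<in> borel_measurable borel"
    using borel_measurable_integrable[OF has_densityD(1)[OF dens0]] by simp
  have Zb[measurable]: "Z \<in> sets borel" by (rule borel_closed[OF Zc])
  have Mb[measurable]: "M \<in> sets borel"
  proof -
    have "{p. F0 p \<noteq> 0} = F0 -` (- {0}) \<inter> space borel" by auto
    then have "{p. F0 p \<noteq> 0} \<in> sets borel" by (simp only:) (rule measurable_sets[where A=borel]; simp)
    then show ?thesis unfolding M_def using Zb by (rule sets.Diff)
  qed
  have M_cover: "M \<subseteq> (\<Union>i<N. \<Delta> i)"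
  proof
    fix p assume "p \<in> M"
    then have "F0 p \<noteq> 0" by (simp add: M_def)
    then obtain i where "i < N" "indicator (\<Delta> i) p *\<^sub>R w i \<noteq> 0" unfolding F0_def by (meson lessThan_iff sum.neutral)
    then show "p \<in> (\<Union>i<N. \<Delta> i)" by (auto simp: indicator_def split: if_splits)
  qed
  \<comment> \<open>Near a point of \<open>M\<close> the density is constant on one of the planes and vanishes outside it.\<close>
  have local: "\<exists>i<N. p \<in> \<Delta> i \<and> (\<exists>s. F0 p = s *\<^sub>R wedge k (v i)) \<and> (\<forall>\<^sub>F q in nhds p. q \<in> M \<longleftrightarrow> q - p \<in> span (v i ` {..<k}))"
    if p: "p \<in> M" for p
  proof -
    obtain i where i: "i < N" "p \<in> \<Delta> i" using M_cover p by blast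
    have pP: "p \<in> P i" using i(2) simplex_cell_subset_plane by (auto simp: \<Delta>_def P_def)
    have pZ: "p \<notin> Z" using p by (simp add: M_def)
    have same: "P j = P i" if "j < N" "p \<in> \<Delta> j" for j
    proof (rule ccontr)
      assume "P j \<noteq> P i"
      moreover have "p \<in> P j" using that(2) simplex_cell_subset_plane by (auto simp: \<Delta>_def P_def)
      ultimately have "p \<in> Z" using pP i(1) that(1) unfolding Z_def by blast
      with pZ show False by simp
    qed
    have "\<exists>s. w j = s *\<^sub>R wedge k (v i)" if j: "j < N" "p \<in> \<Delta> j" for j
    proof -
      have "span (v j ` {..<k}) = span (v i ` {..<k})" using plane_eq_imp_span_eq same[OF j] unfolding P_def by blast
      then have "v j l \<in> span (v i ` {..<k})" if "l < k" for l using that span_base[of "v j l" "v j ` {..<k}"] by auto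
      then obtain s where "wedge k (v j) = s *\<^sub>R wedge k (v i)" using wedge_parallel[OF ind[OF i(1)]] by blast
      then show ?thesis by (intro exI[of _ "a j / c j * s"]) (simp add: w_def)
    qed
    then have "\<exists>s. indicator (\<Delta> j) p *\<^sub>R w j = s *\<^sub>R wedge k (v i)" if "j < N" for j
      using that by (cases "p \<in> \<Delta> j") (auto intro: exI[of _ 0])
    then obtain s where s: "\<And>j. j < N \<Longrightarrow> indicator (\<Delta> j) p *\<^sub>R w j = s j *\<^sub>R wedge k (v i)" by metis
    have F0p: "F0 p = (\<Sum>j<N. s j) *\<^sub>R wedge k (v i)" unfolding F0_def scaleR_sum_left by (rule sum.cong) (auto simp: s)
    have ev1: "\<forall>\<^sub>F q in nhds p. q \<in> - Z" using Zc pZ by (intro eventually_nhds_in_open) auto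
    have "\<forall>\<^sub>F q in nhds p. q \<in> \<Delta> j \<longleftrightarrow> p \<in> \<Delta> j \<and> q \<in> P i" if j: "j < N" for j
    proof (cases "p \<in> \<Delta> j")
      case True
      have "p \<notin> simplex_rel_boundary k (x j) (v j)" using pZ j by (auto simp: Z_def)
      from eventually_plane_in_simplex[OF ind[OF j] True[unfolded \<Delta>_def] this]
      show ?thesis
      proof eventually_elim
        case (elim q)
        have "q \<in> \<Delta> j \<Longrightarrow> q \<in> P j" using simplex_cell_subset_plane by (auto simp: \<Delta>_def P_def)
        then show ?case using elim True same[OF j True] by (auto simp: \<Delta>_def P_def)
      qed
    next
      case False
      then have "\<forall>\<^sub>F q in nhds p. q \<in> - \<Delta> j"
        using closed_simplex_cell[OF ind[OF j]] by (intro eventually_nhds_in_open) (auto simp: \<Delta>_def)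
      then show ?thesis by eventually_elim (use False in auto)
    qed
    then have ev2: "\<forall>\<^sub>F q in nhds p. \<forall>j\<in>{..<N}. q \<in> \<Delta> j \<longleftrightarrow> p \<in> \<Delta> j \<and> q \<in> P i"
      by (intro eventually_ball_finite) auto
    have "\<forall>\<^sub>F q in nhds p. q \<in> M \<longleftrightarrow> q - p \<in> span (v i ` {..<k})"
      using ev1 ev2
    proof eventually_elim
      case (elim q)
      have "F0 q = (if q \<in> P i then F0 p else 0)"
      proof (cases "q \<in> P i")
        case True
        have "F0 q = F0 p" unfolding F0_def by (rule sum.cong) (use elim(2) True in \<open>auto simp: indicator_def\<close>)
        then show ?thesis using True by simp
      next
        case False
        have "F0 q = 0" unfolding F0_def by (rule sum.neutral) (use elim(2) False in \<open>auto simp: indicator_def\<close>)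
        then show ?thesis using False by simp
      qed
      then have "q \<in> M \<longleftrightarrow> q \<in> P i" using elim(1) p by (auto simp: M_def)
      also have "\<dots> \<longleftrightarrow> q - p \<in> span (v i ` {..<k})"
      proof -
        have "q - x i = (q - p) + (p - x i)" by simp
        then show ?thesis using pP span_add_eq2[of "p - x i" "v i ` {..<k}" "q - p"] unfolding P_def plane_def by (simp only: mem_Collect_eq)
      qed
      finally show ?case .
    qed
    with i F0p show ?thesis by blast
  qed
  define \<tau> where "\<tau> = (\<lambda>p. (1 / norm (F0 p)) *\<^sub>R F0 p)"
  have \<tau>G0: "\<tau> p \<in> G0 k" if p: "p \<in> M" for p
  proof -
    obtain i s where "F0 p = s *\<^sub>R wedge k (v i)" using local[OF p] by blast
    then have "\<tau> p = (1 / norm (F0 p) * s) *\<^sub>R wedge k (v i)" by (simp add: \<tau>_def)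
    moreover have "norm (\<tau> p) = 1" using p by (simp add: \<tau>_def M_def)
    ultimately show ?thesis unfolding G0_def simple_kvector_def by blast
  qed
  have bdM: "bounded M"
  proof -
    have "bounded (\<Delta> i)" for i
      using bounded_aff_image[OF std_simplex_subset_unit_cube, of k "x i" "v i"] unfolding \<Delta>_def simplex_cell_def bounded_iff .
    then have "bounded (\<Union>i<N. \<Delta> i)" by (intro bounded_UN) auto
    then show ?thesis using M_cover by (rule bounded_subset)
  qed
  have finM: "emeasure ?H M < \<infinity>"
  proof -
    have \<Delta>b: "\<Delta> i \<in> sets borel" if "i < N" for i unfolding \<Delta>_def by (rule borel_closed[OF closed_simplex_cell[OF ind[OF that]]])
    have "emeasure ?H (\<Delta> i) < \<infinity>" if "i < N" for i
    proof -
      have "emeasure ?H (\<Delta> i) = hausdorff_outer k (\<Delta> i)" by (rule emeasure_hausdorff[OF \<Delta>b[OF that]])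
      also have "\<dots> \<le> hausdorff_outer k (aff k (x i) (v i) ` unit_cube k)"
        unfolding \<Delta>_def simplex_cell_def
        by (intro hausdorff_outer_mono image_mono std_simplex_subset_unit_cube)
      also have "\<dots> < top" by (rule hausdorff_outer_aff_cube_finite)
      finally show ?thesis by simp
    qed
    then have "(\<Sum>i<N. emeasure ?H (\<Delta> i)) < \<infinity>" by simp
    moreover have "emeasure ?H M \<le> emeasure ?H (\<Union>i<N. \<Delta> i)" using M_cover \<Delta>b by (intro emeasure_mono) auto
    moreover have "\<dots> \<le> (\<Sum>i<N. emeasure ?H (\<Delta> i))" using \<Delta>b by (intro emeasure_subadditive_finite) auto
    ultimately show ?thesis by (meson order_le_less_trans)
  qed
  have rect: "rectifiable_set k M"
    unfolding rectifiable_set_def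
  proof (intro conjI Mb bdM finM exI)
    let ?A = "\<lambda>i. if i < N then std_simplex k else {}" and ?f = "\<lambda>i. aff k (x i) (v i)"
    show "\<forall>i. ?A i \<subseteq> PiE {..<k} (\<lambda>_. UNIV) \<and> lipschitz_Rk k (?A i) (?f i)"
      by (simp add: lipschitz_aff std_simplex_def) (auto simp: PiE_def)
    show "\<exists>N\<in>null_sets ?H. M \<subseteq> N \<union> (\<Union>i. ?f i ` ?A i)"
    proof (rule bexI[of _ "{}"])
      have "(\<Union>i<N. \<Delta> i) \<subseteq> (\<Union>i. ?f i ` ?A i)"
      proof
        fix p assume "p \<in> (\<Union>i<N. \<Delta> i)"
        then obtain i where "i < N" "p \<in> aff k (x i) (v i) ` std_simplex k" by (auto simp: \<Delta>_def simplex_cell_def)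
        then have "p \<in> ?f i ` ?A i" by simp
        then show "p \<in> (\<Union>i. ?f i ` ?A i)" by blast
      qed
      from subset_trans[OF M_cover this] show "M \<subseteq> {} \<union> (\<Union>i. ?f i ` ?A i)" by (simp only: Un_empty_left)
    qed simp
  qed
  have orient: "orientation k M \<tau>"
    unfolding orientation_def
  proof (intro conjI ballI \<tau>G0 AE_I2 impI)
    show "\<tau> \<in> borel_measurable (restrict_space borel M)"
      unfolding \<tau>_def by (rule measurable_restrict_space1) measurable
    fix p assume p: "p \<in> M"
    obtain i s where i: "i < N" "F0 p = s *\<^sub>R wedge k (v i)" "\<forall>\<^sub>F q in nhds p. q \<in> M \<longleftrightarrow> q - p \<in> span (v i ` {..<k})"
      using local[OF p] by blast
    have "\<tau> p = (1 / norm (F0 p) * s) *\<^sub>R wedge k (v i)" by (simp add: \<tau>_def i(2))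
    moreover have "approx_tangent_space k M p (span (v i ` {..<k}))"
      by (rule approx_tangent_space_plane[OF subspace_span dim_span_frame[OF ind[OF i(1)]] i(3)])
    ultimately show "\<exists>a v. \<tau> p = a *\<^sub>R wedge k v \<and> approx_tangent_space k M p (span (v ` {..<k}))" by blast
  qed
  have ae: "AE p in ?H. F0 p = indicator M p *\<^sub>R F0 p"
    using AE_not_in[OF Zn] by eventually_elim (auto simp: M_def indicator_def)
  have rep: "represents k S M \<tau> (\<lambda>p. norm (F0 p))"
    unfolding represents_def
  proof (intro conjI rect orient ballI)
    show "0 < norm (F0 p)" if "p \<in> M" for p using that by (simp add: M_def)
    have "integrable ?H (\<lambda>p. indicator M p *\<^sub>R norm (F0 p))"
      by (rule integrable_mult_indicator) (use has_densityD(1)[OF dens0] Mb in auto)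
    then show "set_integrable ?H M (\<lambda>p. norm (F0 p))" by (simp add: set_integrable_def)
    fix \<omega> :: "(real, 'n) vec \<Rightarrow> (real, 'n set) vec" assume \<omega>: "\<omega> \<in> smooth_forms k"
    have [measurable]: "\<omega> \<in> borel_measurable borel" using smooth_formsD(2)[OF \<omega>] by (rule borel_measurable_continuous_onI)
    have "S \<omega> = (LINT p|?H. \<omega> p \<bullet> F0 p)" by (rule has_densityD(3)[OF dens0 \<omega>])
    also have "\<dots> = (LINT p|?H. indicator M p *\<^sub>R (norm (F0 p) * (\<omega> p \<bullet> \<tau> p)))"
    proof (rule integral_cong_AE)
      show "AE p in ?H. \<omega> p \<bullet> F0 p = indicator M p *\<^sub>R (norm (F0 p) * (\<omega> p \<bullet> \<tau> p))"
        using ae by eventually_elim (auto simp: \<tau>_def indicator_def)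
    qed (simp_all add: \<tau>_def)
    finally show "S \<omega> = (LINT p:M|?H. norm (F0 p) * (\<omega> p \<bullet> \<tau> p))" by (simp add: set_lebesgue_integral_def)
  qed
  show ?thesis
  proof (rule that[OF rep represents_has_density[OF rep]])
    let ?F = "\<lambda>p. indicator M p *\<^sub>R (norm (F0 p) *\<^sub>R \<tau> p)"
    have Fe: "?F p = indicator M p *\<^sub>R F0 p" for p by (simp add: \<tau>_def)
    have "F0 p \<in> (\<lambda>I. \<Sum>i\<in>I. w i) ` Pow {..<N}" for p
    proof (rule image_eqI[of _ _ "{i\<in>{..<N}. p \<in> \<Delta> i}"])
      have "(\<Sum>i<N. indicator (\<Delta> i) p *\<^sub>R w i) = (\<Sum>i<N. if p \<in> \<Delta> i then w i else 0)"
        by (rule sum.cong) (auto simp: indicator_def)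
      then show "F0 p = (\<Sum>i\<in>{i\<in>{..<N}. p \<in> \<Delta> i}. w i)"
        unfolding F0_def by (simp add: sum.inter_filter)
    qed auto
    then have "range ?F \<subseteq> insert 0 ((\<lambda>I. \<Sum>i\<in>I. w i) ` Pow {..<N})" unfolding Fe by (auto simp: indicator_def)
    then show "finite (range ?F)" by (rule finite_subset) simp
    fix p assume "?F p \<noteq> 0"
    then have "p \<in> M" by (simp add: indicator_def split: if_splits)
    then show "(1 / norm (?F p)) *\<^sub>R ?F p \<in> G0 k" using \<tau>G0[of p] unfolding Fe by (simp add: \<tau>_def)
  qed
qed

text \<open>
  The finitely many values are what turns the integrals of the ellipticity inequality into finite sums.
\<close>

corollary polyhedral_represents:
  assumes "S \<in> polyhedral_currents k"
  obtains M \<tau> \<Theta> F where "represents k S M \<tau> \<Theta>" "has_density k S F" "finite (range F)"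
    "\<And>p. F p \<noteq> 0 \<Longrightarrow> (1 / norm (F p)) *\<^sub>R F p \<in> G0 k"
proof -
  obtain N a u where S: "S = (\<lambda>\<omega>. \<Sum>i<N. a i * simplex_current k (u i) \<omega>)"
    and u: "\<forall>i<(N::nat). inj_on (u i) {..k} \<and> \<not> affine_dependent (u i ` {..k})"
    using assms unfolding polyhedral_currents_def by auto
  define v where "v = (\<lambda>i j. u i (Suc j) - u i 0)"
  have ind: "indep_frame k (v i)" if "i < N" for i
  proof -
    have inj: "inj_on (u i) {..k}" and ad: "\<not> affine_dependent (u i ` {..k})" using u that by auto
    have img: "(\<lambda>y. - u i 0 + y) ` (u i ` {..k} - {u i 0}) = v i ` {..<k}"
    proof -
      have "u i ` {..k} - {u i 0} = u i ` Suc ` {..<k}"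
      proof -
        have "{..k} = insert 0 (Suc ` {..<k})" by (auto simp: image_iff less_Suc_eq_0_disj elim: lessE gr0_implies_Suc) (metis Suc_le_eq not0_implies_Suc lessThan_iff)
        moreover have "u i 0 \<notin> u i ` Suc ` {..<k}"
        proof
          assume "u i 0 \<in> u i ` Suc ` {..<k}"
          then obtain j where "j < k" "u i 0 = u i (Suc j)" by auto
          with inj_onD[OF inj, of 0 "Suc j"] show False by simp
        qed
        ultimately show ?thesis by auto
      qed
      then show ?thesis by (auto simp: v_def image_image)
    qed
    have "independent (v i ` {..<k})"
      using ad affine_dependent_iff_dependent2[of "u i 0" "u i ` {..k}"] unfolding img by auto
    moreover have "inj_on (v i) {..<k}"
    proof (rule inj_onI)
      fix j l assume "j \<in> {..<k}" "l \<in> {..<k}" "v i j = v i l"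
      then show "j = l" using inj_onD[OF inj, of "Suc j" "Suc l"] by (simp add: v_def)
    qed
    ultimately show ?thesis by (simp add: indep_frame_def)
  qed
  have "simplex_current k (u i) = cell k (std_simplex k) (u i 0) (v i)" for i
    by (simp add: simplex_current_def cell_def v_def aff_def[abs_def])
  then have "S = (\<lambda>\<omega>. \<Sum>i<N. a i * cell k (std_simplex k) (u i 0) (v i) \<omega>)" by (simp add: S)
  from simplex_sum_represents[OF ind this] show ?thesis using that by blast
qed

section \<open>Orthogonal projections\<close>

definition orthonormal_frame :: "nat \<Rightarrow> (nat \<Rightarrow> 'a::real_inner) \<Rightarrow> bool" where
  "orthonormal_frame k e \<longleftrightarrow> (\<forall>i<k. \<forall>j<k. e i \<bullet> e j = (if i = j then 1 else 0))"

lemma indep_orthonormal_frame: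
  fixes e :: "nat \<Rightarrow> 'a::euclidean_space"
  assumes e: "orthonormal_frame k e"
  shows "indep_frame k e"
proof -
  have ip: "e i \<bullet> e j = (if i = j then 1 else 0)" if "i < k" "j < k" for i j using e that by (simp add: orthonormal_frame_def)
  have "inj_on e {..<k}"
  proof (rule inj_onI)
    fix i j assume ij: "i \<in> {..<k}" "j \<in> {..<k}" "e i = e j"
    then have "e i \<bullet> e j = 1" using ip[of j j] by simp
    then show "i = j" using ip[of i j] ij by (simp split: if_splits)
  qed
  moreover have "independent (e ` {..<k})"
  proof (rule pairwise_orthogonal_independent)
    show "pairwise orthogonal (e ` {..<k})"
      using ip by (fastforce simp: pairwise_def orthogonal_def split: if_splits)
    show "0 \<notin> e ` {..<k}"
    proof
      assume "0 \<in> e ` {..<k}"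
      then obtain j where "j < k" "e j = 0" by auto
      then show False using ip[of j j] by simp
    qed
  qed
  ultimately show ?thesis by (simp add: indep_frame_def)
qed

lemma adjoint_Rk_eq_aff:
  assumes "\<And>x j. j < k \<Longrightarrow> p x j = x \<bullet> e j"
  shows "adjoint_Rk k p = aff k 0 e"
proof
  fix y
  have s: "(\<Sum>j<k. p x j * y j) = x \<bullet> aff k 0 e y" for x
  proof -
    have "(\<Sum>j<k. p x j * y j) = (\<Sum>j<k. y j * (x \<bullet> e j))" by (rule sum.cong) (auto simp: assms)
    then show ?thesis by (simp add: aff_def inner_sum_right)
  qed
  have "(\<forall>x. (\<Sum>j<k. p x j * y j) = x \<bullet> w) \<longleftrightarrow> w = aff k 0 e y" for w
    unfolding s using vector_eq_rdot[of "aff k 0 e y" w] by (auto simp: inner_commute)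
  then show "adjoint_Rk k p y = aff k 0 e y" unfolding adjoint_Rk_def by simp
qed

lemma orthogonal_projection_iff_frame:
  assumes p: "range p \<subseteq> PiE {..<k} (\<lambda>_. UNIV)" "\<And>x j. j < k \<Longrightarrow> p x j = x \<bullet> e j"
  shows "orthogonal_projection k p \<longleftrightarrow> orthonormal_frame k e"
proof
  have adj: "adjoint_Rk k p = aff k 0 e" by (rule adjoint_Rk_eq_aff) (rule p(2))
  have pa: "p (aff k 0 e y) j = (\<Sum>i<k. y i * (e i \<bullet> e j))" if "j < k" for y j
    using p(2)[OF that] by (simp add: aff_def inner_sum_left)
  {
    assume "orthogonal_projection k p"
    then have op: "p (aff k 0 e y) = y" if "y \<in> PiE {..<k} (\<lambda>_. UNIV)" for y
      using that by (simp add: orthogonal_projection_def adj)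
    show "orthonormal_frame k e"
      unfolding orthonormal_frame_def
    proof (intro allI impI)
      fix i j assume ij: "i < k" "j < k"
      have u: "unit_coord k i \<in> PiE {..<k} (\<lambda>_. UNIV)" by (simp add: unit_coord_def)
      have "(\<Sum>l<k. unit_coord k i l * (e l \<bullet> e j)) = (\<Sum>l<k. if l = i then e l \<bullet> e j else 0)"
        by (rule sum.cong) (auto simp: unit_coord_def)
      then have "e i \<bullet> e j = p (aff k 0 e (unit_coord k i)) j" using pa[OF ij(2)] ij by simp
      also have "\<dots> = unit_coord k i j" using op[OF u] by simp
      finally show "e i \<bullet> e j = (if i = j then 1 else 0)" using ij by (auto simp: unit_coord_def)
    qed
  next
    assume e: "orthonormal_frame k e"
    have "p (aff k 0 e y) = y" if y: "y \<in> PiE {..<k} (\<lambda>_. UNIV)" for y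
    proof
      fix j
      show "p (aff k 0 e y) j = y j"
      proof (cases "j < k")
        case True
        have "p (aff k 0 e y) j = (\<Sum>i<k. if i = j then y i else 0)"
          unfolding pa[OF True] by (rule sum.cong) (use e True in \<open>auto simp: orthonormal_frame_def\<close>)
        then show ?thesis using True by simp
      next
        case False
        have "p (aff k 0 e y) \<in> PiE {..<k} (\<lambda>_. UNIV)" using p(1) by blast
        then show ?thesis using False y by (simp add: PiE_def extensional_def)
      qed
    qed
    moreover have "linear (\<lambda>x. p x j)" if "j < k" for j
      by (rule linearI) (simp_all add: p(2)[OF that] inner_add_left)
    ultimately show "orthogonal_projection k p"
      unfolding orthogonal_projection_def linear_to_Rk_def adj using p(1) by simp
  }
qed

text \<open>
  The rows of an orthogonal projection are orthonormal, and its adjoint maps coordinates to combinations of the rows.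
\<close>

lemma polyhedral_test_pairs_iff:
  "(S, D) \<in> polyhedral_test_pairs k \<longleftrightarrow>
     S \<in> polyhedral_currents k \<and> (\<exists>e. orthonormal_frame k e \<and> D = cube_cell k 0 e \<and> cycle k (S - D))"
proof
  assume "(S, D) \<in> polyhedral_test_pairs k"
  then obtain p where p: "orthogonal_projection k p" and S: "S \<in> polyhedral_currents k"
    and D: "D = push_current k (adjoint_Rk k p) (unit_cube k)" and bd: "boundary k S = boundary k D"
    by (auto simp: polyhedral_test_pairs_def)
  have lin: "linear (\<lambda>x. p x j)" if "j < k" for j using p that by (simp add: orthogonal_projection_def linear_to_Rk_def)
  define e where "e = (\<lambda>j. \<Sum>b\<in>Basis. p b j *\<^sub>R b)"
  have pe: "p x j = x \<bullet> e j" if j: "j < k" for x j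
  proof -
    have "p x j = p (\<Sum>b\<in>Basis. (x \<bullet> b) *\<^sub>R b) j" by (simp add: euclidean_representation)
    also have "\<dots> = (\<Sum>b\<in>Basis. (x \<bullet> b) * p b j)"
      using linear_sum[OF lin[OF j], of "\<lambda>b. (x \<bullet> b) *\<^sub>R b" Basis] by (simp add: linear_scale[OF lin[OF j]])
    finally show ?thesis by (simp add: e_def inner_sum_right mult.commute)
  qed
  have rp: "range p \<subseteq> PiE {..<k} (\<lambda>_. UNIV)" using p by (simp add: orthogonal_projection_def linear_to_Rk_def)
  have adj: "adjoint_Rk k p = aff k 0 e" by (rule adjoint_Rk_eq_aff) (rule pe)
  have "orthogonal_projection k p \<longleftrightarrow> orthonormal_frame k e" by (rule orthogonal_projection_iff_frame[OF rp]) (rule pe)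
  then have "orthonormal_frame k e" using p by simp
  moreover have "D = cube_cell k 0 e" by (simp only: D adj cell_def)
  ultimately show "S \<in> polyhedral_currents k \<and> (\<exists>e. orthonormal_frame k e \<and> D = cube_cell k 0 e \<and> cycle k (S - D))"
    using S bd by (auto simp: boundary_eq_iff_cycle)
next
  assume "S \<in> polyhedral_currents k \<and> (\<exists>e. orthonormal_frame k e \<and> D = cube_cell k 0 e \<and> cycle k (S - D))"
  then obtain e where S: "S \<in> polyhedral_currents k" and e: "orthonormal_frame k e" and D: "D = cube_cell k 0 e" and cyc: "cycle k (S - D)" by blast
  define p where "p = (\<lambda>x. \<lambda>j\<in>{..<k}. x \<bullet> e j)"
  have pe: "p x j = x \<bullet> e j" if "j < k" for x j using that by (simp add: p_def)
  have rp: "range p \<subseteq> PiE {..<k} (\<lambda>_. UNIV)" by (auto simp: p_def split: if_splits)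
  have adj: "adjoint_Rk k p = aff k 0 e" by (rule adjoint_Rk_eq_aff) (rule pe)
  have "orthogonal_projection k p \<longleftrightarrow> orthonormal_frame k e" by (rule orthogonal_projection_iff_frame[OF rp]) (rule pe)
  then have "orthogonal_projection k p" using e by simp
  moreover have "D = push_current k (adjoint_Rk k p) (unit_cube k)" by (simp only: D adj cell_def)
  ultimately show "(S, D) \<in> polyhedral_test_pairs k"
    using S cyc by (auto simp: polyhedral_test_pairs_def boundary_eq_iff_cycle)
qed

section \<open>Constant forms are exact\<close>

text \<open>
  Up to sign, \<open>dx_I\<close> is the exterior derivative of \<open>x_i dx_(I - {i})\<close> for any \<open>i \<in> I\<close>.
\<close>

lemma axis_form_exact:
  fixes I :: "'n::{finite,linorder} set"
  assumes I: "card I = k" "1 \<le> k"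
  shows "\<exists>\<phi>\<in>smooth_forms (k - 1). \<exists>s. s \<noteq> 0 \<and> ext_deriv \<phi> = (\<lambda>x. s *\<^sub>R (axis I 1 :: real ^ ('n set)))"
proof -
  obtain i where i: "i \<in> I" using I by fastforce
  define \<phi> where "\<phi> = (\<lambda>x. (x $ i) *\<^sub>R (axis (I - {i}) 1 :: (real, 'n set) vec))"
  define s :: real where "s = (-1) ^ card {j\<in>I. j < i}"
  have "\<phi> \<in> smooth_forms (k - 1)"
    unfolding \<phi>_def
    by (rule smooth_forms_polynomial) (use I i in \<open>auto intro!: real_polynomial_function.intros(1) bounded_linear_vec_nth\<close>)
  moreover have "ext_deriv \<phi> x = s *\<^sub>R axis I 1" for x
  proof -
    have "(\<phi> has_derivative (\<lambda>h. (h $ i) *\<^sub>R axis (I - {i}) 1)) (at x)"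
      unfolding \<phi>_def
      by (rule has_derivative_scaleR_left[OF bounded_linear_imp_has_derivative[OF bounded_linear_vec_nth]])
    from frechet_derivative_at[OF this, symmetric]
    have d: "frechet_derivative \<phi> (at x) (axis j 1) $ J = (if j = i \<and> J = I - {i} then 1 else 0)" for j J
      by (auto simp: axis_def)
    have "(\<Sum>j\<in>J. (-1) ^ card {l\<in>J. l < j} * (if j = i \<and> J - {j} = I - {i} then 1 else 0)) = (if J = I then s else 0)" for J
    proof -
      have "(\<Sum>j\<in>J. (-1) ^ card {l\<in>J. l < j} * (if j = i \<and> J - {j} = I - {i} then 1 else 0)) =
          (\<Sum>j\<in>J. if j = i then (if J = I then s else 0) else 0)"
        by (rule sum.cong) (use i in \<open>auto simp: s_def\<close>)
      also have "\<dots> = (if J = I then s else 0)" using i by auto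
      finally show ?thesis .
    qed
    then have "ext_deriv \<phi> x $ J = (if J = I then s else 0)" for J by (simp only: ext_deriv_def vec_lambda_beta d)
    then show ?thesis by (simp add: vec_eq_iff axis_def)
  qed
  moreover have "s \<noteq> 0" by (simp add: s_def)
  ultimately show ?thesis by blast
qed

lemma cycle_density_integral_zero:
  fixes T :: "'n::{finite,linorder} current"
  assumes F: "has_density k T F" and T: "cycle k T"
  shows "(LINT p|hausdorff_measure k. F p) = 0"
proof -
  let ?H = "hausdorff_measure k :: ((real, 'n) vec) measure"
  have int: "integrable ?H F" by (rule has_densityD(1)[OF F])
  have nth: "(LINT p|?H. F p) $ I = (LINT p|?H. F p $ I)" for I
    using integral_bounded_linear[OF bounded_linear_vec_nth int, of I] by simp
  have "(LINT p|?H. F p $ I) = 0" for I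
  proof (cases "card I = k")
    case False
    then have "F p $ I = 0" for p using has_densityD(2)[OF F, of p] by (simp add: kvectors_def)
    then show ?thesis by simp
  next
    case True
    have "\<exists>s \<omega>. s \<noteq> 0 \<and> \<omega> \<in> smooth_forms k \<and> \<omega> = (\<lambda>x. s *\<^sub>R (axis I 1 :: (real, 'n set) vec)) \<and> T \<omega> = 0"
    proof (cases "k = 0")
      case True
      then have "I = {}" using \<open>card I = k\<close> by simp
      then show ?thesis
        using T True by (intro exI[of _ 1] exI[of _ "\<lambda>x. axis {} 1"])
          (auto simp: cycle_def kvectors_def axis_def intro!: smooth_formsI Cm_const)
    next
      case False
      then obtain \<phi> s where \<phi>: "\<phi> \<in> smooth_forms (k - 1)" "s \<noteq> 0" "ext_deriv \<phi> = (\<lambda>x. s *\<^sub>R (axis I 1 :: (real, 'n set) vec))"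
        using axis_form_exact[OF True] by (auto simp: Suc_le_eq)
      moreover have "ext_deriv \<phi> \<in> smooth_forms k" using ext_deriv_smooth[OF \<phi>(1)] False by simp
      moreover have "T (ext_deriv \<phi>) = 0" using T \<phi>(1) False by (simp add: cycle_def)
      ultimately show ?thesis by metis
    qed
    then obtain s where s: "s \<noteq> 0" "(\<lambda>x. s *\<^sub>R (axis I 1 :: (real, 'n set) vec)) \<in> smooth_forms k" "T (\<lambda>x. s *\<^sub>R axis I 1) = 0" by metis
    then have "(LINT p|?H. (s *\<^sub>R axis I 1) \<bullet> F p) = 0" using has_densityD(3)[OF F s(2)] by simp
    then have "s * (LINT p|?H. F p $ I) = 0" by (simp add: inner_axis' del: mult_eq_0_iff)
    then show ?thesis using s(1) by simp
  qed
  then show ?thesis by (simp add: vec_eq_iff nth)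
qed

section \<open>The integrand and its excess\<close>

text \<open>
  McShane's extension by infimal convolution with the distance.
\<close>

lemma lipschitz_extension:
  fixes f :: "'a::metric_space \<Rightarrow> real"
  assumes f: "L-lipschitz_on S f" and S: "S \<noteq> {}"
  shows "\<exists>h. L-lipschitz_on UNIV h \<and> (\<forall>x\<in>S. h x = f x)"
proof -
  have L: "L \<ge> 0" by (rule lipschitz_on_nonneg[OF f])
  have fl: "\<bar>f x - f y\<bar> \<le> L * dist x y" if "x \<in> S" "y \<in> S" for x y
    using lipschitz_onD[OF f that] by (simp add: dist_real_def)
  define h where "h = (\<lambda>x. INF s\<in>S. f s + L * dist x s)"
  have bd: "bdd_below ((\<lambda>s. f s + L * dist x s) ` S)" for x
  proof -
    obtain s0 where s0: "s0 \<in> S" using S by blast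
    have "f s0 - L * dist x s0 \<le> f s + L * dist x s" if "s \<in> S" for s
    proof -
      have "f s0 - f s \<le> L * dist s0 s" using fl[OF s0 that] by linarith
      also have "\<dots> \<le> L * (dist x s0 + dist x s)" by (intro mult_left_mono L) (rule dist_triangle3)
      finally show ?thesis by (simp add: algebra_simps)
    qed
    then show ?thesis by (auto simp: bdd_below_def)
  qed
  have le: "h x \<le> h y + L * dist x y" for x y
  proof -
    have "h x - L * dist x y \<le> f s + L * dist y s" if "s \<in> S" for s
    proof -
      have "h x \<le> f s + L * dist x s" unfolding h_def by (rule cINF_lower[OF bd that])
      also have "L * dist x s \<le> L * (dist x y + dist y s)" by (intro mult_left_mono L dist_triangle)
      finally show ?thesis by (simp add: algebra_simps)
    qed
    then have "h x - L * dist x y \<le> h y" unfolding h_def[of ] by (intro cINF_greatest[OF S])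
    then show ?thesis by simp
  qed
  have "L-lipschitz_on UNIV h"
  proof (rule lipschitz_onI[OF _ L])
    fix x y
    show "dist (h x) (h y) \<le> L * dist x y" using le[of x y] le[of y x] by (simp add: dist_real_def dist_commute abs_le_iff)
  qed
  moreover have "h x = f x" if x: "x \<in> S" for x
  proof (rule antisym)
    show "h x \<le> f x" unfolding h_def using cINF_lower[OF bd x, of x] by simp
    show "f x \<le> h x" unfolding h_def
    proof (rule cINF_greatest[OF S])
      fix s assume "s \<in> S"
      then show "f x \<le> f s + L * dist x s" using fl[OF x, of s] by linarith
    qed
  qed
  ultimately show ?thesis by blast
qed

text \<open>
  With an extension to all multivectors, it is irrelevant where exactly a density takes values that are not simple.
\<close>

lemma geometric_integrand_extension:
  assumes \<Psi>: "geometric_integrand k \<Psi>" and L: "L-lipschitz_on (ray (G0 k)) \<Psi>"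
  shows "\<exists>h. L-lipschitz_on UNIV h \<and> h 0 = 0 \<and> (\<forall>\<xi>\<in>G0 k. \<forall>t\<ge>0. h (t *\<^sub>R \<xi>) = t * \<Psi> \<xi>)"
proof (cases "G0 k = ({} :: (real, 'a set) vec set)")
  case True
  then show ?thesis using lipschitz_on_nonneg[OF L]
    by (intro exI[of _ "\<lambda>_. 0"]) (auto intro: lipschitz_onI)
next
  case False
  then obtain \<zeta> :: "(real, 'a set) vec" where \<zeta>: "\<zeta> \<in> G0 k" by blast
  have "ray (G0 k) \<noteq> ({} :: (real, 'a set) vec set)" using rayI[OF \<zeta>, of 0] by auto
  then obtain h where h: "L-lipschitz_on UNIV h" "\<And>x. x \<in> ray (G0 k) \<Longrightarrow> h x = \<Psi> x"
    using lipschitz_extension[OF L] by blast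
  have hom: "h (t *\<^sub>R \<xi>) = t * \<Psi> \<xi>" if \<xi>: "\<xi> \<in> G0 k" and t: "0 \<le> t" for \<xi> t
  proof -
    have "\<xi> \<in> ray (G0 k)" using rayI[OF \<xi>, of 1] by simp
    then show ?thesis using \<Psi> t h(2)[OF rayI[OF \<xi> t]] by (simp add: geometric_integrand_def)
  qed
  then have "h 0 = 0" using hom[OF \<zeta>, of 0] by simp
  with hom h(1) show ?thesis by blast
qed

lemma integral_finite_range:
  fixes F :: "'a \<Rightarrow> 'b::{banach,second_countable_topology}" and G :: "'b \<Rightarrow> 'c::{banach,second_countable_topology}"
  assumes F: "integrable M F" "finite (range F)" and G: "G 0 = 0"
  shows "(LINT p|M. G (F p)) = (\<Sum>w\<in>range F - {0}. measure M {p \<in> space M. F p = w} *\<^sub>R G w)"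
proof -
  let ?W = "range F - {0}" and ?E = "\<lambda>w. {p \<in> space M. F p = w}"
  have [measurable]: "F \<in> borel_measurable M" using F(1) by simp
  have Em[measurable]: "?E w \<in> sets M" for w by measurable
  have int: "integrable M (indicator (?E w) :: 'a \<Rightarrow> real)" if w: "w \<in> ?W" for w
  proof (rule Bochner_Integration.integrable_bound)
    show "integrable M (\<lambda>p. norm (F p) / norm w)" using F(1) by simp
    show "AE p in M. norm (indicator (?E w) p :: real) \<le> norm (norm (F p) / norm w)"
      using w by (intro AE_I2) (auto simp: indicator_def)
  qed measurable
  have "(LINT p|M. G (F p)) = (LINT p|M. (\<Sum>w\<in>?W. indicator (?E w) p *\<^sub>R G w))"
  proof (rule Bochner_Integration.integral_cong[OF refl])
    fix p assume p: "p \<in> space M"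
    have "(\<Sum>w\<in>?W. indicator (?E w) p *\<^sub>R G w) = (\<Sum>w\<in>?W. if w = F p then G w else 0)"
      by (rule sum.cong) (use p in \<open>auto simp: indicator_def\<close>)
    also have "\<dots> = G (F p)" using F(2) G by (cases "F p = 0") auto
    finally show "G (F p) = (\<Sum>w\<in>?W. indicator (?E w) p *\<^sub>R G w)" ..
  qed
  also have "\<dots> = (\<Sum>w\<in>?W. LINT p|M. indicator (?E w) p *\<^sub>R G w)"
    by (intro Bochner_Integration.integral_sum integrable_scaleR_left int)
  also have "\<dots> = (\<Sum>w\<in>?W. measure M (?E w) *\<^sub>R G w)"
  proof (rule sum.cong[OF refl])
    fix w assume w: "w \<in> ?W"
    have "(LINT p|M. indicator (?E w) p *\<^sub>R G w) = (LINT p|M. indicator (?E w) p) *\<^sub>R G w"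
      using int[OF w] by (intro integral_scaleR_left) simp
    also have "(LINT p|M. indicator (?E w) p) = measure M (?E w)" using sets.Int_space_eq2[OF Em[of w]] by simp
    finally show "(LINT p|M. indicator (?E w) p *\<^sub>R G w) = measure M (?E w) *\<^sub>R G w" .
  qed
  finally show ?thesis .
qed

locale lipschitz_integrand =
  fixes k :: nat and \<Psi> h :: "real ^ ('n::{finite,linorder} set) \<Rightarrow> real" and c L :: real
  assumes lipschitz: "L-lipschitz_on UNIV h" and h_0: "h 0 = 0"
    and extends: "\<xi> \<in> G0 k \<Longrightarrow> 0 \<le> t \<Longrightarrow> h (t *\<^sub>R \<xi>) = t * \<Psi> \<xi>"
    and c_pos: "c > 0"
begin

text \<open>
  The integrand of the excess.
\<close>

definition g :: "real ^ ('n set) \<Rightarrow> real" where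
  "g \<xi> = h \<xi> - c * norm \<xi>"

lemma L_nonneg: "0 \<le> L"
  by (rule lipschitz_on_nonneg[OF lipschitz])

lemma h_diff: "\<bar>h \<xi> - h \<zeta>\<bar> \<le> L * norm (\<xi> - \<zeta>)"
  using lipschitz_onD[OF lipschitz, of \<xi> \<zeta>] by (simp add: dist_norm)

lemma measurable_h [measurable]: "h \<in> borel_measurable borel"
  by (rule borel_measurable_continuous_onI[OF lipschitz_on_continuous_on[OF lipschitz]])

lemma measurable_g [measurable]: "g \<in> borel_measurable borel"
  unfolding g_def[abs_def] by measurable

lemma g_0: "g 0 = 0"
  by (simp add: g_def h_0)

lemma g_diff: "\<bar>g \<xi> - g \<zeta>\<bar> \<le> (L + c) * norm (\<xi> - \<zeta>)"
proof -
  have "c * \<bar>norm \<xi> - norm \<zeta>\<bar> \<le> c * norm (\<xi> - \<zeta>)" using c_pos norm_triangle_ineq3[of \<xi> \<zeta>] by simp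
  moreover have "\<bar>g \<xi> - g \<zeta>\<bar> \<le> \<bar>h \<xi> - h \<zeta>\<bar> + \<bar>c * (norm \<xi> - norm \<zeta>)\<bar>"
    unfolding g_def by (simp add: algebra_simps)
  moreover have "\<bar>c * (norm \<xi> - norm \<zeta>)\<bar> = c * \<bar>norm \<xi> - norm \<zeta>\<bar>" using c_pos by (simp add: abs_mult)
  ultimately show ?thesis using h_diff[of \<xi> \<zeta>] unfolding distrib_right by linarith
qed

lemma g_bound: "\<bar>g \<xi>\<bar> \<le> (L + c) * norm \<xi>"
  using g_diff[of \<xi> 0] by (simp add: g_0)

lemma unit_simple: "simple_kvector k \<xi> \<Longrightarrow> \<xi> \<noteq> 0 \<Longrightarrow> (1 / norm \<xi>) *\<^sub>R \<xi> \<in> G0 k"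
proof -
  assume \<xi>: "simple_kvector k \<xi>" "\<xi> \<noteq> 0"
  then obtain a v where "\<xi> = a *\<^sub>R wedge k v" by (auto simp: simple_kvector_def)
  then have "(1 / norm \<xi>) *\<^sub>R \<xi> = (1 / norm \<xi> * a) *\<^sub>R wedge k v" by simp
  then have "simple_kvector k ((1 / norm \<xi>) *\<^sub>R \<xi>)" unfolding simple_kvector_def by blast
  then show ?thesis using \<xi>(2) by (simp add: G0_def)
qed

lemma h_scale:
  assumes \<xi>: "simple_kvector k \<xi>" and t: "0 \<le> t"
  shows "h (t *\<^sub>R \<xi>) = t * h \<xi>"
proof (cases "\<xi> = 0")
  case False
  let ?u = "(1 / norm \<xi>) *\<^sub>R \<xi>"
  have "h (s *\<^sub>R \<xi>) = s * norm \<xi> * \<Psi> ?u" if "0 \<le> s" for s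
    using extends[OF unit_simple[OF \<xi> False], of "s * norm \<xi>"] that False by simp
  from this[OF t] this[of 1] show ?thesis by simp
qed (simp add: h_0)

lemma g_scale: "simple_kvector k \<xi> \<Longrightarrow> 0 \<le> t \<Longrightarrow> g (t *\<^sub>R \<xi>) = t * g \<xi>"
  by (simp add: g_def h_scale right_diff_distrib)

lemma G0_simple: "\<xi> \<in> G0 k \<Longrightarrow> simple_kvector k \<xi>"
  by (simp add: G0_def)

lemma g_G0: "\<xi> \<in> G0 k \<Longrightarrow> g \<xi> = \<Psi> \<xi> - c"
  using extends[of \<xi> 1] by (simp add: g_def G0_def)

lemma integrable_g:
  assumes "integrable M F"
  shows "integrable M (\<lambda>p. g (F p))"
proof (rule Bochner_Integration.integrable_bound)
  show "integrable M (\<lambda>p. (L + c) * norm (F p))" using assms by simp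
  have [measurable]: "F \<in> borel_measurable M" using assms by simp
  show "(\<lambda>p. g (F p)) \<in> borel_measurable M" by measurable
  show "AE p in M. norm (g (F p)) \<le> norm ((L + c) * norm (F p))"
    by (rule AE_I2) (simp, rule order_trans[OF g_bound abs_ge_self])
qed

lemma energy_minus_mass:
  assumes S: "S \<in> polyhedral_currents k" and F: "has_density k S F"
  shows "energy k \<Psi> S - c * mass k S = (LINT p|hausdorff_measure k. g (F p))"
proof -
  let ?H = "hausdorff_measure k :: ((real, 'n) vec) measure"
  obtain M \<tau> \<Theta> where rep: "represents k S M \<tau> \<Theta>" using polyhedral_represents[OF S] by metis
  have e: "energy k \<Psi> S = (LINT p|?H. h (F p))"
    by (rule energy_eq[OF rep F measurable_h h_0]) (simp add: extends)
  have int: "integrable ?H F" by (rule has_densityD(1)[OF F])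
  have "integrable ?H (\<lambda>p. g (F p) + c * norm (F p))"
    by (intro Bochner_Integration.integrable_add integrable_g int integrable_mult_right integrable_norm)
  then have "integrable ?H (\<lambda>p. h (F p))" by (simp add: g_def)
  then show ?thesis unfolding e mass_eq[OF rep F] g_def using int by simp
qed

lemma AUE_iff:
  "\<Psi> \<in> AUE k (polyhedral_test_pairs k) c \<longleftrightarrow>
    (\<forall>(S, D)\<in>polyhedral_test_pairs k. energy k \<Psi> D - c * mass k D \<le> energy k \<Psi> S - c * mass k S)"
  unfolding AUE_def by (auto simp: right_diff_distrib algebra_simps)

lemma cube_density:
  assumes ind: "indep_frame k v"
  obtains F where "has_density k (b *\<^sub>R cube_cell k x v) F" "(LINT p|hausdorff_measure k. g (F p)) = g (b *\<^sub>R wedge k v)"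
    "(LINT p|hausdorff_measure k. F p) = b *\<^sub>R wedge k v" "\<And>p. F p \<noteq> 0 \<Longrightarrow> p \<in> plane k x v"
proof -
  let ?H = "hausdorff_measure k :: ((real, 'n) vec) measure"
  define a where "a = area_factor k x v"
  define K where "K = aff k x v ` unit_cube k"
  define F where "F = (\<lambda>p. b *\<^sub>R (indicator K p *\<^sub>R ((1 / a) *\<^sub>R wedge k v)))"
  have a: "a > 0" unfolding a_def by (rule area_factor(1)[OF ind])
  have F: "has_density k (b *\<^sub>R cube_cell k x v) F"
    unfolding F_def K_def a_def by (intro has_density_scaleR cell_has_density ind unit_cube_sets order_refl)
  have m: "measure (leb_Rk k) (unit_cube k) = 1" by (simp add: measure_def emeasure_unit_cube)
  have ci: "integrable ?H (\<lambda>p. indicator K p / a * s)" "(LINT p|?H. indicator K p / a * s) = s" for s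
    using cell_integral_const[OF ind unit_cube_sets order_refl, of x s] unfolding K_def[symmetric] a_def[symmetric] m by simp_all
  have simple: "simple_kvector k (b *\<^sub>R wedge k v)" unfolding simple_kvector_def by blast
  have Fe: "F p = (indicator K p / a) *\<^sub>R (b *\<^sub>R wedge k v)" for p by (simp add: F_def)
  show ?thesis
  proof (rule that[OF F])
    have "g (F p) = indicator K p / a * g (b *\<^sub>R wedge k v)" for p
      unfolding Fe by (rule g_scale[OF simple]) (use a in simp)
    then show "(LINT p|?H. g (F p)) = g (b *\<^sub>R wedge k v)" by (simp only: ci(2))
    have "(LINT p|?H. F p) = (LINT p|?H. indicator K p / a) *\<^sub>R (b *\<^sub>R wedge k v)"
      unfolding Fe by (rule integral_scaleR_left) (use ci(1)[of 1] in simp)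
    also have "(LINT p|?H. indicator K p / a) = 1" using ci(2)[of 1] by simp
    finally show "(LINT p|?H. F p) = b *\<^sub>R wedge k v" by simp
    show "F p \<noteq> 0 \<Longrightarrow> p \<in> plane k x v" for p
      using aff_in_plane[of k x v] by (auto simp: F_def K_def indicator_def split: if_splits)
  qed
qed

end

section \<open>Polyconvexity implies ellipticity\<close>

context lipschitz_integrand
begin

text \<open>
  The vectors are normalised, which is possible by homogeneity, and the indices of weight \<open>0\<close> are discarded.
\<close>

lemma UPC_weighted:
  assumes UPC: "\<Psi> \<in> UPC k c" and W: "finite W" "\<And>w. w \<in> W \<Longrightarrow> w \<noteq> 0 \<and> (1 / norm w) *\<^sub>R w \<in> G0 k"
    and \<mu>: "\<And>w. w \<in> W \<Longrightarrow> 0 \<le> \<mu> w" and \<xi>: "simple_kvector k \<xi>" "\<xi> \<noteq> 0" "\<xi> = (\<Sum>w\<in>W. \<mu> w *\<^sub>R w)"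
  shows "g \<xi> \<le> (\<Sum>w\<in>W. \<mu> w * g w)"
proof -
  define V where "V = {w\<in>W. \<mu> w \<noteq> 0}"
  have V: "finite V" using W(1) by (simp add: V_def)
  have sumV: "(\<Sum>w\<in>W. f w) = (\<Sum>w\<in>V. f w)" if "\<And>w. \<mu> w = 0 \<Longrightarrow> f w = 0" for f :: "_ \<Rightarrow> 'b::comm_monoid_add"
    by (rule sum.mono_neutral_right[OF W(1)]) (auto simp: V_def that)
  have \<xi>V: "\<xi> = (\<Sum>w\<in>V. \<mu> w *\<^sub>R w)" unfolding \<xi>(3) by (rule sumV) simp
  define d where "d = card V"
  obtain f where f: "bij_betw f {1..d} V" using ex_bij_betw_nat_finite_1[OF V] unfolding d_def by blast
  have fV: "f i \<in> V" if "i \<in> {1..d}" for i using f that by (auto simp: bij_betw_def)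
  have d: "0 < d" using \<xi>(2) \<xi>V V by (auto simp: d_def card_gt_0_iff)
  define n0 where "n0 = norm \<xi>"
  have n0: "n0 > 0" using \<xi>(2) by (simp add: n0_def)
  define \<eta> where "\<eta> = (\<lambda>i::nat. if i = 0 then (1 / n0) *\<^sub>R \<xi> else (1 / norm (f i)) *\<^sub>R f i)"
  define m where "m = (\<lambda>i. \<mu> (f i) * norm (f i) / n0)"
  have m: "0 < m i" if "i \<in> {1..d}" for i
    using fV[OF that] \<mu>[of "f i"] W(2)[of "f i"] n0 by (simp add: m_def V_def less_le)
  have \<eta>G: "\<eta> i \<in> G0 k" if "i \<in> {0..d}" for i
    using fV[of i] W(2)[of "f i"] unit_simple[OF \<xi>(1,2)] that by (cases "i = 0") (auto simp: \<eta>_def n0_def V_def)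
  have reindex: "(\<Sum>i=1..d. u (f i)) = (\<Sum>w\<in>V. u w)" for u :: "_ \<Rightarrow> 'b::comm_monoid_add"
    by (rule sum.reindex_bij_betw[OF f])
  have "m i *\<^sub>R \<eta> i = (1 / n0) *\<^sub>R (\<mu> (f i) *\<^sub>R f i)" if "i \<in> {1..d}" for i
    using that fV[OF that] W(2)[of "f i"] by (simp add: m_def \<eta>_def V_def)
  then have "(\<Sum>i=1..d. m i *\<^sub>R \<eta> i) = (\<Sum>i=1..d. (1 / n0) *\<^sub>R (\<mu> (f i) *\<^sub>R f i))" by (rule sum.cong[OF refl])
  also have "\<dots> = (1 / n0) *\<^sub>R (\<Sum>i=1..d. \<mu> (f i) *\<^sub>R f i)" by (rule scaleR_sum_right[symmetric])
  also have "\<dots> = (1 / n0) *\<^sub>R \<xi>" by (simp only: reindex[of "\<lambda>w. \<mu> w *\<^sub>R w"] \<xi>V[symmetric])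
  finally have eq: "\<eta> 0 = (\<Sum>i=1..d. m i *\<^sub>R \<eta> i)" by (simp add: \<eta>_def)
  have "(\<Sum>i=1..d. m i * \<Psi> (\<eta> i)) - \<Psi> (\<eta> 0) \<ge> c * ((\<Sum>i=1..d. m i * norm (\<eta> i)) - norm (\<eta> 0))"
    using UPC d m \<eta>G eq unfolding UPC_def by blast
  moreover have "norm (\<eta> i) = 1" if "i \<in> {0..d}" for i using \<eta>G[OF that] by (simp add: G0_def)
  then have "(\<Sum>i=1..d. m i * norm (\<eta> i)) = (\<Sum>i=1..d. m i)" "norm (\<eta> 0) = 1" by simp_all
  ultimately have "\<Psi> (\<eta> 0) - c \<le> (\<Sum>i=1..d. m i * \<Psi> (\<eta> i)) - c * (\<Sum>i=1..d. m i)"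
    by (simp add: algebra_simps)
  also have "\<dots> = (\<Sum>i=1..d. m i * (\<Psi> (\<eta> i) - c))"
    by (simp add: right_diff_distrib sum_subtractf sum_distrib_left mult.commute)
  also have "\<dots> = (\<Sum>i=1..d. m i * g (\<eta> i))" by (rule sum.cong) (auto simp: g_G0 \<eta>G)
  finally have ineq: "g (\<eta> 0) \<le> (\<Sum>i=1..d. m i * g (\<eta> i))" using g_G0[OF \<eta>G[of 0]] by simp
  have "n0 * (m i * g (\<eta> i)) = \<mu> (f i) * g (f i)" if i: "i \<in> {1..d}" for i
  proof -
    have f0: "f i \<noteq> 0" using fV[OF i] W(2) by (simp add: V_def)
    have "g (f i) = norm (f i) * g (\<eta> i)"
      using g_scale[OF G0_simple[OF \<eta>G[of i]], of "norm (f i)"] i f0 by (simp add: \<eta>_def)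
    then show ?thesis using n0 by (simp add: m_def)
  qed
  then have "n0 * (\<Sum>i=1..d. m i * g (\<eta> i)) = (\<Sum>i=1..d. \<mu> (f i) * g (f i))" by (simp add: sum_distrib_left)
  also have "\<dots> = (\<Sum>w\<in>V. \<mu> w * g w)" by (rule reindex)
  also have "\<dots> = (\<Sum>w\<in>W. \<mu> w * g w)" by (rule sumV[symmetric]) simp
  finally have "n0 * (\<Sum>i=1..d. m i * g (\<eta> i)) = (\<Sum>w\<in>W. \<mu> w * g w)" .
  moreover have "g \<xi> = n0 * g (\<eta> 0)"
    using g_scale[OF G0_simple[OF \<eta>G[of 0]], of n0] n0 by (simp add: \<eta>_def)
  ultimately show ?thesis using mult_left_mono[OF ineq, of n0] n0 by simp
qed

lemma UPC_imp_AUE: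
  assumes UPC: "\<Psi> \<in> UPC k c"
  shows "\<Psi> \<in> AUE k (polyhedral_test_pairs k) c"
  unfolding AUE_iff
proof (clarify)
  fix S D :: "'n current" assume "(S, D) \<in> polyhedral_test_pairs k"
  then obtain e where S: "S \<in> polyhedral_currents k" and e: "orthonormal_frame k e" and D: "D = cube_cell k 0 e"
    and cyc: "cycle k (S - D)" unfolding polyhedral_test_pairs_iff by blast
  let ?H = "hausdorff_measure k :: ((real, 'n) vec) measure"
  have ind: "indep_frame k e" by (rule indep_orthonormal_frame[OF e])
  obtain FD where FD: "has_density k D FD" "(LINT p|?H. g (FD p)) = g (wedge k e)" "(LINT p|?H. FD p) = wedge k e"
    using cube_density[OF ind, of 1 0] unfolding D by (metis scaleR_one)
  obtain F where F: "has_density k S F" "finite (range F)" "\<And>p. F p \<noteq> 0 \<Longrightarrow> (1 / norm (F p)) *\<^sub>R F p \<in> G0 k"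
    using polyhedral_represents[OF S] by metis
  have "has_density k (S - D) (\<lambda>p. F p - FD p)"
    using has_density_plus[OF F(1) has_density_scaleR[OF FD(1), of "-1"]] by simp
  from cycle_density_integral_zero[OF this cyc]
  have "(LINT p|?H. F p) = wedge k e"
    using has_densityD(1)[OF F(1)] has_densityD(1)[OF FD(1)] FD(3) by simp
  then have sum: "wedge k e = (\<Sum>w\<in>range F - {0}. measure ?H {p \<in> space ?H. F p = w} *\<^sub>R w)"
    using integral_finite_range[OF has_densityD(1)[OF F(1)] F(2), of "\<lambda>w. w"] by simp
  have "g (wedge k e) \<le> (\<Sum>w\<in>range F - {0}. measure ?H {p \<in> space ?H. F p = w} * g w)"
  proof (rule UPC_weighted[OF UPC _ _ _ _ _ sum])
    show "simple_kvector k (wedge k e)" unfolding simple_kvector_def by (metis scaleR_one)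
    show "wedge k e \<noteq> 0" using ind wedge_eq_zero_iff by blast
  qed (use F in auto)
  also have "\<dots> = (LINT p|?H. g (F p))"
    using integral_finite_range[OF has_densityD(1)[OF F(1)] F(2), of g] g_0 by simp
  finally have "(LINT p|?H. g (FD p)) \<le> (LINT p|?H. g (F p))" by (simp add: FD(2))
  then show "energy k \<Psi> D - c * mass k D \<le> energy k \<Psi> S - c * mass k S"
    using energy_minus_mass[OF S F(1)] energy_minus_mass[OF _ FD(1)] cube_polyhedral[of k 0 e] by (simp add: D)
qed

section \<open>Ellipticity implies polyconvexity\<close>

lemma negligible_plane:
  fixes v :: "nat \<Rightarrow> real ^ 'n::{finite,linorder}"
  assumes k: "k < CARD('n)"
  shows "negligible {u. x + u \<in> plane k y v}"
proof -
  have "dim (span (v ` {..<k})) \<le> card (v ` {..<k})" by (simp add: dim_le_card')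
  also have "\<dots> \<le> k" using card_image_le[of "{..<k}" v] by simp
  finally have "negligible (span (v ` {..<k}))" using k by (intro negligible_lowdim) simp
  then have "negligible ((+) (y - x) ` span (v ` {..<k}))" by (rule negligible_translation)
  moreover have "{u. x + u \<in> plane k y v} \<subseteq> (+) (y - x) ` span (v ` {..<k})"
  proof
    fix u assume "u \<in> {u. x + u \<in> plane k y v}"
    then have "x + u - y \<in> span (v ` {..<k})" by (simp add: plane_def)
    then show "u \<in> (+) (y - x) ` span (v ` {..<k})" by (rule rev_image_eqI) simp
  qed
  ultimately show ?thesis by (rule negligible_subset)
qed

text \<open>
  Since \<open>k < n\<close>, arbitrarily small translations put the cells into pairwise different planes, where their
  densities do not interact.
\<close>

lemma generic_cells:
  assumes k: "k < CARD('n)" and \<epsilon>: "\<epsilon> > 0"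
  shows "\<exists>T Q F X. small_chain k \<epsilon> Q \<and> cycle k (cells k ps - T - Q) \<and> T \<in> polyhedral_currents k \<and>
    has_density k T F \<and> finite X \<and> (\<forall>(y, w)\<in>X. indep_frame k w) \<and> (\<forall>p. F p \<noteq> 0 \<longrightarrow> (\<exists>(y, w)\<in>X. p \<in> plane k y w)) \<and>
    (LINT p|hausdorff_measure k. g (F p)) = (\<Sum>(b, x, v)\<leftarrow>ps. g (b *\<^sub>R wedge k (v :: nat \<Rightarrow> (real, 'n) vec)))"
  using \<epsilon>
proof (induction ps arbitrary: \<epsilon>)
  case Nil
  have "0 \<in> polyhedral_currents k" using zero_polyhedral[of k] by (simp only: zero_fun_def)
  then show ?case
    using Nil by (intro exI[where x="0 :: 'n current"] exI[where x="\<lambda>p. 0 :: (real, 'n set) vec"] exI[where x="{}"])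
      (simp add: cells_def small_chain_0 cycle_0 has_density_0 g_0)
next
  case (Cons q ps)
  let ?H = "hausdorff_measure k :: ((real, 'n) vec) measure"
  obtain b x v where q: "q = (b, x, v)" by (cases q) auto
  obtain T Q F X where IH: "small_chain k (\<epsilon>/2) Q" "cycle k (cells k ps - T - Q)" "T \<in> polyhedral_currents k"
    "has_density k T F" "finite X" "\<forall>(y, w)\<in>X. indep_frame k w" "\<forall>p. F p \<noteq> 0 \<longrightarrow> (\<exists>(y, w)\<in>X. p \<in> plane k y w)"
    "(LINT p|?H. g (F p)) = (\<Sum>(b, x, v)\<leftarrow>ps. g (b *\<^sub>R wedge k v))"
    using Cons.IH[of "\<epsilon>/2"] Cons.prems by auto
  show ?case
  proof (cases "indep_frame k v")
    case False
    then have "cells k (q # ps) = cells k ps" "wedge k v = 0"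
      using wedge_eq_zero_iff[of k v] by (simp_all add: cells_def q cell_wedge_zero)
    moreover have "small_chain k \<epsilon> Q" by (rule small_chain_mono[OF IH(1)]) (use Cons.prems in simp)
    ultimately show ?thesis using IH(2-8) by (intro exI[of _ T] exI[of _ Q] exI[of _ F] exI[of _ X]) (simp add: q g_0)
  next
    case True
    obtain C where C: "C \<ge> 0" "\<And>x u. \<exists>Q. small_chain k (C * norm u) Q \<and> cycle k (cube_cell k (x + u) v - cube_cell k x v - Q)"
      using translation_walls[of k v] by blast
    define \<delta> where "\<delta> = \<epsilon> / (2 * (\<bar>b\<bar> * C + 1))"
    have \<delta>: "\<delta> > 0" "\<bar>b\<bar> * C * \<delta> \<le> \<epsilon>/2"
    proof -
      have bC: "0 \<le> \<bar>b\<bar> * C" using C(1) by simp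
      then show "\<delta> > 0" using Cons.prems by (simp add: \<delta>_def)
      have "\<bar>b\<bar> * C * \<delta> \<le> (\<bar>b\<bar> * C + 1) * \<delta>" using \<open>\<delta> > 0\<close> by (simp add: distrib_right)
      also have "\<dots> = \<epsilon>/2" using bC by (simp add: \<delta>_def field_simps add_nonneg_eq_0_iff)
      finally show "\<bar>b\<bar> * C * \<delta> \<le> \<epsilon>/2" .
    qed
    have "negligible (\<Union>((\<lambda>(y, w). {u. x + u \<in> plane k y w}) ` X))"
      using IH(5) negligible_plane[OF k, of x] by (intro negligible_Union) auto
    then have "\<not> ball 0 \<delta> \<subseteq> \<Union>((\<lambda>(y, w). {u. x + u \<in> plane k y w}) ` X)"
      using \<delta>(1) negligible_subset open_not_negligible[of "ball (0 :: (real, 'n) vec) \<delta>"] by auto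
    then obtain u where u: "norm u < \<delta>" "\<And>y w. (y, w) \<in> X \<Longrightarrow> x + u \<notin> plane k y w" by fastforce
    obtain Q' where Q': "small_chain k (C * norm u) Q'" "cycle k (cube_cell k (x + u) v - cube_cell k x v - Q')" using C(2) by blast
    obtain G where G: "has_density k (b *\<^sub>R cube_cell k (x + u) v) G" "(LINT p|?H. g (G p)) = g (b *\<^sub>R wedge k v)"
      "\<And>p. G p \<noteq> 0 \<Longrightarrow> p \<in> plane k (x + u) v" using cube_density[OF True] by metis
    define R where "R = Q - b *\<^sub>R Q'"
    have "small_chain k (\<epsilon>/2 + \<epsilon>/2) R"
      unfolding R_def
    proof (intro small_chain_diff IH(1) small_chain_mono[OF small_chain_scaleR[OF Q'(1)]])
      have "\<bar>b\<bar> * (C * norm u) \<le> \<bar>b\<bar> * C * \<delta>"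
        using mult_left_mono[of "norm u" \<delta> "\<bar>b\<bar> * C"] u(1) C(1) by simp
      then show "\<bar>b\<bar> * (C * norm u) \<le> \<epsilon>/2" using \<delta>(2) by linarith
    qed
    then have small: "small_chain k \<epsilon> R" by simp
    have cyc: "cycle k (cells k (q # ps) - (T + b *\<^sub>R cube_cell k (x + u) v) - R)"
    proof -
      have "cells k (q # ps) - (T + b *\<^sub>R cube_cell k (x + u) v) - R =
          (cells k ps - T - Q) - b *\<^sub>R (cube_cell k (x + u) v - cube_cell k x v - Q')"
        by (simp add: cells_def q R_def scaleR_diff_right)
      then show ?thesis by (simp only:) (rule cycle_diff[OF IH(2) cycle_scaleR[OF Q'(2), of b]])
    qed
    have poly: "T + b *\<^sub>R cube_cell k (x + u) v \<in> polyhedral_currents k"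
      using polyhedral_add[OF IH(3) polyhedral_scale[OF cube_polyhedral, of b]]
      by (simp add: plus_fun_def scaleR_fun_def)
    have null: "(\<Union>((\<lambda>(y, w). plane k (x + u) v \<inter> plane k y w) ` X)) \<in> null_sets ?H"
    proof (intro null_sets.finite_UN IH(5))
      fix yw assume "yw \<in> X"
      then obtain y w where yw: "yw = (y, w)" "(y, w) \<in> X" by (cases yw) auto
      have ind: "indep_frame k w" using IH(6) yw(2) by blast
      have "plane k (x + u) v \<noteq> plane k y w" using u(2)[OF yw(2)] base_in_plane[of "x + u" k v] by auto
      then show "(case yw of (y, w) \<Rightarrow> plane k (x + u) v \<inter> plane k y w) \<in> null_sets ?H"
        using null_plane_inter[OF True _ \<open>plane k (x + u) v \<noteq> plane k y w\<close>] ind by (simp add: yw(1))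
    qed
    have ae: "AE p in ?H. g (F p + G p) = g (F p) + g (G p)"
      using AE_not_in[OF null]
    proof eventually_elim
      case (elim p)
      then have "F p = 0 \<or> G p = 0" using IH(7) G(3)[of p] by fastforce
      then show ?case by (auto simp: g_0)
    qed
    have dens: "has_density k (T + b *\<^sub>R cube_cell k (x + u) v) (\<lambda>p. F p + G p)" by (rule has_density_plus[OF IH(4) G(1)])
    have int: "integrable ?H F" "integrable ?H G" using IH(4) G(1) has_densityD(1) by blast+
    then have [measurable]: "F \<in> borel_measurable ?H" "G \<in> borel_measurable ?H" by auto
    have "(LINT p|?H. g (F p + G p)) = (LINT p|?H. g (F p) + g (G p))"
      by (rule integral_cong_AE[OF _ _ ae]) measurable
    also have "\<dots> = (LINT p|?H. g (F p)) + (LINT p|?H. g (G p))"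
      by (intro Bochner_Integration.integral_add integrable_g int)
    finally have val: "(LINT p|?H. g (F p + G p)) = (\<Sum>(b, x, v)\<leftarrow>q # ps. g (b *\<^sub>R wedge k v))"
      by (simp add: IH(8) G(2) q)
    have "\<exists>(y, w)\<in>insert (x + u, v) X. p \<in> plane k y w" if "F p + G p \<noteq> 0" for p
      using IH(7) G(3)[of p] that by fastforce
    then show ?thesis
      using small cyc poly dens val IH(5,6) True
      by (intro exI[of _ "T + b *\<^sub>R cube_cell k (x + u) v"] exI[of _ R] exI[of _ "\<lambda>p. F p + G p"] exI[of _ "insert (x + u, v) X"]) auto
  qed
qed

text \<open>
  The competitor consists of the cells of the filling in general position and of two corrections of small
  mass.  The Lipschitz bound for \<open>g\<close> controls the corrections even where they overlap the cells.
\<close>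

lemma AUE_imp_orthonormal_inequality:
  fixes e :: "nat \<Rightarrow> (real, 'n) vec" and w :: "nat \<Rightarrow> nat \<Rightarrow> (real, 'n) vec" and n :: nat
  assumes AUE: "\<Psi> \<in> AUE k (polyhedral_test_pairs k) c" and k: "k < CARD('n)"
    and e: "orthonormal_frame k e" and comb: "wedge k e = (\<Sum>i<n. b i *\<^sub>R wedge k (w i))"
  shows "g (wedge k e) \<le> (\<Sum>i<n. g (b i *\<^sub>R wedge k (w i)))"
proof (rule field_le_epsilon)
  fix \<epsilon> :: real assume \<epsilon>: "\<epsilon> > 0"
  let ?H = "hausdorff_measure k :: ((real, 'n) vec) measure"
  have Lc: "L + c > 0" using L_nonneg c_pos by simp
  define \<delta> where "\<delta> = \<epsilon> / (2 * (L + c))"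
  have \<delta>0: "(a::real) * (\<epsilon> / (2 * a) + \<epsilon> / (2 * a)) = \<epsilon>" if "a > 0" for a using that by (simp add: field_simps)
  have \<delta>: "\<delta> > 0" "(L + c) * (\<delta> + \<delta>) = \<epsilon>" using \<epsilon> Lc \<delta>0[OF Lc] unfolding \<delta>_def by (simp_all only: divide_pos_pos mult_pos_pos zero_less_numeral)
  obtain ps Q where ps: "small_chain k \<delta> Q" "cycle k (cube_cell k 0 e - cells k ps - Q)"
    "(\<Sum>(b, x, v)\<leftarrow>ps. g (b *\<^sub>R wedge k v)) = (\<Sum>i<n. g (b i *\<^sub>R wedge k (w i)))"
  proof (rule cube_filling[OF comb \<delta>(1)])
    fix ps Q assume a: "small_chain k \<delta> Q" "cycle k (cube_cell k 0 e - cells k ps - Q)"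
      and hom: "\<And>G :: (real, 'n set) vec \<Rightarrow> real. (\<And>t \<xi>. simple_kvector k \<xi> \<Longrightarrow> 0 \<le> t \<Longrightarrow> G (t *\<^sub>R \<xi>) = t * G \<xi>) \<Longrightarrow>
        (\<Sum>(b, x, v)\<leftarrow>ps. G (b *\<^sub>R wedge k v)) = (\<Sum>i<n. G (b i *\<^sub>R wedge k (w i)))"
    show thesis by (rule that[OF a hom]) (rule g_scale)
  qed
  obtain T Q' F where T: "small_chain k \<delta> Q'" "cycle k (cells k ps - T - Q')" "T \<in> polyhedral_currents k"
    "has_density k T F" "(LINT p|?H. g (F p)) = (\<Sum>(b, x, v)\<leftarrow>ps. g (b *\<^sub>R wedge k v))"
    using generic_cells[OF k \<delta>(1), of ps] by blast
  obtain G where G: "has_density k (Q + Q') G" "(LINT p|?H. norm (G p)) \<le> \<delta> + \<delta>" and QQ: "Q + Q' \<in> polyhedral_currents k"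
    using small_chain_density[OF small_chain_add[OF ps(1) T(1)]] by blast
  define S where "S = T + (Q + Q')"
  have S: "S \<in> polyhedral_currents k" using polyhedral_add[OF T(3) QQ] by (simp add: S_def plus_fun_def)
  have dens: "has_density k S (\<lambda>p. F p + G p)" unfolding S_def by (rule has_density_plus[OF T(4) G(1)])
  have "cycle k (- 1 *\<^sub>R ((cube_cell k 0 e - cells k ps - Q) + (cells k ps - T - Q')))"
    by (intro cycle_scaleR cycle_add ps(2) T(2))
  moreover have "- 1 *\<^sub>R ((cube_cell k 0 e - cells k ps - Q) + (cells k ps - T - Q')) = S - cube_cell k 0 e"
    by (simp add: S_def)
  ultimately have cyc: "cycle k (S - cube_cell k 0 e)" by (simp only:)
  have "(S, cube_cell k 0 e) \<in> polyhedral_test_pairs k"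
    unfolding polyhedral_test_pairs_iff by (intro conjI S exI[of _ e] e refl cyc)
  then have le: "energy k \<Psi> (cube_cell k 0 e) - c * mass k (cube_cell k 0 e) \<le> energy k \<Psi> S - c * mass k S"
    using AUE unfolding AUE_iff by blast
  obtain FD where FD: "has_density k (cube_cell k 0 e) FD" "(LINT p|?H. g (FD p)) = g (wedge k e)"
    using cube_density[OF indep_orthonormal_frame[OF e], of 1 0] by (metis scaleR_one)
  have int: "integrable ?H F" "integrable ?H G" using T(4) G(1) has_densityD(1) by blast+
  have "g (wedge k e) \<le> (LINT p|?H. g (F p + G p))"
    using le energy_minus_mass[OF S dens] energy_minus_mass[OF cube_polyhedral FD(1)] FD(2) by simp
  also have "\<dots> \<le> (LINT p|?H. g (F p) + (L + c) * norm (G p))"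
  proof (rule integral_mono)
    show "integrable ?H (\<lambda>p. g (F p + G p))" by (intro integrable_g Bochner_Integration.integrable_add int)
    show "integrable ?H (\<lambda>p. g (F p) + (L + c) * norm (G p))"
      by (intro Bochner_Integration.integrable_add integrable_g int integrable_mult_right integrable_norm)
    show "g (F p + G p) \<le> g (F p) + (L + c) * norm (G p)" for p using g_diff[of "F p + G p" "F p"] by simp
  qed
  also have "\<dots> = (LINT p|?H. g (F p)) + (L + c) * (LINT p|?H. norm (G p))"
    using int by (subst Bochner_Integration.integral_add) (auto intro: integrable_g)
  also have "\<dots> \<le> (LINT p|?H. g (F p)) + (L + c) * (\<delta> + \<delta>)"
    using G(2) Lc by (intro add_left_mono mult_left_mono) auto
  finally show "g (wedge k e) \<le> (\<Sum>i<n. g (b i *\<^sub>R wedge k (w i))) + \<epsilon>" unfolding \<delta>(2) T(5) ps(3) .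
qed

lemma orthonormal_frame_of_simple:
  fixes \<xi> :: "(real, 'n) vec \<Rightarrow> _"
  assumes ind: "indep_frame k (v :: nat \<Rightarrow> (real, 'n) vec)"
  shows "\<exists>e s. orthonormal_frame k e \<and> wedge k v = s *\<^sub>R wedge k e"
proof -
  obtain B where B: "pairwise orthogonal B" "\<And>x. x \<in> B \<Longrightarrow> norm x = 1" "independent B" "card B = dim (span (v ` {..<k}))" "span B = span (v ` {..<k})"
    using orthonormal_basis_subspace[OF subspace_span, of "v ` {..<k}"] by metis
  have cB: "card B = k" using B(4) dim_span_frame[OF ind] by simp
  have fB: "finite B" using independent_imp_finite[OF B(3)] .
  obtain e where e: "bij_betw e {0..<k} B" using ex_bij_betw_nat_finite[OF fB] unfolding cB by blast
  have on: "orthonormal_frame k e"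
    unfolding orthonormal_frame_def
  proof (intro allI impI)
    fix i j assume ij: "i < k" "j < k"
    then have eB: "e i \<in> B" "e j \<in> B" using e by (auto simp: bij_betw_def)
    show "e i \<bullet> e j = (if i = j then 1 else 0)"
    proof (cases "i = j")
      case True then show ?thesis using B(2)[OF eB(1)] by (simp add: dot_square_norm)
    next
      case False
      then have "e i \<noteq> e j" using e ij by (auto simp: bij_betw_def inj_on_def)
      then show ?thesis using B(1) eB False by (simp add: pairwise_def orthogonal_def)
    qed
  qed
  have "e ` {..<k} = B" using e by (simp add: bij_betw_def atLeast0LessThan)
  then have "v j \<in> span (e ` {..<k})" if "j < k" for j using that B(5) span_base[of "v j" "v ` {..<k}"] by auto
  then show ?thesis using wedge_parallel[OF indep_orthonormal_frame[OF on]] on by blast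
qed

text \<open>
  For \<open>k \<ge> 1\<close> the simple multivector \<open>\<eta> 0\<close> is a positive multiple of the multivector of an orthonormal frame, after
  changing the sign of one of its vectors.  A frame of length \<open>0\<close> cannot be reoriented, so for \<open>k = 0\<close> the negative
  orientation needs an extra argument.
\<close>

lemma AUE_imp_UPC:
  assumes AUE: "\<Psi> \<in> AUE k (polyhedral_test_pairs k) c" and k: "k < CARD('n)"
  shows "\<Psi> \<in> UPC k c"
  unfolding UPC_def
proof (intro CollectI allI impI)
  fix d m and \<eta> :: "nat \<Rightarrow> (real, 'n set) vec"
  assume m: "\<forall>i\<in>{1..d}. 0 < m i" and \<eta>: "\<forall>i\<in>{0..d}. \<eta> i \<in> G0 k" and eq: "\<eta> 0 = (\<Sum>i=1..d. m i *\<^sub>R \<eta> i)"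
  have "\<exists>a v. \<eta> i = a *\<^sub>R wedge k v" if "i \<in> {0..d}" for i using \<eta> that by (auto simp: G0_def simple_kvector_def)
  then obtain a v where av: "\<And>i. i \<in> {0..d} \<Longrightarrow> \<eta> i = a i *\<^sub>R wedge k (v i)" by metis
  have n1: "norm (\<eta> i) = 1" if "i \<in> {0..d}" for i using \<eta> that by (simp add: G0_def)
  have shift: "(\<Sum>i<d. f (Suc i)) = (\<Sum>i=1..d. f i)" for f :: "nat \<Rightarrow> 'b::comm_monoid_add"
    using sum.shift_bounds_Suc_ivl[of f 0 d] by (simp add: atLeast0LessThan atLeastLessThanSuc_atLeastAtMost)
  have "\<eta> 0 \<noteq> 0" using n1[of 0] by auto
  then have "indep_frame k (v 0)" using av[of 0] wedge_eq_zero_iff[of k "v 0"] by auto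
  then obtain e0 s where e0: "orthonormal_frame k e0" "wedge k (v 0) = s *\<^sub>R wedge k e0" using orthonormal_frame_of_simple by blast
  define r where "r = a 0 * s"
  have r: "\<eta> 0 = r *\<^sub>R wedge k e0" using av[of 0] e0(2) by (simp add: r_def)
  have r0: "r \<noteq> 0" using r \<open>\<eta> 0 \<noteq> 0\<close> by auto
  have pos: "g (\<eta> 0) \<le> (\<Sum>i=1..d. m i * g (\<eta> i))"
    if e: "orthonormal_frame k e" and b: "b > 0" "\<eta> 0 = b *\<^sub>R wedge k e" for e :: "nat \<Rightarrow> (real, 'n) vec" and b
  proof -
    have \<eta>s: "(m (Suc i) * a (Suc i) / b) *\<^sub>R wedge k (v (Suc i)) = (m (Suc i) / b) *\<^sub>R \<eta> (Suc i)" if "i < d" for i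
      using av[of "Suc i"] that by simp
    have "wedge k e = (1 / b) *\<^sub>R \<eta> 0" using b by simp
    also have "\<dots> = (\<Sum>i=1..d. (m i / b) *\<^sub>R \<eta> i)" unfolding eq by (simp add: scaleR_sum_right)
    also have "\<dots> = (\<Sum>i<d. (m (Suc i) / b) *\<^sub>R \<eta> (Suc i))" by (rule shift[symmetric])
    also have "\<dots> = (\<Sum>i<d. (m (Suc i) * a (Suc i) / b) *\<^sub>R wedge k (v (Suc i)))" by (rule sum.cong) (simp_all add: \<eta>s)
    finally have "g (wedge k e) \<le> (\<Sum>i<d. g ((m (Suc i) * a (Suc i) / b) *\<^sub>R wedge k (v (Suc i))))"
      by (rule AUE_imp_orthonormal_inequality[OF AUE k e])
    also have "\<dots> = (\<Sum>i<d. m (Suc i) / b * g (\<eta> (Suc i)))"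
    proof (rule sum.cong[OF refl])
      fix i assume "i \<in> {..<d}"
      then have i: "i < d" by simp
      have "simple_kvector k (\<eta> (Suc i))" "0 \<le> m (Suc i) / b" using \<eta> m b i by (auto intro!: G0_simple simp: less_imp_le)
      then show "g ((m (Suc i) * a (Suc i) / b) *\<^sub>R wedge k (v (Suc i))) = m (Suc i) / b * g (\<eta> (Suc i))"
        unfolding \<eta>s[OF i] by (rule g_scale)
    qed
    also have "\<dots> = (\<Sum>i=1..d. m i / b * g (\<eta> i))" by (rule shift)
    also have "\<dots> = (\<Sum>i=1..d. m i * g (\<eta> i)) / b" by (simp add: sum_divide_distrib)
    finally have "b * g (wedge k e) \<le> (\<Sum>i=1..d. m i * g (\<eta> i))" using b(1) by (simp add: field_simps)
    moreover have "g (\<eta> 0) = b * g (wedge k e)"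
    proof -
      have "simple_kvector k (wedge k e)" unfolding simple_kvector_def by (metis scaleR_one)
      then show ?thesis unfolding b(2) by (rule g_scale) (use b(1) in simp)
    qed
    ultimately show ?thesis by simp
  qed
  have "g (\<eta> 0) \<le> (\<Sum>i=1..d. m i * g (\<eta> i))"
  proof (cases "r > 0")
    case True
    then show ?thesis using pos[OF e0(1) True r] by simp
  next
    case False
    then have rneg: "r < 0" using r0 by simp
    show ?thesis
    proof (cases "k = 0")
      case False
      define e where "e = e0(0 := - e0 0)"
      have on: "orthonormal_frame k e" using e0(1) by (auto simp: orthonormal_frame_def e_def)
      have "wedge k e = - wedge k e0" using wedge_scale[of 0 k e0 "-1" "e0 0"] False by (simp add: e_def)
      then have "\<eta> 0 = (- r) *\<^sub>R wedge k e" using r by simp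
      then show ?thesis using pos[OF on, of "- r"] rneg by simp
    next
      case True
      \<comment> \<open>In dimension \<open>0\<close> the test pairs only see the positive orientation \<open>\<omega>\<close> of a point; the negative one is
        reached through \<open>\<omega> = 2 \<omega> + (- \<omega>)\<close>.\<close>
      define \<omega> where "\<omega> = wedge k e0"
      have w: "wedge k u = \<omega>" for u unfolding \<omega>_def by (rule wedge_cong) (simp add: True)
      have s\<omega>: "simple_kvector k (t *\<^sub>R \<omega>)" for t unfolding \<omega>_def simple_kvector_def by blast
      define b where "b = (\<lambda>i::nat. if i = 0 then 2 else - 1 :: real)"
      have "wedge k e0 = (\<Sum>i<2. b i *\<^sub>R wedge k e0)" by (simp add: numeral_2_eq_2 b_def vec_eq_iff)
      from AUE_imp_orthonormal_inequality[OF AUE k e0(1) this]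
      have "g \<omega> \<le> g (2 *\<^sub>R \<omega>) + g (- \<omega>)" by (simp add: numeral_2_eq_2 b_def \<omega>_def)
      moreover have "g (2 *\<^sub>R \<omega>) = 2 * g \<omega>" using g_scale[OF s\<omega>[of 1], of 2] by simp
      ultimately have gg: "0 \<le> g \<omega> + g (- \<omega>)" by simp
      have gt: "- t * g (- \<omega>) \<le> g (t *\<^sub>R \<omega>)" for t
      proof (cases "0 \<le> t")
        case True
        have "g (t *\<^sub>R \<omega>) = t * g \<omega>" using g_scale[OF s\<omega>[of 1] True] by simp
        then show ?thesis using mult_left_mono[OF gg True] by (simp add: algebra_simps)
      next
        case False
        then have "g ((- t) *\<^sub>R (- \<omega>)) = (- t) * g (- \<omega>)" using g_scale[OF s\<omega>[of "-1"], of "- t"] by simp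
        then show ?thesis by simp
      qed
      have \<eta>\<omega>: "\<eta> i = a i *\<^sub>R \<omega>" if "i \<in> {0..d}" for i using av[OF that] w by simp
      have \<omega>0: "\<omega> \<noteq> 0" using r \<open>\<eta> 0 \<noteq> 0\<close> by (auto simp: \<omega>_def)
      have "r *\<^sub>R \<omega> = (\<Sum>i=1..d. m i *\<^sub>R \<eta> i)" using eq r by (simp add: \<omega>_def)
      also have "\<dots> = (\<Sum>i=1..d. (m i * a i) *\<^sub>R \<omega>)" by (rule sum.cong) (auto simp: \<eta>\<omega>)
      also have "\<dots> = (\<Sum>i=1..d. m i * a i) *\<^sub>R \<omega>" by (simp add: scaleR_sum_left)
      finally have rs: "r = (\<Sum>i=1..d. m i * a i)" using \<omega>0 by simp
      have "g (\<eta> 0) = - r * g (- \<omega>)" using g_scale[OF s\<omega>[of "-1"], of "- r"] rneg r by (simp add: \<omega>_def)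
      also have "\<dots> = (\<Sum>i=1..d. m i * (- a i * g (- \<omega>)))"
        unfolding rs sum_negf[symmetric] sum_distrib_right by (rule sum.cong) auto
      also have "\<dots> \<le> (\<Sum>i=1..d. m i * g (\<eta> i))"
      proof (rule sum_mono)
        fix i assume i: "i \<in> {1..d}"
        then show "m i * (- a i * g (- \<omega>)) \<le> m i * g (\<eta> i)"
          using m gt[of "a i"] \<eta>\<omega>[of i] by (intro mult_left_mono) (auto simp: less_imp_le)
      qed
      finally show ?thesis .
    qed
  qed
  moreover have "(\<Sum>i=1..d. m i * g (\<eta> i)) = (\<Sum>i=1..d. m i * \<Psi> (\<eta> i)) - c * (\<Sum>i=1..d. m i)"
  proof -
    have "(\<Sum>i=1..d. m i * g (\<eta> i)) = (\<Sum>i=1..d. m i * \<Psi> (\<eta> i) - c * m i)"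
      by (rule sum.cong) (use \<eta> in \<open>auto simp: g_G0 algebra_simps\<close>)
    then show ?thesis by (simp add: sum_subtractf sum_distrib_left)
  qed
  moreover have "(\<Sum>i=1..d. m i * norm (\<eta> i)) = (\<Sum>i=1..d. m i)" by (rule sum.cong) (auto simp: n1)
  moreover have "g (\<eta> 0) = \<Psi> (\<eta> 0) - c" "norm (\<eta> 0) = 1" using \<eta> n1 by (auto intro: g_G0)
  ultimately show "(\<Sum>i=1..d. m i * \<Psi> (\<eta> i)) - \<Psi> (\<eta> 0) \<ge> c * ((\<Sum>i=1..d. m i * norm (\<eta> i)) - norm (\<eta> 0))"
    by (simp add: right_diff_distrib)
qed

end

theorem theorem3p12:
  fixes k :: nat
    and \<Psi> :: "real ^ ('n::{finite,linorder} set) \<Rightarrow> real"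
    and c :: real
  assumes "k < CARD('n)"
    and "geometric_integrand k \<Psi>"
    and "\<exists>L. L-lipschitz_on (ray (G0 k)) \<Psi>"
    and "c > 0"
  shows "\<Psi> \<in> AUE k (polyhedral_test_pairs k) c \<longleftrightarrow> \<Psi> \<in> UPC k c"
proof -
  obtain L where L: "L-lipschitz_on (ray (G0 k)) \<Psi>" using assms(3) by blast
  obtain h where h: "L-lipschitz_on UNIV h" "h 0 = 0" "\<forall>\<xi>\<in>G0 k. \<forall>t\<ge>0. h (t *\<^sub>R \<xi>) = t * \<Psi> \<xi>"
    using geometric_integrand_extension[OF assms(2) L] by blast
  interpret lipschitz_integrand k \<Psi> h c L
    by standard (use h assms(4) in auto)
  show ?thesis using UPC_imp_AUE AUE_imp_UPC[OF _ assms(1)] by blast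
qed

end
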